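(* There exists a constant $C>0$ such that the following holds for all $\mu_1,\mu_2>0$ and all initial data $(u_0,B_0)\in\chi^{-1}(\mathbb{R}^3)$ with $\mathrm{div}\,u_0=\mathrm{div}\,B_0=0$. Put $\nu_+=\frac{\mu_1+\mu_2}{2}$, $\nu_-=\frac{\mu_1-\mu_2}{2}$, $W_0^\pm=u_0\pm B_0$. If $$\Big(\|W_0^-\|_{\chi^{-1}}+\frac{C|\nu_-|}{\nu_+}\big(|\nu_-|+\|W_0^+\|_{\chi^{-1}}\big)\Big)\exp\Big\{\frac{C}{\nu_+^2}\big(|\nu_-|+\|W_0^+\|_{\chi^{-1}}\big)^2\Big\}<2\nu_+$$ or $$\Big(\|W_0^+\|_{\chi^{-1}}+\frac{C|\nu_-|}{\nu_+}\big(|\nu_-|+\|W_0^-\|_{\chi^{-1}}\big)\Big)\exp\Big\{\frac{C}{\nu_+^2}\big(|\nu_-|+\|W_0^-\|_{\chi^{-1}}\big)^2\Big\}<2\nu_+,$$ then the 3D incompressible MHD system with viscosity $\mu_1$, diffusivity $\mu_2$ and initial data $(u_0,B_0)$ admits a unique global solution $(u,B)$ satisfying $$(u,B)\in C([0,\infty);\chi^{-1}(\mathbb{R}^3))\cap L^1([0,\infty);\chi^{1}(\mathbb{R}^3)).$$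
   Context: The 3D incompressible MHD system, for $(t,x)\in\mathbb{R}^+\times\mathbb{R}^3$, unknown velocity $u$, magnetic field $B$ (both $\mathbb{R}^3$-valued) and scalar pressure $\Pi$, is $$\partial_t u+u\cdot\nabla u-\mu_1\Delta u+\nabla \Pi=B\cdot\nabla B,\qquad \partial_t B+u\cdot\nabla B-B\cdot\nabla u-\mu_2\Delta B=0,$$ $$\mathrm{div}\,u=\mathrm{div}\,B=0,\qquad u(0,x)=u_0(x),\ B(0,x)=B_0(x).$$ The Fourier transform is $\widehat f(\xi)=\int_{\mathbb{R}^3}e^{-ix\cdot\xi}f(x)\,dx$. For $s\in\mathbb{R}$, $\chi^s(\mathbb{R}^3)$ is the space of (tempered) distributions $f$ whose Fourier transform is a locally integrable function with finite norm $\|f\|_{\chi^s}=\int_{\mathbb{R}^3}|\xi|^s|\widehat f(\xi)|\,d\xi$ (for vector fields, $|\widehat f|$ is the Euclidean norm). *)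

theory Defs
  imports "HOL-Analysis.Analysis" "HOL-Library.Function_Algebras"
begin

definition partial :: "3 \<Rightarrow> (real^3 \<Rightarrow> complex) \<Rightarrow> real^3 \<Rightarrow> complex" where
  "partial j f = (\<lambda>x. frechet_derivative f (at x) (axis j 1))"

definition partials :: "3 list \<Rightarrow> (real^3 \<Rightarrow> complex) \<Rightarrow> real^3 \<Rightarrow> complex" where
  "partials js f = foldr partial js f"

definition schwartz :: "(real^3 \<Rightarrow> complex) set" where
  "schwartz = {f. (\<forall>js x. partials js f differentiable (at x)) \<and>
                  (\<forall>js k. bounded (range (\<lambda>x. (1 + norm x) ^ k * norm (partials js f x))))}"

definition schwartz_norm :: "nat \<Rightarrow> (real^3 \<Rightarrow> complex) \<Rightarrow> real" where
  "schwartz_norm N f =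
     (SUP (js, x) \<in> {js. length js \<le> N} \<times> UNIV. (1 + norm x) ^ N * norm (partials js f x))"

text \<open>A distribution is a HOL function on all complex-valued functions, of which only the values on
  Schwartz functions are meaningful; accordingly equality of distributions is \<open>dist_eq\<close> below.\<close>

type_synonym tdist = "(real^3 \<Rightarrow> complex) \<Rightarrow> complex"
type_synonym vdist = "tdist^3"

definition tempered :: "tdist \<Rightarrow> bool" where
  "tempered T \<longleftrightarrow>
     (\<forall>\<phi>\<in>schwartz. \<forall>\<psi>\<in>schwartz. \<forall>a b. T (\<lambda>x. a * \<phi> x + b * \<psi> x) = a * T \<phi> + b * T \<psi>) \<and>
     (\<exists>N C. \<forall>\<phi>\<in>schwartz. norm (T \<phi>) \<le> C * schwartz_norm N \<phi>)"

definition real_valued :: "tdist \<Rightarrow> bool" where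
  "real_valued T \<longleftrightarrow> (\<forall>\<phi>\<in>schwartz. (\<forall>x. \<phi> x \<in> \<real>) \<longrightarrow> T \<phi> \<in> \<real>)"

definition dist_eq :: "tdist \<Rightarrow> tdist \<Rightarrow> bool" where
  "dist_eq S T \<longleftrightarrow> (\<forall>\<phi>\<in>schwartz. S \<phi> = T \<phi>)"

definition vdist_eq :: "vdist \<Rightarrow> vdist \<Rightarrow> bool" where
  "vdist_eq u v \<longleftrightarrow> (\<forall>i. dist_eq (u $ i) (v $ i))"

definition locally_integrable :: "(real^3 \<Rightarrow> complex) \<Rightarrow> bool" where
  "locally_integrable f \<longleftrightarrow> (\<forall>K. compact K \<longrightarrow> set_integrable lborel K f)"

text \<open>The tempered distribution \<open>T\<close> is the function \<open>g\<close>. The absolute convergence of the pairing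
  excludes only oscillating functions of rapid growth; it is automatic for a locally integrable
  \<open>g\<close> for which \<open>\<bar>\<xi>\<bar>\<close> to some power times \<open>\<bar>g\<bar>\<close> is integrable.\<close>

definition represents :: "(real^3 \<Rightarrow> complex) \<Rightarrow> tdist \<Rightarrow> bool" where
  "represents g T \<longleftrightarrow> locally_integrable g \<and>
     (\<forall>\<phi>\<in>schwartz. integrable lborel (\<lambda>x. g x * \<phi> x) \<and> T \<phi> = (LINT x|lborel. g x * \<phi> x))"

text \<open>Determined almost everywhere by the distribution, and meaningful only if the latter is
  a function.\<close>

definition fun_of :: "tdist \<Rightarrow> real^3 \<Rightarrow> complex" where
  "fun_of T = (SOME g. represents g T)"

definition fourier :: "(real^3 \<Rightarrow> complex) \<Rightarrow> real^3 \<Rightarrow> complex" where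
  "fourier \<phi> \<xi> = (LINT x|lborel. exp (- \<i> * complex_of_real (x \<bullet> \<xi>)) * \<phi> x)"

definition fourier_dist :: "tdist \<Rightarrow> tdist" where
  "fourier_dist T = (\<lambda>\<phi>. T (fourier \<phi>))"

definition fourier_fun :: "vdist \<Rightarrow> real^3 \<Rightarrow> complex^3" where
  "fourier_fun u \<xi> = (\<chi> i. fun_of (fourier_dist (u $ i)) \<xi>)"

definition chi :: "real \<Rightarrow> vdist set" where
  "chi s = {u. (\<forall>i. tempered (u $ i) \<and> (\<exists>g. represents g (fourier_dist (u $ i)))) \<and>
               integrable lborel (\<lambda>\<xi>. norm \<xi> powr s * norm (fourier_fun u \<xi>))}"

definition chi_norm :: "real \<Rightarrow> vdist \<Rightarrow> real" where
  "chi_norm s u = (LINT \<xi>|lborel. norm \<xi> powr s * norm (fourier_fun u \<xi>))"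

definition C_chi :: "real \<Rightarrow> (real \<Rightarrow> vdist) set" where
  "C_chi s = {u. (\<forall>t\<ge>0. u t \<in> chi s) \<and>
                 (\<forall>t\<ge>0. ((\<lambda>r. chi_norm s (u r - u t)) \<longlongrightarrow> 0) (at t within {0..}))}"

text \<open>Bochner integrability over \<open>[0, \<infinity>)\<close>: strong measurability, i.e. almost everywhere approximation
  by simple functions, and integrability of the norm.\<close>

definition L1_chi :: "real \<Rightarrow> (real \<Rightarrow> vdist) set" where
  "L1_chi s = {u. (AE t in lebesgue_on {0..}. u t \<in> chi s) \<and>
     (\<exists>\<sigma>. (\<forall>n. simple_function (lebesgue_on {0..}) (\<sigma> n) \<and> (\<forall>t\<ge>0. \<sigma> n t \<in> chi s)) \<and>
          (AE t in lebesgue_on {0..}. (\<lambda>n::nat. chi_norm s (\<sigma> n t - u t)) \<longlonglongrightarrow> 0)) \<and>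
     integrable (lebesgue_on {0..}) (\<lambda>t. chi_norm s (u t))}"

definition dpartial :: "3 \<Rightarrow> tdist \<Rightarrow> tdist" where
  "dpartial j T = (\<lambda>\<phi>. - T (partial j \<phi>))"

definition dlaplace :: "tdist \<Rightarrow> tdist" where
  "dlaplace T = (\<lambda>\<phi>. \<Sum>j\<in>UNIV. dpartial j (dpartial j T) \<phi>)"

definition ddiv :: "vdist \<Rightarrow> tdist" where
  "ddiv u = (\<lambda>\<phi>. \<Sum>j\<in>UNIV. dpartial j (u $ j) \<phi>)"

text \<open>\<open>a \<cdot> \<nabla>f\<close>, the product being the pointwise one of the functions \<open>a\<^sub>j\<close> and \<open>\<partial>\<^sub>j f\<close>. If \<open>a\<close> and
  the field with component \<open>f\<close> lie in both \<open>chi (-1)\<close> and \<open>chi 1\<close>, as the solutions below do at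
  almost every time, then \<open>a\<^sub>j\<close> and \<open>\<partial>\<^sub>j f\<close> have integrable Fourier transforms and hence are
  bounded continuous functions.\<close>

definition advect :: "vdist \<Rightarrow> tdist \<Rightarrow> tdist" where
  "advect a f = (\<lambda>\<phi>. LINT x|lborel. (\<Sum>j\<in>UNIV. fun_of (a $ j) x * fun_of (dpartial j f) x) * \<phi> x)"

text \<open>\<open>\<partial>\<^sub>t f = F\<close> on \<open>(0, \<infinity>)\<close> in the sense of distributions, in time-integrated form.\<close>

definition time_derivative :: "(real \<Rightarrow> tdist) \<Rightarrow> (real \<Rightarrow> tdist) \<Rightarrow> bool" where
  "time_derivative f F \<longleftrightarrow> (\<forall>\<phi>\<in>schwartz. \<forall>t\<ge>0.
     integrable (lebesgue_on {0..t}) (\<lambda>s. F s \<phi>) \<and>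
     f t \<phi> - f 0 \<phi> = (LINT s|lebesgue_on {0..t}. F s \<phi>))"

text \<open>Weak solutions, to be used for \<open>u\<close> and \<open>B\<close> in \<open>C_chi (-1) \<inter> L1_chi 1\<close>, where the
  nonlinear terms are well defined. The pressure is an unknown, existentially quantified since it
  is determined by the fields only up to a function of time.\<close>

definition mhd_solution ::
  "real \<Rightarrow> real \<Rightarrow> vdist \<Rightarrow> vdist \<Rightarrow> (real \<Rightarrow> vdist) \<Rightarrow> (real \<Rightarrow> vdist) \<Rightarrow> bool" where
  "mhd_solution \<mu>1 \<mu>2 u0 B0 u B \<longleftrightarrow>
     (\<forall>t\<ge>0. \<forall>i. real_valued (u t $ i) \<and> real_valued (B t $ i)) \<and>
     (\<exists>p. (\<forall>t\<ge>0. tempered (p t) \<and> real_valued (p t)) \<and>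
        (\<forall>i. time_derivative (\<lambda>t. u t $ i)
           (\<lambda>t \<phi>. - advect (u t) (u t $ i) \<phi> + of_real \<mu>1 * dlaplace (u t $ i) \<phi>
                   - dpartial i (p t) \<phi> + advect (B t) (B t $ i) \<phi>))) \<and>
     (\<forall>i. time_derivative (\<lambda>t. B t $ i)
        (\<lambda>t \<phi>. - advect (u t) (B t $ i) \<phi> + advect (B t) (u t $ i) \<phi>
                + of_real \<mu>2 * dlaplace (B t $ i) \<phi>)) \<and>
     (\<forall>t\<ge>0. dist_eq (ddiv (u t)) 0 \<and> dist_eq (ddiv (B t)) 0) \<and>
     vdist_eq (u 0) u0 \<and> vdist_eq (B 0) B0"

end

theory Submission
  imports Defs "HOL-Probability.Characteristic_Functions" "HOL-Probability.Sinc_Integral"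
begin

text \<open>After a Fourier transform and the Leray projection the Elsasser fields \<open>u \<plusminus> B\<close> solve mild
  equations in which the nonlinearity at frequency \<open>z\<close> is at most \<open>\<bar>z\<bar>\<close> times the convolution of the
  moduli of the two fields, so Picard's iteration is dominated, frequency by frequency, by the same
  iteration for a pair of nonnegative scalar majorants. That iteration is monotone, and its increments
  dominate those of Picard's, so bounds on the majorants alone give convergence. They come from
  the energy identity in \<open>\<chi>\<^sup>-\<^sup>1\<close>, the interpolation \<open>\<parallel>f\<parallel>\<^sub>0\<^sup>2 \<le> \<parallel>f\<parallel>\<^sub>-\<^sub>1 \<parallel>f\<parallel>\<^sub>1\<close> and Gronwall's inequality, which is
  where the exponential in the smallness condition arises.

  For uniqueness, testing the weak formulation against Schwartz functions, solenoidal ones in the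
  momentum equation to remove the pressure, yields an ordinary differential equation at almost every
  frequency. The difference of two solutions is then dominated by a solution of the majorant inequality
  with zero data, which vanishes by the estimate already used for existence.\<close>

text \<open>With \<nu> = (\<mu>1 + \<mu>2) / 2 and m = (\<mu>1 - \<mu>2) / 2, each Elsasser field is
  transported by the other, diffuses at rate \<nu>, and feels the other linearly only through m
  times its Laplacian. With the other field frozen the equation is linear, so its bound is data plus
  coupling, times an exponential of the other field. The obstacle is that the two bounds refer to
  each other and only one field is small. While the small field stays below 2\<nu> in \<chi>^-1, its
  effect on the large one is an absolute constant, so the large one stays below a multiple M of |m|
  plus its own data; inserting M in the bound for the small field gives back 2\<nu> under the
  smallness condition.

  Values in [0,\<infinity>] let majorants be formed before any integrability is known: monotone
  convergence yields their fixed point, in place of a contraction argument. Finiteness must however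
  be known before dissipation is absorbed, and it comes from the previous iterate. Uniqueness needs
  no smallness: with zero data and no coupling the same linear bound is zero.\<close>

type_synonym sfield = "real^3 \<Rightarrow> complex"
type_synonym vfield = "real^3 \<Rightarrow> complex^3"

abbreviation cor :: "real \<Rightarrow> complex" where "cor \<equiv> complex_of_real"

abbreviation bm :: "('a::topological_space \<Rightarrow> 'b::topological_space) \<Rightarrow> bool" where
  "bm f \<equiv> f \<in> borel_measurable borel"

abbreviation en :: "'a::real_normed_vector \<Rightarrow> ennreal" where "en v \<equiv> ennreal (norm v)"

abbreviation nrm :: "('a \<Rightarrow> 'b::real_normed_vector) \<Rightarrow> 'a \<Rightarrow> ennreal" where "nrm f \<equiv> \<lambda>x. en (f x)"

abbreviation nn_lborel (binder "\<integral>\<^sub>L" 10) where "nn_lborel f \<equiv> nn_integral lborel f"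

abbreviation lint :: "real set \<Rightarrow> (real \<Rightarrow> ennreal) \<Rightarrow> ennreal" where
  "lint A f \<equiv> (\<integral>\<^sup>+s\<in>A. f s \<partial>lborel)"

lemmas integrable_plus = Bochner_Integration.integrable_add
  and integrable_le = Bochner_Integration.integrable_bound
  and integrable_sub = Bochner_Integration.integrable_diff
  and LINT_add = Bochner_Integration.integral_add
  and LINT_cong = Bochner_Integration.integral_cong
  and LINT_cong_AE = Bochner_Integration.integral_cong_AE
  and LINT_diff = Bochner_Integration.integral_diff
  and LINT_sum = Bochner_Integration.integral_sum

subsection \<open>Integration on \<open>\<real>\<^sup>3\<close>\<close>

lemma lborel_integrable_affine:
  fixes f :: "'a::euclidean_space \<Rightarrow> 'b::{banach, second_countable_topology}"
  assumes "c \<noteq> 0" "integrable lborel f"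
  shows "integrable lborel (\<lambda>x. f (t + c *\<^sub>R x))"
proof -
  have [measurable]: "bm f"
    using assms(2) by (simp add: integrable_iff_bounded)
  show ?thesis
  proof -
    have "integrable lborel f = integrable (density (distr lborel borel (\<lambda>x. t + c *\<^sub>R x)) (\<lambda>_. \<bar>c\<bar> ^ DIM('a))) f"
      by (subst lborel_affine[OF assms(1), of t]) simp
    then have "integrable lborel (\<lambda>x. \<bar>c\<bar> ^ DIM('a) *\<^sub>R f (t + c *\<^sub>R x))"
      using assms by (simp add: integrable_density integrable_distr_eq)
    from integrable_scaleR_right[OF this, of "1 / \<bar>c\<bar> ^ DIM('a)"] show ?thesis
      using assms(1) by simp
  qed
qed

lemma lborel_integral_affine:
  fixes f :: "'a::euclidean_space \<Rightarrow> 'b::{banach, second_countable_topology}"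
  assumes "c \<noteq> 0" and [measurable]: "bm f"
  shows "(LBINT x. f x) = \<bar>c\<bar> ^ DIM('a) *\<^sub>R (LBINT x. f (t + c *\<^sub>R x))"
  by (subst lborel_affine[OF assms(1), of t], subst integral_density, simp_all add: integral_distr)

lemma lborel_integral_shift:
  fixes f :: "'a::euclidean_space \<Rightarrow> 'b::{banach, second_countable_topology}"
  assumes [measurable]: "bm f"
  shows "(LBINT x. f (x + t)) = (LBINT x. f x)"
  using lborel_integral_affine[of 1 f t] by (simp add: add.commute)

lemma lborel_integral_reflect:
  fixes f :: "'a::euclidean_space \<Rightarrow> 'b::{banach, second_countable_topology}"
  assumes [measurable]: "bm f"
  shows "(LBINT x. f (t - x)) = (LBINT x. f x)"
  using lborel_integral_affine[of "-1" f t] by simp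

lemma lborel_nn_integral_reflect:
  fixes f :: "'a::euclidean_space \<Rightarrow> ennreal"
  assumes [measurable]: "bm f"
  shows "(\<integral>\<^sub>Lx. f (t - x)) = (\<integral>\<^sub>Lx. f x)"
  by (subst (2) lborel_affine[of "-1" t], simp, subst nn_integral_density, simp_all add: nn_integral_distr)

lemma lborel_nn_integral_shift:
  fixes f :: "'a::euclidean_space \<Rightarrow> ennreal"
  assumes [measurable]: "bm f"
  shows "(\<integral>\<^sub>Lx. f (x - t)) = (\<integral>\<^sub>Lx. f x)"
  by (subst (2) lborel_affine[of 1 "-t"], simp, subst nn_integral_density, simp_all add: nn_integral_distr)

lemma AE_lborel_reflect:
  fixes P :: "'a::euclidean_space \<Rightarrow> bool"
  assumes "AE x in lborel. P x"
  shows "AE x in lborel. P (t - x)"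
proof -
  obtain N where N: "{x. \<not> P x} \<subseteq> N" "N \<in> null_sets lborel"
    using assms by (auto elim!: AE_E simp: null_sets_def)
  have [measurable]: "N \<in> sets borel" using N(2) by auto
  have "(\<integral>\<^sub>Lx. indicator N (t - x)) = 0"
    using N(2) by (subst lborel_nn_integral_reflect) (auto simp: null_sets_def)
  then have "AE x in lborel. indicator N (t - x) = (0::ennreal)"
    by (subst (asm) nn_integral_0_iff_AE) auto
  then show ?thesis by eventually_elim (use N(1) in \<open>auto simp: indicator_def split: if_splits\<close>)
qed

lemma lborel_product_integral:
  fixes f :: "'a::euclidean_space \<Rightarrow> real \<Rightarrow> 'b::{real_normed_field, banach, second_countable_topology}"
  assumes f: "\<And>b. b \<in> Basis \<Longrightarrow> integrable lborel (f b)"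
  shows "integrable lborel (\<lambda>x. \<Prod>b\<in>Basis. f b (x \<bullet> b))" (is ?I)
    and "(LBINT x. (\<Prod>b\<in>Basis. f b (x \<bullet> b))) = (\<Prod>b\<in>Basis. LBINT r. f b r)" (is ?E)
proof -
  interpret product_sigma_finite "\<lambda>_::'a. lborel :: real measure" ..
  have [measurable]: "bm (f b)" if "b \<in> Basis" for b
    using f[OF that] by (simp add: integrable_iff_bounded)
  have *: "(\<Prod>b\<in>Basis. f b ((\<Sum>b\<in>Basis. x b *\<^sub>R b) \<bullet> b)) = (\<Prod>b\<in>Basis. f b (x b))" for x
    by (intro prod.cong refl) simp
  show ?I
    by (subst lborel_eq, subst integrable_distr_eq) (auto simp: * intro!: product_integrable_prod f)
  show ?E
    by (subst lborel_eq, subst integral_distr) (auto simp: * intro!: product_integral_prod f)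
qed

lemma integrable_inverse_1_plus_square_real: "integrable lborel (\<lambda>x::real. 1 / (1 + x\<^sup>2))"
proof -
  have "einterval (-\<infinity>) \<infinity> = UNIV" by (auto simp: einterval_def)
  then show ?thesis
    using integrable_inverse_1_plus_square by (simp add: set_integrable_def inverse_eq_divide)
qed

text \<open>The weight is dominated by the product of three functions 1 / (1 + r^2) of one
  coordinate each, all integrable on the line; the exponent 6 is twice the dimension.\<close>

lemma integrable_weight: "integrable lborel (\<lambda>x::real^3. 1 / (1 + norm x) ^ 6)"
proof (rule integrable_le)
  show "integrable lborel (\<lambda>x::real^3. \<Prod>b\<in>Basis. 1 / (1 + (x \<bullet> b)\<^sup>2))"
    by (rule lborel_product_integral(1)[where f="\<lambda>_ r. 1 / (1 + r\<^sup>2)"])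
       (rule integrable_inverse_1_plus_square_real)
  show "AE x::real^3 in lborel. norm (1 / (1 + norm x) ^ 6) \<le> norm (\<Prod>b\<in>Basis. 1 / (1 + (x \<bullet> b)\<^sup>2))"
  proof (rule AE_I2)
    fix x :: "real^3"
    have "(\<Prod>b\<in>(Basis :: (real^3) set). 1 + (x \<bullet> b)\<^sup>2) \<le> (\<Prod>b\<in>(Basis :: (real^3) set). (1 + norm x)\<^sup>2)"
    proof (rule prod_mono, safe)
      fix b :: "real^3" assume "b \<in> Basis"
      then have "(x \<bullet> b)\<^sup>2 \<le> (norm x)\<^sup>2"
        by (metis Basis_le_norm abs_ge_zero power2_abs power_mono)
      then show "1 + (x \<bullet> b)\<^sup>2 \<le> (1 + norm x)\<^sup>2"
        by (simp add: power2_sum) (smt (verit) norm_ge_zero)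
    qed simp
    also have "\<dots> = (1 + norm x) ^ 6" by (simp flip: power_mult)
    finally have "1 / (1 + norm x) ^ 6 \<le> 1 / (\<Prod>b\<in>(Basis :: (real^3) set). 1 + (x \<bullet> b)\<^sup>2)"
      by (intro divide_left_mono) (auto intro!: prod_pos mult_pos_pos add_pos_nonneg zero_less_power)
    also have "\<dots> = (\<Prod>b\<in>(Basis :: (real^3) set). 1 / (1 + (x \<bullet> b)\<^sup>2))" by (simp add: prod_dividef)
    finally show "norm (1 / (1 + norm x) ^ 6) \<le> norm (\<Prod>b\<in>Basis. 1 / (1 + (x \<bullet> b)\<^sup>2))"
      by (simp add: abs_mult)
  qed
qed simp

lemma integrable_pair_product:
  fixes f :: "'a \<Rightarrow> complex" and g :: "'b \<Rightarrow> complex"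
  assumes "sigma_finite_measure M" "sigma_finite_measure N"
    and f: "integrable M f" and g: "integrable N g"
  shows "integrable (M \<Otimes>\<^sub>M N) (\<lambda>(x, y). f x * g y)"
proof -
  interpret M: sigma_finite_measure M by fact
  interpret N: sigma_finite_measure N by fact
  interpret pair_sigma_finite M N ..
  have [measurable]: "f \<in> borel_measurable M" "g \<in> borel_measurable N" using f g by auto
  show ?thesis
  proof (rule Fubini_integrable)
    show "integrable M (\<lambda>x. LINT y|N. norm (case (x, y) of (x, y) \<Rightarrow> f x * g y))"
      by (simp add: norm_mult) (use f in auto)
  qed (use g in auto)
qed

subsection \<open>Schwartz functions\<close>

lemma partial_eq: "(f has_derivative f') (at x) \<Longrightarrow> partial j f x = f' (axis j 1)"
  unfolding partial_def by (metis frechet_derivative_at)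

text \<open>\<open>schwartz\<close> quantifies over all iterated derivatives. A class closed under a
  single derivative contains them all, so membership reduces to checks on the functions
  themselves.\<close>

lemma schwartz_coinduct:
  assumes "\<And>f j. f \<in> S \<Longrightarrow> partial j f \<in> S"
    and "\<And>f x. f \<in> S \<Longrightarrow> f differentiable (at x)"
    and "\<And>f k. f \<in> S \<Longrightarrow> bounded (range (\<lambda>x. (1 + norm x) ^ k * norm (f x)))"
  shows "S \<subseteq> schwartz"
proof
  fix f assume f: "f \<in> S"
  have *: "partials js f \<in> S" for js
    by (induction js) (auto simp: partials_def f assms(1))
  show "f \<in> schwartz" unfolding schwartz_def using * assms(2,3) by auto
qed

lemma schwartz_differentiable: "f \<in> schwartz \<Longrightarrow> f differentiable (at x)"
  unfolding schwartz_def partials_def by (auto dest: spec[of _ "[]"])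

lemma schwartz_partials: "f \<in> schwartz \<Longrightarrow> partials js f \<in> schwartz"
  unfolding schwartz_def partials_def by (simp flip: foldr_append[unfolded comp_def])

lemma schwartz_partial: "f \<in> schwartz \<Longrightarrow> partial j f \<in> schwartz"
  using schwartz_partials[of f "[j]"] by (simp add: partials_def)

lemma schwartz_bounded: "f \<in> schwartz \<Longrightarrow> bounded (range (\<lambda>x. (1 + norm x) ^ k * norm (f x)))"
  unfolding schwartz_def partials_def by (auto dest: spec[of _ "[]"])

lemma bounded_range_iff: "bounded (range f) \<longleftrightarrow> (\<exists>B\<ge>0. \<forall>x. f x \<le> B)"
  if "\<And>x. f x \<ge> (0::real)"
  by (auto simp: bounded_iff that) (metis order_trans that)

lemma rapid_iff: "bounded (range (\<lambda>x. (1 + norm x) ^ k * norm (f x))) \<longleftrightarrow>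
   (\<exists>B\<ge>0. \<forall>x. (1 + norm x) ^ k * norm (f x) \<le> B)"
  by (rule bounded_range_iff) auto

lemma schwartz_bound:
  assumes "f \<in> schwartz"
  obtains B where "B \<ge> 0" "\<And>x. (1 + norm x) ^ k * norm (f x) \<le> B"
  using schwartz_bounded[OF assms, of k] unfolding rapid_iff by auto

lemma schwartz_has_derivative:
  "f \<in> schwartz \<Longrightarrow> (f has_derivative frechet_derivative f (at x)) (at x)"
  using schwartz_differentiable frechet_derivative_works by blast

lemma schwartz_continuous: "f \<in> schwartz \<Longrightarrow> continuous_on UNIV f"
  by (simp add: continuous_at_imp_continuous_on differentiable_imp_continuous_within schwartz_differentiable)

lemma schwartz_measurable: "f \<in> schwartz \<Longrightarrow> bm f"
  by (simp add: borel_measurable_continuous_onI schwartz_continuous)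

text \<open>Closing under all these operations at once makes each of them preserve \<open>schwartz\<close> by a
  single coinduction.\<close>

inductive_set schwartz_gen :: "sfield set" where
  base: "f \<in> schwartz \<Longrightarrow> f \<in> schwartz_gen"
| gauss: "a > 0 \<Longrightarrow> (\<lambda>x. cor (exp (- a * ((x - y) \<bullet> (x - y))))) \<in> schwartz_gen"
| coord: "f \<in> schwartz_gen \<Longrightarrow> (\<lambda>x. cor (x $ k) * f x) \<in> schwartz_gen"
| lin: "f \<in> schwartz_gen \<Longrightarrow> g \<in> schwartz_gen \<Longrightarrow> (\<lambda>x. c * f x + d * g x) \<in> schwartz_gen"
| mult: "f \<in> schwartz_gen \<Longrightarrow> g \<in> schwartz_gen \<Longrightarrow> (\<lambda>x. f x * g x) \<in> schwartz_gen"
| reflect: "f \<in> schwartz_gen \<Longrightarrow> (\<lambda>x. f (- x)) \<in> schwartz_gen"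
| cnj: "f \<in> schwartz_gen \<Longrightarrow> (\<lambda>x. cnj (f x)) \<in> schwartz_gen"

lemma bounded_linear_of_real_nth: "bounded_linear (\<lambda>x::real^3. cor (x $ k))"
  by (rule bounded_linear_compose[OF bounded_linear_of_real bounded_linear_vec_nth])

text \<open>With r = |x - y| one has 1 + |x| \<le> (1 + |y|) exp r, so the k-th power of the weight
  costs at most exp (k r); completing the square shows that the Gaussian compensates this uniformly
  in r.\<close>

lemma gauss_rapid:
  fixes y :: "real^3"
  assumes "a > 0"
  shows "bounded (range (\<lambda>x. (1 + norm x) ^ k * norm (cor (exp (- a * ((x - y) \<bullet> (x - y)))))))"
proof -
  define B where "B = (1 + norm y) ^ k * exp ((real k)\<^sup>2 / (4 * a))"
  have "(1 + norm x) ^ k * norm (cor (exp (- a * ((x - y) \<bullet> (x - y))))) \<le> B" for x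
  proof -
    define r where "r = norm (x - y)"
    have r: "r \<ge> 0" by (simp add: r_def)
    have "norm x \<le> norm y + r" unfolding r_def by norm
    then have "1 + norm x \<le> (1 + norm y) * (1 + r)"
      using r mult_nonneg_nonneg[OF norm_ge_zero[of y] r] unfolding distrib_left distrib_right by linarith
    also have "\<dots> \<le> (1 + norm y) * exp r"
      using exp_ge_add_one_self[of r] by (intro mult_left_mono) auto
    finally have "(1 + norm x) ^ k \<le> ((1 + norm y) * exp r) ^ k"
      by (intro power_mono) auto
    also have "\<dots> = (1 + norm y) ^ k * exp (k * r)"
      by (simp add: power_mult_distrib exp_of_nat_mult)
    finally have 1: "(1 + norm x) ^ k \<le> (1 + norm y) ^ k * exp (k * r)" .
    have "0 \<le> (real k - 2 * a * r)\<^sup>2 / (4 * a)" using assms by simp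
    also have "\<dots> = (real k)\<^sup>2 / (4 * a) - k * r + a * r\<^sup>2"
      using assms by (simp add: field_simps power2_eq_square)
    finally have "k * r - a * r\<^sup>2 \<le> (real k)\<^sup>2 / (4 * a)" by simp
    then have 2: "exp (k * r) * exp (- a * r\<^sup>2) \<le> exp ((real k)\<^sup>2 / (4 * a))"
      by (simp flip: exp_add)
    have "norm (cor (exp (- a * ((x - y) \<bullet> (x - y))))) = exp (- a * r\<^sup>2)"
      by (simp add: r_def power2_norm_eq_inner)
    then have "(1 + norm x) ^ k * norm (cor (exp (- a * ((x - y) \<bullet> (x - y)))))
        \<le> ((1 + norm y) ^ k * exp (k * r)) * exp (- a * r\<^sup>2)"
      using 1 by (simp only:) (intro mult_right_mono, auto)
    also have "\<dots> \<le> B"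
      unfolding B_def using 2 by (simp add: mult.assoc mult_left_mono)
    finally show ?thesis .
  qed
  moreover have "B \<ge> 0" by (simp add: B_def)
  ultimately show ?thesis unfolding rapid_iff by blast
qed

lemma schwartz_gen_differentiable: "f \<in> schwartz_gen \<Longrightarrow> f differentiable (at x)"
proof (induction arbitrary: x rule: schwartz_gen.induct)
  case (gauss a y)
  have "((\<lambda>x. cor (exp (- a * ((x - y) \<bullet> (x - y))))) has_derivative
     (\<lambda>v. cor (exp (- a * ((x - y) \<bullet> (x - y))) * (- 2 * a * ((x - y) \<bullet> v))))) (at x)"
    by (auto intro!: derivative_eq_intros simp: inner_commute algebra_simps)
  then show ?case by (auto simp: differentiable_def)
next
  case (reflect f)
  have "(f has_derivative frechet_derivative f (at (- x))) (at (- x))"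
    using reflect.IH frechet_derivative_works by blast
  then have "((\<lambda>x. f (- x)) has_derivative (\<lambda>v. frechet_derivative f (at (- x)) (- v))) (at x)"
    by (rule has_derivative_compose[of uminus uminus, rotated]) (auto intro!: derivative_eq_intros)
  then show ?case by (auto simp: differentiable_def)
next
  case (coord f k)
  have "(\<lambda>x::real^3. cor (x $ k)) differentiable (at x)"
    unfolding differentiable_def
    using bounded_linear_imp_has_derivative[OF bounded_linear_of_real_nth] by blast
  then show ?case using coord by (intro differentiable_mult)
next
  case (cnj f)
  then show ?case
    using bounded_linear.has_derivative[OF bounded_linear_cnj] unfolding differentiable_def by blast
qed (auto intro!: schwartz_differentiable differentiable_add differentiable_mult)

lemma schwartz_gen_has_derivative:
  "f \<in> schwartz_gen \<Longrightarrow> (f has_derivative frechet_derivative f (at x)) (at x)"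
  using schwartz_gen_differentiable frechet_derivative_works by blast

lemma schwartz_gen_partial: "f \<in> schwartz_gen \<Longrightarrow> partial j f \<in> schwartz_gen"
proof (induction rule: schwartz_gen.induct)
  case (gauss a y)
  let ?g = "\<lambda>x. cor (exp (- a * ((x - y) \<bullet> (x - y))))"
  have "(?g has_derivative
     (\<lambda>v. cor (exp (- a * ((x - y) \<bullet> (x - y))) * (- 2 * a * ((x - y) \<bullet> v))))) (at x)" for x
    by (auto intro!: derivative_eq_intros simp: inner_commute algebra_simps)
  from partial_eq[OF this]
  have "partial j ?g = (\<lambda>x. (- 2 * a) * (cor (x $ j) * ?g x) + (2 * a * y $ j) * ?g x)"
    by (auto simp: fun_eq_iff inner_axis algebra_simps)
  then show ?case
    by (simp only:) (intro schwartz_gen.lin schwartz_gen.coord schwartz_gen.gauss; rule gauss)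
next
  case (reflect f)
  have "partial j (\<lambda>x. f (- x)) x = - partial j f (- x)" for x
  proof -
    have "((\<lambda>x. f (- x)) has_derivative (\<lambda>v. frechet_derivative f (at (- x)) (- v))) (at x)"
      by (rule has_derivative_compose[of uminus uminus, rotated])
        (use schwartz_gen_has_derivative[OF reflect.hyps] in \<open>auto intro!: derivative_eq_intros\<close>)
    from partial_eq[OF this, of j] show ?thesis
      by (simp add: partial_def linear_neg linear_frechet_derivative schwartz_gen_differentiable reflect.hyps)
  qed
  \<comment> \<open>The sign is written as a combination with a dummy zero term so that the rule
    \<open>lin\<close> produces it.\<close>
  then have "partial j (\<lambda>x. f (- x)) = (\<lambda>x. (-1) * partial j f (- x) + 0 * partial j f (- x))" by auto
  then show ?case
    using schwartz_gen.lin[OF schwartz_gen.reflect schwartz_gen.reflect, OF reflect.IH reflect.IH, of "-1" 0]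
    by (simp only:)
next
  case (coord f k)
  have "partial j (\<lambda>x. cor (x $ k) * f x) x = (cor (x $ k) * partial j f x)
     + of_real ((axis j 1::real^3) $ k) * f x" for x
  proof -
    have "((\<lambda>x. cor (x $ k) * f x) has_derivative
      (\<lambda>v. cor (x $ k) * frechet_derivative f (at x) v + cor (v $ k) * f x)) (at x)"
      by (rule has_derivative_mult[OF _ schwartz_gen_has_derivative[OF coord.hyps]])
        (rule bounded_linear_imp_has_derivative[OF bounded_linear_of_real_nth])
    from partial_eq[OF this, of j] show ?thesis by (simp add: partial_def)
  qed
  then have "partial j (\<lambda>x. cor (x $ k) * f x) = (\<lambda>x. 1 * (cor (x $ k) * partial j f x)
     + of_real ((axis j 1::real^3) $ k) * f x)" by auto
  then show ?case
    using schwartz_gen.lin[OF schwartz_gen.coord[OF coord.IH] coord.hyps, of 1 k "of_real ((axis j 1::real^3) $ k)"]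
    by (simp only:)
next
  case (lin f g c d)
  have "partial j (\<lambda>x. c * f x + d * g x) = (\<lambda>x. c * partial j f x + d * partial j g x)"
  proof
    fix x
    have "((\<lambda>x. c * f x + d * g x) has_derivative
      (\<lambda>v. c * frechet_derivative f (at x) v + d * frechet_derivative g (at x) v)) (at x)"
      using schwartz_gen_has_derivative lin.hyps by (intro has_derivative_add has_derivative_mult_right) auto
    from partial_eq[OF this, of j] show "partial j (\<lambda>x. c * f x + d * g x) x = c * partial j f x + d * partial j g x"
      by (simp add: partial_def)
  qed
  then show ?case using schwartz_gen.lin[OF lin.IH, of c d] by (simp only:)
next
  case (mult f g)
  have "partial j (\<lambda>x. f x * g x) = (\<lambda>x. 1 * (f x * partial j g x) + 1 * (partial j f x * g x))"
  proof
    fix x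
    have "((\<lambda>x. f x * g x) has_derivative
      (\<lambda>v. f x * frechet_derivative g (at x) v + frechet_derivative f (at x) v * g x)) (at x)"
      using schwartz_gen_has_derivative mult.hyps by (intro has_derivative_mult) auto
    from partial_eq[OF this, of j] show "partial j (\<lambda>x. f x * g x) x = 1 * (f x * partial j g x) + 1 * (partial j f x * g x)"
      by (simp add: partial_def)
  qed
  then show ?case
    using schwartz_gen.lin[OF schwartz_gen.mult schwartz_gen.mult, OF mult.hyps(1) mult.IH(2) mult.IH(1) mult.hyps(2), of 1 1]
    by (simp only:)
next
  case (cnj f)
  have "partial j (\<lambda>x. cnj (f x)) = (\<lambda>x. cnj (partial j f x))"
  proof
    fix x
    have "((\<lambda>x. cnj (f x)) has_derivative (\<lambda>v. cnj (frechet_derivative f (at x) v))) (at x)"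
      using schwartz_gen_has_derivative[OF cnj.hyps] by (intro bounded_linear.has_derivative[OF bounded_linear_cnj])
    from partial_eq[OF this, of j] show "partial j (\<lambda>x. cnj (f x)) x = cnj (partial j f x)"
      by (simp add: partial_def)
  qed
  then show ?case using schwartz_gen.cnj[OF cnj.IH] by (simp only:)
qed (auto intro!: schwartz_gen.base schwartz_partial)

lemma schwartz_gen_rapid:
  "f \<in> schwartz_gen \<Longrightarrow> bounded (range (\<lambda>x. (1 + norm x) ^ k * norm (f x)))"
proof (induction arbitrary: k rule: schwartz_gen.induct)
  case (gauss a y) then show ?case by (rule gauss_rapid)
next
  case (coord f i)
  obtain B where B: "B \<ge> 0" "\<And>x. (1 + norm x) ^ Suc k * norm (f x) \<le> B"
    using coord.IH[of "Suc k"] unfolding rapid_iff by auto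
  have "(1 + norm x) ^ k * norm (cor (x $ i) * f x) \<le> B" for x
  proof -
    have "(1 + norm x) ^ k * norm (cor (x $ i) * f x) = \<bar>x $ i\<bar> * ((1 + norm x) ^ k * norm (f x))"
      by (simp add: norm_mult)
    also have "\<dots> \<le> (1 + norm x) * ((1 + norm x) ^ k * norm (f x))"
      using component_le_norm_cart[of x i] by (intro mult_right_mono) auto
    also have "\<dots> \<le> B" using B(2)[of x] by (simp add: mult.assoc)
    finally show ?thesis .
  qed
  then show ?case using B unfolding rapid_iff by auto
next
  case (lin f g c d)
  obtain B where B: "B \<ge> 0" "\<And>x. (1 + norm x) ^ k * norm (f x) \<le> B"
    using lin.IH(1)[of k] unfolding rapid_iff by auto
  obtain B' where B': "B' \<ge> 0" "\<And>x. (1 + norm x) ^ k * norm (g x) \<le> B'"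
    using lin.IH(2)[of k] unfolding rapid_iff by auto
  have "(1 + norm x) ^ k * norm (c * f x + d * g x) \<le> norm c * B + norm d * B'" for x
  proof -
    have "(1 + norm x) ^ k * norm (c * f x + d * g x) \<le> (1 + norm x) ^ k * (norm c * norm (f x) + norm d * norm (g x))"
      by (intro mult_left_mono norm_triangle_le) (auto simp: norm_mult)
    also have "\<dots> = norm c * ((1 + norm x) ^ k * norm (f x)) + norm d * ((1 + norm x) ^ k * norm (g x))"
      by (simp add: algebra_simps)
    also have "\<dots> \<le> norm c * B + norm d * B'"
      using B B' by (intro add_mono mult_left_mono) auto
    finally show ?thesis .
  qed
  then show ?case using B B' unfolding rapid_iff
    by (intro exI[of _ "norm c * B + norm d * B'"]) auto
next
  case (mult f g)
  obtain B where B: "B \<ge> 0" "\<And>x. (1 + norm x) ^ k * norm (f x) \<le> B"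
    using mult.IH(1)[of k] unfolding rapid_iff by auto
  obtain B' where B': "B' \<ge> 0" "\<And>x. (1 + norm x) ^ 0 * norm (g x) \<le> B'"
    using mult.IH(2)[of 0] unfolding rapid_iff by auto
  have "(1 + norm x) ^ k * norm (f x * g x) \<le> B * B'" for x
    using mult_mono[OF B(2)[of x] B'(2)[of x]] B by (simp add: norm_mult mult.assoc)
  then show ?case using B B' unfolding rapid_iff
    by (intro exI[of _ "B * B'"]) auto
next
  case (reflect f)
  then show ?case unfolding rapid_iff by (metis norm_minus_cancel)
next
  case (cnj f)
  then show ?case by simp
qed (rule schwartz_bounded)

lemma schwartz_gen_eq: "schwartz_gen = schwartz"
  using schwartz_coinduct[of schwartz_gen] schwartz_gen_partial schwartz_gen_differentiable
    schwartz_gen_rapid schwartz_gen.base by blast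

lemmas schwartz_gauss = schwartz_gen.gauss[unfolded schwartz_gen_eq]
  and schwartz_coord = schwartz_gen.coord[unfolded schwartz_gen_eq]
  and schwartz_lin = schwartz_gen.lin[unfolded schwartz_gen_eq]
  and schwartz_mult = schwartz_gen.mult[unfolded schwartz_gen_eq]
  and schwartz_reflect = schwartz_gen.reflect[unfolded schwartz_gen_eq]
  and schwartz_cnj = schwartz_gen.cnj[unfolded schwartz_gen_eq]

lemma schwartz_scale: "f \<in> schwartz \<Longrightarrow> (\<lambda>x. c * f x) \<in> schwartz"
  using schwartz_lin[of f f c 0] by simp

lemma schwartz_add: "f \<in> schwartz \<Longrightarrow> g \<in> schwartz \<Longrightarrow> (\<lambda>x. f x + g x) \<in> schwartz"
  using schwartz_lin[of f g 1 1] by simp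

lemma schwartz_diff: "f \<in> schwartz \<Longrightarrow> g \<in> schwartz \<Longrightarrow> (\<lambda>x. f x - g x) \<in> schwartz"
  using schwartz_lin[of f g 1 "-1"] by simp

lemma schwartz_zero: "(\<lambda>x. 0) \<in> schwartz"
  using schwartz_scale[OF schwartz_gauss[of 1 0], of 0] by simp

lemma schwartz_sum:
  "finite I \<Longrightarrow> (\<And>i. i \<in> I \<Longrightarrow> f i \<in> schwartz) \<Longrightarrow> (\<lambda>x. \<Sum>i\<in>I. f i x) \<in> schwartz"
  by (induction rule: finite_induct) (auto intro!: schwartz_zero schwartz_add)

lemma integrable_rapid:
  fixes f :: "sfield"
  assumes "bm f" and B: "\<And>x. (1 + norm x) ^ 6 * norm (f x) \<le> B"
  shows "integrable lborel f"
proof (rule integrable_le)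
  show "integrable lborel (\<lambda>x::real^3. B * (1 / (1 + norm x) ^ 6))"
    by (rule integrable_mult_right[OF integrable_weight])
  have "norm (f x) \<le> B * (1 / (1 + norm x) ^ 6)" for x
    using B[of x] zero_less_power[of "1 + norm x" 6]
    by (simp add: pos_le_divide_eq mult.commute add_pos_nonneg)
  then show "AE x in lborel. norm (f x) \<le> norm (B * (1 / (1 + norm x) ^ 6))"
    by (intro AE_I2) (smt (verit) real_norm_def)
qed (use assms in auto)

lemma schwartz_integrable: "f \<in> schwartz \<Longrightarrow> integrable lborel f"
  using schwartz_bound[of f 6] integrable_rapid schwartz_measurable by metis


subsection \<open>The Fourier transform of Schwartz functions\<close>

lemma phase_schwartz_integrable:
  assumes "f \<in> schwartz"
  shows "integrable lborel (\<lambda>x. exp (- \<i> * cor (x \<bullet> z)) * f x)"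
  by (rule integrable_le[OF schwartz_integrable[OF assms]])
    (use schwartz_measurable[OF assms] in \<open>auto simp: norm_mult\<close>)

lemma exp_i_remainder: "norm (exp (- \<i> * cor r) - 1 + \<i> * cor r) \<le> r\<^sup>2"
proof -
  have "norm (iexp (- r) - (\<Sum>k\<le>1. (\<i> * (- r)) ^ k / fact k)) \<le> \<bar>- r\<bar> ^ Suc 1 / fact (Suc 1)"
    by (rule iexp_approx1)
  moreover have "iexp (- r) - (\<Sum>k\<le>1. (\<i> * (- r)) ^ k / fact k) = exp (- \<i> * cor r) - 1 + \<i> * cor r"
    by simp
  ultimately have "norm (exp (- \<i> * cor r) - 1 + \<i> * cor r) \<le> \<bar>- r\<bar> ^ Suc 1 / fact (Suc 1)"
    by (simp only:)
  then have "norm (exp (- \<i> * cor r) - 1 + \<i> * cor r) \<le> r\<^sup>2 / 2"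
    by (simp add: power2_eq_square)
  then show ?thesis by (smt (verit) field_sum_of_halves zero_le_power2)
qed

lemma schwartz_norm_power_integrable:
  assumes "f \<in> schwartz"
  shows "integrable lborel (\<lambda>x. norm x ^ k * norm (f x))"
proof -
  obtain B where B: "\<And>x. (1 + norm x) ^ (6 + k) * norm (f x) \<le> B" using schwartz_bound[OF assms] by metis
  have [measurable]: "bm f" by (rule schwartz_measurable[OF assms])
  have "integrable lborel (\<lambda>x. cor (norm x ^ k * norm (f x)))"
  proof (rule integrable_rapid)
    fix x
    have "(1 + norm x) ^ 6 * (norm x ^ k * norm (f x)) \<le> (1 + norm x) ^ 6 * ((1 + norm x) ^ k * norm (f x))"
      by (intro mult_left_mono mult_right_mono power_mono) auto
    also have "\<dots> \<le> B" using B[of x] by (simp add: power_add mult.assoc)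
    finally show "(1 + norm x) ^ 6 * norm (cor (norm x ^ k * norm (f x))) \<le> B"
      by (simp add: abs_mult norm_mult norm_power)
  qed measurable
  then show ?thesis by (simp only: complex_of_real_integrable_eq)
qed

text \<open>Differentiation under the integral by an explicit error bound: the Taylor remainder of
  the phase is quadratic in the increment, with the integrable factor |x|^2 |f x|.\<close>

lemma fourier_has_derivative:
  assumes f: "f \<in> schwartz"
  defines "L \<equiv> \<lambda>z v. LBINT x. exp (- \<i> * cor (x \<bullet> z)) * (- \<i> * cor (x \<bullet> v) * f x)"
  shows "(fourier f has_derivative L z) (at z)"
proof (rule has_derivativeI_sandwich[of 1 _ _ _ _ "\<lambda>y. (LBINT x. norm x ^ 2 * norm (f x)) * norm (y - z)"])
  have [measurable]: "bm f" by (rule schwartz_measurable[OF f])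
  let ?e = "\<lambda>x. exp (- \<i> * cor (x \<bullet> z))"
  have int: "integrable lborel (\<lambda>x. exp (- \<i> * cor (x \<bullet> z)) * (- \<i> * cor (x \<bullet> v) * f x))" for v
  proof (rule integrable_le)
    show "integrable lborel (\<lambda>x. norm v * (norm x ^ 1 * norm (f x)))"
      using schwartz_norm_power_integrable[OF f, of 1] by (rule integrable_mult_right)
    have "\<bar>x \<bullet> v\<bar> * norm (f x) \<le> norm v * (norm x * norm (f x))" for x
      using mult_right_mono[OF Cauchy_Schwarz_ineq2[of x v], of "norm (f x)"] by (simp add: algebra_simps)
    then show "AE x in lborel. norm (?e x * (- \<i> * cor (x \<bullet> v) * f x)) \<le> norm (norm v * (norm x ^ 1 * norm (f x)))"
      by (intro AE_I2) (simp add: norm_mult abs_mult)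
  qed measurable
  show "bounded_linear (L z)"
  proof (rule bounded_linear_intro)
    show "L z (v + w) = L z v + L z w" for v w
      unfolding L_def by (subst LINT_add[symmetric, OF int int])
        (simp add: inner_right_distrib algebra_simps)
    show "L z (r *\<^sub>R v) = r *\<^sub>R L z v" for r v
      unfolding L_def by (subst Bochner_Integration.integral_scaleR_right[symmetric]) (simp add: scaleR_conv_of_real[where 'a=complex] algebra_simps)
    show "norm (L z v) \<le> norm v * (LBINT x. norm x ^ 1 * norm (f x))" for v
    proof -
      have "norm (L z v) \<le> (LBINT x. norm v * (norm x ^ 1 * norm (f x)))"
        unfolding L_def
      proof (rule Bochner_Integration.integral_norm_bound_integral[OF int])
        show "integrable lborel (\<lambda>x. norm v * (norm x ^ 1 * norm (f x)))"
          using schwartz_norm_power_integrable[OF f, of 1] by (rule integrable_mult_right)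
        show "norm (?e x * (- \<i> * cor (x \<bullet> v) * f x)) \<le> norm v * (norm x ^ 1 * norm (f x))" for x
          using mult_right_mono[OF Cauchy_Schwarz_ineq2[of x v], of "norm (f x)"] by (simp add: algebra_simps norm_mult)
      qed
      then show ?thesis by simp
    qed
  qed
  show "(\<lambda>y. (LBINT x. norm x ^ 2 * norm (f x)) * norm (y - z)) \<midarrow>z\<rightarrow> 0"
    by (auto intro!: tendsto_eq_intros)
  fix y assume y: "y \<noteq> z" "dist y z < 1"
  define v where "v = y - z"
  have "fourier f y - fourier f z - L z v =
     (LBINT x. ?e x * (exp (- \<i> * cor (x \<bullet> v)) - 1 + \<i> * cor (x \<bullet> v)) * f x)"
    unfolding fourier_def L_def
    apply (subst LINT_diff[symmetric, OF phase_schwartz_integrable[OF f] phase_schwartz_integrable[OF f]])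
    apply (subst LINT_diff[symmetric, OF _ int])
    using phase_schwartz_integrable[OF f] apply simp
    apply (rule LINT_cong)
     apply (auto simp: v_def inner_diff_right algebra_simps exp_diff exp_minus field_simps)
    done
  also have "norm \<dots> \<le> (LBINT x. (norm v)\<^sup>2 * (norm x ^ 2 * norm (f x)))"
  proof (rule Bochner_Integration.integral_norm_bound_integral)
    show i: "integrable lborel (\<lambda>x. (norm v)\<^sup>2 * (norm x ^ 2 * norm (f x)))"
      using schwartz_norm_power_integrable[OF f, of 2] by (rule integrable_mult_right)
    have *: "norm (?e x * (exp (- \<i> * cor (x \<bullet> v)) - 1 + \<i> * cor (x \<bullet> v)) * f x)
      \<le> (norm v)\<^sup>2 * (norm x ^ 2 * norm (f x))" for x
    proof -
      have "norm (exp (- \<i> * cor (x \<bullet> v)) - 1 + \<i> * cor (x \<bullet> v)) \<le> (x \<bullet> v)\<^sup>2"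
        by (rule exp_i_remainder)
      also have "\<dots> \<le> (norm x * norm v)\<^sup>2"
        using Cauchy_Schwarz_ineq2[of x v] by (metis abs_ge_zero power2_abs power_mono)
      finally have "norm (exp (- \<i> * cor (x \<bullet> v)) - 1 + \<i> * cor (x \<bullet> v)) * norm (f x) \<le> (norm x * norm v)\<^sup>2 * norm (f x)"
        by (rule mult_right_mono) simp
      also have "\<dots> = (norm v)\<^sup>2 * (norm x ^ 2 * norm (f x))" by (simp add: power_mult_distrib)
      finally show ?thesis by (simp add: norm_mult del: minus_mult_left)
    qed
    show "integrable lborel (\<lambda>x. ?e x * (exp (- \<i> * cor (x \<bullet> v)) - 1 + \<i> * cor (x \<bullet> v)) * f x)"
      by (rule integrable_le[OF i]) (measurable, use * in auto)
    show "\<And>x. norm (?e x * (exp (- \<i> * cor (x \<bullet> v)) - 1 + \<i> * cor (x \<bullet> v)) * f x)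
      \<le> (norm v)\<^sup>2 * (norm x ^ 2 * norm (f x))" by (rule *)
  qed
  finally have "norm (fourier f y - fourier f z - L z v) \<le> (norm v)\<^sup>2 * (LBINT x. norm x ^ 2 * norm (f x))"
    by (simp only: integral_mult_right_zero)
  moreover have "norm v > 0" using y by (simp add: v_def)
  ultimately show "norm ((fourier f y - fourier f z) - L z (y - z)) / norm (y - z) \<le> (LBINT x. norm x ^ 2 * norm (f x)) * norm (y - z)"
    unfolding v_def[symmetric] by (simp add: pos_divide_le_eq power2_eq_square mult_ac)
qed simp

lemma partial_fourier:
  assumes "f \<in> schwartz"
  shows "partial j (fourier f) = fourier (\<lambda>x. - \<i> * (cor (x $ j) * f x))"
  using partial_eq[OF fourier_has_derivative[OF assms], of j]
  by (auto simp: fun_eq_iff inner_axis fourier_def mult.assoc)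

lemma fourier_translate:
  assumes "f \<in> schwartz"
  shows "(LBINT x. exp (- \<i> * cor (x \<bullet> z)) * f (x + v)) = exp (\<i> * cor (v \<bullet> z)) * fourier f z"
    and "integrable lborel (\<lambda>x. exp (- \<i> * cor (x \<bullet> z)) * f (x + v))"
proof -
  have [measurable]: "bm f" by (rule schwartz_measurable[OF assms])
  let ?g = "\<lambda>x. exp (\<i> * cor (v \<bullet> z)) * (exp (- \<i> * cor (x \<bullet> z)) * f x)"
  have eq: "exp (- \<i> * cor (x \<bullet> z)) * f (x + v) = ?g (x + v)" for x
    by (simp add: inner_add_left algebra_simps flip: exp_add mult.assoc)
  show "(LBINT x. exp (- \<i> * cor (x \<bullet> z)) * f (x + v)) = exp (\<i> * cor (v \<bullet> z)) * fourier f z"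
    unfolding eq by (subst lborel_integral_shift) (simp_all add: fourier_def)
  have "integrable lborel (\<lambda>x. ?g (v + 1 *\<^sub>R x))"
    by (rule lborel_integrable_affine) (use phase_schwartz_integrable[OF assms] in auto)
  then show "integrable lborel (\<lambda>x. exp (- \<i> * cor (x \<bullet> z)) * f (x + v))"
    unfolding eq by (simp add: add.commute)
qed

text \<open>Supplies the dominating function for the difference quotients in
  \<open>fourier_partial\<close>. Along a segment of length at most 1 the weight 1 + |x| changes by
  a factor of at most 2, whence 2 ^ 6.\<close>

lemma schwartz_difference_bound:
  assumes f: "f \<in> schwartz" and B: "\<And>x. (1 + norm x) ^ 6 * norm (partial j f x) \<le> B"
    and h: "0 < h" "h \<le> 1"
  shows "norm (f (x + h *\<^sub>R axis j 1) - f x) \<le> h * (2 ^ 6 * B * (1 / (1 + norm x) ^ 6))"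
proof -
  let ?g = "\<lambda>s. f (x + s *\<^sub>R axis j 1)"
  have d: "(?g has_derivative (\<lambda>s. s *\<^sub>R partial j f (x + s' *\<^sub>R axis j 1))) (at s')" for s'
  proof -
    let ?D = "frechet_derivative f (at (x + s' *\<^sub>R axis j 1))"
    have "(?g has_derivative (\<lambda>s. ?D (s *\<^sub>R axis j 1))) (at s')"
      by (rule has_derivative_compose[OF _ schwartz_has_derivative[OF f]]) (auto intro!: derivative_eq_intros)
    then show ?thesis
      using linear_frechet_derivative[OF schwartz_differentiable[OF f]]
      by (simp add: partial_def linear_cmul)
  qed
  have "norm (?g h - ?g 0) \<le> (2 ^ 6 * B * (1 / (1 + norm x) ^ 6)) * norm (h - 0)"
  proof (rule differentiable_bound[of "{0..h}"])
    fix s assume s: "s \<in> {0..h}"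
    show "(?g has_derivative (\<lambda>t. t *\<^sub>R partial j f (x + s *\<^sub>R axis j 1))) (at s within {0..h})"
      using d has_derivative_at_withinI by blast
    let ?y = "x + s *\<^sub>R axis j 1"
    have "norm x \<le> norm ?y + norm (s *\<^sub>R axis j 1 :: real^3)"
      by (metis add_diff_cancel_right' norm_triangle_sub norm_minus_commute norm_triangle_ineq4)
    then have "norm x \<le> norm ?y + 1" using s h by (simp add: norm_axis_1)
    then have "1 + norm x \<le> 2 * (1 + norm ?y)" by (simp add: algebra_simps) (smt (verit) norm_ge_zero)
    then have "(1 + norm x) ^ 6 \<le> (2 * (1 + norm ?y)) ^ 6"
      by (rule power_mono) simp
    then have "(1 + norm x) ^ 6 \<le> 2 ^ 6 * (1 + norm ?y) ^ 6"
      by (simp only: power_mult_distrib)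
    then have "(1 + norm x) ^ 6 * norm (partial j f ?y) \<le> 2 ^ 6 * (1 + norm ?y) ^ 6 * norm (partial j f ?y)"
      by (rule mult_right_mono) simp
    also have "\<dots> \<le> 2 ^ 6 * B" using B[of ?y] by simp
    finally have le: "norm (partial j f ?y) \<le> 2 ^ 6 * B * (1 / (1 + norm x) ^ 6)"
      using zero_less_power[of "1 + norm x" 6] by (simp add: pos_le_divide_eq mult.commute add_pos_nonneg)
    show "onorm (\<lambda>t. t *\<^sub>R partial j f ?y) \<le> 2 ^ 6 * B * (1 / (1 + norm x) ^ 6)"
    proof (rule onorm_le)
      fix t :: real
      have "\<bar>t\<bar> * norm (partial j f ?y) \<le> \<bar>t\<bar> * (2 ^ 6 * B * (1 / (1 + norm x) ^ 6))"
        by (intro mult_left_mono le) auto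
      then show "norm (t *\<^sub>R partial j f ?y) \<le> 2 ^ 6 * B * (1 / (1 + norm x) ^ 6) * norm t"
        by (simp only: norm_scaleR real_norm_def mult.commute)
    qed
  qed (use h in auto)
  then show ?thesis using h by (simp add: mult.commute)
qed

text \<open>Translation by h along an axis multiplies the transform by exp (i h z_j). Both sides are
  therefore limits of the transform of the same difference quotient, which replaces an integration
  by parts.\<close>

lemma fourier_partial:
  assumes f: "f \<in> schwartz"
  shows "fourier (partial j f) z = \<i> * cor (z $ j) * fourier f z"
proof -
  have [measurable]: "bm f" "bm (partial j f)"
    by (auto intro: schwartz_measurable f schwartz_partial)
  define h where "h n = 1 / real (Suc n)" for n
  have h: "h n > 0" "h n \<le> 1" for n by (auto simp: h_def)
  have h0: "h \<longlonglongrightarrow> 0" unfolding h_def using LIMSEQ_inverse_real_of_nat by (simp add: inverse_eq_divide)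
  have hat: "filterlim h (at 0) sequentially"
    using h0 h(1) by (auto simp: filterlim_at intro!: always_eventually) (metis less_irrefl)
  obtain B where B: "B \<ge> 0" "\<And>x. (1 + norm x) ^ 6 * norm (partial j f x) \<le> B"
    using schwartz_bound[OF schwartz_partial[OF f]] by metis
  let ?e = "\<lambda>x. exp (- \<i> * cor (x \<bullet> z))"
  let ?D = "\<lambda>n x. (f (x + h n *\<^sub>R axis j 1) - f x) / cor (h n)"
  have lim: "(\<lambda>n. LBINT x. ?e x * ?D n x) \<longlonglongrightarrow> (LBINT x. ?e x * partial j f x)"
  proof (rule integral_dominated_convergence)
    show "integrable lborel (\<lambda>x::real^3. 2 ^ 6 * B * (1 / (1 + norm x) ^ 6))"
      by (rule integrable_mult_right[OF integrable_weight])
    show "AE x in lborel. (\<lambda>n. ?e x * ?D n x) \<longlonglongrightarrow> ?e x * partial j f x"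
    proof (rule AE_I2, rule tendsto_mult_left)
      fix x
      let ?L = "frechet_derivative f (at x)"
      have "((\<lambda>s. f (x + s *\<^sub>R axis j 1)) has_derivative (\<lambda>s. ?L (s *\<^sub>R axis j 1))) (at 0)"
        by (rule has_derivative_compose[of "\<lambda>s. x + s *\<^sub>R axis j 1"])
          (auto intro!: derivative_eq_intros schwartz_has_derivative[OF f])
      then have "((\<lambda>s. f (x + s *\<^sub>R axis j 1)) has_derivative (\<lambda>s. s *\<^sub>R partial j f x)) (at 0)"
        using linear_frechet_derivative[OF schwartz_differentiable[OF f]]
        by (simp add: partial_def linear_cmul)
      then have "((\<lambda>s. norm (f (x + s *\<^sub>R axis j 1) - f x - s *\<^sub>R partial j f x) / norm s) \<longlongrightarrow> 0) (at 0)"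
        by (simp add: has_derivative_at)
      then have "((\<lambda>s. (f (x + s *\<^sub>R axis j 1) - f x) /\<^sub>R s - partial j f x) \<longlongrightarrow> 0) (at 0)"
      proof (intro tendsto_norm_zero_cancel[of "\<lambda>s. (f (x + s *\<^sub>R axis j 1) - f x) /\<^sub>R s - partial j f x"])
        assume "((\<lambda>s. norm (f (x + s *\<^sub>R axis j 1) - f x - s *\<^sub>R partial j f x) / norm s) \<longlongrightarrow> 0) (at 0)"
        then show "((\<lambda>s. norm ((f (x + s *\<^sub>R axis j 1) - f x) /\<^sub>R s - partial j f x)) \<longlongrightarrow> 0) (at 0)"
        proof (rule Lim_transform_within[of _ _ _ _ 1])
          fix s :: real assume "0 < dist s 0"
          then have s: "s \<noteq> 0" by simp
          then have "(f (x + s *\<^sub>R axis j 1) - f x) /\<^sub>R s - partial j f x = (f (x + s *\<^sub>R axis j 1) - f x - s *\<^sub>R partial j f x) /\<^sub>R s"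
            by (simp add: scaleR_diff_right)
          then show "norm (f (x + s *\<^sub>R axis j 1) - f x - s *\<^sub>R partial j f x) / norm s =
             norm ((f (x + s *\<^sub>R axis j 1) - f x) /\<^sub>R s - partial j f x)"
            using s by (simp add: divide_inverse mult.commute)
        qed simp
      qed
      then have "((\<lambda>s. (f (x + s *\<^sub>R axis j 1) - f x) /\<^sub>R s) \<longlongrightarrow> partial j f x) (at 0)"
        by (simp add: LIM_zero_iff)
      then have "(\<lambda>n. (f (x + h n *\<^sub>R axis j 1) - f x) /\<^sub>R h n) \<longlonglongrightarrow> partial j f x"
        using hat by (rule filterlim_compose)
      then show "(\<lambda>n. ?D n x) \<longlonglongrightarrow> partial j f x"
        by (simp add: scaleR_conv_of_real divide_inverse mult.commute)
    qed
    show "AE x in lborel. norm (?e x * ?D n x) \<le> 2 ^ 6 * B * (1 / (1 + norm x) ^ 6)" for n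
      using schwartz_difference_bound[OF f B(2) h[of n]] h[of n]
      by (intro AE_I2) (simp add: norm_mult norm_divide pos_divide_le_eq mult.commute)
  qed measurable
  have eq: "(LBINT x. ?e x * ?D n x) = (exp (\<i> * cor (h n * z $ j)) - 1) / cor (h n) * fourier f z" for n
  proof -
    have "(LBINT x. ?e x * ?D n x) = (LBINT x. (?e x * f (x + h n *\<^sub>R axis j 1) - ?e x * f x) / cor (h n))"
      by (simp add: algebra_simps)
    also have "\<dots> = (exp (\<i> * cor ((h n *\<^sub>R axis j 1) \<bullet> z)) * fourier f z - fourier f z) / cor (h n)"
      using fourier_translate[OF f, of z "h n *\<^sub>R axis j 1"] phase_schwartz_integrable[OF f, of z]
      by (simp add: fourier_def)
    also have "(h n *\<^sub>R axis j 1) \<bullet> z = h n * z $ j" by (simp add: inner_axis')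
    finally show ?thesis by (simp add: algebra_simps)
  qed
  have "(\<lambda>n. (exp (\<i> * cor (h n * z $ j)) - 1) / cor (h n) * fourier f z) \<longlonglongrightarrow> \<i> * cor (z $ j) * fourier f z"
  proof (rule tendsto_mult_right)
    have "((\<lambda>u. exp (\<i> * cor (z $ j) * u)) has_field_derivative \<i> * cor (z $ j)) (at 0)"
      by (auto intro!: derivative_eq_intros)
    then have *: "((\<lambda>u. (exp (\<i> * cor (z $ j) * u) - 1) / u) \<longlongrightarrow> \<i> * cor (z $ j)) (at 0)"
      by (simp add: has_field_derivative_iff)
    have "filterlim (\<lambda>n. cor (h n)) (at 0) sequentially"
      using tendsto_of_real[OF h0, where 'a=complex] h(1) by (auto simp: filterlim_at intro!: always_eventually) (metis less_irrefl)
    from filterlim_compose[OF * this]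
    show "(\<lambda>n. (exp (\<i> * cor (h n * z $ j)) - 1) / cor (h n)) \<longlonglongrightarrow> \<i> * cor (z $ j)"
      by (simp add: algebra_simps)
  qed
  then show ?thesis
    unfolding fourier_def[of "partial j f"] using LIMSEQ_unique[OF lim] by (simp only: eq)
qed

lemma norm_fourier_le:
  assumes "f \<in> schwartz"
  shows "norm (fourier f z) \<le> (LBINT x. norm (f x))"
  unfolding fourier_def
  by (rule Bochner_Integration.integral_norm_bound_integral[OF phase_schwartz_integrable[OF assms]])
    (use schwartz_integrable[OF assms] in \<open>auto simp: norm_mult\<close>)

lemma norm_le_sum_components: "norm (x :: real^3) \<le> (\<Sum>j\<in>UNIV. \<bar>x $ j\<bar>)"
  by (rule norm_le_l1_cart)

text \<open>One power of |z| on the transform is paid for by one derivative of f;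
  \<open>fourier_rapid\<close> iterates this.\<close>

lemma fourier_weight_le:
  assumes "f \<in> schwartz"
  shows "(1 + norm z) * norm (fourier f z) \<le> norm (fourier f z) + (\<Sum>j\<in>UNIV. norm (fourier (partial j f) z))"
proof -
  have "norm z * norm (fourier f z) \<le> (\<Sum>j\<in>UNIV. \<bar>z $ j\<bar>) * norm (fourier f z)"
    by (intro mult_right_mono norm_le_sum_components) simp
  also have "\<dots> = (\<Sum>j\<in>UNIV. norm (fourier (partial j f) z))"
    by (simp add: fourier_partial[OF assms] norm_mult sum_distrib_right)
  finally show ?thesis by (simp add: algebra_simps)
qed

lemma fourier_rapid:
  "f \<in> schwartz \<Longrightarrow> \<exists>B\<ge>0. \<forall>z. (1 + norm z) ^ k * norm (fourier f z) \<le> B"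
proof (induction k arbitrary: f)
  case 0
  then show ?case using norm_fourier_le[OF 0]
    by (intro exI[of _ "LBINT x. norm (f x)"]) auto
next
  case (Suc k)
  obtain B where B: "B \<ge> 0" "\<And>z. (1 + norm z) ^ k * norm (fourier f z) \<le> B"
    using Suc.IH[OF Suc.prems] by auto
  have "\<forall>j. \<exists>B\<ge>0. \<forall>z. (1 + norm z) ^ k * norm (fourier (partial j f) z) \<le> B"
    using Suc.IH schwartz_partial[OF Suc.prems] by blast
  then obtain B' where B': "\<And>j. B' j \<ge> 0" "\<And>j z. (1 + norm z) ^ k * norm (fourier (partial j f) z) \<le> B' j"
    by metis
  have "(1 + norm z) ^ Suc k * norm (fourier f z) \<le> B + (\<Sum>j\<in>UNIV. B' j)" for z
  proof -
    have "(1 + norm z) ^ Suc k * norm (fourier f z) = (1 + norm z) ^ k * ((1 + norm z) * norm (fourier f z))" by simp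
    also have "\<dots> \<le> (1 + norm z) ^ k * (norm (fourier f z) + (\<Sum>j\<in>UNIV. norm (fourier (partial j f) z)))"
      by (intro mult_left_mono fourier_weight_le[OF Suc.prems]) simp
    also have "\<dots> = (1 + norm z) ^ k * norm (fourier f z) + (\<Sum>j\<in>UNIV. (1 + norm z) ^ k * norm (fourier (partial j f) z))"
      by (simp add: distrib_left sum_distrib_left)
    also have "\<dots> \<le> B + (\<Sum>j\<in>UNIV. B' j)" by (intro add_mono sum_mono B B')
    finally show ?thesis .
  qed
  then show ?case using B B' by (intro exI[of _ "B + (\<Sum>j\<in>UNIV. B' j)"]) (auto intro!: sum_nonneg add_nonneg_nonneg)
qed

lemma fourier_schwartz: "f \<in> schwartz \<Longrightarrow> fourier f \<in> schwartz"
proof -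
  assume f: "f \<in> schwartz"
  have "fourier ` schwartz \<subseteq> schwartz"
  proof (rule schwartz_coinduct)
    fix g j assume "g \<in> fourier ` schwartz"
    then show "partial j g \<in> fourier ` schwartz"
      by (auto simp: partial_fourier intro!: imageI schwartz_scale[where c="- \<i>", simplified] schwartz_coord)
  next
    fix g x assume "g \<in> fourier ` schwartz"
    then show "g differentiable at x"
      using fourier_has_derivative by (auto simp: differentiable_def)
  next
    fix g k assume "g \<in> fourier ` schwartz"
    then show "bounded (range (\<lambda>x. (1 + norm x) ^ k * norm (g x)))"
      unfolding rapid_iff using fourier_rapid by auto
  qed
  then show ?thesis using f by blast
qed

definition inv_fourier :: "sfield \<Rightarrow> sfield" where
  "inv_fourier f z = fourier f (- z) / cor ((2 * pi) ^ 3)"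

lemma inv_fourier_schwartz: "f \<in> schwartz \<Longrightarrow> inv_fourier f \<in> schwartz"
  using schwartz_scale[OF schwartz_reflect[OF fourier_schwartz], of f "1 / cor ((2 * pi) ^ 3)"]
  by (simp add: inv_fourier_def[abs_def])

section \<open>Gaussian integrals and the inversion formula\<close>

lemma gauss_char_1: "integrable lborel (\<lambda>r. exp (\<i> * cor (t * r)) * cor (exp (- r\<^sup>2 / 2)))" (is ?I)
  "(LBINT r. exp (\<i> * cor (t * r)) * cor (exp (- r\<^sup>2 / 2))) =
   cor (sqrt (2 * pi) * exp (- t\<^sup>2 / 2))" (is ?E)
proof -
  have n: "integrable lborel std_normal_density" by (rule integrable_normal_density) simp
  have "integrable lborel (\<lambda>r. sqrt (2 * pi) * std_normal_density r)"
    using n by (rule integrable_mult_right)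
  then have g: "integrable lborel (\<lambda>r::real. exp (- r\<^sup>2 / 2))"
    by (simp add: std_normal_density_def)
  show ?I by (rule integrable_le[OF g]) (auto simp: norm_mult)
  have "(LBINT r. std_normal_density r *\<^sub>R iexp (t * r)) = cor (exp (- t\<^sup>2 / 2))"
    using fun_cong[OF char_std_normal_distribution, of t] unfolding char_def
    by (subst (asm) integral_density) (auto intro!: AE_I2)
  moreover have "exp (\<i> * cor (t * r)) * cor (exp (- r\<^sup>2 / 2)) =
     cor (sqrt (2 * pi)) * (std_normal_density r *\<^sub>R iexp (t * r))" for r
    by (simp add: std_normal_density_def scaleR_conv_of_real)
  ultimately have "(LBINT r. exp (\<i> * cor (t * r)) * cor (exp (- r\<^sup>2 / 2))) =
     cor (sqrt (2 * pi)) * cor (exp (- t\<^sup>2 / 2))"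
    by (simp only: integral_mult_right_zero)
  then show ?E by (simp only: of_real_mult)
qed

lemma prod_Basis_exp_inner:
  fixes x y :: "'a::euclidean_space"
  shows "(\<Prod>b\<in>Basis. exp (\<i> * cor ((x \<bullet> b) * (y \<bullet> b)))) = exp (\<i> * cor (x \<bullet> y))"
    "(\<Prod>b\<in>Basis. exp (- (y \<bullet> b)\<^sup>2 / 2)) = exp (- (y \<bullet> y) / 2)"
  by (simp_all add: exp_sum[symmetric] euclidean_inner[of x y] euclidean_inner[of y y] sum_distrib_left[symmetric]
     sum_divide_distrib sum_negf power2_eq_square)

lemma gauss_char_3:
  fixes x :: "real^3"
  shows "integrable lborel (\<lambda>z. exp (\<i> * cor (x \<bullet> z)) * cor (exp (- (z \<bullet> z) / 2)))" (is ?I)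
    and "(LBINT z. exp (\<i> * cor (x \<bullet> z)) * cor (exp (- (z \<bullet> z) / 2))) =
     cor (sqrt (2 * pi) ^ 3 * exp (- (x \<bullet> x) / 2))" (is ?E)
proof -
  let ?f = "\<lambda>b r. exp (\<i> * cor ((x \<bullet> b) * r)) * cor (exp (- r\<^sup>2 / 2))"
  have eq: "(\<Prod>b\<in>Basis. ?f b (z \<bullet> b)) = exp (\<i> * cor (x \<bullet> z)) * cor (exp (- (z \<bullet> z) / 2))" for z
    unfolding prod.distrib prod_Basis_exp_inner(1) of_real_prod[symmetric] prod_Basis_exp_inner(2) ..
  show ?I using lborel_product_integral(1)[of ?f] gauss_char_1(1) unfolding eq by auto
  have "(\<Prod>b\<in>(Basis::(real^3) set). cor (sqrt (2 * pi) * exp (- (x \<bullet> b)\<^sup>2 / 2))) =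
     cor (sqrt (2 * pi) ^ 3 * exp (- (x \<bullet> x) / 2))"
    unfolding of_real_prod[symmetric] prod.distrib prod_Basis_exp_inner(2) by simp
  then show ?E using lborel_product_integral(2)[of ?f] gauss_char_1 unfolding eq by auto
qed

lemma gauss_char_3_scaled:
  fixes x :: "real^3"
  assumes e: "e > 0"
  shows "integrable lborel (\<lambda>z. exp (\<i> * cor (x \<bullet> z)) * cor (exp (- (e\<^sup>2 * (z \<bullet> z)) / 2)))" (is ?I)
    and "(LBINT z. exp (\<i> * cor (x \<bullet> z)) * cor (exp (- (e\<^sup>2 * (z \<bullet> z)) / 2))) =
     cor (sqrt (2 * pi) ^ 3 * (exp (- (x \<bullet> x) / (2 * e\<^sup>2)) / e ^ 3))" (is ?E)
proof -
  let ?g = "\<lambda>z. exp (\<i> * cor ((x /\<^sub>R e) \<bullet> z)) * cor (exp (- (z \<bullet> z) / 2))"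
  have eq: "?g (0 + e *\<^sub>R z) = exp (\<i> * cor (x \<bullet> z)) * cor (exp (- (e\<^sup>2 * (z \<bullet> z)) / 2))" for z
  proof -
    have "(x /\<^sub>R e) \<bullet> (0 + e *\<^sub>R z) = x \<bullet> z" using e by simp
    then show ?thesis by (simp only:) (simp add: power2_eq_square mult_ac)
  qed
  show ?I using lborel_integrable_affine[of e ?g 0] gauss_char_3(1)[of "x /\<^sub>R e"] e unfolding eq by auto
  have "(LBINT z. ?g z) = e ^ 3 *\<^sub>R (LBINT z. ?g (0 + e *\<^sub>R z))"
    by (subst lborel_integral_affine[of e ?g 0]) (use e in auto)
  then have "e ^ 3 *\<^sub>R (LBINT z. ?g (0 + e *\<^sub>R z)) = cor (sqrt (2 * pi) ^ 3 * exp (- ((x /\<^sub>R e) \<bullet> (x /\<^sub>R e)) / 2))"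
    unfolding gauss_char_3(2) by simp
  also have "- ((x /\<^sub>R e) \<bullet> (x /\<^sub>R e)) / 2 = - ((x \<bullet> x) / (2 * e\<^sup>2))"
    using e by (simp add: power2_eq_square field_simps)
  finally have "cor (e ^ 3) * (LBINT z. ?g (0 + e *\<^sub>R z)) = cor (sqrt (2 * pi) ^ 3 * exp (- ((x \<bullet> x) / (2 * e\<^sup>2))))"
    by (simp add: scaleR_conv_of_real)
  then show ?E unfolding eq using e by (simp add: field_simps)
qed

text \<open>After y = x + e z the kernel no longer depends on the width e, so the limit e
  \<longlonglongrightarrow> 0 falls on f alone and dominated convergence applies.\<close>

lemma gauss_mollify:
  fixes f :: "sfield"
  assumes [measurable]: "bm f" and e: "e > 0"
  shows "(LBINT y. f y * cor (exp (- ((x - y) \<bullet> (x - y)) / (2 * e\<^sup>2)) / e ^ 3)) =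
     (LBINT z. f (x + e *\<^sub>R z) * cor (exp (- (z \<bullet> z) / 2)))"
proof -
  let ?g = "\<lambda>y. f y * cor (exp (- ((x - y) \<bullet> (x - y)) / (2 * e\<^sup>2)) / e ^ 3)"
  have "(LBINT y. ?g y) = e ^ 3 *\<^sub>R (LBINT z. ?g (x + e *\<^sub>R z))"
    by (subst lborel_integral_affine[of e ?g x]) (use e in auto)
  also have "\<dots> = (LBINT z. f (x + e *\<^sub>R z) * cor (exp (- (z \<bullet> z) / 2)))"
    unfolding integral_scaleR_right[symmetric] using e
    by (intro LINT_cong) (auto simp: scaleR_conv_of_real[where 'a=complex] power2_eq_square)
  finally show ?thesis .
qed

lemma gauss_integrable: "integrable lborel (\<lambda>z::real^3. exp (- (z \<bullet> z) / 2))"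
  and gauss_integral: "(LINT z::real^3|lborel. cor (exp (- (z \<bullet> z) / 2))) = cor (sqrt (2 * pi) ^ 3)"
  using gauss_char_3[of 0] by (simp_all only: inner_zero_left of_real_0 mult_zero_right exp_zero mult_1 complex_of_real_integrable_eq) simp_all

lemma gauss_mollify_limit:
  fixes f :: "sfield"
  assumes c: "continuous_on UNIV f" and B: "\<And>x. norm (f x) \<le> B"
  shows "(\<lambda>n. LBINT z. f (x + (1 / real (Suc n)) *\<^sub>R z) * cor (exp (- (z \<bullet> z) / 2)))
     \<longlonglongrightarrow> f x * cor (sqrt (2 * pi) ^ 3)"
proof -
  have [measurable]: "bm f" by (rule borel_measurable_continuous_onI[OF c])
  have "(\<lambda>n. LBINT z. f (x + (1 / real (Suc n)) *\<^sub>R z) * cor (exp (- (z \<bullet> z) / 2)))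
     \<longlonglongrightarrow> (LINT z::real^3|lborel. f x * cor (exp (- (z \<bullet> z) / 2)))"
  proof (rule integral_dominated_convergence)
    show "integrable lborel (\<lambda>z::real^3. B * exp (- (z \<bullet> z) / 2))"
      by (rule integrable_mult_right[OF gauss_integrable])
    show "AE z in lborel. (\<lambda>n. f (x + (1 / real (Suc n)) *\<^sub>R z) * cor (exp (- (z \<bullet> z) / 2)))
       \<longlonglongrightarrow> f x * cor (exp (- (z \<bullet> z) / 2))"
    proof (rule AE_I2, rule tendsto_mult_right)
      fix z
      have "(\<lambda>n. x + (1 / real (Suc n)) *\<^sub>R z) \<longlonglongrightarrow> x + 0 *\<^sub>R z"
        using LIMSEQ_inverse_real_of_nat unfolding inverse_eq_divide by (intro tendsto_intros)
      then show "(\<lambda>n. f (x + (1 / real (Suc n)) *\<^sub>R z)) \<longlonglongrightarrow> f x"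
        using c by (intro isCont_tendsto_compose[of x f]) (auto simp: continuous_on_eq_continuous_at)
    qed
  qed (auto simp: norm_mult B mult_right_mono)
  then show ?thesis by (simp only: integral_mult_right_zero gauss_integral)
qed

text \<open>Inserting the definition of \<open>fourier f\<close> gives a double integral that does
  not converge absolutely. The factor exp (- e^2 |z|^2 / 2) repairs this; Fubini then turns the left
  side into a Gaussian mollification of f, and both sides converge as e tends to 0.\<close>

lemma fourier_inversion:
  assumes f: "f \<in> schwartz"
  shows "(LBINT z. exp (\<i> * cor (x \<bullet> z)) * fourier f z) = cor ((2 * pi) ^ 3) * f x"
proof -
  have m[measurable]: "bm f" "bm (fourier f)"
    by (auto intro: schwartz_measurable f fourier_schwartz)
  obtain B where B: "\<And>x. (1 + norm x) ^ 0 * norm (f x) \<le> B" using schwartz_bound[OF f] by metis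
  define e where "e n = 1 / real (Suc n)" for n
  have e: "e n > 0" for n by (simp add: e_def)
  let ?E = "\<lambda>z. exp (\<i> * cor (x \<bullet> z))"
  let ?A = "\<lambda>n. LBINT z. ?E z * fourier f z * cor (exp (- ((e n)\<^sup>2 * (z \<bullet> z)) / 2))"
  have lim: "?A \<longlonglongrightarrow> (LBINT z. ?E z * fourier f z)"
  proof (rule integral_dominated_convergence)
    show "integrable lborel (\<lambda>z. norm (fourier f z))"
      using schwartz_integrable[OF fourier_schwartz[OF f]] by simp
    show "AE z in lborel. (\<lambda>n. ?E z * fourier f z * cor (exp (- ((e n)\<^sup>2 * (z \<bullet> z)) / 2)))
        \<longlonglongrightarrow> ?E z * fourier f z"
    proof (rule AE_I2)
      fix z :: "real^3"
      have "(\<lambda>n. ?E z * fourier f z * cor (exp (- ((e n)\<^sup>2 * (z \<bullet> z)) / 2)))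
        \<longlonglongrightarrow> ?E z * fourier f z * cor (exp (- (0\<^sup>2 * (z \<bullet> z)) / 2))"
        using LIMSEQ_inverse_real_of_nat unfolding e_def inverse_eq_divide by (intro tendsto_intros) auto
      then show "(\<lambda>n. ?E z * fourier f z * cor (exp (- ((e n)\<^sup>2 * (z \<bullet> z)) / 2))) \<longlonglongrightarrow> ?E z * fourier f z"
        by simp
    qed
  qed (auto simp: norm_mult intro!: mult_right_le_one_le mult_nonneg_nonneg)
  have A: "?A n = cor (sqrt (2 * pi) ^ 3) * (LBINT z. f (x + (1 / real (Suc n)) *\<^sub>R z) * cor (exp (- (z \<bullet> z) / 2)))" for n
  proof -
    let ?G = "\<lambda>z::real^3. cor (exp (- ((e n)\<^sup>2 * (z \<bullet> z)) / 2))"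
    have G: "integrable lborel ?G"
      using gauss_char_3_scaled(1)[OF e, of 0 n] by simp
    have int: "integrable (lborel \<Otimes>\<^sub>M lborel) (\<lambda>(z, y). ?E z * (exp (- \<i> * cor (y \<bullet> z)) * f y) * ?G z)"
    proof (rule integrable_le)
      show "integrable (lborel \<Otimes>\<^sub>M lborel) (\<lambda>(z, y). ?G z * f y)"
        by (rule integrable_pair_product[OF sigma_finite_lborel sigma_finite_lborel G schwartz_integrable[OF f]])
    qed (auto simp: norm_mult)
    have "?A n = (LBINT z. LBINT y. ?E z * (exp (- \<i> * cor (y \<bullet> z)) * f y) * ?G z)"
      unfolding fourier_def by simp
    also have "\<dots> = (LBINT y. LBINT z. ?E z * (exp (- \<i> * cor (y \<bullet> z)) * f y) * ?G z)"
      by (rule lborel_pair.Fubini_integral[symmetric, OF int])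
    also have "\<dots> = (LBINT y. f y * (LBINT z. exp (\<i> * cor ((x - y) \<bullet> z)) * ?G z))"
    proof (rule LINT_cong[OF refl])
      fix y
      have ph: "?E z * exp (- \<i> * cor (y \<bullet> z)) = exp (\<i> * cor ((x - y) \<bullet> z))" for z
        by (simp add: inner_diff_left algebra_simps flip: exp_add)
      have "?E z * (exp (- \<i> * cor (y \<bullet> z)) * f y) * ?G z = f y * (exp (\<i> * cor ((x - y) \<bullet> z)) * ?G z)" for z
        unfolding ph[symmetric] by (simp only: mult_ac)
      then show "(LBINT z. ?E z * (exp (- \<i> * cor (y \<bullet> z)) * f y) * ?G z) =
         f y * (LBINT z. exp (\<i> * cor ((x - y) \<bullet> z)) * ?G z)"
        by (simp only: integral_mult_right_zero)
    qed
    also have "\<dots> = cor (sqrt (2 * pi) ^ 3) * (LBINT y. f y * cor (exp (- ((x - y) \<bullet> (x - y)) / (2 * (e n)\<^sup>2)) / e n ^ 3))"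
      unfolding gauss_char_3_scaled(2)[OF e] integral_mult_right_zero[symmetric] of_real_mult
      by (intro LINT_cong refl) (simp only: mult_ac)
    also have "\<dots> = cor (sqrt (2 * pi) ^ 3) * (LBINT z. f (x + e n *\<^sub>R z) * cor (exp (- (z \<bullet> z) / 2)))"
      by (subst gauss_mollify[OF m(1) e]) simp
    finally show ?thesis by (simp add: e_def)
  qed
  have "?A \<longlonglongrightarrow> cor (sqrt (2 * pi) ^ 3) * (f x * cor (sqrt (2 * pi) ^ 3))"
    unfolding A using B by (intro tendsto_mult_left gauss_mollify_limit[of f B] schwartz_continuous[OF f]) simp
  from LIMSEQ_unique[OF lim this]
  have "(LBINT z. ?E z * fourier f z) = cor (sqrt (2 * pi) ^ 3 * sqrt (2 * pi) ^ 3) * f x"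
    by (simp only: of_real_mult mult_ac)
  also have "sqrt (2 * pi) ^ 3 * sqrt (2 * pi) ^ 3 = (2 * pi) ^ 3"
    unfolding power_mult_distrib[symmetric] by simp
  finally show ?thesis .
qed

lemma inv_fourier_fourier: "f \<in> schwartz \<Longrightarrow> inv_fourier (fourier f) = f"
  using fourier_inversion[of f]
  by (auto simp: fun_eq_iff inv_fourier_def fourier_def[of "fourier f"] inner_commute)

lemma fourier_inv_fourier: "f \<in> schwartz \<Longrightarrow> fourier (inv_fourier f) = f"
proof
  fix x assume f: "f \<in> schwartz"
  have [measurable]: "bm (fourier f)" by (intro schwartz_measurable fourier_schwartz f)
  have "fourier (inv_fourier f) x = (LBINT z. exp (- \<i> * cor (z \<bullet> x)) * fourier f (- z)) / cor ((2 * pi) ^ 3)"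
    by (simp add: fourier_def[of "inv_fourier f"] inv_fourier_def)
  also have "(LBINT z. exp (- \<i> * cor (z \<bullet> x)) * fourier f (- z)) = (LBINT z. exp (\<i> * cor (x \<bullet> z)) * fourier f z)"
    using lborel_integral_reflect[of "\<lambda>z. exp (\<i> * cor (x \<bullet> z)) * fourier f z" 0] by (simp add: inner_commute)
  finally show "fourier (inv_fourier f) x = f x" using fourier_inversion[OF f] by simp
qed

subsection \<open>Functions are determined by their integrals against Schwartz functions\<close>

text \<open>Gaussians suffice as test functions. Superposing them with a bounded continuous weight f
  mollifies f, so h annihilates f in the limit; the functions max 0 (1 - n dist) pass from there to
  indicators of closed sets, and closed sets form an intersection-stable generator of the Borel
  sets.\<close>

lemma schwartz_fundamental_integrable:
  fixes h :: "sfield"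
  assumes h: "integrable lborel h"
    and zero: "\<And>x e. e > 0 \<Longrightarrow> (LBINT y. h y * cor (exp (- ((x - y) \<bullet> (x - y)) / (2 * e\<^sup>2)))) = 0"
  shows "AE x in lborel. h x = 0"
proof -
  have [measurable]: "bm h" using h by auto
  have cont: "(LBINT y. h y * f y) = 0" if c: "continuous_on UNIV f" and B: "\<And>x. norm (f x) \<le> B" for f B
  proof -
    have [measurable]: "bm f" by (rule borel_measurable_continuous_onI[OF c])
    define e where "e n = 1 / real (Suc n)" for n
    have e: "e n > 0" for n by (simp add: e_def)
    let ?K = "\<lambda>n y. LBINT z. f (y + (1 / real (Suc n)) *\<^sub>R z) * cor (exp (- (z \<bullet> z) / 2))"
    have "(\<lambda>n. LBINT y. h y * ?K n y) \<longlonglongrightarrow> (LBINT y. h y * (f y * cor (sqrt (2 * pi) ^ 3)))"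
    proof (rule integral_dominated_convergence)
      show "AE y in lborel. (\<lambda>n. h y * ?K n y) \<longlonglongrightarrow> h y * (f y * cor (sqrt (2 * pi) ^ 3))"
        by (intro AE_I2 tendsto_mult_left gauss_mollify_limit[OF c B])
      show "integrable lborel (\<lambda>y. norm (h y) * (LINT z::real^3|lborel. B * exp (- (z \<bullet> z) / 2)))"
        using h by (intro integrable_mult_left) auto
      have K: "norm (?K n y) \<le> (LINT z::real^3|lborel. B * exp (- (z \<bullet> z) / 2))" for n y
      proof (rule Bochner_Integration.integral_norm_bound_integral)
        show i: "integrable lborel (\<lambda>z::real^3. B * exp (- (z \<bullet> z) / 2))"
          by (rule integrable_mult_right[OF gauss_integrable])
        show b: "norm (f (y + (1 / real (Suc n)) *\<^sub>R z) * cor (exp (- (z \<bullet> z) / 2))) \<le> B * exp (- (z \<bullet> z) / 2)" for z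
          using B by (auto simp: norm_mult intro!: mult_right_mono)
        show "integrable lborel (\<lambda>z. f (y + (1 / real (Suc n)) *\<^sub>R z) * cor (exp (- (z \<bullet> z) / 2)))"
          by (rule integrable_le[OF i]) (measurable, use b in \<open>auto intro: order_trans[OF _ abs_ge_self]\<close>)
      qed
      show "AE y in lborel. norm (h y * ?K n y) \<le> norm (h y) * (LINT z::real^3|lborel. B * exp (- (z \<bullet> z) / 2))" for n
        using K by (intro AE_I2) (auto simp: norm_mult intro!: mult_left_mono)
    qed measurable
    moreover have "(LBINT y. h y * ?K n y) = 0" for n
    proof -
      let ?G = "\<lambda>x y::real^3. cor (exp (- ((x - y) \<bullet> (x - y)) / (2 * (e n)\<^sup>2)))"
      have inner_swap: "(y - x) \<bullet> (y - x) = (x - y) \<bullet> (x - y)" for x y :: "real^3"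
        by (metis inner_minus_left inner_minus_right minus_diff_eq)
      have "(LBINT y. h y * ?K n y) = (LBINT y. h y * (LBINT x. f x * cor (exp (- ((y - x) \<bullet> (y - x)) / (2 * (e n)\<^sup>2)) / e n ^ 3)))"
        by (subst gauss_mollify[OF _ e]) (simp_all add: e_def)
      also have "\<dots> = (LBINT y. LBINT x. f x / cor (e n ^ 3) * (h y * ?G x y))"
        unfolding integral_mult_right_zero[symmetric]
      proof (intro LINT_cong refl)
        fix y x
        show "h y * (f x * cor (exp (- ((y - x) \<bullet> (y - x)) / (2 * (e n)\<^sup>2)) / e n ^ 3)) =
          f x / cor (e n ^ 3) * (h y * ?G x y)"
          unfolding inner_swap[of y x] by simp
      qed
      also have "\<dots> = (LBINT x. LBINT y. f x / cor (e n ^ 3) * (h y * ?G x y))"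
      proof (rule lborel_pair.Fubini_integral)
        have G1: "integrable lborel (\<lambda>x::real^3. exp (- (x \<bullet> x) / (2 * (e n)\<^sup>2)))"
          using lborel_integrable_affine[OF _ gauss_integrable, of "1 / e n" 0] e[of n]
          by (simp add: power2_eq_square mult_ac)
        have sh: "(\<lambda>x. exp (- ((x - y) \<bullet> (x - y)) / (2 * (e n)\<^sup>2))) = (\<lambda>x. exp (- ((- y + 1 *\<^sub>R x) \<bullet> (- y + 1 *\<^sub>R x)) / (2 * (e n)\<^sup>2)))" for y :: "real^3"
          by simp
        have G2: "integrable lborel (\<lambda>x. exp (- ((x - y) \<bullet> (x - y)) / (2 * (e n)\<^sup>2)))" for y :: "real^3"
          unfolding sh by (rule lborel_integrable_affine[OF _ G1]) simp
        have G3: "(LBINT x. exp (- ((x - y) \<bullet> (x - y)) / (2 * (e n)\<^sup>2))) = (LINT x::real^3|lborel. exp (- (x \<bullet> x) / (2 * (e n)\<^sup>2)))" for y :: "real^3"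
          using lborel_integral_shift[of "\<lambda>x::real^3. exp (- (x \<bullet> x) / (2 * (e n)\<^sup>2))" "-y"] by simp
        have "integrable (lborel \<Otimes>\<^sub>M lborel) (\<lambda>(y, x). h y * ?G x y)"
        proof (rule lborel_pair.Fubini_integrable)
          show "integrable lborel (\<lambda>y. LBINT x. norm (case (y, x) of (y, x) \<Rightarrow> h y * ?G x y))"
            unfolding prod.case norm_mult norm_of_real abs_exp_cancel integral_mult_right_zero G3
            using h by (intro integrable_mult_left integrable_norm)
          show "AE y in lborel. integrable lborel (\<lambda>x. case (y, x) of (y, x) \<Rightarrow> h y * ?G x y)"
            using G2 by (intro AE_I2) (simp del: of_real_exp)
        qed measurable
        then have "integrable (lborel \<Otimes>\<^sub>M lborel) (\<lambda>p. B / e n ^ 3 * norm (case p of (y, x) \<Rightarrow> h y * ?G x y))"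
          by (intro integrable_mult_right integrable_norm)
        then have "integrable (lborel \<Otimes>\<^sub>M lborel) (\<lambda>(y, x). f x / cor (e n ^ 3) * (h y * ?G x y))"
        proof (rule integrable_le)
          have "norm (f x / cor (e n ^ 3) * (h y * ?G x y)) \<le> B / e n ^ 3 * norm (h y * ?G x y)" for x y
            unfolding norm_mult[of "_ / _"] using B[of x] e[of n]
            by (intro mult_right_mono) (auto simp: norm_divide norm_power divide_right_mono)
          then have "norm (case p of (y, x) \<Rightarrow> f x / cor (e n ^ 3) * (h y * ?G x y))
             \<le> B / e n ^ 3 * norm (case p of (y, x) \<Rightarrow> h y * ?G x y)" for p
            by (cases p) (simp only: prod.case)
          then show "AE p in lborel \<Otimes>\<^sub>M lborel. norm (case p of (y, x) \<Rightarrow> f x / cor (e n ^ 3) * (h y * ?G x y))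
             \<le> norm (B / e n ^ 3 * norm (case p of (y, x) \<Rightarrow> h y * ?G x y))"
            unfolding real_norm_def[of "B / e n ^ 3 * _"] by (intro AE_I2 order_trans[OF _ abs_ge_self])
        qed measurable
        from lborel_pair.integrable_product_swap[OF this]
        show "integrable (lborel \<Otimes>\<^sub>M lborel) (\<lambda>(x, y). f x / cor (e n ^ 3) * (h y * ?G x y))"
          by (simp add: case_prod_beta)
      qed
      also have "\<dots> = 0" using zero[OF e] by simp
      finally show ?thesis .
    qed
    ultimately have "(LBINT y. h y * (f y * cor (sqrt (2 * pi) ^ 3))) = 0"
      by (simp add: LIMSEQ_const_iff)
    then have "(LBINT y. h y * f y) * cor (sqrt (2 * pi) ^ 3) = 0"
      unfolding integral_mult_left_zero[symmetric] by (simp only: mult.assoc)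
    then show ?thesis by simp
  qed
  have clo: "(LBINT y. h y * indicator A y) = 0" if A: "closed A" for A
  proof (cases "A = {}")
    case False
    let ?f = "\<lambda>n y. cor (max 0 (1 - real n * infdist y A))"
    have [measurable]: "A \<in> sets borel" using A by simp
    have c: "continuous_on UNIV (?f n)" for n by (intro continuous_intros)
    have b: "norm (?f n y) \<le> 1" for n y using infdist_nonneg[of y A] by (auto simp: max_def)
    have [measurable]: "?f n \<in> borel_measurable borel" for n by (rule borel_measurable_continuous_onI[OF c])
    have "(\<lambda>n. LBINT y. h y * ?f n y) \<longlonglongrightarrow> (LBINT y. h y * indicator A y)"
    proof (rule integral_dominated_convergence)
      show "AE y in lborel. (\<lambda>n. h y * ?f n y) \<longlonglongrightarrow> h y * indicator A y"
      proof (rule AE_I2, rule tendsto_mult_left)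
        fix y
        show "(\<lambda>n. ?f n y) \<longlonglongrightarrow> indicator A y"
        proof (cases "y \<in> A")
          case True then show ?thesis by simp
        next
          case F: False
          then have d: "infdist y A > 0" using A False in_closed_iff_infdist_zero infdist_nonneg
            by (metis less_eq_real_def)
          obtain N where N: "real N * infdist y A > 1" using d reals_Archimedean3 by blast
          have "?f n y = 0" if "n \<ge> N" for n
          proof -
            have "real N * infdist y A \<le> real n * infdist y A"
              using that d by (intro mult_right_mono) auto
            then show ?thesis using N by (simp add: max_def)
          qed
          then have "eventually (\<lambda>n. ?f n y = 0) sequentially" unfolding eventually_sequentially by blast
          then show ?thesis using F by (simp add: tendsto_eventually)
        qed
      qed
      show "AE y in lborel. norm (h y * ?f n y) \<le> norm (h y)" for n
        using b by (intro AE_I2) (simp only: norm_mult mult_right_le_one_le norm_ge_zero)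
    qed (use h in \<open>auto simp: indicator_def\<close>)
    moreover have "(LBINT y. h y * ?f n y) = 0" for n by (rule cont[OF c b])
    ultimately show ?thesis by (simp add: LIMSEQ_const_iff)
  qed simp
  have i: "set_integrable lborel A h" if "A \<in> sets borel" for A
    unfolding set_integrable_def
    by (rule integrable_le[OF h]) (use that in \<open>auto simp: indicator_def\<close>)
  have closed: "set_lebesgue_integral lborel A h = 0" if "closed A" for A
    using clo[OF that] by (simp add: set_lebesgue_integral_def scaleR_conv_of_real mult.commute of_real_indicator)
  have all: "set_lebesgue_integral lborel A h = 0" if "A \<in> sets borel" for A
  proof -
    have "Int_stable (Collect closed :: (real^3) set set)" by (auto simp: Int_stable_def)
    moreover have "Collect closed \<subseteq> Pow (UNIV :: (real^3) set)" by simp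
    moreover have "A \<in> sigma_sets UNIV (Collect closed)" using that by (simp add: borel_eq_closed)
    ultimately show ?thesis
    proof (induction rule: sigma_sets_induct_disjoint)
      case (compl A)
      then have A: "A \<in> sets borel" by (simp add: borel_eq_closed)
      have "set_lebesgue_integral lborel (A \<union> (UNIV - A)) h = set_lebesgue_integral lborel A h + set_lebesgue_integral lborel (UNIV - A) h"
        by (rule set_integral_Un) (use A in \<open>auto intro!: i\<close>)
      then show ?case using compl closed[of UNIV] by (simp add: Un_Diff_cancel)
    next
      case (union A)
      then have A: "\<And>i. A i \<in> sets borel" by (auto simp: borel_eq_closed)
      have "set_lebesgue_integral lborel (\<Union>i. A i) h = (\<Sum>i. set_lebesgue_integral lborel (A i) h)"
        by (rule lebesgue_integral_countable_add) (use A union in \<open>auto simp: disjoint_family_on_def intro!: i\<close>)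
      then show ?case using union by simp
    qed (auto intro: closed)
  qed
  show ?thesis by (rule sigma_finite_measure.density_zero[OF sigma_finite_lborel h]) (use all in auto)
qed

lemma borel_measurable_vec_nth [measurable (raw)]:
  fixes f :: "'a \<Rightarrow> 'b::euclidean_space ^ 'n"
  assumes "f \<in> borel_measurable M"
  shows "(\<lambda>x. f x $ i) \<in> borel_measurable M"
  by (rule measurable_compose[OF assms]) (auto intro!: borel_measurable_continuous_onI continuous_intros)

lemma borel_measurable_vec_lambda [measurable (raw)]:
  fixes f :: "'n::finite \<Rightarrow> 'a \<Rightarrow> 'b::euclidean_space"
  assumes "\<And>i. f i \<in> borel_measurable M"
  shows "(\<lambda>x. \<chi> i. f i x) \<in> borel_measurable M"
  by (subst borel_measurable_euclidean_space) (use assms in \<open>auto simp: Basis_vec_def inner_axis\<close>)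

lemma integrable_dominated:
  fixes f :: "'a \<Rightarrow> 'b::{banach, second_countable_topology}"
  assumes "integrable M g" "f \<in> borel_measurable M" "\<And>x. norm (f x) \<le> g x"
  shows "integrable M f"
  using assms(1,2)
proof (rule integrable_le)
  show "AE x in M. norm (f x) \<le> norm (g x)"
    using assms(3) order_trans[OF _ abs_ge_self] by (intro AE_I2) (simp add: order_trans[OF _ abs_ge_self])
qed

subsection \<open>Distributions whose Fourier transform is a function\<close>

lemma schwartz_norm_upper:
  assumes f: "f \<in> schwartz" and js: "length js \<le> N"
  shows "(1 + norm x) ^ N * norm (partials js f x) \<le> schwartz_norm N f"
proof -
  have "\<exists>B\<ge>0. \<forall>x. (1 + norm x) ^ N * norm (partials js f x) \<le> B" for js
    using schwartz_bounded[OF schwartz_partials[OF f]] unfolding rapid_iff by blast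
  then obtain B where B: "\<And>js x. (1 + norm x) ^ N * norm (partials js f x) \<le> B js" by metis
  have fin: "finite {js :: 3 list. length js \<le> N}"
    using finite_lists_length_le[of "UNIV :: 3 set" N] by simp
  have "bdd_above ((\<lambda>(js, x). (1 + norm x) ^ N * norm (partials js f x)) ` ({js. length js \<le> N} \<times> UNIV))"
  proof (rule bdd_aboveI)
    fix r assume "r \<in> (\<lambda>(js, x). (1 + norm x) ^ N * norm (partials js f x)) ` ({js. length js \<le> N} \<times> UNIV)"
    then obtain js x where "length js \<le> N" "r = (1 + norm x) ^ N * norm (partials js f x)" by auto
    moreover have "B js \<le> Max (B ` {js. length js \<le> N})" if "length js \<le> N" for js
      using fin that by (intro Max_ge) auto
    ultimately show "r \<le> Max (B ` {js. length js \<le> N})" using B order_trans by blast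
  qed
  then show ?thesis
    unfolding schwartz_norm_def using js cSUP_upper[of "(js, x)" "{js. length js \<le> N} \<times> UNIV"
      "\<lambda>(js, x). (1 + norm x) ^ N * norm (partials js f x)"] by simp
qed

text \<open>The functions for which integration against Schwartz functions makes sense in the cases at hand:
  those in \<open>L\<^sup>1\<close>, and those in \<open>L\<^sup>1\<close> with weight \<open>\<bar>z\<bar>\<^sup>-\<^sup>1\<close>.\<close>

definition slow :: "sfield \<Rightarrow> bool" where
  "slow w \<longleftrightarrow> w \<in> borel_measurable borel \<and> integrable lborel (\<lambda>z. norm (w z) / (1 + norm z))"

lemma one_plus_norm_pos [simp]: "0 < 1 + norm x" "1 + norm x \<noteq> 0" "0 \<le> 1 + norm x"
  by (smt (verit) norm_ge_zero)+

lemma slow_pairing: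
  assumes w: "slow w" and m: "bm f" and B: "\<And>z. (1 + norm z) * norm (f z) \<le> B"
  shows "integrable lborel (\<lambda>z. w z * f z)"
    and "norm (LBINT z. w z * f z) \<le> (LBINT z. norm (w z) / (1 + norm z)) * B"
proof -
  have [measurable]: "bm w" "bm f" using w m by (auto simp: slow_def)
  have i: "integrable lborel (\<lambda>z. norm (w z) / (1 + norm z) * B)"
    using w by (intro integrable_mult_left) (simp add: slow_def)
  have b: "norm (w z * f z) \<le> norm (w z) / (1 + norm z) * B" for z
  proof -
    have "norm (w z * f z) = norm (w z) / (1 + norm z) * ((1 + norm z) * norm (f z))"
      by (simp add: norm_mult)
    also have "\<dots> \<le> norm (w z) / (1 + norm z) * B" using B by (intro mult_left_mono) auto
    finally show ?thesis .
  qed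
  show I: "integrable lborel (\<lambda>z. w z * f z)"
    by (rule integrable_dominated[OF i _ b]) measurable
  show "norm (LBINT z. w z * f z) \<le> (LBINT z. norm (w z) / (1 + norm z)) * B"
    using Bochner_Integration.integral_norm_bound_integral[OF I i b] by (simp only: integral_mult_left_zero)
qed

lemma slow_schwartz:
  assumes "slow w" "f \<in> schwartz"
  shows "integrable lborel (\<lambda>z. w z * f z)"
proof -
  obtain B where "\<And>z. (1 + norm z) ^ 1 * norm (f z) \<le> B" using schwartz_bound[OF assms(2)] by metis
  then show ?thesis using slow_pairing(1)[OF assms(1) schwartz_measurable[OF assms(2)], of B] by simp
qed

lemma slow_locally_integrable:
  assumes "slow w" shows "locally_integrable w"
  unfolding locally_integrable_def set_integrable_def
proof safe
  fix K :: "(real^3) set" assume K: "compact K"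
  then obtain R where R: "\<And>x. x \<in> K \<Longrightarrow> norm x \<le> R" using compact_imp_bounded bounded_iff by metis
  have [measurable]: "bm w" "K \<in> sets borel"
    using assms K by (auto simp: slow_def compact_imp_closed)
  have "integrable lborel (\<lambda>z. norm (w z) / (1 + norm z) * (1 + \<bar>R\<bar>))"
    using assms by (intro integrable_mult_left) (simp add: slow_def)
  then show "integrable lborel (\<lambda>x. indicat_real K x *\<^sub>R w x)"
  proof (rule integrable_le)
    have "norm (w z) \<le> norm (w z) / (1 + norm z) * (1 + \<bar>R\<bar>)" if "z \<in> K" for z
    proof -
      have "norm (w z) = norm (w z) / (1 + norm z) * (1 + norm z)" by simp
      also have "\<dots> \<le> norm (w z) / (1 + norm z) * (1 + \<bar>R\<bar>)" using R[OF that] by (intro mult_left_mono) auto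
      finally show ?thesis .
    qed
    then show "AE x in lborel. norm (indicat_real K x *\<^sub>R w x) \<le> norm (norm (w x) / (1 + norm x) * (1 + \<bar>R\<bar>))"
      by (intro AE_I2) (auto simp: indicator_def abs_mult)
  qed measurable
qed

lemma locally_integrable_measurable:
  assumes "locally_integrable f" shows "bm f"
proof (rule borel_measurable_LIMSEQ_metric)
  show "bm (\<lambda>x. indicat_real (cball 0 (real n)) x *\<^sub>R f x)" for n
  proof -
    have "integrable lborel (\<lambda>x. indicat_real (cball 0 (real n)) x *\<^sub>R f x)"
      using assms[unfolded locally_integrable_def set_integrable_def, rule_format, OF compact_cball] .
    from borel_measurable_integrable[OF this] show ?thesis by simp
  qed
  fix x :: "real^3"
  obtain N where "norm x \<le> real N" using real_arch_simple by blast
  then have "indicat_real (cball 0 (real n)) x *\<^sub>R f x = f x" if "n \<ge> N" for n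
    using that by (auto simp: indicator_def)
  then show "(\<lambda>n. indicat_real (cball 0 (real n)) x *\<^sub>R f x) \<longlonglongrightarrow> f x"
    by (intro tendsto_eventually) (auto simp: eventually_sequentially)
qed

lemma representsD:
  assumes "represents g T" "f \<in> schwartz"
  shows "integrable lborel (\<lambda>x. g x * f x)" "T f = (LBINT x. g x * f x)"
  using assms by (auto simp: represents_def)

lemma represents_measurable: "represents g T \<Longrightarrow> bm g"
  by (simp add: represents_def locally_integrable_measurable)

text \<open>Multiplication by a fixed Gaussian makes g integrable without creating zeros, and the
  product of that Gaussian with another one is still a Schwartz test function.\<close>

lemma schwartz_fundamental:
  assumes [measurable]: "bm g"
    and i: "\<And>f. f \<in> schwartz \<Longrightarrow> integrable lborel (\<lambda>x. g x * f x)"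
    and z: "\<And>f. f \<in> schwartz \<Longrightarrow> (LBINT x. g x * f x) = 0"
  shows "AE x in lborel. g x = 0"
proof -
  let ?e = "\<lambda>y. cor (exp (- 1 * ((y - 0) \<bullet> (y - (0::real^3)))))"
  have e: "?e \<in> schwartz" by (rule schwartz_gauss) simp
  have "AE x in lborel. g x * ?e x = 0"
  proof (rule schwartz_fundamental_integrable)
    show "integrable lborel (\<lambda>x. g x * ?e x)" by (rule i[OF e])
    fix x :: "real^3" and d :: real assume d: "d > 0"
    have sw: "(x - y) \<bullet> (x - y) = (y - x) \<bullet> (y - x)" for y
      by (metis inner_minus_left inner_minus_right minus_diff_eq)
    have "(\<lambda>y. cor (exp (- (1 / (2 * d\<^sup>2)) * ((y - x) \<bullet> (y - x))))) \<in> schwartz"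
      by (rule schwartz_gauss) (use d in simp)
    then have "(\<lambda>y. cor (exp (- ((x - y) \<bullet> (x - y)) / (2 * d\<^sup>2)))) \<in> schwartz"
      unfolding sw by simp
    from z[OF schwartz_mult[OF e this]]
    show "(LBINT y. g y * ?e y * cor (exp (- ((x - y) \<bullet> (x - y)) / (2 * d\<^sup>2)))) = 0"
      by (simp only: mult.assoc)
  qed
  then show ?thesis by eventually_elim simp
qed

lemma represents_unique:
  assumes g: "represents g T" and h: "represents h S" and eq: "dist_eq T S"
  shows "AE x in lborel. g x = h x"
proof -
  have [measurable]: "bm g" "bm h"
    using g h by (auto intro: represents_measurable)
  have "AE x in lborel. g x - h x = 0"
  proof (rule schwartz_fundamental)
    fix f assume f: "f \<in> schwartz"
    show "integrable lborel (\<lambda>x. (g x - h x) * f x)"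
      using representsD(1)[OF g f] representsD(1)[OF h f] by (simp add: left_diff_distrib)
    show "(LBINT x. (g x - h x) * f x) = 0"
      using representsD[OF g f] representsD[OF h f] eq f by (simp add: left_diff_distrib dist_eq_def)
  qed measurable
  then show ?thesis by simp
qed

lemma represents_fun_of: "represents g T \<Longrightarrow> represents (fun_of T) T"
  unfolding fun_of_def by (rule someI[of "\<lambda>g. represents g T"])

lemma fun_of_AE: "represents g T \<Longrightarrow> AE x in lborel. fun_of T x = g x"
  using represents_unique[OF represents_fun_of] by (auto simp: dist_eq_def)

definition frep :: "sfield \<Rightarrow> tdist \<Rightarrow> bool" where
  "frep g T \<longleftrightarrow> represents g (fourier_dist T)"

lemma frepD:
  assumes "frep g T" "f \<in> schwartz"
  shows "integrable lborel (\<lambda>x. g x * f x)" "T (fourier f) = (LBINT x. g x * f x)"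
  using representsD assms by (auto simp: frep_def fourier_dist_def)

lemma frep_measurable: "frep g T \<Longrightarrow> bm g"
  by (auto simp: frep_def represents_measurable)

lemma frep_unique:
  assumes "frep g T" "frep h S" "dist_eq T S"
  shows "AE x in lborel. g x = h x"
  using represents_unique[of g "fourier_dist T" h "fourier_dist S"] assms
  by (auto simp: frep_def dist_eq_def fourier_dist_def fourier_schwartz)

lemma frep_dist_eq:
  assumes g: "frep g T" and h: "frep h S" and eq: "AE x in lborel. g x = h x"
  shows "dist_eq T S"
  unfolding dist_eq_def
proof
  fix f assume f: "f \<in> schwartz"
  have [measurable]: "bm g" "bm h" "bm (inv_fourier f)"
    using g h f by (auto intro: frep_measurable inv_fourier_schwartz schwartz_measurable)
  have "T (fourier (inv_fourier f)) = S (fourier (inv_fourier f))"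
    unfolding frepD(2)[OF g inv_fourier_schwartz[OF f]] frepD(2)[OF h inv_fourier_schwartz[OF f]]
    by (rule LINT_cong_AE) (use eq in auto)
  then show "T f = S f" using fourier_inv_fourier[OF f] by simp
qed

lemma frep_diff: "frep g T \<Longrightarrow> frep h S \<Longrightarrow> frep (\<lambda>x. g x - h x) (T - S)"
  unfolding frep_def represents_def locally_integrable_def fourier_dist_def
  by (auto simp: left_diff_distrib set_integrable_def scaleR_diff_right)

lemma frep_add: "frep g T \<Longrightarrow> frep h S \<Longrightarrow> frep (\<lambda>x. g x + h x) (T + S)"
  unfolding frep_def represents_def locally_integrable_def fourier_dist_def
  by (auto simp: distrib_right set_integrable_def scaleR_add_right)

text \<open>The inverse transform by duality: a field in \<chi>^-1 has a transform that is
  integrable only with a weight, so no pointwise inverse integral can be used.\<close>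

definition ift :: "sfield \<Rightarrow> tdist" where
  "ift w f = (LBINT z. w z * inv_fourier f z)"

lemma frep_ift:
  assumes "slow w" shows "frep w (ift w)"
  unfolding frep_def represents_def fourier_dist_def ift_def
  using slow_locally_integrable[OF assms] slow_schwartz[OF assms] by (auto simp: inv_fourier_fourier)

lemma inv_fourier_lin:
  assumes "f \<in> schwartz" "g \<in> schwartz"
  shows "inv_fourier (\<lambda>x. a * f x + b * g x) z = a * inv_fourier f z + b * inv_fourier g z"
proof -
  have "fourier (\<lambda>x. a * f x + b * g x) y = a * fourier f y + b * fourier g y" for y
  proof -
    have "fourier (\<lambda>x. a * f x + b * g x) y =
      (LBINT x. a * (exp (- \<i> * cor (x \<bullet> y)) * f x) + b * (exp (- \<i> * cor (x \<bullet> y)) * g x))"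
      by (simp add: fourier_def algebra_simps)
    also have "\<dots> = a * fourier f y + b * fourier g y"
      using phase_schwartz_integrable[OF assms(1), of y] phase_schwartz_integrable[OF assms(2), of y]
      by (simp add: fourier_def)
    finally show ?thesis .
  qed
  then show ?thesis by (simp add: inv_fourier_def add_divide_distrib)
qed

lemma schwartz_L1_le:
  assumes "f \<in> schwartz" "length js \<le> 6"
  shows "(LBINT x. norm (partials js f x)) \<le> (LINT x::real^3|lborel. 1 / (1 + norm x) ^ 6) * schwartz_norm 6 f"
proof -
  have "(LBINT x. norm (partials js f x)) \<le> (LINT x::real^3|lborel. 1 / (1 + norm x) ^ 6 * schwartz_norm 6 f)"
  proof (rule integral_mono)
    show "integrable lborel (\<lambda>x. norm (partials js f x))"
      using schwartz_integrable[OF schwartz_partials[OF assms(1)]] by simp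
    show "integrable lborel (\<lambda>x::real^3. 1 / (1 + norm x) ^ 6 * schwartz_norm 6 f)"
      by (rule integrable_mult_left[OF integrable_weight])
    fix x :: "real^3"
    show "norm (partials js f x) \<le> 1 / (1 + norm x) ^ 6 * schwartz_norm 6 f"
      using schwartz_norm_upper[OF assms, of x] zero_less_power[OF one_plus_norm_pos(1), of x 6]
      by (simp add: pos_le_divide_eq mult.commute)
  qed
  then show ?thesis by (simp only: integral_mult_left_zero)
qed

text \<open>The continuity estimate behind \<open>tempered_ift\<close>. The factor 4 counts f and
  its three first derivatives, whose L^1 norms are controlled through the integrable weight of order
  6; the factor (2\<pi>)^-3 \<le> 1 is dropped.\<close>

lemma inv_fourier_weight_bound:
  assumes f: "f \<in> schwartz"
  shows "(1 + norm z) * norm (inv_fourier f z) \<le> 4 * (LINT x::real^3|lborel. 1 / (1 + norm x) ^ 6) * schwartz_norm 6 f"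
proof -
  let ?M = "(LINT x::real^3|lborel. 1 / (1 + norm x) ^ 6) * schwartz_norm 6 f"
  have "(1 + norm (- z)) * norm (fourier f (- z)) \<le> norm (fourier f (- z)) + (\<Sum>j\<in>UNIV. norm (fourier (partial j f) (- z)))"
    by (rule fourier_weight_le[OF f])
  also have "\<dots> \<le> ?M + (\<Sum>j\<in>(UNIV::3 set). ?M)"
  proof (intro add_mono sum_mono)
    show "norm (fourier f (- z)) \<le> ?M"
      using order_trans[OF norm_fourier_le[OF f] schwartz_L1_le[OF f, of "[]", unfolded partials_def, simplified]] .
    show "norm (fourier (partial j f) (- z)) \<le> ?M" for j
      using order_trans[OF norm_fourier_le[OF schwartz_partial[OF f]] schwartz_L1_le[OF f, of "[j]", unfolded partials_def, simplified]] .
  qed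
  also have "\<dots> = 4 * ?M" by simp
  finally have "(1 + norm z) * norm (fourier f (- z)) \<le> 4 * ?M" by simp
  moreover have "(1 + norm z) * norm (inv_fourier f z) \<le> (1 + norm z) * norm (fourier f (- z))"
  proof (rule mult_left_mono)
    have "(2 * pi) ^ 3 \<ge> 1" using pi_ge_two by (intro one_le_power) auto
    then have "norm (fourier f (- z)) * 1 \<le> norm (fourier f (- z)) * (2 * pi) ^ 3" by (intro mult_left_mono) auto
    then show "norm (inv_fourier f z) \<le> norm (fourier f (- z))"
      unfolding inv_fourier_def norm_divide norm_of_real by (simp add: pos_divide_le_eq)
  qed simp
  ultimately show ?thesis by (simp only: mult.assoc order_trans)
qed

lemma tempered_ift:
  assumes w: "slow w" shows "tempered (ift w)"
  unfolding tempered_def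
proof (intro conjI ballI allI exI)
  fix f g a b assume fg: "f \<in> schwartz" "g \<in> schwartz"
  show "ift w (\<lambda>x. a * f x + b * g x) = a * ift w f + b * ift w g"
    unfolding ift_def inv_fourier_lin[OF fg]
    using slow_schwartz[OF w inv_fourier_schwartz[OF fg(1)]] slow_schwartz[OF w inv_fourier_schwartz[OF fg(2)]]
    by (simp add: distrib_left mult.left_commute)
next
  fix f assume f: "f \<in> schwartz"
  show "norm (ift w f) \<le> ((LBINT z. norm (w z) / (1 + norm z)) * (4 * (LINT x::real^3|lborel. 1 / (1 + norm x) ^ 6))) * schwartz_norm 6 f"
    using slow_pairing(2)[OF w schwartz_measurable[OF inv_fourier_schwartz[OF f]] inv_fourier_weight_bound[OF f]]
    by (simp add: ift_def mult.assoc)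
qed

subsection \<open>Reality\<close>

lemma borel_measurable_cnj [measurable]: "bm cnj"
  by (intro borel_measurable_continuous_onI continuous_intros)

lemma cnj_fourier: "cnj (fourier f x) = fourier (\<lambda>y. cnj (f y)) (- x)"
  unfolding fourier_def by (subst Bochner_Integration.integral_cnj[symmetric]) (simp add: exp_cnj)

lemma fourier_cnj_reflect:
  assumes f: "f \<in> schwartz"
  shows "fourier (\<lambda>y. cnj (f (- y))) x = cnj (fourier f x)"
proof -
  have [measurable]: "bm f" by (rule schwartz_measurable[OF f])
  have "bm (\<lambda>y. exp (- \<i> * cor (y \<bullet> - x)) * cnj (f y))" by measurable
  from lborel_integral_reflect[OF this, of 0] show ?thesis
    unfolding cnj_fourier unfolding fourier_def by simp
qed

lemma real_valued_ift:
  assumes [measurable]: "bm w" and herm: "\<And>z. cnj (w (- z)) = w z"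
  shows "real_valued (ift w)"
  unfolding real_valued_def
proof safe
  fix f assume f: "f \<in> schwartz" and r: "\<forall>x. f x \<in> \<real>"
  have [measurable]: "bm (inv_fourier f)"
    by (intro schwartz_measurable inv_fourier_schwartz f)
  have "cnj (inv_fourier f z) = inv_fourier f (- z)" for z
    using r by (simp add: inv_fourier_def cnj_fourier Reals_cnj_iff)
  then have "cnj (ift w f) = (LBINT z. cnj (w z) * inv_fourier f (- z))"
    unfolding ift_def by (subst Bochner_Integration.integral_cnj[symmetric]) simp
  also have "\<dots> = (LBINT z. cnj (w (- z)) * inv_fourier f z)"
    using lborel_integral_reflect[of "\<lambda>z. cnj (w (- z)) * inv_fourier f z" 0] by simp
  also have "\<dots> = ift w f" unfolding ift_def herm ..
  finally show "ift w f \<in> \<real>" by (simp add: Reals_cnj_iff)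
qed

text \<open>Reality is given only on real test functions. For f~(z) = cnj (f (- z)) the transform of
  f~ is the conjugate of that of f, so f + f~ and - i f + i f~ have real transforms; the two
  resulting conditions identify the pairing with f~ as the conjugate of the pairing with f.\<close>

lemma real_valued_frep:
  assumes w: "frep w T" and T: "real_valued T"
  shows "AE z in lborel. cnj (w (- z)) = w z"
proof -
  have m[measurable]: "bm w" by (rule frep_measurable[OF w])
  have key: "(LBINT z. w z * cnj (f (- z))) = (LBINT z. cnj (w (- z)) * cnj (f (- z)))"
    "integrable lborel (\<lambda>z. cnj (w (- z)) * cnj (f (- z)))" if f: "f \<in> schwartz" for f
  proof -
    let ?f = "\<lambda>z. cnj (f (- z))"
    have f': "?f \<in> schwartz" using schwartz_cnj[OF schwartz_reflect[OF f]] .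
    have [measurable]: "bm f" by (rule schwartz_measurable[OF f])
    have lin: "fourier (\<lambda>x. a * f x + b * ?f x) x = a * fourier f x + b * cnj (fourier f x)" for a b x
      using inv_fourier_lin[OF f f', of a b "- x"] by (simp add: inv_fourier_def fourier_cnj_reflect[OF f] divide_simps)
    let ?A = "LBINT z. w z * f z" and ?A' = "LBINT z. w z * ?f z"
    have T2: "T (fourier (\<lambda>x. a * f x + b * ?f x)) = a * ?A + b * ?A'" for a b
      unfolding frepD(2)[OF w schwartz_lin[OF f f']]
      using frepD(1)[OF w f] frepD(1)[OF w f'] by (simp add: distrib_left mult.left_commute)
    have "T (fourier (\<lambda>x. 1 * f x + 1 * ?f x)) \<in> \<real>" "T (fourier (\<lambda>x. (- \<i>) * f x + \<i> * ?f x)) \<in> \<real>"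
    proof -
      have "fourier (\<lambda>x. 1 * f x + 1 * ?f x) x \<in> \<real>" "fourier (\<lambda>x. (- \<i>) * f x + \<i> * ?f x) x \<in> \<real>" for x
        unfolding lin by (simp_all add: complex_is_Real_iff)
      then show "T (fourier (\<lambda>x. 1 * f x + 1 * ?f x)) \<in> \<real>" "T (fourier (\<lambda>x. (- \<i>) * f x + \<i> * ?f x)) \<in> \<real>"
        using T fourier_schwartz[OF schwartz_lin[OF f f']] unfolding real_valued_def by blast+
    qed
    then have "?A' = cnj ?A" unfolding T2 by (simp add: complex_is_Real_iff complex_eq_iff)
    also have "\<dots> = (LBINT z. cnj (w z) * cnj (f z))" by (subst Bochner_Integration.integral_cnj[symmetric]) simp
    also have "\<dots> = (LBINT z. cnj (w (- z)) * cnj (f (- z)))"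
      using lborel_integral_reflect[of "\<lambda>z. cnj (w z) * cnj (f z)" 0] by simp
    finally show "?A' = (LBINT z. cnj (w (- z)) * cnj (f (- z)))" .
    have "integrable lborel (\<lambda>z. cnj (w z * f z))"
      by (rule integrable_bounded_linear[OF bounded_linear_cnj frepD(1)[OF w f]])
    from lborel_integrable_affine[OF _ this, of "-1" 0]
    show "integrable lborel (\<lambda>z. cnj (w (- z)) * cnj (f (- z)))" by simp
  qed
  have "AE z in lborel. cnj (w (- z)) - w z = 0"
  proof (rule schwartz_fundamental)
    fix f assume f: "f \<in> schwartz"
    let ?f = "\<lambda>z. cnj (f (- z))"
    have f': "?f \<in> schwartz" using schwartz_cnj[OF schwartz_reflect[OF f]] .
    show "integrable lborel (\<lambda>z. (cnj (w (- z)) - w z) * f z)"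
      using key(2)[OF f'] frepD(1)[OF w f] by (simp add: left_diff_distrib)
    show "(LBINT z. (cnj (w (- z)) - w z) * f z) = 0"
      using key[OF f'] frepD(1)[OF w f] by (simp add: left_diff_distrib)
  qed measurable
  then show ?thesis by simp
qed

subsection \<open>Derivatives and the advection term in Fourier variables\<close>

definition dotc :: "real^3 \<Rightarrow> complex^3 \<Rightarrow> complex" where
  "dotc z v = (\<Sum>j\<in>UNIV. cor (z $ j) * v $ j)"

lemma frep_dpartial:
  assumes b: "frep b T"
  shows "frep (\<lambda>z. \<i> * cor (z $ j) * b z) (dpartial j T)"
  unfolding frep_def represents_def
proof (intro conjI ballI)
  have [measurable]: "bm b" by (rule frep_measurable[OF b])
  show "locally_integrable (\<lambda>z. \<i> * cor (z $ j) * b z)"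
    unfolding locally_integrable_def set_integrable_def
  proof safe
    fix K :: "(real^3) set" assume K: "compact K"
    then obtain R where R: "\<And>x. x \<in> K \<Longrightarrow> norm x \<le> R" using compact_imp_bounded bounded_iff by metis
    have [measurable]: "K \<in> sets borel" using K by (auto simp: compact_imp_closed)
    have "integrable lborel (\<lambda>x. indicat_real K x *\<^sub>R b x)"
      using b K by (auto simp: frep_def represents_def locally_integrable_def set_integrable_def)
    then have "integrable lborel (\<lambda>x. \<bar>R\<bar> * norm (indicat_real K x *\<^sub>R b x))" by (intro integrable_mult_right integrable_norm)
    then show "integrable lborel (\<lambda>x. indicat_real K x *\<^sub>R (\<i> * cor (x $ j) * b x))"
    proof (rule integrable_le)
      have "\<bar>x $ j\<bar> * norm (b x) \<le> \<bar>R\<bar> * norm (b x)" if "x \<in> K" for x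
        using R[OF that] component_le_norm_cart[of x j] by (intro mult_right_mono) auto
      then show "AE x in lborel. norm (indicat_real K x *\<^sub>R (\<i> * cor (x $ j) * b x)) \<le> norm (\<bar>R\<bar> * norm (indicat_real K x *\<^sub>R b x))"
        by (intro AE_I2) (auto simp: indicator_def norm_mult abs_mult)
    qed measurable
  qed
  fix f assume f: "f \<in> schwartz"
  have f': "(\<lambda>x. - \<i> * (cor (x $ j) * f x)) \<in> schwartz"
    by (intro schwartz_scale schwartz_coord f)
  have eq: "\<i> * cor (x $ j) * b x * f x = - (b x * (- \<i> * (cor (x $ j) * f x)))" for x
    by simp
  show "integrable lborel (\<lambda>x. \<i> * cor (x $ j) * b x * f x)"
    unfolding eq by (intro integrable_minus frepD(1)[OF b f'])
  show "fourier_dist (dpartial j T) f = (LBINT x. \<i> * cor (x $ j) * b x * f x)"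
    unfolding eq integral_minus fourier_dist_def dpartial_def partial_fourier[OF f] frepD(2)[OF b f'] ..
qed

lemma dlaplace_fourier:
  assumes b: "frep b T" and f: "f \<in> schwartz"
  shows "dlaplace T (fourier f) = (LBINT z. - cor ((norm z)\<^sup>2) * b z * f z)"
    and "integrable lborel (\<lambda>z. - cor ((norm z)\<^sup>2) * b z * f z)"
proof -
  let ?t = "\<lambda>j z. \<i> * cor (z $ j) * (\<i> * cor (z $ j) * b z) * f z"
  have i: "integrable lborel (?t j)" for j
    using frepD(1)[OF frep_dpartial[OF frep_dpartial[OF b]] f] .
  have eq: "(\<Sum>j\<in>UNIV. ?t j z) = - cor ((norm z)\<^sup>2) * b z * f z" for z
  proof -
    have i2: "\<i> * r * (\<i> * r * s) * t = (\<i> * \<i>) * (r * r * (s * t))" for r s t :: complex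
      by (simp only: mult_ac)
    have "(\<Sum>j\<in>UNIV. ?t j z) = (\<Sum>j\<in>UNIV. - (cor ((z $ j)\<^sup>2)) * (b z * f z))"
      unfolding i2 by (intro sum.cong) (auto simp: power2_eq_square)
    also have "\<dots> = - cor (\<Sum>j\<in>UNIV. (z $ j)\<^sup>2) * (b z * f z)"
      by (simp add: sum_distrib_right sum_negf)
    also have "(\<Sum>j\<in>UNIV. (z $ j)\<^sup>2) = (norm z)\<^sup>2"
      unfolding power2_norm_eq_inner inner_vec_def by (simp add: power2_eq_square)
    finally show ?thesis by simp
  qed
  show "dlaplace T (fourier f) = (LBINT z. - cor ((norm z)\<^sup>2) * b z * f z)"
    unfolding dlaplace_def frepD(2)[OF frep_dpartial[OF frep_dpartial[OF b]] f] eq[symmetric]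
    by (rule LINT_sum[symmetric]) (rule i)
  show "integrable lborel (\<lambda>z. - cor ((norm z)\<^sup>2) * b z * f z)"
    unfolding eq[symmetric] by (intro Bochner_Integration.integrable_sum i)
qed

lemma ddiv_fourier:
  assumes w: "\<And>j. frep (\<lambda>z. w z $ j) (u $ j)" and f: "f \<in> schwartz"
  shows "ddiv u (fourier f) = (LBINT z. \<i> * dotc z (w z) * f z)"
    and "integrable lborel (\<lambda>z. \<i> * dotc z (w z) * f z)"
proof -
  let ?t = "\<lambda>j z. \<i> * cor (z $ j) * w z $ j * f z"
  have i: "integrable lborel (?t j)" for j
    using frepD(1)[OF frep_dpartial[OF w] f] .
  have eq: "(\<Sum>j\<in>UNIV. ?t j z) = \<i> * dotc z (w z) * f z" for z
    by (simp add: dotc_def sum_distrib_left sum_distrib_right mult.assoc)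
  show "ddiv u (fourier f) = (LBINT z. \<i> * dotc z (w z) * f z)"
    unfolding ddiv_def frepD(2)[OF frep_dpartial[OF w] f] eq[symmetric]
    by (rule LINT_sum[symmetric]) (rule i)
  show "integrable lborel (\<lambda>z. \<i> * dotc z (w z) * f z)"
    unfolding eq[symmetric] by (intro Bochner_Integration.integrable_sum i)
qed

lemma dotc_measurable [measurable (raw)]:
  assumes [measurable]: "f \<in> borel_measurable M" "w \<in> borel_measurable M"
  shows "(\<lambda>x. dotc (f x) (w x)) \<in> borel_measurable M"
  unfolding dotc_def by measurable

lemma ddiv_zero_iff:
  assumes w: "\<And>j. frep (\<lambda>z. w z $ j) (u $ j)" and [measurable]: "bm w"
  shows "dist_eq (ddiv u) 0 \<longleftrightarrow> (AE z in lborel. dotc z (w z) = 0)"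
proof
  assume "dist_eq (ddiv u) 0"
  then have "AE z in lborel. \<i> * dotc z (w z) = 0"
  proof (intro schwartz_fundamental)
    fix f assume e: "dist_eq (ddiv u) 0" and f: "f \<in> schwartz"
    show "integrable lborel (\<lambda>z. \<i> * dotc z (w z) * f z)" by (rule ddiv_fourier(2)[OF w f])
    show "(LBINT z. \<i> * dotc z (w z) * f z) = 0"
      using e fourier_schwartz[OF f] unfolding ddiv_fourier(1)[OF w f, symmetric] by (simp add: dist_eq_def)
  qed measurable
  then show "AE z in lborel. dotc z (w z) = 0" by eventually_elim simp
next
  assume z: "AE z in lborel. dotc z (w z) = 0"
  have "ddiv u f = 0" if f: "f \<in> schwartz" for f
  proof -
    have "ddiv u (fourier (inv_fourier f)) = (LINT z::real^3|lborel. 0)"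
      unfolding ddiv_fourier(1)[OF w inv_fourier_schwartz[OF f]]
    proof (rule LINT_cong_AE)
      have [measurable]: "bm (inv_fourier f)" by (intro schwartz_measurable inv_fourier_schwartz f)
      show "(\<lambda>z. \<i> * dotc z (w z) * inv_fourier f z) \<in> borel_measurable lborel" by measurable
      show "AE z in lborel. \<i> * dotc z (w z) * inv_fourier f z = 0"
        using z by eventually_elim simp
    qed simp
    then show ?thesis by (simp add: fourier_inv_fourier[OF f])
  qed
  then show "dist_eq (ddiv u) 0" by (auto simp: dist_eq_def)
qed

lemma fubini_kernel:
  fixes f g :: "'a::euclidean_space \<Rightarrow> complex"
  assumes f: "integrable lborel f" and g: "integrable lborel g"
    and [measurable]: "(\<lambda>(x, y). k x y) \<in> borel_measurable (borel \<Otimes>\<^sub>M borel)" and k: "\<And>x y. norm (k x y) \<le> (1::real)"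
  shows "(LBINT x. f x * (LBINT y. g y * k x y)) = (LBINT y. g y * (LBINT x. f x * k x y))"
proof -
  have [measurable]: "bm f" "bm g" using f g by auto
  have i: "integrable (lborel \<Otimes>\<^sub>M lborel) (\<lambda>(x, y). f x * g y * k x y)"
  proof (rule integrable_le)
    show "integrable (lborel \<Otimes>\<^sub>M lborel) (\<lambda>(x, y). f x * g y)"
      by (rule integrable_pair_product[OF sigma_finite_lborel sigma_finite_lborel f g])
    have "norm (f x * g y * k x y) \<le> norm (f x * g y)" for x y
      using k[of x y] by (simp add: norm_mult mult_right_le_one_le)
    then show "AE p in lborel \<Otimes>\<^sub>M lborel. norm (case p of (x, y) \<Rightarrow> f x * g y * k x y) \<le> norm (case p of (x, y) \<Rightarrow> f x * g y)"
      by (intro AE_I2) (simp add: case_prod_beta)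
  qed measurable
  have "(LBINT x. f x * (LBINT y. g y * k x y)) = (LBINT x. LBINT y. f x * g y * k x y)"
    by (simp add: mult.assoc)
  also have "\<dots> = (LBINT y. LBINT x. f x * g y * k x y)"
    by (rule lborel_pair.Fubini_integral[symmetric, OF i])
  also have "\<dots> = (LBINT y. g y * (LBINT x. f x * k x y))"
    unfolding integral_mult_right_zero[symmetric] by (simp only: mult_ac)
  finally show ?thesis .
qed

lemma convolution_integrable:
  fixes a c :: "sfield"
  assumes a: "integrable lborel a" and c: "integrable lborel c"
  shows "integrable (lborel \<Otimes>\<^sub>M lborel) (\<lambda>(\<eta>, \<zeta>). a (\<zeta> - \<eta>) * c \<eta>)"
proof -
  have [measurable]: "bm a" "bm c" using a c by auto
  have sh: "integrable lborel (\<lambda>\<zeta>. a (\<zeta> - \<eta>))" for \<eta>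
    using lborel_integrable_affine[OF _ a, of 1 "- \<eta>"] by simp
  have sh2: "(LBINT \<zeta>. norm (a (\<zeta> - \<eta>))) = (LBINT \<zeta>. norm (a \<zeta>))" for \<eta>
    using lborel_integral_shift[of "\<lambda>\<zeta>. norm (a \<zeta>)" "- \<eta>"] by simp
  show ?thesis
  proof (rule lborel_pair.Fubini_integrable)
    show "integrable lborel (\<lambda>\<eta>. LBINT \<zeta>. norm (case (\<eta>, \<zeta>) of (\<eta>, \<zeta>) \<Rightarrow> a (\<zeta> - \<eta>) * c \<eta>))"
      using c by (simp add: norm_mult sh2)
  qed (use sh in auto)
qed

text \<open>This is what makes \<open>advect\<close> computable: it identifies the function selected
  by \<open>fun_of\<close>, almost everywhere, with a bounded inverse Fourier integral.\<close>

lemma represents_inverse_transform: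
  assumes a: "frep a T" and i: "integrable lborel a"
  shows "represents (\<lambda>x. LBINT z. a z * (exp (\<i> * cor (x \<bullet> z)) / cor ((2 * pi) ^ 3))) T"
    (is "represents ?g T")
    and "norm (LBINT z. a z * (exp (\<i> * cor (x \<bullet> z)) / cor ((2 * pi) ^ 3))) \<le> (LBINT z. norm (a z))"
proof -
  have [measurable]: "bm a" using i by auto
  have one: "(2 * pi) ^ 3 \<ge> 1" using pi_ge_two by (intro one_le_power) auto
  have k: "norm (exp (\<i> * cor r) / cor ((2 * pi) ^ 3)) \<le> 1" for r
    unfolding norm_divide norm_exp_i_times norm_of_real using one by (simp add: pos_divide_le_eq)
  have kk: "norm (a z * (exp (\<i> * cor r) / cor ((2 * pi) ^ 3))) \<le> norm (a z)" for z r
    unfolding norm_mult[of "a z"] by (rule mult_right_le_one_le[OF norm_ge_zero norm_ge_zero k])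
  have ii: "integrable lborel (\<lambda>z. a z * (exp (\<i> * cor (x \<bullet> z)) / cor ((2 * pi) ^ 3)))" for x
    by (rule integrable_dominated[OF integrable_norm[OF i] _ kk]) measurable
  show b: "norm (?g x) \<le> (LBINT z. norm (a z))" for x
    by (rule Bochner_Integration.integral_norm_bound_integral[OF ii integrable_norm[OF i] kk])
  have gm[measurable]: "?g \<in> borel_measurable borel" by measurable
  show "represents ?g T"
    unfolding represents_def
  proof (intro conjI ballI)
    show "locally_integrable ?g"
      unfolding locally_integrable_def set_integrable_def
    proof safe
      fix K :: "(real^3) set" assume K: "compact K"
      have [measurable]: "K \<in> sets borel" using K by (auto simp: compact_imp_closed)
      have "integrable lborel (\<lambda>x. (LBINT z. norm (a z)) * indicat_real K x)"
        using emeasure_compact_finite[OF K] by (intro integrable_mult_right) (simp add: integrable_indicator_iff)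
      then show "integrable lborel (\<lambda>x. indicat_real K x *\<^sub>R ?g x)"
        by (rule integrable_dominated) (measurable, use b in \<open>auto simp: indicator_def\<close>)
    qed
    fix f assume f: "f \<in> schwartz"
    have [measurable]: "bm f" by (rule schwartz_measurable[OF f])
    have "integrable lborel (\<lambda>x. (LBINT z. norm (a z)) * norm (f x))"
      using schwartz_integrable[OF f] by simp
    then show "integrable lborel (\<lambda>x. ?g x * f x)"
      by (rule integrable_dominated) (measurable, use b in \<open>auto simp only: norm_mult intro!: mult_right_mono norm_ge_zero\<close>)
    have "T f = T (fourier (inv_fourier f))" by (simp add: fourier_inv_fourier[OF f])
    also have "\<dots> = (LBINT z. a z * inv_fourier f z)"
      by (rule frepD(2)[OF a inv_fourier_schwartz[OF f]])
    also have "\<dots> = (LBINT z. a z * (LBINT x. f x * (exp (\<i> * cor (x \<bullet> z)) / cor ((2 * pi) ^ 3))))"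
      unfolding inv_fourier_def fourier_def integral_divide_zero[symmetric] by (simp add: mult_ac)
    also have "\<dots> = (LBINT x. f x * ?g x)"
      by (rule fubini_kernel[OF i schwartz_integrable[OF f]]) (measurable, rule k)
    finally show "T f = (LBINT x. ?g x * f x)" by (simp only: mult.commute)
  qed
qed

text \<open>Since \<open>a\<close> is divergence free, \<open>\<eta> \<cdot> a(\<zeta> - \<eta>) = \<zeta> \<cdot> a(\<zeta> - \<eta>)\<close>, so the derivative falls on the product.\<close>

definition bilin :: "vfield \<Rightarrow> sfield \<Rightarrow> sfield" where
  "bilin a b \<zeta> = (LBINT \<eta>. \<i> * dotc \<zeta> (a (\<zeta> - \<eta>)) * b \<eta> / cor ((2 * pi) ^ 3))"

text \<open>Both factors of the product are replaced by their inverse Fourier integrals P and Q. Two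
  applications of Fubini isolate the integral over x, which \<open>fourier_inversion\<close>
  evaluates to a value of g at the sum of the two frequencies; what remains is a convolution.
  Boundedness of P and Q justifies each exchange.\<close>

lemma advect_fourier:
  assumes a: "\<And>j. frep (\<lambda>z. a z $ j) (A $ j)" and ai: "\<And>j. integrable lborel (\<lambda>z. a z $ j)"
    and b: "frep b f" and bi: "\<And>j. integrable lborel (\<lambda>z. cor (z $ j) * b z)"
    and adiv: "AE z in lborel. dotc z (a z) = 0"
    and g: "g \<in> schwartz"
  shows "advect A f (fourier g) = (LBINT \<zeta>. bilin a b \<zeta> * g \<zeta>)"
proof -
  let ?c = "cor ((2 * pi) ^ 3)"
  have [measurable]: "bm b" "bm g" "\<And>j. bm (\<lambda>z. a z $ j)"
    "bm (fourier g)"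
    using frep_measurable[OF b] schwartz_measurable[OF g] frep_measurable[OF a] schwartz_measurable[OF fourier_schwartz[OF g]] by auto
  define d where "d j z = \<i> * cor (z $ j) * b z" for j z
  have dm[measurable]: "bm (d j)" for j unfolding d_def by measurable
  have df: "frep (d j) (dpartial j f)" for j unfolding d_def by (rule frep_dpartial[OF b])
  have di: "integrable lborel (d j)" for j
    unfolding d_def using integrable_mult_right[OF bi, of \<i> j] by (simp add: mult.assoc)
  define P where "P j x = (LBINT z. a z $ j * (exp (\<i> * cor (x \<bullet> z)) / ?c))" for j x
  define Q where "Q j x = (LBINT z. d j z * (exp (\<i> * cor (x \<bullet> z)) / ?c))" for j x
  have PA: "AE x in lborel. fun_of (A $ j) x = P j x" for j
    using fun_of_AE[OF represents_inverse_transform(1)[OF a ai]] unfolding P_def .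
  have QA: "AE x in lborel. fun_of (dpartial j f) x = Q j x" for j
    using fun_of_AE[OF represents_inverse_transform(1)[OF df di]] unfolding Q_def .
  have [measurable]: "bm (fun_of (A $ j))" "bm (fun_of (dpartial j f))" for j
    using represents_measurable[OF represents_fun_of[OF represents_inverse_transform(1)[OF a ai]]]
      represents_measurable[OF represents_fun_of[OF represents_inverse_transform(1)[OF df di]]] by auto
  have [measurable]: "bm (P j)" "bm (Q j)" for j
    unfolding P_def Q_def by measurable
  have Pb: "norm (P j x) \<le> (LBINT z. norm (a z $ j))" for j x
    unfolding P_def by (rule represents_inverse_transform(2)[OF a ai])
  have Qb: "norm (Q j x) \<le> (LBINT z. norm (d j z))" for j x
    unfolding Q_def by (rule represents_inverse_transform(2)[OF df di])
  have gi: "integrable lborel (fourier g)" by (intro schwartz_integrable fourier_schwartz g)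
  have Pg: "integrable lborel (\<lambda>x. P j x * fourier g x)" for j
  proof (rule integrable_dominated)
    show "integrable lborel (\<lambda>x. (LBINT z. norm (a z $ j)) * norm (fourier g x))" using gi by simp
    show "norm (P j x * fourier g x) \<le> (LBINT z. norm (a z $ j)) * norm (fourier g x)" for x
      unfolding norm_mult by (intro mult_right_mono Pb) simp
  qed measurable
  have PQg: "integrable lborel (\<lambda>x. P j x * Q j x * fourier g x)" for j
  proof (rule integrable_dominated)
    show "integrable lborel (\<lambda>x. (LBINT z. norm (d j z)) * norm (P j x * fourier g x))" using Pg[of j] by simp
    show "norm (P j x * Q j x * fourier g x) \<le> (LBINT z. norm (d j z)) * norm (P j x * fourier g x)" for x
      using mult_right_mono[OF Qb[of j x], of "norm (P j x * fourier g x)"] by (simp add: norm_mult mult_ac)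
  qed measurable
  have k: "norm (exp (\<i> * cor r)) \<le> 1" for r by simp
  have G: "(LBINT x. fourier g x * exp (\<i> * cor (x \<bullet> y))) = ?c * g y" for y
    using fourier_inversion[OF g, of y] by (simp add: inner_commute mult.commute)
  define F where "F j \<zeta> \<eta> = a (\<zeta> - \<eta>) $ j * d j \<eta> * g \<zeta> / ?c" for j \<zeta> \<eta>
  obtain Bg where Bg: "Bg \<ge> 0" "\<And>x. (1 + norm x) ^ 0 * norm (g x) \<le> Bg" using schwartz_bound[OF g] by metis
  have conv: "integrable (lborel \<Otimes>\<^sub>M lborel) (\<lambda>(\<eta>, \<zeta>). a (\<zeta> - \<eta>) $ j * d j \<eta>)" for j
    by (rule convolution_integrable[OF ai di])
  have Fi: "integrable (lborel \<Otimes>\<^sub>M lborel) (\<lambda>(\<eta>, \<zeta>). F j \<zeta> \<eta>)" for j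
  proof (rule integrable_dominated)
    show "integrable (lborel \<Otimes>\<^sub>M lborel) (\<lambda>p. Bg / ((2 * pi) ^ 3) * norm (case p of (\<eta>, \<zeta>) \<Rightarrow> a (\<zeta> - \<eta>) $ j * d j \<eta>))"
      by (intro integrable_mult_right integrable_norm conv)
    have "norm (F j \<zeta> \<eta>) \<le> Bg / ((2 * pi) ^ 3) * norm (a (\<zeta> - \<eta>) $ j * d j \<eta>)" for \<zeta> \<eta>
      using mult_left_mono[OF Bg(2)[of \<zeta>], of "norm (a (\<zeta> - \<eta>) $ j * d j \<eta>) / ((2 * pi) ^ 3)"]
      unfolding F_def norm_mult norm_divide norm_of_real by (simp add: mult_ac)
    then show "norm (case p of (\<eta>, \<zeta>) \<Rightarrow> F j \<zeta> \<eta>) \<le> Bg / ((2 * pi) ^ 3) * norm (case p of (\<eta>, \<zeta>) \<Rightarrow> a (\<zeta> - \<eta>) $ j * d j \<eta>)" for p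
      by (cases p) (simp only: prod.case)
  qed (unfold F_def, measurable)
  have trm: "(LBINT x. P j x * Q j x * fourier g x) = (LBINT \<zeta>. LBINT \<eta>. F j \<zeta> \<eta>)" for j
  proof -
    have "(LBINT x. P j x * Q j x * fourier g x) =
       (LBINT x. (P j x * fourier g x) * (LBINT \<eta>. d j \<eta> * exp (\<i> * cor (x \<bullet> \<eta>)))) / ?c"
      unfolding Q_def integral_divide_zero[symmetric] times_divide_eq_right by (simp add: mult_ac)
    also have "(LBINT x. (P j x * fourier g x) * (LBINT \<eta>. d j \<eta> * exp (\<i> * cor (x \<bullet> \<eta>)))) =
       (LBINT \<eta>. d j \<eta> * (LBINT x. (P j x * fourier g x) * exp (\<i> * cor (x \<bullet> \<eta>))))"
      by (rule fubini_kernel[OF Pg di _ k]) measurable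
    also have "\<dots> = (LBINT \<eta>. d j \<eta> * (LBINT z. a z $ j * g (z + \<eta>)))"
    proof (rule LINT_cong[OF refl])
      fix \<eta>
      have eg: "integrable lborel (\<lambda>x. fourier g x * exp (\<i> * cor (x \<bullet> \<eta>)))"
        by (rule integrable_le[OF gi]) (auto simp: norm_mult)
      have "(LBINT x. (P j x * fourier g x) * exp (\<i> * cor (x \<bullet> \<eta>))) =
        (LBINT x. (fourier g x * exp (\<i> * cor (x \<bullet> \<eta>))) * (LBINT z. a z $ j * exp (\<i> * cor (x \<bullet> z)))) / ?c"
        unfolding P_def integral_divide_zero[symmetric] times_divide_eq_right by (simp add: mult_ac)
      also have "(LBINT x. (fourier g x * exp (\<i> * cor (x \<bullet> \<eta>))) * (LBINT z. a z $ j * exp (\<i> * cor (x \<bullet> z)))) =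
        (LBINT z. a z $ j * (LBINT x. (fourier g x * exp (\<i> * cor (x \<bullet> \<eta>))) * exp (\<i> * cor (x \<bullet> z))))"
        by (rule fubini_kernel[OF eg ai _ k]) measurable
      also have "\<dots> = (LBINT z. a z $ j * (LBINT x. fourier g x * exp (\<i> * cor (x \<bullet> (z + \<eta>)))))"
        by (simp add: inner_add_right distrib_left exp_add mult_ac)
      also have "\<dots> = (LBINT z. a z $ j * g (z + \<eta>)) * ?c"
        unfolding G integral_mult_left_zero[symmetric] by (simp only: mult_ac)
      finally have "(LBINT x. (P j x * fourier g x) * exp (\<i> * cor (x \<bullet> \<eta>))) = (LBINT z. a z $ j * g (z + \<eta>))"
        by simp
      then show "d j \<eta> * (LBINT x. (P j x * fourier g x) * exp (\<i> * cor (x \<bullet> \<eta>))) = d j \<eta> * (LBINT z. a z $ j * g (z + \<eta>))"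
        by (simp only:)
    qed
    also have "\<dots> / ?c = (LBINT \<eta>. LBINT \<zeta>. F j \<zeta> \<eta>)"
      unfolding integral_divide_zero[symmetric]
    proof (rule LINT_cong[OF refl])
      fix \<eta>
      have "(LBINT z. a z $ j * g (z + \<eta>)) = (LBINT \<zeta>. a (\<zeta> - \<eta>) $ j * g \<zeta>)"
        using lborel_integral_shift[of "\<lambda>\<zeta>. a (\<zeta> - \<eta>) $ j * g \<zeta>" \<eta>] by simp
      then show "d j \<eta> * (LBINT z. a z $ j * g (z + \<eta>)) / ?c = (LBINT \<zeta>. F j \<zeta> \<eta>)"
        unfolding F_def by (simp only: integral_mult_right_zero[symmetric] integral_divide_zero[symmetric] mult_ac)
    qed
    also have "\<dots> = (LBINT \<zeta>. LBINT \<eta>. F j \<zeta> \<eta>)"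
      using lborel_pair.Fubini_integral[OF Fi] ..
    finally show ?thesis .
  qed
  have Fi': "integrable (lborel \<Otimes>\<^sub>M lborel) (\<lambda>(\<zeta>, \<eta>). F j \<zeta> \<eta>)" for j
    using lborel_pair.integrable_product_swap[OF Fi] by (simp add: case_prod_beta)
  have "advect A f (fourier g) = (LBINT x. (\<Sum>j\<in>UNIV. P j x * Q j x * fourier g x))"
    unfolding advect_def
  proof (rule LINT_cong_AE)
    have "AE x in lborel. \<forall>j\<in>(UNIV::3 set). fun_of (A $ j) x = P j x \<and> fun_of (dpartial j f) x = Q j x"
      using PA QA by (intro AE_finite_allI) auto
    then show "AE x in lborel. (\<Sum>j\<in>UNIV. fun_of (A $ j) x * fun_of (dpartial j f) x) * fourier g x = (\<Sum>j\<in>UNIV. P j x * Q j x * fourier g x)"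
      by eventually_elim (simp add: sum_distrib_right)
  qed measurable
  also have "\<dots> = (\<Sum>j\<in>UNIV. LBINT \<zeta>. LBINT \<eta>. F j \<zeta> \<eta>)"
    unfolding LINT_sum[OF PQg] trm ..
  also have "\<dots> = (LBINT \<zeta>. (\<Sum>j\<in>UNIV. LBINT \<eta>. F j \<zeta> \<eta>))"
    by (rule LINT_sum[symmetric]) (rule lborel_pair.integrable_fst[OF Fi'])
  also have "\<dots> = (LBINT \<zeta>. bilin a b \<zeta> * g \<zeta>)"
  proof (rule LINT_cong_AE)
    have "bm (\<lambda>z. \<chi> j. a z $ j)" by measurable
    then have [measurable]: "bm a" by simp
    show "(\<lambda>\<zeta>. bilin a b \<zeta> * g \<zeta>) \<in> borel_measurable lborel" unfolding bilin_def by measurable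
    show "(\<lambda>\<zeta>. \<Sum>j\<in>UNIV. LBINT \<eta>. F j \<zeta> \<eta>) \<in> borel_measurable lborel" unfolding F_def by measurable
    have "AE \<zeta> in lborel. \<forall>j\<in>(UNIV::3 set). integrable lborel (F j \<zeta>)"
      using lborel_pair.AE_integrable_fst[OF Fi'] by (intro AE_finite_allI) auto
    then show "AE \<zeta> in lborel. (\<Sum>j\<in>UNIV. LBINT \<eta>. F j \<zeta> \<eta>) = bilin a b \<zeta> * g \<zeta>"
    proof eventually_elim
      case (elim \<zeta>)
      have "(\<Sum>j\<in>UNIV. LBINT \<eta>. F j \<zeta> \<eta>) = (LBINT \<eta>. (\<Sum>j\<in>UNIV. F j \<zeta> \<eta>))"
        using elim by (intro LINT_sum[symmetric]) auto
      also have "\<dots> = (LBINT \<eta>. \<i> * dotc \<zeta> (a (\<zeta> - \<eta>)) * b \<eta> / ?c * g \<zeta>)"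
      proof (rule LINT_cong_AE)
        have "AE \<eta> in lborel. dotc (\<zeta> - \<eta>) (a (\<zeta> - \<eta>)) = 0" by (rule AE_lborel_reflect[OF adiv])
        then show "AE \<eta> in lborel. (\<Sum>j\<in>UNIV. F j \<zeta> \<eta>) = \<i> * dotc \<zeta> (a (\<zeta> - \<eta>)) * b \<eta> / ?c * g \<zeta>"
        proof eventually_elim
          case (elim \<eta>)
          have "dotc \<zeta> (a (\<zeta> - \<eta>)) = dotc \<eta> (a (\<zeta> - \<eta>))"
            using elim by (simp add: dotc_def left_diff_distrib sum_subtractf)
          then show ?case by (simp add: F_def d_def dotc_def sum_distrib_left sum_distrib_right sum_divide_distrib mult_ac)
        qed
      qed (unfold F_def, measurable)
      finally show ?case by (simp add: bilin_def)
    qed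
  qed
  finally show ?thesis .
qed

lemma Icc_measurable [measurable (raw)]:
  fixes f g h :: "'a \<Rightarrow> real"
  assumes [measurable]: "f \<in> borel_measurable M" "g \<in> borel_measurable M" "h \<in> borel_measurable M"
  shows "Measurable.pred M (\<lambda>x. g x \<in> {h x..f x})"
    and "(\<lambda>x. indicator {h x..f x} (g x) :: ennreal) \<in> borel_measurable M"
    and "(\<lambda>x. indicator {h x..f x} (g x) :: real) \<in> borel_measurable M"
  unfolding indicator_def atLeastAtMost_iff by measurable

subsection \<open>Gronwall's inequality with an integrable weight\<close>

lemma nn_integral_Icc_split:
  fixes f :: "real \<Rightarrow> ennreal"
  assumes [measurable]: "bm f" and "a \<le> b" "b \<le> c"
  shows "lint {a..c} f = lint {a..b} f + lint {b<..c} f"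
proof -
  have "{a..c} = {a..b} \<union> {b<..c}" using assms(2,3) by auto
  then show ?thesis by (simp only:) (rule nn_integral_disjoint_pair, auto)
qed

text \<open>Absolute continuity of the integral, uniformly in the position of the slice: the
  indefinite integral is continuous on a compact interval, hence uniformly continuous.\<close>

lemma nn_integral_small_slices:
  fixes h :: "real \<Rightarrow> ennreal"
  assumes [measurable]: "bm h" and fin: "lint {0..T} h < \<infinity>" and e: "e > 0"
  obtains d where "d > 0" "\<And>s t. 0 \<le> s \<Longrightarrow> s \<le> t \<Longrightarrow> t \<le> T \<Longrightarrow> t - s < d \<Longrightarrow> (lint {s<..t} h) \<le> ennreal e"
proof -
  define g where "g s = enn2real (h s)" for s
  have [measurable]: "bm g" unfolding g_def by measurable
  have fin': "(\<integral>\<^sub>Ls. h s * indicator {0..T} s) \<noteq> \<infinity>" using fin by simp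
  have ae: "AE s in lborel. h s * indicator {0..T} s \<noteq> \<infinity>" by (rule nn_integral_PInf_AE[OF _ fin']) measurable
  have gh: "lint A h = (\<integral>\<^sub>Ls. ennreal (g s * indicator A s))" if "A \<subseteq> {0..T}" for A
    using ae
  proof (intro nn_integral_cong_AE, eventually_elim)
    case (elim s)
    then show ?case using that by (auto simp: g_def indicator_def less_top split: if_splits)
  qed
  have gi: "set_integrable lborel {0..T} g"
    unfolding set_integrable_def
  proof (rule integrableI_nonneg)
    show "AE x in lborel. 0 \<le> indicat_real {0..T} x *\<^sub>R g x" by (simp add: g_def)
    show "(\<integral>\<^sub>Lx. ennreal (indicat_real {0..T} x *\<^sub>R g x)) < \<infinity>"
      using fin gh[of "{0..T}"] by (simp add: mult.commute)
  qed measurable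
  then have "g integrable_on {0..T}" using set_borel_integral_eq_integral(1) by blast
  then have "continuous_on {0..T} (\<lambda>t. integral {0..t} g)" by (rule indefinite_integral_continuous_1)
  then have "uniformly_continuous_on {0..T} (\<lambda>t. integral {0..t} g)" by (intro compact_uniformly_continuous) auto
  then obtain d where d: "d > 0" "\<And>s t. s \<in> {0..T} \<Longrightarrow> t \<in> {0..T} \<Longrightarrow> dist t s < d \<Longrightarrow> dist (integral {0..t} g) (integral {0..s} g) < e"
    using e unfolding uniformly_continuous_on_def by metis
  show ?thesis
  proof (rule that[OF d(1)])
    fix s t assume st: "0 \<le> s" "s \<le> t" "t \<le> T" "t - s < d"
    have si: "set_integrable lborel {0..r} g" if "r \<le> T" for r
      by (rule set_integrable_subset[OF gi]) (use that in auto)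
    have I: "lint {0..r} h = ennreal (integral {0..r} g)" if "r \<le> T" for r
    proof -
      have "lint {0..r} h = (\<integral>\<^sub>Ls. ennreal (indicator {0..r} s *\<^sub>R g s))"
        using that by (subst gh) (auto simp: mult.commute)
      also have "\<dots> = ennreal (set_lebesgue_integral lborel {0..r} g)"
        unfolding set_lebesgue_integral_def
        using si[OF that] by (intro nn_integral_eq_integral) (auto simp: set_integrable_def g_def)
      also have "set_lebesgue_integral lborel {0..r} g = integral {0..r} g"
        by (rule set_borel_integral_eq_integral(2)[OF si[OF that]])
      finally show ?thesis .
    qed
    have nn: "0 \<le> integral {0..s} g" by (rule integral_nonneg) (use si[of s] st in \<open>auto simp: g_def set_borel_integral_eq_integral(1)\<close>)
    have "ennreal (integral {0..s} g) + lint {s<..t} h = ennreal (integral {0..t} g)"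
      using I[of s] I[of t] nn_integral_Icc_split[of h 0 s t] st by simp
    also have "\<dots> \<le> ennreal (integral {0..s} g + e)"
      using d(2)[of s t] st by (intro ennreal_leI) (auto simp: dist_real_def)
    also have "\<dots> = ennreal (integral {0..s} g) + ennreal e" using nn e by simp
    finally show "lint {s<..t} h \<le> ennreal e" by (simp add: ennreal_add_left_cancel_le)
  qed
qed

text \<open>The weight is only integrable and the inequality holds only almost everywhere, so
  nothing is differentiated. The interval is cut into slices on which h has mass e \<le> 1/2; on
  each one the increment e Y(t) is absorbed, which multiplies Y by at most 1 / (1 - e) \<le> exp (2
  e). This is the origin of the 2 in the exponent, and the absorption is why \<open>Y a T\<close>
  must be finite.\<close>

lemma gronwall:
  fixes h y :: "real \<Rightarrow> ennreal"
  defines "Y \<equiv> \<lambda>a t. a + lint {0..t} (\<lambda>s. h s * y s)"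
  assumes [measurable]: "bm h" "bm y" and T: "T \<ge> 0"
    and hfin: "lint {0..T} h < \<infinity>" and Yfin: "Y a T < \<infinity>"
    and y: "AE s in lborel. s \<in> {0..T} \<longrightarrow> y s \<le> Y a s"
  shows "Y a T \<le> a * ennreal (exp (2 * enn2real (lint {0..T} h)))"
proof -
  obtain d where d: "d > 0" "\<And>s t. 0 \<le> s \<Longrightarrow> s \<le> t \<Longrightarrow> t \<le> T \<Longrightarrow> t - s < d \<Longrightarrow> (lint {s<..t} h) \<le> ennreal (1/2)"
    using nn_integral_small_slices[OF assms(2) hfin, of "1/2"] by auto
  obtain n :: nat where n: "real n * d > T" using reals_Archimedean3[OF d(1)] by blast
  have n0: "n > 0" using n T d(1) by (cases n) auto
  define \<tau> where "\<tau> k = T * real k / real n" for k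
  have mono: "Y a s \<le> Y a t" if "s \<le> t" for s t
    unfolding Y_def using that by (intro add_left_mono nn_integral_mono) (auto simp: indicator_def)
  define H where "H t = lint {0..t} h" for t
  have Hmono: "H s \<le> H t" if "s \<le> t" for s t
    unfolding H_def using that by (intro nn_integral_mono) (auto simp: indicator_def)
  have main: "Y a (\<tau> k) \<le> a * ennreal (exp (2 * enn2real (H (\<tau> k))))" if "k \<le> n" for k
    using that
  proof (induction k)
    case 0
    have z: "lint {0..0} f = 0" for f :: "real \<Rightarrow> ennreal"
    proof -
      have "AE s in lborel. s \<noteq> (0::real)" by (rule AE_lborel_singleton)
      then have "lint {0..0} f = (\<integral>\<^sup>+s. 0 \<partial>(lborel :: real measure))"
        by (intro nn_integral_cong_AE, eventually_elim) auto
      then show ?thesis by simp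
    qed
    then show ?case by (simp add: \<tau>_def Y_def H_def z)
  next
    case (Suc k)
    define s t where "s = \<tau> k" and "t = \<tau> (Suc k)"
    have s0: "0 \<le> s" "s \<le> t" using T n0 by (auto simp: s_def t_def \<tau>_def divide_right_mono mult_left_mono)
    have "t = T * (real (Suc k) / real n)" by (simp add: t_def \<tau>_def)
    also have "\<dots> \<le> T * 1" using Suc.prems n0 T by (intro mult_left_mono) (auto simp: divide_simps)
    finally have tT: "t \<le> T" by simp
    have "t - s = T / real n" by (simp add: t_def s_def \<tau>_def algebra_simps add_divide_distrib)
    also have "\<dots> < d" using n n0 by (simp add: divide_simps mult.commute)
    finally have td: "t - s < d" .
    define e where "e = lint {s<..t} h"
    have e: "e \<le> ennreal (1/2)" unfolding e_def by (rule d(2)) (use s0 tT td in auto)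
    have Yf: "Y a t < \<infinity>" "Y a s < \<infinity>" using Yfin mono[OF tT] mono[of s T] s0 tT by (auto simp: less_top le_less_trans)
    have "Y a t = Y a s + lint {s<..t} (\<lambda>r. h r * y r)"
      unfolding Y_def using nn_integral_Icc_split[of "\<lambda>r. h r * y r" 0 s t] s0 by (simp add: add.assoc)
    also have "lint {s<..t} (\<lambda>r. h r * y r) \<le> lint {s<..t} (\<lambda>r. h r * Y a t)"
      using y
    proof (intro nn_integral_mono_AE, eventually_elim)
      case (elim r)
      then show ?case using s0 tT mono[of r t] by (auto simp: indicator_def intro!: mult_left_mono intro: order_trans)
    qed
    also have "\<dots> = e * Y a t"
      unfolding e_def by (subst nn_integral_multc[symmetric]) (auto intro!: nn_integral_cong simp: mult_ac)
    finally have le: "Y a t \<le> Y a s + e * Y a t" by (simp add: add_left_mono)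
    obtain e' where e12: "e = ennreal e'" "0 \<le> e'" using e by (cases e) (auto simp: top_unique)
    moreover have "e' \<le> 1/2" using e unfolding e12(1) by (subst (asm) ennreal_le_iff) auto
    ultimately have e': "e = ennreal e'" "0 \<le> e'" "e' \<le> 1/2" by auto
    obtain yt where yt: "Y a t = ennreal yt" "0 \<le> yt" using Yf(1) by (cases "Y a t") auto
    obtain ys where ys: "Y a s = ennreal ys" "0 \<le> ys" using Yf(2) by (cases "Y a s") auto
    have "yt \<le> ys + e' * yt" using le e' yt ys by (simp flip: ennreal_mult ennreal_plus)
    then have 1: "yt * (1 - e') \<le> ys" by (simp add: algebra_simps)
    \<comment> \<open>The product is 1 + e' (1 - 2 e'), so here the slice mass must not exceed
      1/2.\<close>
    have "1 \<le> (1 - e') * (1 + 2 * e')"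
      using e' mult_left_mono[of e' "1/2" e'] by (simp add: algebra_simps)
    also have "\<dots> \<le> (1 - e') * exp (2 * e')" using e' exp_ge_add_one_self[of "2 * e'"] by (intro mult_left_mono) auto
    finally have "yt * 1 \<le> yt * ((1 - e') * exp (2 * e'))" using yt by (intro mult_left_mono)
    also have "\<dots> \<le> ys * exp (2 * e')" using 1 by (simp add: mult.assoc[symmetric] mult_right_mono)
    finally have step: "Y a t \<le> Y a s * ennreal (exp (2 * e'))" using yt ys by (simp flip: ennreal_mult)
    have Hf: "H t < \<infinity>" "H s < \<infinity>" using hfin Hmono[OF tT] Hmono[of s T] s0 tT unfolding H_def by (auto simp: le_less_trans)
    have "H t = H s + e" unfolding H_def e_def using s0 by (intro nn_integral_Icc_split) auto
    then have He: "enn2real (H t) = enn2real (H s) + e'"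
      using Hf e' by (simp add: enn2real_plus)
    have "Y a t \<le> Y a s * ennreal (exp (2 * e'))" by (rule step)
    also have "\<dots> \<le> a * ennreal (exp (2 * enn2real (H s))) * ennreal (exp (2 * e'))"
      using Suc s_def by (intro mult_right_mono) auto
    also have "\<dots> = a * ennreal (exp (2 * enn2real (H t)))"
      unfolding He by (simp add: mult.assoc distrib_left exp_add flip: ennreal_mult)
    finally show ?case by (simp add: t_def)
  qed
  from main[of n] show ?thesis using n0 by (simp add: \<tau>_def H_def)
qed

subsection \<open>Duhamel's formula\<close>

definition duhamel :: "real \<Rightarrow> (real \<Rightarrow> ennreal) \<Rightarrow> real \<Rightarrow> ennreal" where
  "duhamel l F t = lint {0..t} (\<lambda>s. ennreal (exp (- l * (t - s))) * F s)"

lemma nn_integral_exp_decay: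
  assumes "l \<ge> 0" "s \<le> t"
  shows "lint {s..t} (\<lambda>r. ennreal (l * exp (- l * (r - s)))) = ennreal (1 - exp (- l * (t - s)))"
proof -
  have "(\<integral>\<^sub>Lr. ennreal (l * exp (- l * (r - s))) * indicator {s..t} r) = - exp (- l * (t - s)) - (- exp (- l * (s - s)))"
    by (rule nn_integral_FTC_Icc) (use assms in \<open>auto intro!: derivative_eq_intros\<close>)
  then show ?thesis by simp
qed

text \<open>The integrated form of y' + l y = F with y 0 = 0. Tonelli proves it in [0,\<infinity>],
  so it holds for sources of infinite mass as well and can later be read as a finiteness
  criterion.\<close>

lemma duhamel_energy:
  assumes [measurable]: "bm F" and l: "l \<ge> 0" and t: "t \<ge> 0"
  shows "duhamel l F t + ennreal l * (lint {0..t} (\<lambda>r. duhamel l F r)) = lint {0..t} F"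
proof -
  have "ennreal l * (lint {0..t} (\<lambda>r. duhamel l F r)) =
     (\<integral>\<^sub>Lr. \<integral>\<^sub>Ls. ennreal (l * exp (- l * (r - s))) * indicator {s..t} r * (F s * indicator {0..t} s))"
    unfolding duhamel_def
    apply (subst nn_integral_cmult[symmetric], measurable)
    apply (rule nn_integral_cong)
    apply (subst nn_integral_multc[symmetric], measurable)
    apply (subst nn_integral_cmult[symmetric], measurable)
    apply (rule nn_integral_cong)
    using l apply (auto simp: indicator_def ennreal_mult' mult_ac)
    done
  also have "\<dots> = (\<integral>\<^sub>Ls. \<integral>\<^sub>Lr. ennreal (l * exp (- l * (r - s))) * indicator {s..t} r * (F s * indicator {0..t} s))"
    by (rule lborel_pair.Fubini') measurable
  also have "\<dots> = lint {0..t} (\<lambda>s. ennreal (1 - exp (- l * (t - s))) * F s)"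
  proof (rule nn_integral_cong)
    fix s
    have "(\<integral>\<^sub>Lr. ennreal (l * exp (- l * (r - s))) * indicator {s..t} r * (F s * indicator {0..t} s))
      = (lint {s..t} (\<lambda>r. ennreal (l * exp (- l * (r - s))))) * (F s * indicator {0..t} s)"
      by (rule nn_integral_multc) measurable
    then show "(\<integral>\<^sub>Lr. ennreal (l * exp (- l * (r - s))) * indicator {s..t} r * (F s * indicator {0..t} s))
      = ennreal (1 - exp (- l * (t - s))) * F s * indicator {0..t} s"
      using nn_integral_exp_decay[OF l, of s t] by (cases "s \<in> {0..t}") (auto simp: mult_ac)
  qed
  finally have "duhamel l F t + ennreal l * (lint {0..t} (\<lambda>r. duhamel l F r)) =
    (lint {0..t} (\<lambda>s. ennreal (exp (- l * (t - s))) * F s)) + lint {0..t} (\<lambda>s. ennreal (1 - exp (- l * (t - s))) * F s)"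
    by (simp add: duhamel_def)
  also have "\<dots> = (\<integral>\<^sub>Ls. ennreal (exp (- l * (t - s))) * F s * indicator {0..t} s + ennreal (1 - exp (- l * (t - s))) * F s * indicator {0..t} s)"
    by (rule nn_integral_add[symmetric]) measurable
  also have "\<dots> = lint {0..t} F"
  proof (rule nn_integral_cong)
    fix s
    show "ennreal (exp (- l * (t - s))) * F s * indicator {0..t} s + ennreal (1 - exp (- l * (t - s))) * F s * indicator {0..t} s = F s * indicator {0..t} s"
    proof (cases "s \<in> {0..t}")
      case True
      then have "exp (- l * (t - s)) \<le> 1" using l by simp
      then have "ennreal (exp (- l * (t - s))) + ennreal (1 - exp (- l * (t - s))) = 1"
        by (simp flip: ennreal_plus ennreal_1)
      then show ?thesis using True by (simp flip: distrib_right)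
    qed simp
  qed
  finally show ?thesis .
qed

lemma exp_energy:
  assumes l: "l \<ge> 0" and t: "t \<ge> 0"
  shows "ennreal (exp (- l * t)) * a + ennreal l * (lint {0..t} (\<lambda>r. ennreal (exp (- l * r)) * a)) = a"
proof -
  have "ennreal l * (lint {0..t} (\<lambda>r. ennreal (exp (- l * r)) * a)) = (lint {0..t} (\<lambda>r. ennreal (l * exp (- l * (r - 0))))) * a"
    apply (subst nn_integral_cmult[symmetric], measurable)
    apply (subst nn_integral_multc[symmetric], measurable)
    apply (rule nn_integral_cong)
    using l apply (auto simp: indicator_def ennreal_mult' mult_ac)
    done
  also have "\<dots> = ennreal (1 - exp (- l * t)) * a"
    using nn_integral_exp_decay[OF l t] by simp
  finally have "ennreal (exp (- l * t)) * a + ennreal l * (lint {0..t} (\<lambda>r. ennreal (exp (- l * r)) * a))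
    = (ennreal (exp (- l * t)) + ennreal (1 - exp (- l * t))) * a" by (simp add: distrib_right)
  also have "ennreal (exp (- l * t)) + ennreal (1 - exp (- l * t)) = 1"
    using l t by (subst ennreal_plus[symmetric]) auto
  finally show ?thesis by simp
qed

subsection \<open>The spaces \<open>\<chi>\<^sup>s\<close> on the Fourier side\<close>

text \<open>\<open>Xm\<close>, \<open>X0\<close> and \<open>X1\<close> are the norms of \<chi>^-1,
  \<chi>^0 and \<chi>^1 with values in [0,\<infinity>]. At the origin the weight of
  \<open>Xm\<close> is \<open>inverse 0 = 0\<close>, which affects a null set only.\<close>

definition Xm :: "(real^3 \<Rightarrow> ennreal) \<Rightarrow> ennreal" where
  "Xm f = (\<integral>\<^sub>Lz. ennreal (inverse (norm z)) * f z)"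

definition X0 :: "(real^3 \<Rightarrow> ennreal) \<Rightarrow> ennreal" where
  "X0 f = (\<integral>\<^sub>Lz. f z)"

definition X1 :: "(real^3 \<Rightarrow> ennreal) \<Rightarrow> ennreal" where
  "X1 f = (\<integral>\<^sub>Lz. ennreal (norm z) * f z)"

lemma X_measurable [measurable]:
  assumes [measurable]: "(\<lambda>(s, z). f s z) \<in> borel_measurable (borel \<Otimes>\<^sub>M borel)"
  shows "bm (\<lambda>s. Xm (f s))" "bm (\<lambda>s. X0 (f s))"
    "bm (\<lambda>s. X1 (f s))"
  unfolding Xm_def X0_def X1_def by measurable

lemma X_mono:
  assumes "\<And>z. f z \<le> g z"
  shows "Xm f \<le> Xm g" "X0 f \<le> X0 g" "X1 f \<le> X1 g"
  unfolding Xm_def X0_def X1_def by (auto intro!: nn_integral_mono mult_left_mono assms)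

text \<open>Cauchy-Schwarz for the measure with density f, applied to |z|^(-1/2) and
  |z|^(1/2).\<close>

lemma X0_interpolation:
  assumes [measurable]: "bm f"
  shows "(X0 f)\<^sup>2 \<le> Xm f * X1 f"
proof -
  let ?M = "density lborel f"
  have "X0 f = (\<integral>\<^sub>Lz. f z * (ennreal (inverse (sqrt (norm z))) * ennreal (sqrt (norm z))))"
    unfolding X0_def
  proof (rule nn_integral_cong_AE)
    show "AE z in lborel. f z = f z * (ennreal (inverse (sqrt (norm z))) * ennreal (sqrt (norm z)))"
      using AE_lborel_singleton[of "0 :: real^3"]
      by eventually_elim (simp add: ennreal_mult[symmetric])
  qed
  also have "\<dots> = (\<integral>\<^sup>+z. ennreal (inverse (sqrt (norm z))) * ennreal (sqrt (norm z)) \<partial>?M)"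
    by (rule nn_integral_density[symmetric]) measurable
  finally have "(X0 f)\<^sup>2 \<le> (\<integral>\<^sup>+z. (ennreal (inverse (sqrt (norm z))))\<^sup>2 \<partial>?M) * (\<integral>\<^sup>+z. (ennreal (sqrt (norm z)))\<^sup>2 \<partial>?M)"
    by (simp only:) (rule Cauchy_Schwarz_nn_integral, measurable)
  also have "(\<integral>\<^sup>+z. (ennreal (inverse (sqrt (norm z))))\<^sup>2 \<partial>?M) = Xm f"
    unfolding Xm_def by (subst nn_integral_density) (auto simp: ennreal_power power_inverse mult.commute)
  also have "(\<integral>\<^sup>+z. (ennreal (sqrt (norm z)))\<^sup>2 \<partial>?M) = X1 f"
    unfolding X1_def by (subst nn_integral_density) (auto simp: ennreal_power mult.commute)
  finally show ?thesis .
qed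

text \<open>In the finite case (x c)^2 is at most four times the product of the two summands on the
  right, hence at most the square of their sum. Infinite and zero values are separated first because
  this argument subtracts.\<close>

lemma ennreal_young:
  fixes x c A B :: ennreal
  assumes x: "x\<^sup>2 \<le> A * B" and e: "e > 0"
  shows "x * c \<le> ennreal (e / 2) * B + ennreal (1 / (2 * e)) * c\<^sup>2 * A"
proof (cases "c = 0")
  case False
  show ?thesis
  proof (cases "A = 0 \<or> B = 0")
    case True
    then have "x = 0" using x by (auto simp: power2_eq_square)
    then show ?thesis by simp
  next
    case F: False
    show ?thesis
    proof (cases "A = \<infinity> \<or> B = \<infinity> \<or> c = \<infinity>")
      case True
      then have "ennreal (e / 2) * B + ennreal (1 / (2 * e)) * c\<^sup>2 * A = \<infinity>"
        using F False e by (auto simp: ennreal_mult_eq_top_iff power2_eq_square ennreal_top_mult)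
      then show ?thesis by (simp only:) simp
    next
      case fin: False
      obtain a b c' where r: "A = ennreal a" "a \<ge> 0" "B = ennreal b" "b \<ge> 0" "c = ennreal c'" "c' \<ge> 0"
        using fin by (cases A; cases B; cases c) auto
      have "x\<^sup>2 < \<infinity>" using x r by (auto simp: le_less_trans ennreal_mult_less_top)
      then obtain x' where x': "x = ennreal x'" "x' \<ge> 0" by (cases x) (auto simp: power2_eq_square)
      have xx: "x'\<^sup>2 \<le> a * b" using x r x' by (simp add: ennreal_power flip: ennreal_mult)
      have "(x' * c')\<^sup>2 \<le> (a * b) * c'\<^sup>2" unfolding power_mult_distrib using xx by (intro mult_right_mono) auto
      also have "\<dots> = (e / 2 * b + 1 / (2 * e) * c'\<^sup>2 * a)\<^sup>2 - (e / 2 * b - 1 / (2 * e) * c'\<^sup>2 * a)\<^sup>2"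
        using e by (simp add: power2_eq_square field_simps)
      also have "\<dots> \<le> (e / 2 * b + 1 / (2 * e) * c'\<^sup>2 * a)\<^sup>2" by simp
      finally have "x' * c' \<le> e / 2 * b + 1 / (2 * e) * c'\<^sup>2 * a"
        by (rule power2_le_imp_le) (use r e in auto)
      then have "ennreal (x' * c') \<le> ennreal (e / 2 * b + 1 / (2 * e) * c'\<^sup>2 * a)" by (rule ennreal_leI)
      also have "\<dots> = ennreal (e / 2) * B + ennreal (1 / (2 * e)) * c\<^sup>2 * A"
      proof -
        have "ennreal (e / 2) * B = ennreal (e / 2 * b)" using r e by (simp only: r, subst ennreal_mult) auto
        moreover have "ennreal (1 / (2 * e)) * c\<^sup>2 * A = ennreal (1 / (2 * e) * c'\<^sup>2 * a)"
        proof -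
          have m3: "ennreal (x * y * z) = ennreal x * ennreal y * ennreal z" if "x \<ge> 0" "y \<ge> 0" "z \<ge> 0" for x y z
            using that by (simp add: ennreal_mult)
          show ?thesis unfolding r(1,5) ennreal_power[OF r(6)] by (rule m3[symmetric]) (use r e in auto)
        qed
        ultimately show ?thesis using r e by (subst ennreal_plus) auto
      qed
      finally show ?thesis using x' r by (simp add: ennreal_mult)
    qed
  qed
qed simp

definition cv :: "(real^3 \<Rightarrow> ennreal) \<Rightarrow> (real^3 \<Rightarrow> ennreal) \<Rightarrow> real^3 \<Rightarrow> ennreal" where
  "cv f g \<zeta> = (\<integral>\<^sub>L\<eta>. f (\<zeta> - \<eta>) * g \<eta>)"

lemma cv_measurable [measurable (raw)]:
  assumes [measurable]: "(\<lambda>(s, z). f s z) \<in> borel_measurable (borel \<Otimes>\<^sub>M borel)" "(\<lambda>(s, z). g s z) \<in> borel_measurable (borel \<Otimes>\<^sub>M borel)"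
    "a \<in> borel_measurable M" "b \<in> borel_measurable M"
  shows "(\<lambda>x. cv (f (a x)) (g (a x)) (b x)) \<in> borel_measurable M"
  unfolding cv_def by measurable

lemma X0_cv:
  assumes [measurable]: "bm f" "bm g"
  shows "X0 (cv f g) = X0 f * X0 g"
proof -
  have "X0 (cv f g) = (\<integral>\<^sub>L\<eta>. \<integral>\<^sub>L\<zeta>. f (\<zeta> - \<eta>) * g \<eta>)"
    unfolding X0_def cv_def by (rule lborel_pair.Fubini') measurable
  also have "\<dots> = (\<integral>\<^sub>L\<eta>. X0 f * g \<eta>)"
    unfolding X0_def by (intro nn_integral_cong, subst nn_integral_multc) (auto simp: lborel_nn_integral_shift)
  also have "\<dots> = X0 f * X0 g" unfolding X0_def[of g] by (rule nn_integral_cmult) measurable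
  finally show ?thesis .
qed

lemma cv_commute:
  assumes [measurable]: "bm f" "bm g"
  shows "cv f g \<zeta> = cv g f \<zeta>"
  unfolding cv_def using lborel_nn_integral_reflect[of "\<lambda>\<eta>. f (\<zeta> - \<eta>) * g \<eta>" \<zeta>] by (simp add: mult.commute)

subsection \<open>The majorant iteration\<close>

text \<open>The majorant of the forcing on the field bounded by p: the coupling caused by unequal
  viscosities, and transport by the other field, bounded by q, with the derivative contributing
  |z|.\<close>

definition src :: "real \<Rightarrow> (real^3 \<Rightarrow> ennreal) \<Rightarrow> (real^3 \<Rightarrow> ennreal) \<Rightarrow> real^3 \<Rightarrow> ennreal" where
  "src m p q z = ennreal (m * (norm z)\<^sup>2) * q z + ennreal (norm z) * cv q p z"

definition Phi :: "real \<Rightarrow> real \<Rightarrow> (real^3 \<Rightarrow> ennreal) \<Rightarrow> (real \<Rightarrow> real^3 \<Rightarrow> ennreal) \<Rightarrow> (real \<Rightarrow> real^3 \<Rightarrow> ennreal) \<Rightarrow>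
    real \<Rightarrow> real^3 \<Rightarrow> ennreal" where
  "Phi \<nu> m p0 p q t z = ennreal (exp (- (\<nu> * (norm z)\<^sup>2) * t)) * p0 z + duhamel (\<nu> * (norm z)\<^sup>2) (\<lambda>s. src m (p s) (q s) z) t"

abbreviation jm :: "(real \<Rightarrow> real^3 \<Rightarrow> 'a::topological_space) \<Rightarrow> bool" where
  "jm f \<equiv> (\<lambda>(s, z). f s z) \<in> borel_measurable (borel \<Otimes>\<^sub>M borel)"

lemma jm_section:
  assumes [measurable]: "jm f"
  shows "bm (f s)"
proof -
  have "bm (\<lambda>z. f s z)" by measurable
  then show ?thesis by simp
qed

lemma src_measurable [measurable (raw)]:
  assumes [measurable]: "jm p" "jm q" "a \<in> borel_measurable M" "b \<in> borel_measurable M"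
  shows "(\<lambda>x. src m (p (a x)) (q (a x)) (b x)) \<in> borel_measurable M"
  unfolding src_def cv_def by measurable

lemma jm_Phi:
  assumes [measurable]: "jm p" "jm q" "bm p0"
  shows "jm (Phi \<nu> m p0 p q)"
  unfolding Phi_def duhamel_def by measurable

lemma src_mono:
  assumes "\<And>z. p z \<le> p' z" "\<And>z. q z \<le> q' z"
  shows "src m p q z \<le> src m p' q' z"
  unfolding src_def cv_def by (intro add_mono mult_left_mono nn_integral_mono mult_mono assms) auto

lemma Phi_mono:
  assumes "\<And>s z. p s z \<le> p' s z" "\<And>s z. q s z \<le> q' s z"
  shows "Phi \<nu> m p0 p q t z \<le> Phi \<nu> m p0 p' q' t z"
  unfolding Phi_def duhamel_def
  by (intro add_mono mult_left_mono mult_right_mono nn_integral_mono src_mono assms) auto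

text \<open>At each frequency the mild formula satisfies an exact energy identity. Weighting it with
  1 / |z| turns \<nu> |z|^2 into \<nu> |z| and cancels the derivative in the nonlinearity, leaving
  the L^1 norm of a convolution, which is a product of \<open>X0\<close> norms. Equality is lost
  only at z = 0, where the weight vanishes.\<close>

lemma Phi_energy:
  assumes [measurable]: "jm p" "jm q" "bm p0" and \<nu>: "\<nu> > 0" and m: "m \<ge> 0" and t: "t \<ge> 0"
  shows "Xm (Phi \<nu> m p0 p q t) + ennreal \<nu> * (lint {0..t} (\<lambda>s. X1 (Phi \<nu> m p0 p q s))) \<le>
    Xm p0 + lint {0..t} (\<lambda>s. (ennreal m * X1 (q s) + X0 (p s) * X0 (q s)))"
proof -
  let ?f = "Phi \<nu> m p0 p q"
  let ?k = "\<lambda>z::real^3. ennreal (inverse (norm z))"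
  have [measurable]: "jm ?f" by (rule jm_Phi) measurable
  have pw: "?f t z + ennreal (\<nu> * (norm z)\<^sup>2) * (lint {0..t} (\<lambda>r. ?f r z)) = p0 z + lint {0..t} (\<lambda>s. src m (p s) (q s) z)" for z
  proof -
    let ?l = "\<nu> * (norm z)\<^sup>2" and ?F = "\<lambda>s. src m (p s) (q s) z"
    have l: "?l \<ge> 0" using \<nu> by simp
    have [measurable]: "bm (\<lambda>r. duhamel ?l ?F r)" unfolding duhamel_def by measurable
    have "lint {0..t} (\<lambda>r. ?f r z) = lint {0..t} (\<lambda>r. ennreal (exp (- ?l * r)) * p0 z) + lint {0..t} (\<lambda>r. duhamel ?l ?F r)"
      unfolding Phi_def distrib_right by (rule nn_integral_add) measurable
    then have "?f t z + ennreal ?l * (lint {0..t} (\<lambda>r. ?f r z)) =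
      (ennreal (exp (- ?l * t)) * p0 z + ennreal ?l * (lint {0..t} (\<lambda>r. ennreal (exp (- ?l * r)) * p0 z))) +
      (duhamel ?l ?F t + ennreal ?l * (lint {0..t} (\<lambda>r. duhamel ?l ?F r)))"
      by (simp add: Phi_def distrib_left add_ac)
    also have "\<dots> = p0 z + lint {0..t} (\<lambda>s. ?F s)"
      unfolding exp_energy[OF l t] by (subst duhamel_energy[OF _ l t]) auto
    finally show ?thesis .
  qed
  have kl: "?k z * ennreal (\<nu> * (norm z)\<^sup>2) = ennreal \<nu> * ennreal (norm z)" for z
    using \<nu> by (cases "z = 0") (simp_all add: power2_eq_square flip: ennreal_mult)
  have "Xm (?f t) + ennreal \<nu> * (lint {0..t} (\<lambda>s. X1 (?f s))) =
     Xm (?f t) + (\<integral>\<^sub>Lz. ?k z * (ennreal (\<nu> * (norm z)\<^sup>2) * (lint {0..t} (\<lambda>r. ?f r z))))"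
  proof -
    have "ennreal \<nu> * (lint {0..t} (\<lambda>s. X1 (?f s))) = (\<integral>\<^sub>Ls. \<integral>\<^sub>Lz. ennreal \<nu> * (ennreal (norm z) * ?f s z * indicator {0..t} s))"
      unfolding X1_def
      apply (subst nn_integral_cmult[symmetric], measurable)
      apply (rule nn_integral_cong)
      apply (subst nn_integral_multc[symmetric], measurable)
      apply (subst nn_integral_cmult[symmetric], measurable)
      done
    also have "\<dots> = (\<integral>\<^sub>Lz. \<integral>\<^sub>Ls. ennreal \<nu> * (ennreal (norm z) * ?f s z * indicator {0..t} s))"
      by (rule lborel_pair.Fubini') measurable
    also have "\<dots> = (\<integral>\<^sub>Lz. ?k z * (ennreal (\<nu> * (norm z)\<^sup>2) * (lint {0..t} (\<lambda>r. ?f r z))))"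
      apply (rule nn_integral_cong)
      apply (simp only: mult.assoc[symmetric] kl)
      apply (subst nn_integral_cmult[symmetric], measurable)
      apply (simp add: mult.assoc)
      done
    finally show ?thesis by simp
  qed
  also have "\<dots> = (\<integral>\<^sub>Lz. ?k z * (?f t z + ennreal (\<nu> * (norm z)\<^sup>2) * (lint {0..t} (\<lambda>r. ?f r z))))"
    unfolding Xm_def distrib_left by (rule nn_integral_add[symmetric]) measurable
  also have "\<dots> = Xm p0 + (\<integral>\<^sub>Lz. ?k z * (lint {0..t} (\<lambda>s. src m (p s) (q s) z)))"
    unfolding pw Xm_def distrib_left by (rule nn_integral_add) measurable
  also have "(\<integral>\<^sub>Lz. ?k z * (lint {0..t} (\<lambda>s. src m (p s) (q s) z))) = (\<integral>\<^sub>Ls. \<integral>\<^sub>Lz. ?k z * (src m (p s) (q s) z * indicator {0..t} s))"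
    apply (subst lborel_pair.Fubini')
     apply measurable
    apply (rule nn_integral_cong)
    apply (subst nn_integral_cmult[symmetric], measurable)
    done
  also have "\<dots> \<le> lint {0..t} (\<lambda>s. (ennreal m * X1 (q s) + X0 (p s) * X0 (q s)))"
  proof (rule nn_integral_mono)
    fix s
    have [measurable]: "bm (p s)" "bm (q s)" by (auto intro: jm_section)
    have [measurable]: "bm (cv (q s) (p s))" unfolding cv_def by measurable
    have "?k z * src m (p s) (q s) z \<le> ennreal m * (ennreal (norm z) * q s z) + cv (q s) (p s) z" for z
    proof -
      have "?k z * ennreal (m * (norm z)\<^sup>2) = ennreal m * ennreal (norm z)"
        using m by (cases "z = 0") (simp_all add: power2_eq_square flip: ennreal_mult)
      moreover have "?k z * ennreal (norm z) \<le> 1"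
        by (cases "z = 0") (simp_all flip: ennreal_mult)
      then have "?k z * (ennreal (norm z) * cv (q s) (p s) z) \<le> 1 * cv (q s) (p s) z"
        unfolding mult.assoc[symmetric] by (rule mult_right_mono) simp
      ultimately show ?thesis
        unfolding src_def distrib_left by (simp add: mult.assoc[symmetric])
    qed
    then have "(\<integral>\<^sub>Lz. ?k z * src m (p s) (q s) z) \<le> (\<integral>\<^sub>Lz. ennreal m * (ennreal (norm z) * q s z) + cv (q s) (p s) z)"
      by (intro nn_integral_mono)
    also have "\<dots> = ennreal m * X1 (q s) + X0 (cv (q s) (p s))"
      unfolding X1_def X0_def by (subst nn_integral_add) (auto intro: nn_integral_cmult)
    also have "\<dots> = ennreal m * X1 (q s) + X0 (p s) * X0 (q s)" by (simp add: X0_cv mult.commute)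
    finally have "(\<integral>\<^sub>Lz. ?k z * src m (p s) (q s) z) \<le> ennreal m * X1 (q s) + X0 (p s) * X0 (q s)" .
    then show "(\<integral>\<^sub>Lz. ?k z * (src m (p s) (q s) z * indicator {0..t} s)) \<le> (ennreal m * X1 (q s) + X0 (p s) * X0 (q s)) * indicator {0..t} s"
      by (cases "s \<in> {0..t}") auto
  qed
  finally show ?thesis by (simp add: add_left_mono)
qed

lemma nn_integral_atLeast_le:
  fixes f :: "real \<Rightarrow> ennreal"
  assumes [measurable]: "bm f" and B: "\<And>t. t \<ge> 0 \<Longrightarrow> (lint {0..t} f) \<le> B"
  shows "lint {0..} f \<le> B"
proof -
  have sup: "f s * indicator {0..} s = (SUP n. f s * indicator {0..real n} s)" for s
  proof (rule antisym)
    obtain n where "s \<le> real n" using real_arch_simple by blast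
    then have "f s * indicator {0..} s \<le> f s * indicator {0..real n} s" by (auto simp: indicator_def)
    then show "f s * indicator {0..} s \<le> (SUP n. f s * indicator {0..real n} s)" by (rule SUP_upper2[OF UNIV_I])
    show "(SUP n. f s * indicator {0..real n} s) \<le> f s * indicator {0..} s"
      by (rule SUP_least) (auto simp: indicator_def)
  qed
  have "lint {0..} f = (SUP n. \<integral>\<^sup>+s\<in>{0..real n}. f s \<partial>lborel)"
    unfolding sup by (rule nn_integral_monotone_convergence_SUP) (auto simp: incseq_def le_fun_def indicator_def)
  also have "\<dots> \<le> B" by (rule SUP_least) (auto intro: B)
  finally show ?thesis .
qed

lemma nn_integral_Icc_le_atLeast:
  fixes f :: "real \<Rightarrow> ennreal"
  shows "lint {0..t} f \<le> lint {0..} f"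
  by (intro nn_integral_mono) (auto simp: indicator_def)

text \<open>Here p is a subsolution, so its \<open>X0\<close> norm may be interpolated through f =
  \<open>Phi \<nu> m p0 p q\<close>. Young's inequality moves half of the dissipation to the left,
  and Gronwall with weight (X0 q)^2 / (2 \<nu>), of mass at most H, handles the rest. The bounds
  \<open>pM\<close> and \<open>pI\<close> serve to know beforehand that all terms are finite; their
  values do not reach the conclusion.\<close>

lemma majorant_step:
  assumes [measurable]: "jm p" "jm q" "bm p0" and \<nu>: "\<nu> > 0" and m: "m \<ge> 0"
    and le: "\<And>s z. p s z \<le> Phi \<nu> m p0 p q s z"
    and p0: "Xm p0 = ennreal D" "D \<ge> 0"
    and pM: "\<And>s. s \<ge> 0 \<Longrightarrow> Xm (p s) \<le> ennreal M"
    and pI: "lint {0..} (\<lambda>s. X1 (p s)) < \<infinity>"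
    and qE: "lint {0..} (\<lambda>s. X1 (q s)) \<le> ennreal E" "E \<ge> 0"
    and qH: "lint {0..} (\<lambda>s. (X0 (q s))\<^sup>2) \<le> ennreal (2 * \<nu> * H)" "H \<ge> 0"
    and t: "t \<ge> 0"
  shows "Xm (Phi \<nu> m p0 p q t) + ennreal (\<nu> / 2) * (lint {0..t} (\<lambda>s. X1 (Phi \<nu> m p0 p q s))) \<le> ennreal ((D + m * E) * exp (2 * H))"
proof -
  define f where "f = Phi \<nu> m p0 p q"
  have [measurable]: "jm f" unfolding f_def by (rule jm_Phi) measurable
  define A where "A t = Xm (f t)" for t
  define h where "h s = ennreal (1 / (2 * \<nu>)) * (X0 (q s))\<^sup>2" for s
  have [measurable]: "bm A" "bm h" unfolding A_def h_def by measurable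
  have sec[measurable]: "bm (p s)" "bm (q s)" "bm (f s)" for s
    by (auto intro: jm_section)
  have Hh: "lint {0..t} h \<le> ennreal H" for t
  proof -
    have "lint {0..t} h \<le> lint {0..} h" by (rule nn_integral_Icc_le_atLeast)
    also have "\<dots> = ennreal (1 / (2 * \<nu>)) * (lint {0..} (\<lambda>s. (X0 (q s))\<^sup>2))"
      unfolding h_def by (subst nn_integral_cmult[symmetric]) (auto simp: mult_ac)
    also have "\<dots> \<le> ennreal (1 / (2 * \<nu>)) * ennreal (2 * \<nu> * H)" by (intro mult_left_mono qH) simp
    also have "\<dots> = ennreal H" using \<nu> qH by (simp flip: ennreal_mult)
    finally show ?thesis .
  qed
  have qEt: "lint {0..t} (\<lambda>s. ennreal m * X1 (q s)) \<le> ennreal (m * E)" for t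
  proof -
    have "lint {0..t} (\<lambda>s. ennreal m * X1 (q s)) = ennreal m * (lint {0..t} (\<lambda>s. X1 (q s)))"
      by (subst nn_integral_cmult[symmetric]) (auto simp: mult_ac)
    also have "\<dots> \<le> ennreal m * ennreal E"
      by (intro mult_left_mono order_trans[OF nn_integral_Icc_le_atLeast qE(1)]) simp
    finally show ?thesis using m qE by (simp add: ennreal_mult)
  qed
  have energy: "A t + ennreal \<nu> * (lint {0..t} (\<lambda>s. X1 (f s))) \<le> ennreal (D + m * E) + lint {0..t} (\<lambda>s. X0 (p s) * X0 (q s))" if "t \<ge> 0" for t
  proof -
    have "A t + ennreal \<nu> * (lint {0..t} (\<lambda>s. X1 (f s))) \<le> Xm p0 + lint {0..t} (\<lambda>s. (ennreal m * X1 (q s) + X0 (p s) * X0 (q s)))"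
      unfolding A_def f_def by (rule Phi_energy) (use \<nu> m that in auto)
    also have "lint {0..t} (\<lambda>s. (ennreal m * X1 (q s) + X0 (p s) * X0 (q s))) = lint {0..t} (\<lambda>s. ennreal m * X1 (q s)) + lint {0..t} (\<lambda>s. X0 (p s) * X0 (q s))"
      unfolding distrib_right by (rule nn_integral_add) measurable
    also have "Xm p0 + \<dots> \<le> Xm p0 + (ennreal (m * E) + lint {0..t} (\<lambda>s. X0 (p s) * X0 (q s)))"
      by (intro add_left_mono add_right_mono qEt)
    finally show ?thesis using p0 m qE by (simp add: add.assoc)
  qed
  \<comment> \<open>Applied twice: with g = p s for a crude finite bound, then with g = f s for the
    estimate itself.\<close>
  have young: "X0 (p s) * X0 (q s) \<le> ennreal (\<nu> / 2) * X1 g + h s * Xm g" if "\<And>z. p s z \<le> g z" "bm g" for s g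
  proof -
    have "(X0 (p s))\<^sup>2 \<le> (X0 g)\<^sup>2" by (intro power_mono X_mono that) simp
    also have "\<dots> \<le> Xm g * X1 g" by (rule X0_interpolation[OF that(2)])
    finally show ?thesis using ennreal_young[of "X0 (p s)" "Xm g" "X1 g" \<nu> "X0 (q s)"] \<nu> by (simp add: h_def)
  qed
  \<comment> \<open>Cancelling half of the dissipation and applying Gronwall both require
    finiteness, which this bound provides through p alone.\<close>
  have fin1: "lint {0..t} (\<lambda>s. X0 (p s) * X0 (q s)) \<le> ennreal (\<nu> / 2) * (lint {0..} (\<lambda>s. X1 (p s))) + ennreal H * ennreal M" for t
  proof -
    have "lint {0..t} (\<lambda>s. X0 (p s) * X0 (q s)) \<le> (\<integral>\<^sub>Ls. ennreal (\<nu> / 2) * (X1 (p s) * indicator {0..t} s) + (h s * indicator {0..t} s) * ennreal M)"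
    proof (rule nn_integral_mono)
      fix s
      show "X0 (p s) * X0 (q s) * indicator {0..t} s \<le> ennreal (\<nu> / 2) * (X1 (p s) * indicator {0..t} s) + (h s * indicator {0..t} s) * ennreal M"
        using order_trans[OF young[of s "p s"] add_left_mono[OF mult_left_mono[OF pM[of s], of "h s"]]]
        by (cases "s \<in> {0..t}") auto
    qed
    also have "\<dots> = ennreal (\<nu> / 2) * (lint {0..t} (\<lambda>s. X1 (p s))) + (lint {0..t} h) * ennreal M"
      by (subst nn_integral_add) (auto simp: nn_integral_cmult nn_integral_multc)
    also have "\<dots> \<le> ennreal (\<nu> / 2) * (lint {0..} (\<lambda>s. X1 (p s))) + ennreal H * ennreal M"
      by (intro add_mono mult_left_mono mult_right_mono nn_integral_Icc_le_atLeast Hh) auto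
    finally show ?thesis .
  qed
  define R where "R = ennreal (D + m * E) + (ennreal (\<nu> / 2) * (lint {0..} (\<lambda>s. X1 (p s))) + ennreal H * ennreal M)"
  have R: "R < \<infinity>" unfolding R_def using pI by (auto simp: ennreal_mult_less_top)
  have bd: "A t + ennreal \<nu> * (lint {0..t} (\<lambda>s. X1 (f s))) \<le> R" if "t \<ge> 0" for t
    unfolding R_def by (rule order_trans[OF energy[OF that] add_left_mono[OF fin1]])
  have AR: "A t \<le> R" if "t \<ge> 0" for t using order_trans[OF _ bd[OF that], of "A t"] by simp
  have If: "lint {0..t} (\<lambda>s. X1 (f s)) < \<infinity>" if "t \<ge> 0" for t
  proof -
    have "ennreal \<nu> * (lint {0..t} (\<lambda>s. X1 (f s))) < \<infinity>"
      by (rule le_less_trans[OF order_trans[OF _ bd[OF that]] R]) simp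
    then show ?thesis using \<nu> by (auto simp: ennreal_mult_less_top)
  qed
  define Y where "Y t = ennreal (D + m * E) + lint {0..t} (\<lambda>s. h s * A s)" for t
  have key: "A t + ennreal (\<nu> / 2) * (lint {0..t} (\<lambda>s. X1 (f s))) \<le> Y t" if "t \<ge> 0" for t
  proof -
    let ?I = "ennreal (\<nu> / 2) * (lint {0..t} (\<lambda>s. X1 (f s)))"
    have fin: "?I < \<infinity>" using If[OF that] by (auto simp: ennreal_mult_less_top)
    have two: "ennreal \<nu> * x = ennreal (\<nu> / 2) * x + ennreal (\<nu> / 2) * x" for x
      using \<nu> by (subst distrib_right[symmetric]) (simp flip: ennreal_plus)
    have "lint {0..t} (\<lambda>s. X0 (p s) * X0 (q s)) \<le> (\<integral>\<^sub>Ls. ennreal (\<nu> / 2) * (X1 (f s) * indicator {0..t} s) + h s * A s * indicator {0..t} s)"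
    proof (rule nn_integral_mono)
      fix s
      show "X0 (p s) * X0 (q s) * indicator {0..t} s \<le> ennreal (\<nu> / 2) * (X1 (f s) * indicator {0..t} s) + h s * A s * indicator {0..t} s"
        using young[of s "f s"] le[of s] by (cases "s \<in> {0..t}") (auto simp: f_def A_def jm_section[OF jm_Phi])
    qed
    also have "\<dots> = ?I + lint {0..t} (\<lambda>s. h s * A s)"
      by (subst nn_integral_add) (auto simp: nn_integral_cmult)
    finally have "A t + (?I + ?I) \<le> ennreal (D + m * E) + (?I + lint {0..t} (\<lambda>s. h s * A s))"
      using order_trans[OF energy[OF that] add_left_mono] unfolding two by blast
    then have "?I + (A t + ?I) \<le> ?I + Y t" by (simp add: Y_def add_ac)
    then show ?thesis using fin by (auto simp: ennreal_add_left_cancel_le)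
  qed
  have "Y t \<le> ennreal (D + m * E) * ennreal (exp (2 * enn2real (lint {0..t} h)))"
    unfolding Y_def
  proof (rule gronwall)
    show "lint {0..t} h < \<infinity>" using Hh[of t] by (auto intro: le_less_trans)
    have "lint {0..t} (\<lambda>s. h s * A s) \<le> lint {0..t} (\<lambda>s. h s * R)"
      using AR by (intro nn_integral_mono) (auto simp: indicator_def intro!: mult_left_mono)
    also have "\<dots> = (lint {0..t} h) * R"
      by (subst nn_integral_multc[symmetric]) (auto intro!: nn_integral_cong simp: mult_ac)
    also have "\<dots> \<le> ennreal H * R" by (intro mult_right_mono Hh) simp
    also have "\<dots> < \<infinity>" using R by (auto simp: ennreal_mult_less_top)
    finally show "ennreal (D + m * E) + lint {0..t} (\<lambda>s. h s * A s) < \<infinity>" by simp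
    show "AE s in lborel. s \<in> {0..t} \<longrightarrow> A s \<le> ennreal (D + m * E) + lint {0..s} (\<lambda>s. h s * A s)"
      using order_trans[OF _ key] unfolding Y_def by (intro AE_I2) auto
  qed (use t in auto)
  also have "\<dots> \<le> ennreal (D + m * E) * ennreal (exp (2 * H))"
    using enn2real_mono[OF Hh[of t]] qH(2) by (intro mult_left_mono ennreal_leI) auto
  also have "\<dots> = ennreal ((D + m * E) * exp (2 * H))" using p0 m qE by (simp add: ennreal_mult)
  finally show ?thesis using order_trans[OF key[OF t]] unfolding A_def f_def by blast
qed

text \<open>The Boolean index tells the two Elsasser fields apart; \<open>False\<close> is the one assumed small.\<close>

primrec maj :: "real \<Rightarrow> real \<Rightarrow> (bool \<Rightarrow> real^3 \<Rightarrow> ennreal) \<Rightarrow> nat \<Rightarrow> bool \<Rightarrow> real \<Rightarrow> real^3 \<Rightarrow> ennreal" where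
  "maj \<nu> m d 0 = (\<lambda>b t z. 0)"
| "maj \<nu> m d (Suc n) = (\<lambda>b. Phi \<nu> m (d b) (maj \<nu> m d n b) (maj \<nu> m d n (\<not> b)))"

lemma jm_maj:
  assumes "\<And>b. bm (d b)"
  shows "jm (maj \<nu> m d n b)"
  by (induction n arbitrary: b) (auto intro!: jm_Phi assms)

lemma maj_mono: "maj \<nu> m d n b t z \<le> maj \<nu> m d (Suc n) b t z"
proof (induction n arbitrary: b t z)
  case (Suc n)
  have "Phi \<nu> m (d b) (maj \<nu> m d n b) (maj \<nu> m d n (\<not> b)) t z \<le> Phi \<nu> m (d b) (maj \<nu> m d (Suc n) b) (maj \<nu> m d (Suc n) (\<not> b)) t z"
    by (rule Phi_mono; rule Suc.IH)
  then show ?case by (simp only: maj.simps(2))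
qed simp

lemma maj_incseq: "incseq (\<lambda>n. maj \<nu> m d n b t z)"
  by (rule incseq_SucI) (rule maj_mono)

lemma X0_square_integral:
  assumes [measurable]: "jm q" and B: "\<And>s. s \<ge> 0 \<Longrightarrow> Xm (q s) \<le> ennreal B"
    and E: "lint {0..} (\<lambda>s. X1 (q s)) \<le> ennreal E" and "E \<ge> 0" "B \<ge> 0"
  shows "lint {0..} (\<lambda>s. (X0 (q s))\<^sup>2) \<le> ennreal (B * E)"
proof -
  have "lint {0..} (\<lambda>s. (X0 (q s))\<^sup>2) \<le> (\<integral>\<^sub>Ls. ennreal B * (X1 (q s) * indicator {0..} s))"
  proof (rule nn_integral_mono)
    fix s
    have "(X0 (q s))\<^sup>2 \<le> ennreal B * X1 (q s)" if "s \<ge> 0"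
      by (rule order_trans[OF X0_interpolation mult_right_mono[OF B]]) (use that in \<open>auto intro: jm_section\<close>)
    then show "(X0 (q s))\<^sup>2 * indicator {0..} s \<le> ennreal B * (X1 (q s) * indicator {0..} s)"
      by (auto simp: indicator_def)
  qed
  also have "\<dots> = ennreal B * (lint {0..} (\<lambda>s. X1 (q s)))" by (rule nn_integral_cmult) measurable
  also have "\<dots> \<le> ennreal B * ennreal E" by (intro mult_left_mono E) simp
  finally show ?thesis using assms by (simp add: ennreal_mult)
qed

text \<open>Interpolation bounds the time integral of (X0 q)^2 by B E, so
  \<open>majorant_step\<close> applies with H = B E / (2 \<nu>). In this form the hypotheses on q
  and the conclusions are of the same kind, ready for an induction.\<close>

lemma majorant_bound:
  assumes [measurable]: "jm p" "jm q" "bm p0" and \<nu>: "\<nu> > 0" and m: "m \<ge> 0"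
    and le: "\<And>s z. p s z \<le> Phi \<nu> m p0 p q s z"
    and p0: "Xm p0 = ennreal D" "D \<ge> 0"
    and pM: "\<And>s. s \<ge> 0 \<Longrightarrow> Xm (p s) \<le> ennreal M"
    and pI: "lint {0..} (\<lambda>s. X1 (p s)) < \<infinity>"
    and qE: "lint {0..} (\<lambda>s. X1 (q s)) \<le> ennreal E" "E \<ge> 0"
    and qB: "\<And>s. s \<ge> 0 \<Longrightarrow> Xm (q s) \<le> ennreal B" "B \<ge> 0"
    and R: "(D + m * E) * exp (B * E / \<nu>) \<le> R"
  shows "s \<ge> 0 \<Longrightarrow> Xm (Phi \<nu> m p0 p q s) \<le> ennreal R"
    and "lint {0..} (\<lambda>s. X1 (Phi \<nu> m p0 p q s)) \<le> ennreal (2 * R / \<nu>)"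
proof -
  let ?f = "Phi \<nu> m p0 p q"
  have [measurable]: "jm ?f" by (rule jm_Phi) measurable
  have qH: "lint {0..} (\<lambda>s. (X0 (q s))\<^sup>2) \<le> ennreal (2 * \<nu> * (B * E / (2 * \<nu>)))"
    using X0_square_integral[OF assms(2) qB(1) qE(1)] qE qB \<nu> by simp
  have main: "Xm (?f t) + ennreal (\<nu> / 2) * (lint {0..t} (\<lambda>s. X1 (?f s))) \<le> ennreal R" if "t \<ge> 0" for t
  proof -
    have "Xm (?f t) + ennreal (\<nu> / 2) * (lint {0..t} (\<lambda>s. X1 (?f s))) \<le> ennreal ((D + m * E) * exp (2 * (B * E / (2 * \<nu>))))"
      by (rule majorant_step[OF assms(1,2,3) \<nu> m le p0 pM pI qE qH _ that]) (use qE qB \<nu> in auto)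
    also have "\<dots> \<le> ennreal R" using R by (intro ennreal_leI) simp
    finally show ?thesis .
  qed
  show "Xm (?f s) \<le> ennreal R" if "s \<ge> 0" using order_trans[OF _ main[OF that], of "Xm (?f s)"] by simp
  have "lint {0..t} (\<lambda>s. X1 (?f s)) \<le> ennreal (2 * R / \<nu>)" if "t \<ge> 0" for t
  proof -
    have "ennreal (\<nu> / 2) * (lint {0..t} (\<lambda>s. X1 (?f s))) \<le> ennreal R"
      using order_trans[OF _ main[OF that], of "ennreal (\<nu> / 2) * (lint {0..t} (\<lambda>s. X1 (?f s)))"] by simp
    then have "ennreal (2 / \<nu>) * (ennreal (\<nu> / 2) * (lint {0..t} (\<lambda>s. X1 (?f s)))) \<le> ennreal (2 / \<nu>) * ennreal R"
      by (intro mult_left_mono) auto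
    also have "ennreal (2 / \<nu>) * (ennreal (\<nu> / 2) * (lint {0..t} (\<lambda>s. X1 (?f s)))) = lint {0..t} (\<lambda>s. X1 (?f s))"
    proof -
      have "ennreal (2 / \<nu>) * ennreal (\<nu> / 2) = 1" using \<nu> by (simp flip: ennreal_mult)
      then show ?thesis by (simp only: mult.assoc[symmetric]) simp
    qed
    also have "ennreal (2 / \<nu>) * ennreal R = ennreal (2 * R / \<nu>)" using \<nu> by (simp add: ennreal_mult'[symmetric])
    finally show ?thesis .
  qed
  then show "lint {0..} (\<lambda>s. X1 (?f s)) \<le> ennreal (2 * R / \<nu>)"
    by (intro nn_integral_atLeast_le) measurable
qed

text \<open>Large enough for the bounds \<open>2\<nu>\<close> and \<open>4 exp 8 (m + D True)\<close> in \<open>maj_bounds\<close> to reproduce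
  themselves under the iteration.\<close>

definition smallC :: real where "smallC = 32 * exp 16"

lemma maj_bounds:
  assumes [measurable]: "\<And>b. bm (d b)" and \<nu>: "\<nu> > 0" and m: "m \<ge> 0"
    and d: "\<And>b. Xm (d b) = ennreal (D b)" "\<And>b. D b \<ge> 0"
    and small: "(D False + smallC * m / \<nu> * (m + D True)) * exp (smallC / \<nu>\<^sup>2 * (m + D True)\<^sup>2) < 2 * \<nu>"
  defines "M \<equiv> 4 * exp 8 * (m + D True)"
  shows "(\<forall>s\<ge>0. Xm (maj \<nu> m d n False s) \<le> ennreal (2 * \<nu>)) \<and> (lint {0..} (\<lambda>s. X1 (maj \<nu> m d n False s))) \<le> ennreal 4 \<and>
    (\<forall>s\<ge>0. Xm (maj \<nu> m d n True s) \<le> ennreal M) \<and> (lint {0..} (\<lambda>s. X1 (maj \<nu> m d n True s))) \<le> ennreal (2 * M / \<nu>)"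
proof (induction n)
  case 0
  then show ?case by (simp add: Xm_def X1_def)
next
  case (Suc n)
  have [measurable]: "jm (maj \<nu> m d n b)" for b by (rule jm_maj) measurable
  have M: "M \<ge> 0" using m d(2)[of True] by (simp add: M_def)
  have le: "maj \<nu> m d n b s z \<le> Phi \<nu> m (d b) (maj \<nu> m d n b) (maj \<nu> m d n (\<not> b)) s z" for b s z
    using maj_mono[of \<nu> m d n b s z] by simp
  \<comment> \<open>The bounds 2\<nu> and 4 on the small field make the exponent equal to 8,
    whatever \<nu> is; the 4 in \<open>M\<close> absorbs the coupling m * 4.\<close>
  have P: "(D True + m * 4) * exp (2 * \<nu> * 4 / \<nu>) \<le> M"
    using m d(2)[of True] \<nu> by (simp add: M_def algebra_simps)
  \<comment> \<open>The exponent here is 2 M^2 / \<nu>^2 = 32 exp 16 (m + D True)^2 / \<nu>^2, and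
    this fixes \<open>smallC\<close>. The prefactor would be content with 8 exp 8.\<close>
  have Q: "(D False + m * (2 * M / \<nu>)) * exp (M * (2 * M / \<nu>) / \<nu>) \<le> 2 * \<nu>"
  proof -
    have "m * (2 * M / \<nu>) = 8 * exp 8 * (m / \<nu> * (m + D True))" by (simp add: M_def)
    also have "\<dots> \<le> smallC * (m / \<nu> * (m + D True))"
    proof (rule mult_right_mono)
      have "8 * exp 8 \<le> 32 * exp (16::real)" by (intro mult_mono) auto
      then show "8 * exp 8 \<le> smallC" by (simp add: smallC_def)
    qed (use m \<nu> d(2)[of True] in auto)
    finally have 1: "D False + m * (2 * M / \<nu>) \<le> D False + smallC * m / \<nu> * (m + D True)" by simp
    have "(exp 8 * exp 8 :: real) = exp 16" by (simp flip: exp_add)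
    then have 2: "M * (2 * M / \<nu>) / \<nu> = smallC / \<nu>\<^sup>2 * (m + D True)\<^sup>2"
      using \<nu> by (simp add: M_def smallC_def power2_eq_square field_simps)
    have "(D False + m * (2 * M / \<nu>)) * exp (M * (2 * M / \<nu>) / \<nu>) \<le> (D False + smallC * m / \<nu> * (m + D True)) * exp (smallC / \<nu>\<^sup>2 * (m + D True)\<^sup>2)"
      unfolding 2 by (intro mult_right_mono 1) simp
    then show ?thesis using small by simp
  qed
  have fin: "lint {0..} (\<lambda>s. X1 (maj \<nu> m d n b s)) < \<infinity>" for b
    using Suc by (cases b) (auto intro: le_less_trans)
  note jms = jm_maj[OF assms(1), where \<nu>=\<nu> and m=m and n=n]
  note A = majorant_bound[where p="maj \<nu> m d n True" and q="maj \<nu> m d n False" and ?p0.0="d True" and \<nu>=\<nu> and m=m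
      and D="D True" and M=M and E=4 and B="2 * \<nu>" and R=M, OF jms jms assms(1) \<nu> m _ d _ fin]
  note B = majorant_bound[where p="maj \<nu> m d n False" and q="maj \<nu> m d n True" and ?p0.0="d False" and \<nu>=\<nu> and m=m
      and D="D False" and M="2 * \<nu>" and E="2 * M / \<nu>" and B=M and R="2 * \<nu>", OF jms jms assms(1) \<nu> m _ d _ fin]
  have 1: "Xm (maj \<nu> m d (Suc n) True s) \<le> ennreal M" if "s \<ge> 0" for s
    using A(1)[OF _ _ _ _ _ _ _ that] le[where b=True] Suc \<nu> P by simp
  have 2: "lint {0..} (\<lambda>s. X1 (maj \<nu> m d (Suc n) True s)) \<le> ennreal (2 * M / \<nu>)"
    using A(2) le[where b=True] Suc \<nu> P by simp
  have 3: "Xm (maj \<nu> m d (Suc n) False s) \<le> ennreal (2 * \<nu>)" if "s \<ge> 0" for s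
    using B(1)[OF _ _ _ _ _ _ _ that] le[where b=False] Suc \<nu> M Q by simp
  have 4: "lint {0..} (\<lambda>s. X1 (maj \<nu> m d (Suc n) False s)) \<le> ennreal 4"
    using B(2) le[where b=False] Suc \<nu> M Q by simp
  show ?case using 1 2 3 4 by blast
qed

section \<open>The supremum of the majorants\<close>

definition majl :: "real \<Rightarrow> real \<Rightarrow> (bool \<Rightarrow> real^3 \<Rightarrow> ennreal) \<Rightarrow> bool \<Rightarrow> real \<Rightarrow> real^3 \<Rightarrow> ennreal" where
  "majl \<nu> m d b t z = (SUP n. maj \<nu> m d n b t z)"

lemma jm_majl:
  assumes [measurable]: "\<And>b. bm (d b)"
  shows "jm (majl \<nu> m d b)"
proof -
  have [measurable]: "jm (maj \<nu> m d n b)" for n by (rule jm_maj) measurable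
  show ?thesis unfolding majl_def by measurable
qed

lemma maj_le_majl: "maj \<nu> m d n b t z \<le> majl \<nu> m d b t z"
  unfolding majl_def by (rule SUP_upper) simp

lemma maj_tendsto_majl: "(\<lambda>n. maj \<nu> m d n b t z) \<longlonglongrightarrow> majl \<nu> m d b t z"
  unfolding majl_def by (rule LIMSEQ_SUP) (rule maj_incseq)

lemma SUP_mult_incseq_ennreal:
  fixes f g :: "nat \<Rightarrow> ennreal"
  assumes "incseq f" "incseq g"
  shows "(SUP n. f n) * (SUP n. g n) = (SUP n. f n * g n)"
proof (rule antisym)
  have "(SUP n. f n) * (SUP n. g n) = (SUP k. SUP n. f n * g k)"
    by (simp add: SUP_mult_left_ennreal SUP_mult_right_ennreal)
  also have "\<dots> \<le> (SUP n. f n * g n)"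
  proof (intro SUP_least)
    fix k n
    have "f n * g k \<le> f (max n k) * g (max n k)"
      using assms by (intro mult_mono) (auto simp: incseq_def)
    then show "f n * g k \<le> (SUP n. f n * g n)" by (rule SUP_upper2[OF UNIV_I])
  qed
  finally show "(SUP n. f n) * (SUP n. g n) \<le> (SUP n. f n * g n)" .
  show "(SUP n. f n * g n) \<le> (SUP n. f n) * (SUP n. g n)"
    by (intro SUP_least mult_mono SUP_upper) auto
qed

text \<open>Sums, products and integrals of increasing sequences in [0,\<infinity>] commute with
  suprema, so \<open>Phi\<close> is continuous along the iteration. The identity holds at every
  point, including those where the supremum is infinite.\<close>

lemma majl_fixpoint:
  assumes [measurable]: "\<And>b. bm (d b)"
  shows "Phi \<nu> m (d b) (majl \<nu> m d b) (majl \<nu> m d (\<not> b)) t z = majl \<nu> m d b t z"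
proof -
  let ?P = "\<lambda>n b. maj \<nu> m d n b"
  have [measurable]: "jm (?P n b)" for n b by (rule jm_maj) measurable
  have sec[measurable]: "?P n b s \<in> borel_measurable borel" for n b s by (rule jm_section) measurable
  have cv: "cv (majl \<nu> m d (\<not> b) s) (majl \<nu> m d b s) z = (SUP n. cv (?P n (\<not> b) s) (?P n b s) z)" for s
    unfolding cv_def majl_def
    by (subst SUP_mult_incseq_ennreal[OF maj_incseq maj_incseq], rule nn_integral_monotone_convergence_SUP)
      (auto simp: incseq_def le_fun_def intro!: mult_mono incseqD[OF maj_incseq])
  have cvi: "incseq (\<lambda>n. cv (?P n (\<not> b) s) (?P n b s) z)" for s
    unfolding cv_def by (auto simp: incseq_def intro!: nn_integral_mono mult_mono incseqD[OF maj_incseq])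
  have src: "src m (majl \<nu> m d b s) (majl \<nu> m d (\<not> b) s) z = (SUP n. src m (?P n b s) (?P n (\<not> b) s) z)" for s
    unfolding src_def cv unfolding majl_def
    by (simp add: SUP_mult_left_ennreal, rule ennreal_SUP_add[symmetric])
      (auto simp: incseq_def intro!: mult_left_mono incseqD[OF maj_incseq] incseqD[OF cvi])
  have srci: "incseq (\<lambda>n. src m (?P n b s) (?P n (\<not> b) s) z)" for s
    unfolding incseq_def by (auto intro!: src_mono incseqD[OF maj_incseq])
  have duh: "duhamel (\<nu> * (norm z)\<^sup>2) (\<lambda>s. src m (majl \<nu> m d b s) (majl \<nu> m d (\<not> b) s) z) t =
     (SUP n. duhamel (\<nu> * (norm z)\<^sup>2) (\<lambda>s. src m (?P n b s) (?P n (\<not> b) s) z) t)"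
    unfolding duhamel_def src
    by (simp only: SUP_mult_left_ennreal SUP_mult_right_ennreal, rule nn_integral_monotone_convergence_SUP)
      (auto simp: incseq_def le_fun_def intro!: mult_right_mono mult_left_mono incseqD[OF srci])
  have "Phi \<nu> m (d b) (majl \<nu> m d b) (majl \<nu> m d (\<not> b)) t z = (SUP n. ?P (Suc n) b t z)"
    unfolding Phi_def duh by (simp add: ennreal_SUP_add_right Phi_def)
  also have "\<dots> = majl \<nu> m d b t z"
    unfolding majl_def
    by (rule LIMSEQ_unique[OF LIMSEQ_SUP LIMSEQ_Suc[OF LIMSEQ_SUP]]) (auto simp: incseq_def simp del: maj.simps intro!: incseqD[OF maj_incseq])
  finally show ?thesis .
qed

lemma majl_bounds:
  assumes [measurable]: "\<And>b. bm (d b)" and \<nu>: "\<nu> > 0" and m: "m \<ge> 0"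
    and d: "\<And>b. Xm (d b) = ennreal (D b)" "\<And>b. D b \<ge> 0"
    and small: "(D False + smallC * m / \<nu> * (m + D True)) * exp (smallC / \<nu>\<^sup>2 * (m + D True)\<^sup>2) < 2 * \<nu>"
  obtains B where "\<And>b s. s \<ge> 0 \<Longrightarrow> Xm (majl \<nu> m d b s) \<le> ennreal B"
    and "\<And>b. (lint {0..} (\<lambda>s. X1 (majl \<nu> m d b s))) < \<infinity>"
proof
  have [measurable]: "jm (maj \<nu> m d n b)" for n b by (rule jm_maj) measurable
  have sec[measurable]: "bm (maj \<nu> m d n b s)" for n b s by (rule jm_section) measurable
  define M where "M = 4 * exp 8 * (m + D True)"
  note bd = maj_bounds[OF assms, folded M_def]
  show "Xm (majl \<nu> m d b s) \<le> ennreal (max (2 * \<nu>) M)" if "s \<ge> 0" for b s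
  proof -
    have "Xm (majl \<nu> m d b s) = (SUP n. Xm (maj \<nu> m d n b s))"
      unfolding Xm_def majl_def SUP_mult_left_ennreal
      by (rule nn_integral_monotone_convergence_SUP) (auto simp: incseq_def le_fun_def intro!: mult_left_mono incseqD[OF maj_incseq])
    also have "\<dots> \<le> ennreal (max (2 * \<nu>) M)"
    proof (rule SUP_least)
      fix n
      have "Xm (maj \<nu> m d n b s) \<le> ennreal (if b then M else 2 * \<nu>)" using bd[of n] that by (cases b) auto
      also have "\<dots> \<le> ennreal (max (2 * \<nu>) M)" by (intro ennreal_leI) auto
      finally show "Xm (maj \<nu> m d n b s) \<le> ennreal (max (2 * \<nu>) M)" .
    qed
    finally show ?thesis .
  qed
  show "lint {0..} (\<lambda>s. X1 (majl \<nu> m d b s)) < \<infinity>" for b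
  proof -
    have X1: "X1 (majl \<nu> m d b s) = (SUP n. X1 (maj \<nu> m d n b s))" for s
      unfolding X1_def majl_def SUP_mult_left_ennreal
      by (rule nn_integral_monotone_convergence_SUP) (auto simp: incseq_def le_fun_def intro!: mult_left_mono incseqD[OF maj_incseq])
    have "lint {0..} (\<lambda>s. X1 (majl \<nu> m d b s)) = (SUP n. \<integral>\<^sup>+s\<in>{0..}. X1 (maj \<nu> m d n b s) \<partial>lborel)"
      unfolding X1 SUP_mult_right_ennreal
      by (rule nn_integral_monotone_convergence_SUP)
        (auto simp: incseq_def le_fun_def intro!: mult_right_mono X_mono incseqD[OF maj_incseq])
    also have "\<dots> \<le> ennreal (if b then 2 * M / \<nu> else 4)"
      using bd by (intro SUP_least) (cases b, auto)
    also have "\<dots> < \<infinity>" by simp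
    finally show ?thesis .
  qed
qed

subsection \<open>The nonlinear term on the Fourier side\<close>

text \<open>The projection onto the orthogonal complement of z. At z = 0 the division by zero makes
  it the identity.\<close>

definition leray :: "real^3 \<Rightarrow> complex^3 \<Rightarrow> complex^3" where
  "leray z v = v - (\<chi> i. dotc z v / cor ((norm z)\<^sup>2) * cor (z $ i))"

definition vbilin :: "vfield \<Rightarrow> vfield \<Rightarrow> vfield" where
  "vbilin a b \<zeta> = (\<chi> i. bilin a (\<lambda>\<eta>. b \<eta> $ i) \<zeta>)"


lemma norm_vec3_le: "norm (v :: complex^3) \<le> (\<Sum>i\<in>UNIV. norm (v $ i))"
  unfolding norm_vec_def by (rule L2_set_le_sum) simp

lemma dotc_add: "dotc z (v + w) = dotc z v + dotc z w"
  by (simp add: dotc_def distrib_left sum.distrib)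

lemma dotc_diff: "dotc z (v - w) = dotc z v - dotc z w"
  by (simp add: dotc_def right_diff_distrib sum_subtractf)

lemma dotc_zero [simp]: "dotc z 0 = 0" "dotc 0 v = 0"
  by (simp_all add: dotc_def)

lemma dotc_scaleR: "dotc z (r *\<^sub>R v) = r *\<^sub>R dotc z v"
  by (simp add: dotc_def scaleR_sum_right)

lemma norm_dotc_le: "norm (dotc z v) \<le> 3 * norm z * norm v"
proof -
  have "norm (dotc z v) \<le> (\<Sum>j\<in>(UNIV::3 set). norm z * norm v)"
    unfolding dotc_def
  proof (rule sum_norm_le)
    fix j :: 3
    show "norm (cor (z $ j) * v $ j) \<le> norm z * norm v"
      unfolding norm_mult norm_of_real by (intro mult_mono component_le_norm_cart Finite_Cartesian_Product.norm_nth_le) auto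
  qed
  then show ?thesis by simp
qed

lemma bounded_linear_dotc: "bounded_linear (dotc z)"
  by (rule bounded_linear_intro[of _ "3 * norm z"]) (auto simp: dotc_add dotc_scaleR norm_dotc_le mult.commute norm_dotc_le[simplified mult.commute])

lemma dotc_leray: "dotc z (leray z v) = 0"
proof (cases "z = 0")
  case False
  have s: "(\<Sum>j\<in>UNIV. cor (z $ j) * cor (z $ j)) = cor ((norm z)\<^sup>2)"
    unfolding power2_norm_eq_inner inner_vec_def by simp
  have "dotc z (\<chi> i. dotc z v / cor ((norm z)\<^sup>2) * cor (z $ i)) =
    dotc z v / cor ((norm z)\<^sup>2) * (\<Sum>j\<in>UNIV. cor (z $ j) * cor (z $ j))"
    unfolding dotc_def[of z "\<chi> i. _ i"] sum_distrib_left by (simp add: mult_ac)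
  also have "\<dots> = dotc z v" unfolding s using False by simp
  finally show ?thesis by (simp add: leray_def dotc_diff)
qed simp

lemma leray_diff: "leray z (v - w) = leray z v - leray z w"
  by (simp add: leray_def vec_eq_iff dotc_diff diff_divide_distrib left_diff_distrib)

lemma leray_zero [simp]: "leray z 0 = 0"
  by (simp add: leray_def vec_eq_iff)

text \<open>Orthogonality would give 1. The value 10 = 1 + 3 * 3 comes from bounding the three
  components of the subtracted vector separately, and the normalisation of the transform pays for
  it.\<close>

lemma norm_leray_le: "norm (leray z v) \<le> 10 * norm v"
proof -
  have "norm (\<chi> i. dotc z v / cor ((norm z)\<^sup>2) * cor (z $ i)) \<le> (\<Sum>i\<in>(UNIV::3 set). 3 * norm v)"
  proof (rule order_trans[OF norm_vec3_le], rule sum_mono)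
    fix i :: 3
    show "norm ((\<chi> i. dotc z v / cor ((norm z)\<^sup>2) * cor (z $ i)) $ i) \<le> 3 * norm v"
    proof (cases "z = 0")
      case False
      have "norm (dotc z v) * \<bar>z $ i\<bar> \<le> (3 * norm z * norm v) * norm z"
        by (intro mult_mono norm_dotc_le component_le_norm_cart) auto
      then show ?thesis using False by (simp add: norm_mult norm_divide norm_power divide_simps power2_eq_square mult_ac)
    qed simp
  qed
  then have "norm (\<chi> i. dotc z v / cor ((norm z)\<^sup>2) * cor (z $ i)) \<le> 9 * norm v" by simp
  then show ?thesis unfolding leray_def using norm_triangle_ineq4[of v "\<chi> i. dotc z v / cor ((norm z)\<^sup>2) * cor (z $ i)"]
    by linarith
qed

lemma two_pi_cubed: "(2 * pi) ^ 3 > 216"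
proof -
  have "(6::real) ^ 3 < (2 * pi) ^ 3" using pi_gt3 by (intro power_strict_mono) auto
  then show ?thesis by simp
qed

lemma leray_measurable [measurable (raw)]:
  assumes [measurable]: "f \<in> borel_measurable M" "v \<in> borel_measurable M"
  shows "(\<lambda>x. leray (f x) (v x)) \<in> borel_measurable M"
  unfolding leray_def by measurable

lemma vbilin_measurable [measurable (raw)]:
  assumes [measurable]: "jm a" "jm b" "f \<in> borel_measurable M" "g \<in> borel_measurable M"
  shows "(\<lambda>x. vbilin (a (f x)) (b (f x)) (g x)) \<in> borel_measurable M"
  unfolding vbilin_def bilin_def by measurable

text \<open>The constant is 3 / 216, the 3 coming from \<open>norm_dotc_le\<close> and 216 = 6^3
  from \<pi> > 3.\<close>

lemma bilin_kernel_bound: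
  "norm (\<i> * dotc \<zeta> v * c / cor ((2 * pi) ^ 3)) \<le> norm \<zeta> / 72 * (norm v * norm c)"
proof -
  have "norm (\<i> * dotc \<zeta> v * c / cor ((2 * pi) ^ 3)) = norm (dotc \<zeta> v) * norm c / (2 * pi) ^ 3"
    unfolding norm_divide norm_mult norm_of_real by simp
  also have "\<dots> \<le> (3 * norm \<zeta> * norm v) * norm c / 216"
    using two_pi_cubed by (intro frac_le mult_right_mono norm_dotc_le) auto
  also have "\<dots> = norm \<zeta> / 72 * (norm v * norm c)" by simp
  finally show ?thesis .
qed

lemma bilin_integrable:
  assumes [measurable]: "bm a" "bm b"
    and fin: "(\<integral>\<^sub>L\<eta>. en (a (\<zeta> - \<eta>)) * en (b \<eta>)) < \<infinity>"
  shows "integrable lborel (\<lambda>\<eta>. \<i> * dotc \<zeta> (a (\<zeta> - \<eta>)) * b \<eta> / cor ((2 * pi) ^ 3))"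
proof (rule integrableI_bounded)
  have "(\<integral>\<^sub>L\<eta>. en (\<i> * dotc \<zeta> (a (\<zeta> - \<eta>)) * b \<eta> / cor ((2 * pi) ^ 3)))
    \<le> (\<integral>\<^sub>L\<eta>. ennreal (norm \<zeta> / 72) * (en (a (\<zeta> - \<eta>)) * en (b \<eta>)))"
    by (intro nn_integral_mono) (simp only: ennreal_mult[symmetric] norm_ge_zero mult_nonneg_nonneg divide_nonneg_nonneg, intro ennreal_leI bilin_kernel_bound)
  also have "\<dots> = ennreal (norm \<zeta> / 72) * (\<integral>\<^sub>L\<eta>. en (a (\<zeta> - \<eta>)) * en (b \<eta>))"
    by (rule nn_integral_cmult) measurable
  also have "\<dots> < \<infinity>" using fin by (auto simp: ennreal_mult_less_top)
  finally show "(\<integral>\<^sub>L\<eta>. en (\<i> * dotc \<zeta> (a (\<zeta> - \<eta>)) * b \<eta> / cor ((2 * pi) ^ 3))) < \<infinity>" .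
qed measurable

text \<open>The bilinear term is bounded by \<open>\<bar>\<zeta>\<bar> cv\<close>; the Leray projector, the three components and
  the crude bound on \<open>dotc\<close> together cost less than \<open>(2\<pi>)\<^sup>3\<close>.\<close>

lemma vbilin_diff_bound:
  assumes [measurable]: "bm a" "bm b" "bm a'" "bm b'"
    and f1: "cv (nrm a) (nrm b) \<zeta> < \<infinity>" and f2: "cv (nrm a') (nrm b') \<zeta> < \<infinity>"
  shows "en (vbilin a b \<zeta> - vbilin a' b' \<zeta>) \<le> ennreal (norm \<zeta> / 24) *
     (\<integral>\<^sub>L\<eta>. en (a (\<zeta> - \<eta>)) * en (b \<eta> - b' \<eta>) + en (a (\<zeta> - \<eta>) - a' (\<zeta> - \<eta>)) * en (b' \<eta>))" (is "_ \<le> _ * ?G")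
proof -
  have comp: "en ((vbilin a b \<zeta> - vbilin a' b' \<zeta>) $ i) \<le> ennreal (norm \<zeta> / 72) * ?G" for i
  proof -
    let ?k = "\<lambda>a b \<eta>. \<i> * dotc \<zeta> (a (\<zeta> - \<eta>)) * b \<eta> $ i / cor ((2 * pi) ^ 3)"
    have fin: "(\<integral>\<^sub>L\<eta>. en (a (\<zeta> - \<eta>)) * en (b \<eta> $ i)) < \<infinity>"
      if "cv (nrm a) (nrm b) \<zeta> < \<infinity>" for a b :: "vfield"
      by (rule le_less_trans[OF _ that], unfold cv_def) (intro nn_integral_mono mult_left_mono ennreal_leI Finite_Cartesian_Product.norm_nth_le, simp)
    have i1: "integrable lborel (?k a b)" by (rule bilin_integrable) (measurable, rule fin[OF f1])
    have i2: "integrable lborel (?k a' b')" by (rule bilin_integrable) (measurable, rule fin[OF f2])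
    have "(vbilin a b \<zeta> - vbilin a' b' \<zeta>) $ i = (LBINT \<eta>. ?k a b \<eta> - ?k a' b' \<eta>)"
      using i1 i2 by (simp add: vbilin_def bilin_def)
    also have "en \<dots> \<le> (\<integral>\<^sub>L\<eta>. en (?k a b \<eta> - ?k a' b' \<eta>))"
      by (rule integral_norm_bound_ennreal) (use i1 i2 in auto)
    also have "\<dots> \<le> (\<integral>\<^sub>L\<eta>. ennreal (norm \<zeta> / 72) * (en (a (\<zeta> - \<eta>)) * en (b \<eta> - b' \<eta>) + en (a (\<zeta> - \<eta>) - a' (\<zeta> - \<eta>)) * en (b' \<eta>)))"
    proof (rule nn_integral_mono)
      fix \<eta>
      have e3: "ennreal (k * (x * y + z * w)) = ennreal k * (ennreal x * ennreal y + ennreal z * ennreal w)"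
        if "k \<ge> 0" "x \<ge> 0" "y \<ge> 0" "z \<ge> 0" "w \<ge> 0" for k x y z w :: real
        using that by (simp add: ennreal_mult ennreal_plus)
      let ?c = "cor ((2 * pi) ^ 3)"
      have "?k a b \<eta> - ?k a' b' \<eta> = \<i> * dotc \<zeta> (a (\<zeta> - \<eta>)) * (b \<eta> - b' \<eta>) $ i / ?c + \<i> * dotc \<zeta> (a (\<zeta> - \<eta>) - a' (\<zeta> - \<eta>)) * b' \<eta> $ i / ?c"
        by (simp add: dotc_diff diff_divide_distrib algebra_simps)
      also have "norm \<dots> \<le> norm \<zeta> / 72 * (norm (a (\<zeta> - \<eta>)) * norm ((b \<eta> - b' \<eta>) $ i)) + norm \<zeta> / 72 * (norm (a (\<zeta> - \<eta>) - a' (\<zeta> - \<eta>)) * norm (b' \<eta> $ i))"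
        by (intro norm_triangle_le add_mono bilin_kernel_bound)
      also have "\<dots> \<le> norm \<zeta> / 72 * (norm (a (\<zeta> - \<eta>)) * norm (b \<eta> - b' \<eta>)) + norm \<zeta> / 72 * (norm (a (\<zeta> - \<eta>) - a' (\<zeta> - \<eta>)) * norm (b' \<eta>))"
        by (intro add_mono mult_left_mono Finite_Cartesian_Product.norm_nth_le) auto
      finally have "en (?k a b \<eta> - ?k a' b' \<eta>) \<le> ennreal (norm \<zeta> / 72 * (norm (a (\<zeta> - \<eta>)) * norm (b \<eta> - b' \<eta>) + norm (a (\<zeta> - \<eta>) - a' (\<zeta> - \<eta>)) * norm (b' \<eta>)))"
        unfolding distrib_left by (rule ennreal_leI)
      also have "\<dots> = ennreal (norm \<zeta> / 72) * (en (a (\<zeta> - \<eta>)) * en (b \<eta> - b' \<eta>) + en (a (\<zeta> - \<eta>) - a' (\<zeta> - \<eta>)) * en (b' \<eta>))"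
        by (rule e3) auto
      finally show "en (?k a b \<eta> - ?k a' b' \<eta>) \<le> ennreal (norm \<zeta> / 72) * (en (a (\<zeta> - \<eta>)) * en (b \<eta> - b' \<eta>) + en (a (\<zeta> - \<eta>) - a' (\<zeta> - \<eta>)) * en (b' \<eta>))"
        .
    qed
    also have "\<dots> = ennreal (norm \<zeta> / 72) * ?G" by (rule nn_integral_cmult) measurable
    finally show ?thesis .
  qed
  have "en (vbilin a b \<zeta> - vbilin a' b' \<zeta>) \<le> ennreal (\<Sum>i\<in>UNIV. norm ((vbilin a b \<zeta> - vbilin a' b' \<zeta>) $ i))"
    by (intro ennreal_leI norm_vec3_le)
  also have "\<dots> = (\<Sum>i\<in>UNIV. en ((vbilin a b \<zeta> - vbilin a' b' \<zeta>) $ i))" by (simp add: sum_ennreal)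
  also have "\<dots> \<le> (\<Sum>i\<in>(UNIV::3 set). ennreal (norm \<zeta> / 72) * ?G)" by (intro sum_mono comp)
  also have "\<dots> = ennreal 3 * ennreal (norm \<zeta> / 72) * ?G" by (simp add: mult.assoc)
  also have "ennreal 3 * ennreal (norm \<zeta> / 72) = ennreal (norm \<zeta> / 24)" by (subst ennreal_mult[symmetric]) auto
  finally show ?thesis .
qed

lemma vbilin_zero [simp]: "vbilin (\<lambda>_. 0) b \<zeta> = 0" "vbilin a b 0 = 0"
  by (simp_all add: vbilin_def bilin_def vec_eq_iff)

text \<open>The finite case compares with zero fields. An infinite convolution makes the right side
  infinite except at \<zeta> = 0, where the left side vanishes.\<close>

lemma vbilin_bound:
  assumes [measurable]: "bm a" "bm b"
  shows "en (vbilin a b \<zeta>) \<le> ennreal (norm \<zeta> / 24) * cv (nrm a) (nrm b) \<zeta>"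
proof (cases "\<zeta> \<noteq> 0 \<and> cv (nrm a) (nrm b) \<zeta> = \<infinity>")
  case True
  then show ?thesis by (simp add: ennreal_mult_top)
next
  case False
  show ?thesis
  proof (cases "\<zeta> = 0")
    case F: False
    then have "cv (nrm a) (nrm b) \<zeta> < \<infinity>" using False by (auto simp: less_top)
    then show ?thesis using vbilin_diff_bound[of a b "\<lambda>_. 0" "\<lambda>_. 0" \<zeta>] by (simp add: cv_def) 
  qed simp
qed

text \<open>The right side of the equation of the Elsasser field a, apart from its own heat term: m
  times the Laplacian of b, and the projected transport of a by b. Here m carries its sign; the
  majorants use its absolute value.\<close>

definition vsrc :: "real \<Rightarrow> vfield \<Rightarrow> vfield \<Rightarrow> vfield" where
  "vsrc m a b z = - ((m * (norm z)\<^sup>2) *\<^sub>R b z) - leray z (vbilin b a z)"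

lemma vsrc_measurable [measurable (raw)]:
  assumes [measurable]: "jm a" "jm b" "f \<in> borel_measurable M" "g \<in> borel_measurable M"
  shows "(\<lambda>x. vsrc m (a (f x)) (b (f x)) (g x)) \<in> borel_measurable M"
  unfolding vsrc_def by measurable

lemma en_triangle: "en (x + y) \<le> en x + en y" "en (x - y) \<le> en x + en y"
  by (simp_all add: norm_triangle_ineq norm_triangle_ineq4 ennreal_leI flip: ennreal_plus)

text \<open>The comparison that drives the whole convergence proof. Splitting the bilinear
  difference into b (a - a') + (b - b') a' and bounding factor by factor gives q (p - p') + (q - q')
  p' = q p - q' p'. The majorants may be infinite, so differences are expressed by adding the
  smaller majorant on the left.\<close>

lemma vsrc_diff:
  assumes [measurable]: "bm a" "bm b" "bm a'" "bm b'"
    and [measurable]: "bm p" "bm q" "bm p'" "bm q'"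
    and da: "\<And>\<eta>. en (a \<eta> - a' \<eta>) + p' \<eta> \<le> p \<eta>" and db: "\<And>\<eta>. en (b \<eta> - b' \<eta>) + q' \<eta> \<le> q \<eta>"
    and a': "\<And>\<eta>. en (a' \<eta>) \<le> p' \<eta>" and b': "\<And>\<eta>. en (b' \<eta>) \<le> q' \<eta>"
    and fin: "src \<bar>m\<bar> p q z < \<infinity>"
  shows "en (vsrc m a b z - vsrc m a' b' z) + src \<bar>m\<bar> p' q' z \<le> src \<bar>m\<bar> p q z"
proof (cases "z = 0")
  case True
  then show ?thesis by (simp add: vsrc_def src_def)
next
  case False
  have a: "en (a \<eta>) \<le> p \<eta>" for \<eta>
    using order_trans[OF en_triangle(1)[of "a \<eta> - a' \<eta>" "a' \<eta>"] order_trans[OF add_left_mono[OF a'] da]] by simp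
  have b: "en (b \<eta>) \<le> q \<eta>" for \<eta>
    using order_trans[OF en_triangle(1)[of "b \<eta> - b' \<eta>" "b' \<eta>"] order_trans[OF add_left_mono[OF b'] db]] by simp
  have "ennreal (norm z) * cv q p z < \<infinity>"
    using fin unfolding src_def by (auto simp: less_top)
  then have cvf: "cv q p z < \<infinity>" using False by (auto simp: ennreal_mult_less_top)
  have p': "p' \<eta> \<le> p \<eta>" for \<eta> by (rule order_trans[OF _ da]) simp
  have q': "q' \<eta> \<le> q \<eta>" for \<eta> by (rule order_trans[OF _ db]) simp
  have cm: "cv f g z \<le> cv f' g' z" if "\<And>\<eta>. f \<eta> \<le> f' \<eta>" "\<And>\<eta>. g \<eta> \<le> g' \<eta>" for f g f' g'
    unfolding cv_def by (intro nn_integral_mono mult_mono that) auto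
  let ?G = "\<integral>\<^sup>+\<eta>. en (b (z - \<eta>)) * en (a \<eta> - a' \<eta>) + en (b (z - \<eta>) - b' (z - \<eta>)) * en (a' \<eta>) \<partial>lborel"
  have "?G + cv q' p' z = (\<integral>\<^sub>L\<eta>. (en (b (z - \<eta>)) * en (a \<eta> - a' \<eta>) + en (b (z - \<eta>) - b' (z - \<eta>)) * en (a' \<eta>)) + q' (z - \<eta>) * p' \<eta>)"
    unfolding cv_def by (rule nn_integral_add[symmetric]) measurable
  also have "\<dots> \<le> cv q p z"
    unfolding cv_def
  proof (rule nn_integral_mono)
    fix \<eta>
    let ?x = "z - \<eta>"
    have "(en (b ?x) * en (a \<eta> - a' \<eta>) + en (b ?x - b' ?x) * en (a' \<eta>)) + q' ?x * p' \<eta>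
      \<le> (q ?x * en (a \<eta> - a' \<eta>) + en (b ?x - b' ?x) * p' \<eta>) + q' ?x * p' \<eta>"
      by (intro add_mono mult_mono b a' order_refl) auto
    also have "\<dots> = q ?x * en (a \<eta> - a' \<eta>) + (en (b ?x - b' ?x) + q' ?x) * p' \<eta>"
      by (simp add: distrib_right add.assoc)
    also have "\<dots> \<le> q ?x * en (a \<eta> - a' \<eta>) + q ?x * p' \<eta>"
      by (intro add_left_mono mult_right_mono db) auto
    also have "\<dots> = q ?x * (en (a \<eta> - a' \<eta>) + p' \<eta>)" by (simp add: distrib_left)
    also have "\<dots> \<le> q ?x * p \<eta>" by (intro mult_left_mono da) auto
    finally show "(en (b ?x) * en (a \<eta> - a' \<eta>) + en (b ?x - b' ?x) * en (a' \<eta>)) + q' ?x * p' \<eta> \<le> q ?x * p \<eta>" .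
  qed
  finally have G: "?G + cv q' p' z \<le> cv q p z" .
  have "en (leray z (vbilin b a z - vbilin b' a' z)) \<le> ennreal 10 * en (vbilin b a z - vbilin b' a' z)"
    by (subst ennreal_mult[symmetric]) (auto intro!: ennreal_leI norm_leray_le)
  also have "\<dots> \<le> ennreal 10 * (ennreal (norm z / 24) * ?G)"
  proof (intro mult_left_mono vbilin_diff_bound)
    show "cv (nrm b) (nrm a) z < \<infinity>" by (rule le_less_trans[OF cm cvf]) (auto intro: a b)
    show "cv (nrm b') (nrm a') z < \<infinity>"
      by (rule le_less_trans[OF cm cvf]) (auto intro: order_trans[OF a' p'] order_trans[OF b' q'])
  qed measurable
  also have "\<dots> = ennreal (10 * (norm z / 24)) * ?G" by (simp only: mult.assoc[symmetric], subst ennreal_mult[symmetric]) auto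
  \<comment> \<open>Since 10 / 24 < 1, all crude constants disappear and \<open>src\<close> can
    carry the plain factor |z|.\<close>
  also have "\<dots> \<le> ennreal (norm z) * ?G" by (intro mult_right_mono ennreal_leI) auto
  finally have L: "en (leray z (vbilin b a z - vbilin b' a' z)) \<le> ennreal (norm z) * ?G" .
  have "vsrc m a b z - vsrc m a' b' z = - ((m * (norm z)\<^sup>2) *\<^sub>R (b z - b' z)) - leray z (vbilin b a z - vbilin b' a' z)"
    by (simp add: vsrc_def leray_diff algebra_simps)
  also have "en \<dots> \<le> en (- ((m * (norm z)\<^sup>2) *\<^sub>R (b z - b' z))) + en (leray z (vbilin b a z - vbilin b' a' z))"
    by (rule en_triangle)
  also have "en (- ((m * (norm z)\<^sup>2) *\<^sub>R (b z - b' z))) = ennreal (\<bar>m\<bar> * (norm z)\<^sup>2) * en (b z - b' z)"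
    by (simp add: abs_mult ennreal_mult)
  finally have "en (vsrc m a b z - vsrc m a' b' z) + src \<bar>m\<bar> p' q' z \<le>
     (ennreal (\<bar>m\<bar> * (norm z)\<^sup>2) * en (b z - b' z) + ennreal (norm z) * ?G) + src \<bar>m\<bar> p' q' z"
    using L by (intro add_right_mono) (meson add_left_mono order_trans)
  also have "\<dots> = ennreal (\<bar>m\<bar> * (norm z)\<^sup>2) * (en (b z - b' z) + q' z) + ennreal (norm z) * (?G + cv q' p' z)"
    unfolding src_def distrib_left by (simp only: ac_simps)
  also have "\<dots> \<le> src \<bar>m\<bar> p q z"
    unfolding src_def by (intro add_mono mult_left_mono db G) auto
  finally show ?thesis .
qed

lemma vsrc_zero [simp]: "vsrc m (\<lambda>_. 0) (\<lambda>_. 0) z = 0"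
  by (simp add: vsrc_def)

lemma vsrc_bound:
  assumes [measurable]: "bm a" "bm b"
    and [measurable]: "bm p" "bm q"
    and a: "\<And>\<eta>. en (a \<eta>) \<le> p \<eta>" and b: "\<And>\<eta>. en (b \<eta>) \<le> q \<eta>"
  shows "en (vsrc m a b z) \<le> src \<bar>m\<bar> p q z"
proof (cases "src \<bar>m\<bar> p q z < \<infinity>")
  case True
  have "en (vsrc m a b z - vsrc m (\<lambda>_. 0) (\<lambda>_. 0) z) + src \<bar>m\<bar> (\<lambda>_. 0) (\<lambda>_. 0) z \<le> src \<bar>m\<bar> p q z"
    by (rule vsrc_diff) (use a b True in auto)
  then show ?thesis by (simp add: src_def cv_def)
qed (auto simp: less_top[symmetric])

subsection \<open>The Picard iteration\<close>

definition vduhamel :: "real \<Rightarrow> (real \<Rightarrow> 'a::{banach, second_countable_topology}) \<Rightarrow> real \<Rightarrow> 'a" where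
  "vduhamel l F t = (LBINT s. indicator {0..t} s *\<^sub>R (exp (- l * (t - s)) *\<^sub>R F s))"

definition vPhi :: "real \<Rightarrow> real \<Rightarrow> vfield \<Rightarrow> (real \<Rightarrow> vfield) \<Rightarrow> (real \<Rightarrow> vfield) \<Rightarrow>
    real \<Rightarrow> vfield" where
  "vPhi \<nu> m w a b t z = exp (- (\<nu> * (norm z)\<^sup>2) * t) *\<^sub>R w z + vduhamel (\<nu> * (norm z)\<^sup>2) (\<lambda>s. vsrc m (a s) (b s) z) t"

lemma jm_vPhi:
  assumes [measurable]: "jm a" "jm b" "bm w"
  shows "jm (vPhi \<nu> m w a b)"
  unfolding vPhi_def vduhamel_def by measurable

lemma vduhamel_integrable:
  fixes F :: "real \<Rightarrow> 'a::{banach, second_countable_topology}"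
  assumes [measurable]: "bm F" and le: "\<And>s. en (F s) \<le> G s" and fin: "duhamel l G t < \<infinity>"
  shows "integrable lborel (\<lambda>s. indicator {0..t} s *\<^sub>R (exp (- l * (t - s)) *\<^sub>R F s))"
proof (rule integrableI_bounded)
  have "(\<integral>\<^sub>Ls. en (indicator {0..t} s *\<^sub>R (exp (- l * (t - s)) *\<^sub>R F s))) \<le> duhamel l G t"
    unfolding duhamel_def
  proof (rule nn_integral_mono)
    fix s
    have "ennreal (exp (- l * (t - s)) * norm (F s)) \<le> ennreal (exp (- l * (t - s))) * G s"
      using mult_left_mono[OF le[of s], of "ennreal (exp (- l * (t - s)))"] by (simp add: ennreal_mult)
    then show "en (indicator {0..t} s *\<^sub>R (exp (- l * (t - s)) *\<^sub>R F s)) \<le> ennreal (exp (- l * (t - s))) * G s * indicator {0..t} s"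
      by (auto simp: indicator_def)
  qed
  then show "(\<integral>\<^sub>Ls. en (indicator {0..t} s *\<^sub>R (exp (- l * (t - s)) *\<^sub>R F s))) < \<infinity>" using fin by (rule le_less_trans)
qed measurable

lemma vPhi_diff:
  assumes [measurable]: "jm a" "jm b" "jm a'" "jm b'" "jm p" "jm q" "jm p'" "jm q'"
    and da: "\<And>s \<eta>. en (a s \<eta> - a' s \<eta>) + p' s \<eta> \<le> p s \<eta>" and db: "\<And>s \<eta>. en (b s \<eta> - b' s \<eta>) + q' s \<eta> \<le> q s \<eta>"
    and a': "\<And>s \<eta>. en (a' s \<eta>) \<le> p' s \<eta>" and b': "\<And>s \<eta>. en (b' s \<eta>) \<le> q' s \<eta>"
  shows "en (vPhi \<nu> m w a b t z - vPhi \<nu> m w a' b' t z) + Phi \<nu> \<bar>m\<bar> p0 p' q' t z \<le> Phi \<nu> \<bar>m\<bar> p0 p q t z"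
proof (cases "Phi \<nu> \<bar>m\<bar> p0 p q t z < \<infinity>")
  case True
  let ?l = "\<nu> * (norm z)\<^sup>2"
  let ?S = "\<lambda>s. src \<bar>m\<bar> (p s) (q s) z" and ?S' = "\<lambda>s. src \<bar>m\<bar> (p' s) (q' s) z"
  let ?F = "\<lambda>s. vsrc m (a s) (b s) z" and ?F' = "\<lambda>s. vsrc m (a' s) (b' s) z"
  have sec[measurable]: "bm (a s)" "bm (b s)" "bm (a' s)" "bm (b' s)"
    "bm (p s)" "bm (q s)" "bm (p' s)" "bm (q' s)" for s
    by (rule jm_section, measurable)+
  have a: "en (a s \<eta>) \<le> p s \<eta>" for s \<eta>
    using order_trans[OF en_triangle(1)[of "a s \<eta> - a' s \<eta>" "a' s \<eta>"] order_trans[OF add_left_mono[OF a'] da]] by simp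
  have b: "en (b s \<eta>) \<le> q s \<eta>" for s \<eta>
    using order_trans[OF en_triangle(1)[of "b s \<eta> - b' s \<eta>" "b' s \<eta>"] order_trans[OF add_left_mono[OF b'] db]] by simp
  have p': "p' s \<eta> \<le> p s \<eta>" for s \<eta> by (rule order_trans[OF _ da]) simp
  have q': "q' s \<eta> \<le> q s \<eta>" for s \<eta> by (rule order_trans[OF _ db]) simp
  have dfin: "duhamel ?l ?S t < \<infinity>" using True by (auto simp: Phi_def less_top)
  have S: "en (?F s) \<le> ?S s" for s by (rule vsrc_bound) (use a b in auto)
  have S': "en (?F' s) \<le> ?S s" for s
    by (rule vsrc_bound) (use order_trans[OF a' p'] order_trans[OF b' q'] in auto)
  have i: "integrable lborel (\<lambda>s. indicator {0..t} s *\<^sub>R (exp (- ?l * (t - s)) *\<^sub>R ?F s))"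
    by (rule vduhamel_integrable[OF _ S dfin]) measurable
  have i': "integrable lborel (\<lambda>s. indicator {0..t} s *\<^sub>R (exp (- ?l * (t - s)) *\<^sub>R ?F' s))"
    by (rule vduhamel_integrable[OF _ S' dfin]) measurable
  have eq: "vPhi \<nu> m w a b t z - vPhi \<nu> m w a' b' t z = (LBINT s. indicator {0..t} s *\<^sub>R (exp (- ?l * (t - s)) *\<^sub>R ?F s) - indicator {0..t} s *\<^sub>R (exp (- ?l * (t - s)) *\<^sub>R ?F' s))"
    unfolding vPhi_def vduhamel_def using i i' by (subst LINT_diff) auto
  have "en (vPhi \<nu> m w a b t z - vPhi \<nu> m w a' b' t z) \<le> (\<integral>\<^sub>Ls. en (indicator {0..t} s *\<^sub>R (exp (- ?l * (t - s)) *\<^sub>R ?F s) - indicator {0..t} s *\<^sub>R (exp (- ?l * (t - s)) *\<^sub>R ?F' s)))"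
    unfolding eq by (rule integral_norm_bound_ennreal[OF integrable_sub[OF i i']])
  also have "\<dots> = (\<integral>\<^sub>Ls. ennreal (exp (- ?l * (t - s))) * en (?F s - ?F' s) * indicator {0..t} s)"
  proof (rule nn_integral_cong)
    fix s :: real
    have sc: "en (indicat_real A s *\<^sub>R (r *\<^sub>R x) - indicat_real A s *\<^sub>R (r *\<^sub>R y)) = ennreal r * en (x - y) * indicator A s"
      if "r \<ge> 0" for r :: real and A :: "real set" and x y :: "complex^3"
    proof (cases "s \<in> A")
      case True
      have "r *\<^sub>R x - r *\<^sub>R y = r *\<^sub>R (x - y)" by (rule scaleR_diff_right[symmetric])
      then show ?thesis using True that by (simp add: ennreal_mult)
    qed simp
    show "en (indicator {0..t} s *\<^sub>R (exp (- ?l * (t - s)) *\<^sub>R ?F s) - indicator {0..t} s *\<^sub>R (exp (- ?l * (t - s)) *\<^sub>R ?F' s)) =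
      ennreal (exp (- ?l * (t - s))) * en (?F s - ?F' s) * indicator {0..t} s"
      by (rule sc) simp
  qed
  finally have d: "en (vPhi \<nu> m w a b t z - vPhi \<nu> m w a' b' t z) \<le> (\<integral>\<^sub>Ls. ennreal (exp (- ?l * (t - s))) * en (?F s - ?F' s) * indicator {0..t} s)" .
  \<comment> \<open>A finite Duhamel integral makes the source finite at almost every time, which is
    what \<open>vsrc_diff\<close> asks for.\<close>
  have ae: "AE s in lborel. ennreal (exp (- ?l * (t - s))) * ?S s * indicator {0..t} s \<noteq> \<infinity>"
    by (rule nn_integral_PInf_AE) (use dfin in \<open>auto simp: duhamel_def\<close>)
  have "en (vPhi \<nu> m w a b t z - vPhi \<nu> m w a' b' t z) + duhamel ?l ?S' t \<le>
     (\<integral>\<^sub>Ls. ennreal (exp (- ?l * (t - s))) * en (?F s - ?F' s) * indicator {0..t} s + ennreal (exp (- ?l * (t - s))) * ?S' s * indicator {0..t} s)"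
    by (subst nn_integral_add) (use d in \<open>auto simp: duhamel_def intro: add_right_mono\<close>)
  also have "\<dots> \<le> duhamel ?l ?S t"
    unfolding duhamel_def
    using ae
  proof (intro nn_integral_mono_AE, eventually_elim)
    case (elim s)
    show ?case
    proof (cases "s \<in> {0..t}")
      case True
      then have "?S s < \<infinity>" using elim by (auto simp: less_top ennreal_mult_eq_top_iff)
      then have "en (?F s - ?F' s) + ?S' s \<le> ?S s"
        by (intro vsrc_diff) (use da db a' b' in auto)
      from mult_left_mono[OF this, of "ennreal (exp (- ?l * (t - s)))"] show ?thesis
        using True by (simp add: distrib_left)
    qed simp
  qed
  finally show ?thesis unfolding Phi_def by (simp add: add.left_commute add_left_mono)
qed (auto simp: less_top[symmetric])

primrec vit :: "real \<Rightarrow> real \<Rightarrow> (bool \<Rightarrow> vfield) \<Rightarrow> nat \<Rightarrow> bool \<Rightarrow> real \<Rightarrow> vfield" where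
  "vit \<nu> m w 0 = (\<lambda>b t z. 0)"
| "vit \<nu> m w (Suc n) = (\<lambda>b. vPhi \<nu> m (w b) (vit \<nu> m w n b) (vit \<nu> m w n (\<not> b)))"

lemma jm_vit:
  assumes "\<And>b. bm (w b)"
  shows "jm (vit \<nu> m w n b)"
  by (induction n arbitrary: b) (auto intro!: jm_vPhi assms)

text \<open>The two bounds are proved together: comparing successive increments needs the size of
  the earlier iterate, and the size of the later one follows by adding its increment.\<close>

lemma vit_maj:
  fixes w :: "bool \<Rightarrow> vfield"
  defines "d \<equiv> \<lambda>b z. en (w b z)"
  assumes w[measurable]: "\<And>b. bm (w b)"
  shows "en (vit \<nu> m w (Suc n) b t z - vit \<nu> m w n b t z) + maj \<nu> \<bar>m\<bar> d n b t z \<le> maj \<nu> \<bar>m\<bar> d (Suc n) b t z"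
    and "en (vit \<nu> m w n b t z) \<le> maj \<nu> \<bar>m\<bar> d n b t z"
proof -
  have d[measurable]: "bm (d b)" for b unfolding d_def by measurable
  have "(\<forall>b t z. en (vit \<nu> m w (Suc n) b t z - vit \<nu> m w n b t z) + maj \<nu> \<bar>m\<bar> d n b t z \<le> maj \<nu> \<bar>m\<bar> d (Suc n) b t z) \<and>
    (\<forall>b t z. en (vit \<nu> m w n b t z) \<le> maj \<nu> \<bar>m\<bar> d n b t z)"
  proof (induction n)
    case 0
    show ?case by (simp add: vPhi_def vduhamel_def Phi_def d_def ennreal_mult)
  next
    case (Suc n)
    have "en (vit \<nu> m w (Suc n) b t z) \<le> maj \<nu> \<bar>m\<bar> d (Suc n) b t z" for b t z
    proof -
      have "en (vit \<nu> m w (Suc n) b t z) \<le> en (vit \<nu> m w (Suc n) b t z - vit \<nu> m w n b t z) + en (vit \<nu> m w n b t z)"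
        using en_triangle(1)[of "vit \<nu> m w (Suc n) b t z - vit \<nu> m w n b t z" "vit \<nu> m w n b t z"] by (simp del: vit.simps)
      also have "\<dots> \<le> en (vit \<nu> m w (Suc n) b t z - vit \<nu> m w n b t z) + maj \<nu> \<bar>m\<bar> d n b t z"
        using Suc by (intro add_left_mono) blast
      also have "\<dots> \<le> maj \<nu> \<bar>m\<bar> d (Suc n) b t z" using Suc by blast
      finally show ?thesis .
    qed
    moreover have "en (vit \<nu> m w (Suc (Suc n)) b t z - vit \<nu> m w (Suc n) b t z) + maj \<nu> \<bar>m\<bar> d (Suc n) b t z \<le> maj \<nu> \<bar>m\<bar> d (Suc (Suc n)) b t z" for b t z
    proof -
      note j = jm_vit[OF w] and j' = jm_maj[OF d]
      have "en (vPhi \<nu> m (w b) (vit \<nu> m w (Suc n) b) (vit \<nu> m w (Suc n) (\<not> b)) t z - vPhi \<nu> m (w b) (vit \<nu> m w n b) (vit \<nu> m w n (\<not> b)) t z)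
         + Phi \<nu> \<bar>m\<bar> (d b) (maj \<nu> \<bar>m\<bar> d n b) (maj \<nu> \<bar>m\<bar> d n (\<not> b)) t z
         \<le> Phi \<nu> \<bar>m\<bar> (d b) (maj \<nu> \<bar>m\<bar> d (Suc n) b) (maj \<nu> \<bar>m\<bar> d (Suc n) (\<not> b)) t z"
        by (rule vPhi_diff[OF j j j j j' j' j' j']) (use Suc in blast)+
      then show ?thesis by (simp only: vit.simps(2) maj.simps(2))
    qed
    ultimately show ?case by blast
  qed
  then show "en (vit \<nu> m w (Suc n) b t z - vit \<nu> m w n b t z) + maj \<nu> \<bar>m\<bar> d n b t z \<le> maj \<nu> \<bar>m\<bar> d (Suc n) b t z"
    and "en (vit \<nu> m w n b t z) \<le> maj \<nu> \<bar>m\<bar> d n b t z" by blast+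
qed

subsection \<open>The limit of the Picard iteration\<close>

text \<open>The value 0 at points without convergence keeps the limit jointly measurable and lets
  the symmetries of the iterates hold at every point rather than almost everywhere.\<close>

definition vlim :: "real \<Rightarrow> real \<Rightarrow> (bool \<Rightarrow> vfield) \<Rightarrow> bool \<Rightarrow> real \<Rightarrow> vfield" where
  "vlim \<nu> m w b t z = (if Cauchy (\<lambda>n. vit \<nu> m w n b t z) then lim (\<lambda>n. vit \<nu> m w n b t z) else 0)"

lemma jm_vlim:
  assumes w: "\<And>b. bm (w b)"
  shows "jm (vlim \<nu> m w b)"
proof -
  have [measurable]: "jm (vit \<nu> m w n b)" for n by (rule jm_vit[where w=w, OF w])
  show ?thesis unfolding vlim_def by measurable
qed

lemma ennreal_squeeze_limit:
  fixes f :: "nat \<Rightarrow> 'a::real_normed_vector"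
  assumes le: "\<And>n. en (x - f n) + c n \<le> C" and C: "C < \<infinity>" and lim: "c \<longlonglongrightarrow> C"
  shows "f \<longlonglongrightarrow> x"
proof -
  obtain C' where C': "C = ennreal C'" "C' \<ge> 0" using C by (cases C) auto
  have cf: "c n < \<infinity>" for n
    using order_trans[OF _ le[of n], of "c n"] C by (auto intro: le_less_trans)
  define r where "r n = enn2real (c n)" for n
  have r: "c n = ennreal (r n)" "r n \<ge> 0" for n using cf[of n] by (auto simp: r_def less_top)
  have "norm (x - f n) \<le> C' - r n" for n
    using le[of n] C' r by (simp add: ennreal_le_iff flip: ennreal_plus)
  then have "norm (f n - x) \<le> norm (C' - r n)" for n
    by (metis abs_ge_self norm_minus_commute order_trans real_norm_def)
  moreover have "r \<longlonglongrightarrow> C'" unfolding r_def by (rule tendsto_enn2real) (use lim C' in auto)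
  then have "(\<lambda>n. norm (C' - r n)) \<longlonglongrightarrow> 0"
    using tendsto_norm_zero[OF tendsto_diff[OF tendsto_const[of C'], of r C' sequentially, simplified]] by simp
  ultimately have "(\<lambda>n. f n - x) \<longlonglongrightarrow> 0"
    by (intro Lim_null_comparison[of "\<lambda>n. f n - x" "\<lambda>n. norm (C' - r n)"] always_eventually) auto
  then show ?thesis by (simp add: LIM_zero_iff)
qed

lemma vit_Cauchy_bound:
  assumes w: "\<And>b. bm (w b)"
  shows "en (vit \<nu> m w (n + k) b t z - vit \<nu> m w n b t z) + maj \<nu> \<bar>m\<bar> (\<lambda>b z. en (w b z)) n b t z \<le> maj \<nu> \<bar>m\<bar> (\<lambda>b z. en (w b z)) (n + k) b t z"
proof (induction k)
  case (Suc k)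
  let ?v = "\<lambda>n. vit \<nu> m w n b t z" and ?p = "\<lambda>n. maj \<nu> \<bar>m\<bar> (\<lambda>b z. en (w b z)) n b t z"
  have "en (?v (n + Suc k) - ?v n) + ?p n \<le> en (?v (Suc (n + k)) - ?v (n + k)) + en (?v (n + k) - ?v n) + ?p n"
    using en_triangle(1)[of "?v (Suc (n + k)) - ?v (n + k)" "?v (n + k) - ?v n"]
    by (intro add_right_mono) (simp del: vit.simps)
  also have "\<dots> \<le> en (?v (Suc (n + k)) - ?v (n + k)) + ?p (n + k)"
    using Suc by (simp add: add.assoc add_left_mono del: vit.simps)
  also have "\<dots> \<le> ?p (Suc (n + k))" by (rule vit_maj(1)[where w=w, OF w])
  finally show ?case by (simp del: vit.simps maj.simps)
qed simp

text \<open>Where the limit majorant is finite, the majorants form a Cauchy sequence of reals, and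
  two iterates are never farther apart than their majorants.\<close>

lemma vit_tendsto_vlim:
  fixes w :: "bool \<Rightarrow> vfield"
  assumes w: "\<And>b. bm (w b)" and fin: "majl \<nu> \<bar>m\<bar> (\<lambda>b z. en (w b z)) b t z < \<infinity>"
  shows "(\<lambda>n. vit \<nu> m w n b t z) \<longlonglongrightarrow> vlim \<nu> m w b t z"
proof -
  let ?p = "\<lambda>n. maj \<nu> \<bar>m\<bar> (\<lambda>b z. en (w b z)) n b t z" and ?v = "\<lambda>n. vit \<nu> m w n b t z"
  define r where "r n = enn2real (?p n)" for n
  have pf: "?p n < \<infinity>" for n using le_less_trans[OF maj_le_majl fin] .
  have r: "?p n = ennreal (r n)" "r n \<ge> 0" for n using pf[of n] by (auto simp: r_def less_top)
  obtain C where C: "majl \<nu> \<bar>m\<bar> (\<lambda>b z. en (w b z)) b t z = ennreal C" "C \<ge> 0"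
    using fin by (cases "majl \<nu> \<bar>m\<bar> (\<lambda>b z. en (w b z)) b t z") auto
  have "r \<longlonglongrightarrow> C"
    unfolding r_def by (rule tendsto_enn2real) (use C maj_tendsto_majl[of \<nu> "\<bar>m\<bar>" "\<lambda>b z. en (w b z)" b t z] in auto)
  then have C: "Cauchy r" by (rule LIMSEQ_imp_Cauchy)
  have d: "norm (?v (n + k) - ?v n) \<le> r (n + k) - r n" for n k
    using vit_Cauchy_bound[where w=w, OF w, where n=n and k=k and \<nu>=\<nu> and m=m and b=b and t=t and z=z] unfolding r by (simp add: ennreal_le_iff r flip: ennreal_plus)
  have "dist (?v i) (?v j) \<le> dist (r i) (r j)" for i j
  proof (cases "i \<le> j")
    case True
    then show ?thesis using d[of i "j - i"] by (simp add: dist_norm norm_minus_commute)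
  next
    case False
    then show ?thesis using d[of j "i - j"] by (simp add: dist_norm)
  qed
  then have "Cauchy ?v" using C unfolding Cauchy_def by (meson le_less_trans)
  then show ?thesis unfolding vlim_def by (simp add: Cauchy_convergent_iff convergent_LIMSEQ_iff)
qed

lemma vlim_diff:
  assumes w: "\<And>b. bm (w b)"
  shows "en (vlim \<nu> m w b t z - vit \<nu> m w n b t z) + maj \<nu> \<bar>m\<bar> (\<lambda>b z. en (w b z)) n b t z \<le> majl \<nu> \<bar>m\<bar> (\<lambda>b z. en (w b z)) b t z"
proof (cases "majl \<nu> \<bar>m\<bar> (\<lambda>b z. en (w b z)) b t z < \<infinity>")
  case True
  let ?p = "\<lambda>n. maj \<nu> \<bar>m\<bar> (\<lambda>b z. en (w b z)) n b t z" and ?v = "\<lambda>n. vit \<nu> m w n b t z"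
  have "(\<lambda>k. ?v (k + n)) \<longlonglongrightarrow> vlim \<nu> m w b t z"
    by (rule LIMSEQ_ignore_initial_segment[OF vit_tendsto_vlim[where w=w, OF w True]])
  then have "(\<lambda>k. norm (?v (k + n) - ?v n)) \<longlonglongrightarrow> norm (vlim \<nu> m w b t z - ?v n)" by (intro tendsto_intros)
  then have "(\<lambda>k. en (?v (k + n) - ?v n) + ?p n) \<longlonglongrightarrow> en (vlim \<nu> m w b t z - ?v n) + ?p n"
    by (intro tendsto_add tendsto_const tendsto_ennrealI)
  then show ?thesis
  proof (rule LIMSEQ_le_const2)
    have "en (?v (k + n) - ?v n) + ?p n \<le> majl \<nu> \<bar>m\<bar> (\<lambda>b z. en (w b z)) b t z" for k
      using order_trans[OF vit_Cauchy_bound[where w=w, OF w, where n=n and k=k and \<nu>=\<nu> and m=m and b=b and t=t and z=z] maj_le_majl] by (simp add: add.commute[of k])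
    then show "\<exists>N. \<forall>k\<ge>N. en (?v (k + n) - ?v n) + ?p n \<le> majl \<nu> \<bar>m\<bar> (\<lambda>b z. en (w b z)) b t z" by blast
  qed
qed (auto simp: less_top[symmetric])

lemma vlim_majl:
  assumes w: "\<And>b. bm (w b)"
  shows "en (vlim \<nu> m w b t z) \<le> majl \<nu> \<bar>m\<bar> (\<lambda>b z. en (w b z)) b t z"
  using vlim_diff[where w=w, OF w, where n=0 and \<nu>=\<nu> and m=m and b=b and t=t and z=z] by simp

text \<open>By \<open>vPhi_diff\<close> the map applied to the limit and the map applied to the n-th
  iterate differ by at most the gap between the limit majorant and the majorant of index n + 1. This
  gap tends to 0, so no further limit has to be taken under the vector integrals.\<close>

lemma vlim_fixpoint:
  fixes w :: "bool \<Rightarrow> vfield"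
  assumes w: "\<And>b. bm (w b)" and fin: "majl \<nu> \<bar>m\<bar> (\<lambda>b z. en (w b z)) b t z < \<infinity>"
  shows "vPhi \<nu> m (w b) (vlim \<nu> m w b) (vlim \<nu> m w (\<not> b)) t z = vlim \<nu> m w b t z"
proof -
  define d where "d = (\<lambda>b z. en (w b z))"
  have d: "bm (d b)" for b
    unfolding d_def using w by measurable
  note j = jm_vit[where w=w, OF w] jm_vlim[where w=w, OF w] jm_maj[where d=d, OF d] jm_majl[where d=d, OF d]
  have "(\<lambda>n. vit \<nu> m w (Suc n) b t z) \<longlonglongrightarrow> vPhi \<nu> m (w b) (vlim \<nu> m w b) (vlim \<nu> m w (\<not> b)) t z"
  proof (rule ennreal_squeeze_limit)
    show "majl \<nu> \<bar>m\<bar> d b t z < \<infinity>" using fin by (simp add: d_def)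
    show "(\<lambda>n. maj \<nu> \<bar>m\<bar> d (Suc n) b t z) \<longlonglongrightarrow> majl \<nu> \<bar>m\<bar> d b t z"
      by (rule LIMSEQ_Suc[OF maj_tendsto_majl])
    fix n
    have "en (vPhi \<nu> m (w b) (vlim \<nu> m w b) (vlim \<nu> m w (\<not> b)) t z - vPhi \<nu> m (w b) (vit \<nu> m w n b) (vit \<nu> m w n (\<not> b)) t z)
      + Phi \<nu> \<bar>m\<bar> (d b) (maj \<nu> \<bar>m\<bar> d n b) (maj \<nu> \<bar>m\<bar> d n (\<not> b)) t z
      \<le> Phi \<nu> \<bar>m\<bar> (d b) (majl \<nu> \<bar>m\<bar> d b) (majl \<nu> \<bar>m\<bar> d (\<not> b)) t z"
      by (rule vPhi_diff[OF j(2) j(2) j(1) j(1) j(4) j(4) j(3) j(3)])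
        (unfold d_def, (rule vlim_diff[where w=w, OF w] vit_maj(2)[where w=w, OF w])+)
    then show "en (vPhi \<nu> m (w b) (vlim \<nu> m w b) (vlim \<nu> m w (\<not> b)) t z - vit \<nu> m w (Suc n) b t z) + maj \<nu> \<bar>m\<bar> d (Suc n) b t z \<le> majl \<nu> \<bar>m\<bar> d b t z"
      unfolding majl_fixpoint[where d=d, OF d] by (simp only: vit.simps(2) maj.simps(2))
  qed
  moreover have "(\<lambda>n. vit \<nu> m w (Suc n) b t z) \<longlonglongrightarrow> vlim \<nu> m w b t z"
    by (rule LIMSEQ_Suc[OF vit_tendsto_vlim[where w=w, OF w fin]])
  ultimately show ?thesis by (rule LIMSEQ_unique)
qed

subsection \<open>Symmetries preserved by the iteration\<close>

definition vcnj :: "complex^3 \<Rightarrow> complex^3" where "vcnj v = (\<chi> i. cnj (v $ i))"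

lemma vcnj_simps [simp]:
  "vcnj v $ i = cnj (v $ i)" "vcnj 0 = 0" "vcnj (v + w) = vcnj v + vcnj w" "vcnj (v - w) = vcnj v - vcnj w"
  "vcnj (- v) = - vcnj v" "vcnj (r *\<^sub>R v) = r *\<^sub>R vcnj v"
  by (simp_all add: vcnj_def vec_eq_iff)

lemma norm_vcnj [simp]: "norm (vcnj v) = norm v"
  by (simp add: vcnj_def norm_vec_def)

lemma bounded_linear_vcnj: "bounded_linear vcnj"
  by (rule bounded_linear_intro[of _ 1]) auto

lemma dotc_vcnj: "dotc z (vcnj v) = cnj (dotc z v)"
  by (simp add: dotc_def)

lemma dotc_uminus: "dotc z (- v) = - dotc z v"
  by (simp add: dotc_def sum_negf)

lemma dotc_minus: "dotc (- z) v = - dotc z v"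
  by (simp add: dotc_def sum_negf)

lemma leray_vcnj: "vcnj (leray (- z) v) = leray z (vcnj v)"
  by (simp add: leray_def vec_eq_iff dotc_vcnj dotc_minus)

lemma vbilin_vcnj:
  assumes [measurable]: "bm a" "bm b"
    and a: "\<And>\<eta>. vcnj (a (- \<eta>)) = a \<eta>" and b: "\<And>\<eta>. vcnj (b (- \<eta>)) = b \<eta>"
  shows "vcnj (vbilin a b (- \<zeta>)) = vbilin a b \<zeta>"
proof -
  have b': "cnj (b (- \<eta>) $ i) = b \<eta> $ i" for \<eta> i using b[of \<eta>] by (metis vcnj_simps(1))
  have "cnj (bilin a (\<lambda>\<eta>. b \<eta> $ i) (- \<zeta>)) = bilin a (\<lambda>\<eta>. b \<eta> $ i) \<zeta>" for i
  proof -
    let ?c = "cor ((2 * pi) ^ 3)"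
    have "cnj (bilin a (\<lambda>\<eta>. b \<eta> $ i) (- \<zeta>)) = (LBINT \<eta>. cnj (\<i> * dotc (- \<zeta>) (a (- \<zeta> - \<eta>)) * b \<eta> $ i / ?c))"
      unfolding bilin_def by (rule Bochner_Integration.integral_cnj[symmetric])
    also have "\<dots> = (LBINT \<eta>. cnj (\<i> * dotc (- \<zeta>) (a (- \<zeta> - (0 - \<eta>))) * b (0 - \<eta>) $ i / ?c))"
      by (rule lborel_integral_reflect[symmetric]) measurable
    also have "\<dots> = bilin a (\<lambda>\<eta>. b \<eta> $ i) \<zeta>"
      unfolding bilin_def
    proof (rule LINT_cong[OF refl])
      fix \<eta>
      have "cnj (dotc \<zeta> (a (- (\<zeta> - \<eta>)))) = dotc \<zeta> (a (\<zeta> - \<eta>))"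
        unfolding dotc_vcnj[symmetric] a ..
      then show "cnj (\<i> * dotc (- \<zeta>) (a (- \<zeta> - (0 - \<eta>))) * b (0 - \<eta>) $ i / ?c) = \<i> * dotc \<zeta> (a (\<zeta> - \<eta>)) * b \<eta> $ i / ?c"
        by (simp add: dotc_minus b')
    qed
    finally show ?thesis .
  qed
  then show ?thesis by (simp add: vbilin_def vec_eq_iff)
qed

lemma vsrc_vcnj:
  assumes "bm a" "bm b"
    and a: "\<And>\<eta>. vcnj (a (- \<eta>)) = a \<eta>" and b: "\<And>\<eta>. vcnj (b (- \<eta>)) = b \<eta>"
  shows "vcnj (vsrc m a b (- z)) = vsrc m a b z"
  unfolding vsrc_def using vbilin_vcnj[OF assms(2,1) b a] by (simp add: leray_vcnj b)

lemma vPhi_vcnj: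
  assumes [measurable]: "jm a" "jm b" and a: "\<And>s \<eta>. vcnj (a s (- \<eta>)) = a s \<eta>" and b: "\<And>s \<eta>. vcnj (b s (- \<eta>)) = b s \<eta>"
    and w: "\<And>\<eta>. vcnj (w (- \<eta>)) = w \<eta>"
  shows "vcnj (vPhi \<nu> m w a b t (- z)) = vPhi \<nu> m w a b t z"
proof -
  have s: "vcnj (vsrc m (a s) (b s) (- z)) = vsrc m (a s) (b s) z" for s
    by (rule vsrc_vcnj) (auto intro: jm_section a b)
  let ?g = "\<lambda>z s. indicator {0..t} s *\<^sub>R (exp (- (\<nu> * (norm z)\<^sup>2) * (t - s)) *\<^sub>R vsrc m (a s) (b s) z)"
  have g: "vcnj (?g (- z) s) = ?g z s" for s by (simp add: s)
  have "vcnj (integral\<^sup>L lborel (?g (- z))) = (LBINT s. vcnj (?g (- z) s))"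
    by (rule integral_bounded_linear'[OF bounded_linear_vcnj bounded_linear_vcnj, symmetric]) (simp add: vec_eq_iff)
  then show ?thesis unfolding vPhi_def vduhamel_def using g by (simp add: w s)
qed

lemma vPhi_div_free:
  assumes w: "dotc z (w z) = 0" and b: "\<And>s. dotc z (b s z) = 0"
  shows "dotc z (vPhi \<nu> m w a b t z) = 0"
proof -
  have s: "dotc z (vsrc m (a s) (b s) z) = 0" for s
    by (simp add: vsrc_def dotc_diff dotc_scaleR dotc_uminus dotc_leray b)
  have "dotc z (vduhamel l (\<lambda>s. vsrc m (a s) (b s) z) t) = 0" for l
  proof (cases "integrable lborel (\<lambda>s. indicator {0..t} s *\<^sub>R (exp (- l * (t - s)) *\<^sub>R vsrc m (a s) (b s) z))")
    case True
    show ?thesis unfolding vduhamel_def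
      by (subst integral_bounded_linear[OF bounded_linear_dotc True, symmetric]) (simp add: dotc_scaleR s)
  next
    \<comment> \<open>Without integrability the integral has the default value 0, which is
      orthogonal to z as well.\<close>
    case False
    then show ?thesis unfolding vduhamel_def by (simp add: not_integrable_integral_eq)
  qed
  then show ?thesis by (simp add: vPhi_def dotc_add dotc_scaleR w)
qed

lemma vit_vcnj:
  assumes "\<And>b. bm (w b)" "\<And>b \<eta>. vcnj (w b (- \<eta>)) = w b \<eta>"
  shows "vcnj (vit \<nu> m w n b t (- z)) = vit \<nu> m w n b t z"
  by (induction n arbitrary: b t z) (auto intro!: vPhi_vcnj jm_vit assms)

lemma vit_div_free:
  assumes "\<And>b. dotc z (w b z) = 0"
  shows "dotc z (vit \<nu> m w n b t z) = 0"
  by (induction n arbitrary: b t) (auto intro!: vPhi_div_free assms)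

lemma vlim_vcnj:
  assumes w: "\<And>b. bm (w b)" "\<And>b \<eta>. vcnj (w b (- \<eta>)) = w b \<eta>"
  shows "vcnj (vlim \<nu> m w b t (- z)) = vlim \<nu> m w b t z"
proof -
  let ?v = "\<lambda>z n. vit \<nu> m w n b t z"
  have v: "?v z n = vcnj (?v (- z) n)" for n using vit_vcnj[where w=w, OF w] by simp
  have d: "dist (vcnj x) (vcnj y) = dist x y" for x y
    unfolding dist_norm vcnj_simps(4)[symmetric] norm_vcnj ..
  \<comment> \<open>Convergence at z and at - z is equivalent, so the default value of
    \<open>vlim\<close> is used at both points or at neither.\<close>
  have C: "Cauchy (?v z) = Cauchy (?v (- z))" unfolding v Cauchy_def d ..
  show ?thesis
  proof (cases "Cauchy (?v (- z))")
    case True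
    then have L: "?v (- z) \<longlonglongrightarrow> lim (?v (- z))" by (simp add: Cauchy_convergent_iff convergent_LIMSEQ_iff)
    have "(\<lambda>n. vcnj (?v (- z) n)) \<longlonglongrightarrow> vcnj (lim (?v (- z)))"
      by (rule bounded_linear.tendsto[OF bounded_linear_vcnj L])
    then have "?v z \<longlonglongrightarrow> vcnj (lim (?v (- z)))" by (simp flip: v)
    then have "lim (?v z) = vcnj (lim (?v (- z)))" by (rule limI)
    then show ?thesis using True C by (simp add: vlim_def)
  next
    case False
    then show ?thesis using C by (simp add: vlim_def)
  qed
qed

lemma vlim_div_free:
  assumes w: "\<And>b. dotc z (w b z) = 0"
  shows "dotc z (vlim \<nu> m w b t z) = 0"
proof (cases "Cauchy (\<lambda>n. vit \<nu> m w n b t z)")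
  case True
  then have L: "(\<lambda>n. vit \<nu> m w n b t z) \<longlonglongrightarrow> vlim \<nu> m w b t z"
    by (simp add: vlim_def Cauchy_convergent_iff convergent_LIMSEQ_iff)
  from bounded_linear.tendsto[OF bounded_linear_dotc L, of z]
  show ?thesis by (simp add: vit_div_free[where w=w, OF w] LIMSEQ_const_iff)
qed (simp add: vlim_def)

subsection \<open>From the mild to the differential formulation\<close>

text \<open>The mild formula solves f' = F - l f in integrated form. This is Fubini on the triangle
  0 \<le> s \<le> r \<le> t; the absolute convergence that it needs is \<open>duhamel_energy\<close>
  for the norm of F.\<close>

lemma vduhamel_identity:
  fixes F :: "real \<Rightarrow> 'a::{banach, second_countable_topology}" and a :: 'a
  assumes [measurable]: "bm F" and fin: "lint {0..t} (nrm F) < \<infinity>"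
    and l: "l \<ge> 0" and t: "t \<ge> 0"
  defines "f \<equiv> \<lambda>r. exp (- l * r) *\<^sub>R a + vduhamel l F r"
  shows "integrable lborel (\<lambda>s. indicator {0..t} s *\<^sub>R (F s - l *\<^sub>R f s))"
    and "f t = a + (LBINT s. indicator {0..t} s *\<^sub>R (F s - l *\<^sub>R f s))"
proof -
  let ?I = "\<lambda>s. indicat_real {0..t} s"
  let ?k = "\<lambda>r s. (?I r * indicat_real {0..r} s * (l * exp (- l * (r - s)))) *\<^sub>R F s"
  have dm[measurable]: "bm (vduhamel l F)" unfolding vduhamel_def by measurable
  have Fi: "integrable lborel (\<lambda>s. ?I s *\<^sub>R F s)"
  proof (rule integrableI_bounded)
    have "(\<integral>\<^sub>Ls. en (?I s *\<^sub>R F s)) = lint {0..t} (nrm F)"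
      by (intro nn_integral_cong) (auto simp: indicator_def)
    then show "(\<integral>\<^sub>Ls. en (?I s *\<^sub>R F s)) < \<infinity>" using fin by simp
  qed measurable
  have expint: "(LBINT r. indicat_real {s..t} r * (l * exp (- l * (r - s)))) = 1 - exp (- l * (t - s))"
    "integrable lborel (\<lambda>r. indicat_real {s..t} r * (l * exp (- l * (r - s))))" if "s \<le> t" for s
  proof -
    have nn: "(\<integral>\<^sub>Lr. ennreal (indicat_real {s..t} r * (l * exp (- l * (r - s))))) = ennreal (1 - exp (- l * (t - s)))"
    proof -
      have "(\<integral>\<^sub>Lr. ennreal (indicat_real {s..t} r * (l * exp (- l * (r - s))))) = lint {s..t} (\<lambda>r. ennreal (l * exp (- l * (r - s))))"
        by (intro nn_integral_cong) (auto simp: indicator_def)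
      then show ?thesis using nn_integral_exp_decay[OF l that] by simp
    qed
    show "integrable lborel (\<lambda>r. indicat_real {s..t} r * (l * exp (- l * (r - s))))"
      by (rule integrableI_nonneg) (use nn l in auto)
    show "(LBINT r. indicat_real {s..t} r * (l * exp (- l * (r - s)))) = 1 - exp (- l * (t - s))"
      by (rule integral_eq_nn_integral[THEN trans]) (use nn l that in \<open>auto simp: mult_nonneg_nonneg\<close>)
  qed
  have nn: "(\<integral>\<^sub>Lr. \<integral>\<^sub>Ls. en (?k r s)) < \<infinity>"
  proof -
    have "(\<integral>\<^sub>Lr. \<integral>\<^sub>Ls. en (?k r s)) = ennreal l * (lint {0..t} (\<lambda>r. duhamel l (nrm F) r))"
      unfolding duhamel_def
      apply (subst nn_integral_cmult[symmetric], measurable)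
      apply (rule nn_integral_cong)
      apply (subst nn_integral_multc[symmetric], measurable)
      apply (subst nn_integral_cmult[symmetric], measurable)
      apply (rule nn_integral_cong)
      subgoal for r s
        using l by (cases "r \<in> {0..t}"; cases "s \<in> {0..r}") (simp_all add: ennreal_mult abs_mult mult.assoc)
      done
    also have "\<dots> \<le> duhamel l (nrm F) t + ennreal l * (lint {0..t} (\<lambda>r. duhamel l (nrm F) r))"
      by simp
    also have "\<dots> = lint {0..t} (nrm F)"
      by (rule duhamel_energy[OF _ l t]) measurable
    finally show ?thesis using fin by (rule le_less_trans)
  qed
  have ki: "integrable (lborel \<Otimes>\<^sub>M lborel) (\<lambda>(r, s). ?k r s)"
  proof (rule integrableI_bounded)
    have "(\<integral>\<^sup>+p. en (case p of (r, s) \<Rightarrow> ?k r s) \<partial>(lborel \<Otimes>\<^sub>M lborel)) = (\<integral>\<^sub>Lr. \<integral>\<^sub>Ls. en (?k r s))"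
      by (subst lborel.nn_integral_fst[symmetric]) auto
    then show "(\<integral>\<^sup>+p. en (case p of (r, s) \<Rightarrow> ?k r s) \<partial>(lborel \<Otimes>\<^sub>M lborel)) < \<infinity>" using nn by simp
  qed measurable
  have k1: "(LBINT s. ?k r s) = ?I r *\<^sub>R (l *\<^sub>R vduhamel l F r)" for r
    unfolding vduhamel_def integral_scaleR_right[symmetric] by (intro LINT_cong) auto
  have k2: "(LBINT r. ?k r s) = ?I s *\<^sub>R ((1 - exp (- l * (t - s))) *\<^sub>R F s)" for s
  proof (cases "s \<in> {0..t}")
    case True
    have "(LBINT r. ?k r s) = (LBINT r. (indicat_real {s..t} r * (l * exp (- l * (r - s)))) *\<^sub>R F s)"
      using True by (intro LINT_cong) (auto simp: indicator_def)
    also have "\<dots> = (LBINT r. (indicat_real {s..t} r * (l * exp (- l * (r - s))))) *\<^sub>R F s"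
      by (rule integral_scaleR_left) (use expint True in auto)
    finally show ?thesis using expint(1)[of s] True by simp
  next
    case False
    then have "?k r s = 0" for r by (auto simp: indicator_def)
    then have "(LBINT r. ?k r s) = (LINT r::real|lborel. 0)" by (intro LINT_cong refl)
    then show ?thesis using False by simp
  qed
  have dI: "integrable lborel (\<lambda>r. ?I r *\<^sub>R (l *\<^sub>R vduhamel l F r))"
    using lborel_pair.integrable_fst[OF ki] unfolding k1 .
  have dE: "(LBINT r. ?I r *\<^sub>R (l *\<^sub>R vduhamel l F r)) = (LBINT s. ?I s *\<^sub>R F s) - vduhamel l F t"
  proof -
    have "(LBINT r. ?I r *\<^sub>R (l *\<^sub>R vduhamel l F r)) = (LBINT s. ?I s *\<^sub>R ((1 - exp (- l * (t - s))) *\<^sub>R F s))"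
      using lborel_pair.Fubini_integral[OF ki] unfolding k1 k2 by simp
    also have "\<dots> = (LBINT s. ?I s *\<^sub>R F s - ?I s *\<^sub>R (exp (- l * (t - s)) *\<^sub>R F s))"
      by (simp add: scaleR_diff_left scaleR_diff_right)
    also have "\<dots> = (LBINT s. ?I s *\<^sub>R F s) - vduhamel l F t"
      unfolding vduhamel_def
    proof (rule LINT_diff[OF Fi])
      show "integrable lborel (\<lambda>s. ?I s *\<^sub>R (exp (- l * (t - s)) *\<^sub>R F s))"
        by (rule integrable_le[OF Fi]) (use l in \<open>auto simp: indicator_def intro!: mult_left_le_one_le\<close>)
    qed
    finally show ?thesis .
  qed
  have aI: "integrable lborel (\<lambda>r. ?I r *\<^sub>R (l *\<^sub>R (exp (- l * r) *\<^sub>R a)))"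
    and aE: "(LBINT r. ?I r *\<^sub>R (l *\<^sub>R (exp (- l * r) *\<^sub>R a))) = (1 - exp (- l * t)) *\<^sub>R a"
  proof -
    have eq: "?I r *\<^sub>R (l *\<^sub>R (exp (- l * r) *\<^sub>R a)) = (?I r * (l * exp (- l * (r - 0)))) *\<^sub>R a" for r by simp
    show "integrable lborel (\<lambda>r. ?I r *\<^sub>R (l *\<^sub>R (exp (- l * r) *\<^sub>R a)))"
      unfolding eq by (rule integrable_scaleR_left) (rule expint(2)[OF t])
    show "(LBINT r. ?I r *\<^sub>R (l *\<^sub>R (exp (- l * r) *\<^sub>R a))) = (1 - exp (- l * t)) *\<^sub>R a"
      unfolding eq using integral_scaleR_left[OF expint(2)[OF t], of a] expint(1)[OF t] by simp
  qed
  have eq: "?I s *\<^sub>R (F s - l *\<^sub>R f s) = ?I s *\<^sub>R F s - (?I s *\<^sub>R (l *\<^sub>R (exp (- l * s) *\<^sub>R a)) + ?I s *\<^sub>R (l *\<^sub>R vduhamel l F s))" for s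
    by (simp add: f_def scaleR_diff_right scaleR_add_right)
  show "integrable lborel (\<lambda>s. ?I s *\<^sub>R (F s - l *\<^sub>R f s))"
    unfolding eq by (intro integrable_sub integrable_plus Fi aI dI)
  show "f t = a + (LBINT s. ?I s *\<^sub>R (F s - l *\<^sub>R f s))"
  proof -
    have "(LBINT s. ?I s *\<^sub>R (F s - l *\<^sub>R f s)) = (LBINT s. ?I s *\<^sub>R F s) -
       ((1 - exp (- l * t)) *\<^sub>R a + ((LBINT s. ?I s *\<^sub>R F s) - vduhamel l F t))"
      unfolding eq LINT_diff[OF Fi integrable_plus[OF aI dI]] LINT_add[OF aI dI] aE dE ..
    then show ?thesis by (simp only:) (simp add: f_def scaleR_diff_left)
  qed
qed

text \<open>Serves as a finiteness criterion: if at one frequency the limit majorant is finite at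
  time t and integrable up to t, then so is its source.\<close>

lemma majl_energy:
  assumes d[measurable]: "\<And>b. bm (d b)" and \<nu>: "\<nu> > 0" and t: "t \<ge> 0"
  shows "majl \<nu> m d b t z + ennreal (\<nu> * (norm z)\<^sup>2) * (lint {0..t} (\<lambda>r. majl \<nu> m d b r z)) =
    d b z + lint {0..t} (\<lambda>s. src m (majl \<nu> m d b s) (majl \<nu> m d (\<not> b) s) z)"
proof -
  let ?p = "majl \<nu> m d b" and ?l = "\<nu> * (norm z)\<^sup>2" and ?F = "\<lambda>s. src m (majl \<nu> m d b s) (majl \<nu> m d (\<not> b) s) z"
  have [measurable]: "jm (majl \<nu> m d b)" for b by (rule jm_majl[where d=d, OF d])
  have l: "?l \<ge> 0" using \<nu> by simp
  have p: "?p r z = ennreal (exp (- ?l * r)) * d b z + duhamel ?l ?F r" for r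
    using majl_fixpoint[where d=d and \<nu>=\<nu> and m=m and b=b and t=r and z=z, OF d] unfolding Phi_def by simp
  have [measurable]: "bm (\<lambda>r. duhamel ?l ?F r)" unfolding duhamel_def by measurable
  have "lint {0..t} (\<lambda>r. ?p r z) = lint {0..t} (\<lambda>r. ennreal (exp (- ?l * r)) * d b z) + lint {0..t} (\<lambda>r. duhamel ?l ?F r)"
    unfolding p distrib_right by (rule nn_integral_add) measurable
  then have "?p t z + ennreal ?l * (lint {0..t} (\<lambda>r. ?p r z)) =
    (ennreal (exp (- ?l * t)) * d b z + ennreal ?l * (lint {0..t} (\<lambda>r. ennreal (exp (- ?l * r)) * d b z))) +
    (duhamel ?l ?F t + ennreal ?l * (lint {0..t} (\<lambda>r. duhamel ?l ?F r)))"
    by (simp add: p distrib_left add_ac)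
  also have "\<dots> = d b z + lint {0..t} (\<lambda>s. ?F s)"
    unfolding exp_energy[OF l t] by (subst duhamel_energy[OF _ l t]) auto
  finally show ?thesis .
qed

lemma Xm_finite_AE:
  assumes [measurable]: "bm f" and "Xm f < \<infinity>"
  shows "AE z in lborel. f z < \<infinity>"
proof -
  have "AE z in lborel. ennreal (inverse (norm z)) * f z \<noteq> \<infinity>"
    by (rule nn_integral_PInf_AE) (use assms(2) in \<open>auto simp: Xm_def\<close>)
  then show ?thesis
    using AE_lborel_singleton[of "0::real^3"] by eventually_elim (auto simp: ennreal_mult_eq_top_iff less_top)
qed

lemma X1_finite_AE:
  assumes [measurable]: "jm f" and fin: "lint A (\<lambda>s. X1 (f s)) < \<infinity>" and [measurable]: "A \<in> sets borel"
  shows "AE z in lborel. (lint A (\<lambda>s. f s z)) < \<infinity>"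
proof -
  have "lint A (\<lambda>s. X1 (f s)) = (\<integral>\<^sub>Ls. \<integral>\<^sub>Lz. ennreal (norm z) * (f s z * indicator A s))"
    unfolding X1_def
    apply (rule nn_integral_cong)
    apply (subst nn_integral_multc[symmetric], measurable)
    apply (simp add: mult.assoc)
    done
  also have "\<dots> = (\<integral>\<^sub>Lz. \<integral>\<^sub>Ls. ennreal (norm z) * (f s z * indicator A s))"
    by (rule lborel_pair.Fubini') measurable
  also have "\<dots> = (\<integral>\<^sub>Lz. ennreal (norm z) * (lint A (\<lambda>s. f s z)))"
    by (intro nn_integral_cong nn_integral_cmult) measurable
  finally have "(\<integral>\<^sub>Lz. ennreal (norm z) * (lint A (\<lambda>s. f s z))) < \<infinity>" using fin by simp
  then have "AE z in lborel. ennreal (norm z) * (lint A (\<lambda>s. f s z)) \<noteq> \<infinity>"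
    by (intro nn_integral_PInf_AE) auto
  then show ?thesis
    using AE_lborel_singleton[of "0::real^3"] by eventually_elim (auto simp: ennreal_mult_eq_top_iff less_top)
qed

text \<open>The exceptional null set of frequencies depends on t, since the limit majorant at time t
  is finite only almost everywhere. The reality and divergence conditions, in contrast, hold
  everywhere.\<close>

theorem fourier_solution:
  fixes w :: "bool \<Rightarrow> vfield"
  assumes w: "\<And>b. bm (w b)" "\<And>b \<eta>. vcnj (w b (- \<eta>)) = w b \<eta>" "\<And>b z. dotc z (w b z) = 0"
    and \<nu>: "\<nu> > 0"
    and D: "\<And>b. Xm (nrm (w b)) = ennreal (D b)" "\<And>b. D b \<ge> 0"
    and small: "(D False + smallC * \<bar>m\<bar> / \<nu> * (\<bar>m\<bar> + D True)) * exp (smallC / \<nu>\<^sup>2 * (\<bar>m\<bar> + D True)\<^sup>2) < 2 * \<nu>"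
  obtains W :: "bool \<Rightarrow> real \<Rightarrow> vfield" and B :: real
  where "\<And>b. jm (W b)" "\<And>b t z. vcnj (W b t (- z)) = W b t z" "\<And>b t z. dotc z (W b t z) = 0"
    and "\<And>b s. s \<ge> 0 \<Longrightarrow> Xm (nrm (W b s)) \<le> ennreal B"
    and "\<And>b. (lint {0..} (\<lambda>s. X1 (nrm (W b s)))) < \<infinity>"
    and "\<And>b t. t \<ge> 0 \<Longrightarrow> AE z in lborel.
      integrable lborel (\<lambda>s. indicator {0..t} s *\<^sub>R (vsrc m (W b s) (W (\<not> b) s) z - (\<nu> * (norm z)\<^sup>2) *\<^sub>R W b s z)) \<and>
      W b t z = w b z + (LBINT s. indicator {0..t} s *\<^sub>R (vsrc m (W b s) (W (\<not> b) s) z - (\<nu> * (norm z)\<^sup>2) *\<^sub>R W b s z))"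
proof -
  define d where "d = (\<lambda>b z. en (w b z))"
  have d[measurable]: "bm (d b)" for b unfolding d_def using w(1) by measurable
  let ?p = "majl \<nu> \<bar>m\<bar> d"
  define W where "W = vlim \<nu> m w"
  have jp[measurable]: "jm (?p b)" for b by (rule jm_majl[where d=d, OF d])
  have jW[measurable]: "jm (W b)" for b unfolding W_def by (rule jm_vlim[where w=w, OF w(1)])
  have sec[measurable]: "?p b s \<in> borel_measurable borel" "bm (W b s)" for b s
    by (rule jm_section, measurable)+
  have Wp: "en (W b s z) \<le> ?p b s z" for b s z unfolding W_def d_def by (rule vlim_majl[where w=w, OF w(1)])
  obtain B where B: "\<And>b s. s \<ge> 0 \<Longrightarrow> Xm (?p b s) \<le> ennreal B" "\<And>b. (lint {0..} (\<lambda>s. X1 (?p b s))) < \<infinity>"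
    using majl_bounds[where d=d and D=D, OF d \<nu> _ _ D(2) small] D(1) unfolding d_def by auto
  have fixp: "W b t z = vPhi \<nu> m (w b) (W b) (W (\<not> b)) t z" if "?p b t z < \<infinity>" for b t z
    using vlim_fixpoint[where w=w, OF w(1), where \<nu>=\<nu> and m=m and b=b and t=t and z=z] that unfolding W_def d_def by simp
  have eq: "AE z in lborel.
      integrable lborel (\<lambda>s. indicator {0..t} s *\<^sub>R (vsrc m (W b s) (W (\<not> b) s) z - (\<nu> * (norm z)\<^sup>2) *\<^sub>R W b s z)) \<and>
      W b t z = w b z + (LBINT s. indicator {0..t} s *\<^sub>R (vsrc m (W b s) (W (\<not> b) s) z - (\<nu> * (norm z)\<^sup>2) *\<^sub>R W b s z))"
    if t: "t \<ge> 0" for b t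
  proof -
    have "AE z in lborel. ?p b t z < \<infinity>" by (rule Xm_finite_AE) (use B(1)[OF t, of b] in \<open>auto intro: le_less_trans\<close>)
    moreover have "AE z in lborel. (lint {0..t} (\<lambda>s. ?p b s z)) < \<infinity>"
      by (rule X1_finite_AE) (use le_less_trans[OF nn_integral_Icc_le_atLeast B(2)] in auto)
    ultimately show ?thesis
    proof eventually_elim
      case (elim z)
      let ?l = "\<nu> * (norm z)\<^sup>2" and ?F = "\<lambda>s. vsrc m (W b s) (W (\<not> b) s) z"
      have "d b z + lint {0..t} (\<lambda>s. src \<bar>m\<bar> (?p b s) (?p (\<not> b) s) z) < \<infinity>"
        unfolding majl_energy[where d=d, OF d \<nu> t, symmetric] using elim by (auto simp: ennreal_mult_less_top)
      then have sf: "lint {0..t} (\<lambda>s. src \<bar>m\<bar> (?p b s) (?p (\<not> b) s) z) < \<infinity>" by simp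
      have "lint {0..t} (\<lambda>s. en (?F s)) \<le> lint {0..t} (\<lambda>s. src \<bar>m\<bar> (?p b s) (?p (\<not> b) s) z)"
        by (intro nn_integral_mono mult_right_mono vsrc_bound Wp) auto
      then have Ff: "lint {0..t} (\<lambda>s. en (?F s)) < \<infinity>" using sf by (rule le_less_trans)
      define f where "f r = exp (- ?l * r) *\<^sub>R w b z + vduhamel ?l ?F r" for r
      have Fm[measurable]: "?F \<in> borel_measurable borel" by measurable
      have [measurable]: "bm f" unfolding f_def vduhamel_def by measurable
      have Wf: "W b r z = f r" if "?p b r z < \<infinity>" for r
        using fixp[OF that] unfolding f_def vPhi_def .
      \<comment> \<open>At a fixed frequency W agrees with the mild formula only at times where the
        majorant is finite; these are almost all times, which is enough under the integral.\<close>
      have "AE s in lborel. ?p b s z * indicator {0..t} s \<noteq> \<infinity>"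
        by (rule nn_integral_PInf_AE) (use elim in auto)
      then have ae: "AE s in lborel. indicat_real {0..t} s *\<^sub>R (?F s - ?l *\<^sub>R W b s z) = indicat_real {0..t} s *\<^sub>R (?F s - ?l *\<^sub>R f s)"
        by eventually_elim (use Wf in \<open>auto simp: indicator_def less_top\<close>)
      note id = vduhamel_identity[OF Fm Ff _ t, of ?l "w b z", folded f_def]
      have "integrable lborel (\<lambda>s. indicat_real {0..t} s *\<^sub>R (?F s - ?l *\<^sub>R W b s z))"
        by (subst integrable_cong_AE[OF _ _ ae]) (use id(1) \<nu> in auto)
      moreover have "(LBINT s. indicat_real {0..t} s *\<^sub>R (?F s - ?l *\<^sub>R W b s z)) = (LBINT s. indicat_real {0..t} s *\<^sub>R (?F s - ?l *\<^sub>R f s))"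
        by (rule LINT_cong_AE[OF _ _ ae]) auto
      ultimately show ?case using id(2) \<nu> Wf[of t] elim by simp
    qed
  qed
  show ?thesis
  proof (rule that[of W B])
    show "vcnj (W b t (- z)) = W b t z" for b t z unfolding W_def by (rule vlim_vcnj[where w=w, OF w(1,2)])
    show "dotc z (W b t z) = 0" for b t z unfolding W_def by (rule vlim_div_free[where w=w, OF w(3)])
    show "Xm (nrm (W b s)) \<le> ennreal B" if "s \<ge> 0" for b s
      by (rule order_trans[OF X_mono(1) B(1)[OF that]]) (rule Wp)
    have "lint {0..} (\<lambda>s. X1 (nrm (W b s))) \<le> lint {0..} (\<lambda>s. X1 (?p b s))" for b
      by (intro nn_integral_mono mult_right_mono X_mono Wp) auto
    then show "lint {0..} (\<lambda>s. X1 (nrm (W b s))) < \<infinity>" for b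
      using B(2) le_less_trans by blast
  qed (use eq jW in auto)
qed

subsection \<open>Membership in the solution space\<close>

definition vift :: "vfield \<Rightarrow> vdist" where
  "vift w = (\<chi> i. ift (\<lambda>z. w z $ i))"

definition frepv :: "vfield \<Rightarrow> vdist \<Rightarrow> bool" where
  "frepv w u \<longleftrightarrow> (\<forall>i. frep (\<lambda>z. w z $ i) (u $ i))"

lemma slow_of_Xm:
  assumes [measurable]: "bm w" and fin: "Xm (nrm w) < \<infinity>"
  shows "slow (\<lambda>z. w z $ i)"
  unfolding slow_def
proof
  show "integrable lborel (\<lambda>z. norm (w z $ i) / (1 + norm z))"
  proof (rule integrableI_bounded)
    have "(\<integral>\<^sub>Lz. ennreal (norm (norm (w z $ i) / (1 + norm z)))) \<le> Xm (nrm w)"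
      unfolding Xm_def
    proof (intro nn_integral_mono_AE)
      show "AE z in lborel. ennreal (norm (norm (w z $ i) / (1 + norm z))) \<le> ennreal (inverse (norm z)) * en (w z)"
        using AE_lborel_singleton[of "0::real^3"]
      proof eventually_elim
        case (elim z)
        have "norm (w z $ i) / (1 + norm z) \<le> norm (w z) / norm z"
          using elim by (intro frac_le Finite_Cartesian_Product.norm_nth_le) auto
        then show ?case
          by (simp add: divide_inverse mult.commute ennreal_leI flip: ennreal_mult)
      qed
    qed
    then show "(\<integral>\<^sub>Lz. ennreal (norm (norm (w z $ i) / (1 + norm z)))) < \<infinity>" using fin by (rule le_less_trans)
  qed measurable
qed measurable

lemma slow_of_integrable:
  assumes "integrable lborel w" shows "slow w"
  unfolding slow_def
proof
  show m[measurable]: "bm w" using assms by auto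
  show "integrable lborel (\<lambda>z. norm (w z) / (1 + norm z))"
  proof (rule integrable_dominated[OF integrable_norm[OF assms]])
    fix z :: "real^3"
    have "norm (w z) * 1 \<le> norm (w z) * (1 + norm z)" by (intro mult_left_mono) auto
    then show "norm (norm (w z) / (1 + norm z)) \<le> norm (w z)" by (simp add: pos_divide_le_eq)
  qed measurable
qed

lemma frepv_vift:
  assumes "bm w" "Xm (nrm w) < \<infinity>"
  shows "frepv w (vift w)" "tempered (vift w $ i)"
  using frep_ift[OF slow_of_Xm[OF assms]] tempered_ift[OF slow_of_Xm[OF assms]] by (auto simp: frepv_def vift_def)

lemma frepv_measurable:
  assumes "frepv w u" shows "bm w"
proof -
  have [measurable]: "bm (\<lambda>z. w z $ i)" for i
    using assms frep_measurable[of "\<lambda>z. w z $ i" "u $ i"] by (simp add: frepv_def)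
  have "bm (\<lambda>z. \<chi> i. w z $ i)" by measurable
  then show ?thesis by simp
qed

lemma frepv_AE:
  assumes "frepv w u" shows "AE z in lborel. fourier_fun u z = w z"
proof -
  have "AE z in lborel. \<forall>i\<in>(UNIV::3 set). fun_of (fourier_dist (u $ i)) z = w z $ i"
    using assms by (intro AE_finite_allI) (auto simp: frepv_def frep_def intro: fun_of_AE)
  then show ?thesis by eventually_elim (simp add: fourier_fun_def vec_eq_iff)
qed

lemma frepv_fourier_fun:
  assumes "\<And>i. \<exists>g. represents g (fourier_dist (u $ i))" shows "frepv (fourier_fun u) u"
  unfolding frepv_def frep_def fourier_fun_def using assms represents_fun_of by auto

lemma frepv_diff: "frepv w u \<Longrightarrow> frepv w' u' \<Longrightarrow> frepv (\<lambda>z. w z - w' z) (u - u')"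
  unfolding frepv_def using frep_diff by (simp add: fun_diff_def)

lemma frepv_add: "frepv w u \<Longrightarrow> frepv w' u' \<Longrightarrow> frepv (\<lambda>z. w z + w' z) (u + u')"
  unfolding frepv_def using frep_add by (simp add: plus_fun_def)

lemma powr_norm_weights: "norm z powr (- 1) = inverse (norm z)" "norm z powr 1 = norm z"
  by (auto simp: powr_minus)

lemma frepv_fourier_fun_measurable:
  assumes "frepv w u" shows "bm (fourier_fun u)"
  using assms by (intro frepv_measurable[OF frepv_fourier_fun]) (auto simp: frepv_def frep_def)

lemma chi_norm_frepv:
  assumes "frepv w u"
  shows "chi_norm (- 1) u = enn2real (Xm (nrm w))" "chi_norm 1 u = enn2real (X1 (nrm w))"
proof -
  have [measurable]: "bm w" "bm (fourier_fun u)"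
    using frepv_measurable[OF assms] frepv_fourier_fun_measurable[OF assms] by auto
  have "chi_norm (- 1) u = (LBINT z. inverse (norm z) * norm (w z))"
    unfolding chi_norm_def powr_norm_weights
    by (rule LINT_cong_AE) (measurable, use frepv_AE[OF assms] in eventually_elim, simp)
  also have "\<dots> = enn2real (Xm (nrm w))"
    unfolding Xm_def by (subst integral_eq_nn_integral) (auto simp: ennreal_mult)
  finally show "chi_norm (- 1) u = enn2real (Xm (nrm w))" .
  have "chi_norm 1 u = (LBINT z. norm z * norm (w z))"
    unfolding chi_norm_def powr_norm_weights
    by (rule LINT_cong_AE) (measurable, use frepv_AE[OF assms] in eventually_elim, simp)
  also have "\<dots> = enn2real (X1 (nrm w))"
    unfolding X1_def by (subst integral_eq_nn_integral) (auto simp: ennreal_mult)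
  finally show "chi_norm 1 u = enn2real (X1 (nrm w))" .
qed

lemma integrable_weight_iff:
  assumes [measurable]: "bm w"
  shows "integrable lborel (\<lambda>z. norm z powr (- 1) * norm (w z)) \<longleftrightarrow> Xm (nrm w) < \<infinity>"
    "integrable lborel (\<lambda>z. norm z powr 1 * norm (w z)) \<longleftrightarrow> X1 (nrm w) < \<infinity>"
  unfolding powr_norm_weights integrable_iff_bounded Xm_def X1_def by (auto simp: ennreal_mult)

lemma integrable_weight_frepv:
  assumes "frepv w u"
  shows "integrable lborel (\<lambda>z. norm z powr s * norm (fourier_fun u z)) \<longleftrightarrow> integrable lborel (\<lambda>z. norm z powr s * norm (w z))"
proof -
  have [measurable]: "bm w" "bm (fourier_fun u)"
    using frepv_measurable[OF assms] frepv_fourier_fun_measurable[OF assms] by auto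
  show ?thesis
    by (rule integrable_cong_AE) (measurable, use frepv_AE[OF assms] in eventually_elim, simp)
qed

lemma chi_frepv:
  assumes "frepv w u" "\<And>i. tempered (u $ i)"
  shows "u \<in> chi (- 1) \<longleftrightarrow> Xm (nrm w) < \<infinity>" "u \<in> chi 1 \<longleftrightarrow> X1 (nrm w) < \<infinity>"
  unfolding integrable_weight_iff[OF frepv_measurable[OF assms(1)], symmetric] integrable_weight_frepv[OF assms(1), symmetric] chi_def
  using assms by (auto simp: frepv_def frep_def)

lemma chiD:
  assumes "u \<in> chi s"
  shows "frepv (fourier_fun u) u" "tempered (u $ i)" "bm (fourier_fun u)"
  using assms frepv_fourier_fun[of u] frepv_measurable[OF frepv_fourier_fun[of u]] by (auto simp: chi_def)

lemma chi_Xm: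
  assumes "u \<in> chi (- 1)"
  shows "Xm (nrm (fourier_fun u)) = ennreal (chi_norm (- 1) u)"
  using chi_norm_frepv(1)[OF chiD(1)[OF assms]] chi_frepv(1)[OF chiD(1,2)[OF assms]] assms by (simp add: less_top)

lemma chi_X1:
  assumes "u \<in> chi 1"
  shows "X1 (nrm (fourier_fun u)) = ennreal (chi_norm 1 u)"
  using chi_norm_frepv(2)[OF chiD(1)[OF assms]] chi_frepv(2)[OF chiD(1,2)[OF assms]] assms by (simp add: less_top)

text \<open>The weak formulation integrates over \<open>lebesgue_on\<close>, while the Fourier side
  produces a Borel function J. The integrand F is only known to equal J almost everywhere, and
  completeness of the measure makes it measurable.\<close>

lemma lebesgue_on_transfer:
  fixes F J :: "real \<Rightarrow> 'a::euclidean_space"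
  assumes J: "integrable lborel (\<lambda>s. indicator S s *\<^sub>R J s)" and S[measurable]: "S \<in> sets borel"
    and ae: "AE s in lborel. s \<in> S \<longrightarrow> F s = J s"
  shows "integrable (lebesgue_on S) F" "(LINT s|lebesgue_on S. F s) = (LBINT s. indicator S s *\<^sub>R J s)"
proof -
  have Sl: "S \<in> sets lebesgue" using S by auto
  have JI: "J absolutely_integrable_on S"
    unfolding set_integrable_def by (rule integrable_completion[THEN iffD2]) (use J in auto)
  have "AE s in lebesgue. s \<in> S \<longrightarrow> F s = J s" by (rule AE_completion[OF ae])
  then obtain N where N: "{s \<in> space lebesgue. \<not> (s \<in> S \<longrightarrow> F s = J s)} \<subseteq> N" "N \<in> null_sets lebesgue"
    unfolding eventually_ae_filter by blast
  have neg: "negligible N" using N(2) by (simp add: negligible_iff_null_sets)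
  have eq: "F s = J s" if "s \<in> S - N" for s using N(1) that by auto
  have FI: "F absolutely_integrable_on S"
    by (rule absolutely_integrable_spike[OF JI neg]) (use eq in auto)
  then show "integrable (lebesgue_on S) F" using Sl by (simp add: integrable_restrict_space set_integrable_def)
  have "(LINT s|lebesgue_on S. F s) = (LINT s|lebesgue. indicator S s *\<^sub>R F s)"
    using Sl by (simp add: integral_restrict_space)
  also have "\<dots> = (LINT s|lebesgue. indicator S s *\<^sub>R J s)"
  proof (rule LINT_cong_AE)
    show "(\<lambda>s. indicat_real S s *\<^sub>R F s) \<in> borel_measurable lebesgue" "(\<lambda>s. indicat_real S s *\<^sub>R J s) \<in> borel_measurable lebesgue"
      using FI JI by (auto simp: set_integrable_def)
    show "AE s in lebesgue. indicat_real S s *\<^sub>R F s = indicat_real S s *\<^sub>R J s"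
      using AE_completion[OF ae] by eventually_elim (auto simp: indicator_def)
  qed
  also have "\<dots> = (LBINT s. indicator S s *\<^sub>R J s)"
    using J by (intro integral_completion) auto
  finally show "(LINT s|lebesgue_on S. F s) = (LBINT s. indicator S s *\<^sub>R J s)" .
qed

text \<open>A Schwartz function is bounded by a constant times 1 / |z|, which is exactly the weight
  of \<open>Xm\<close>. This is the Fubini condition for all weak formulations.\<close>

lemma pairing_integrable:
  fixes H :: "real \<Rightarrow> vfield"
  assumes [measurable]: "jm H" and Hint: "lint {0..t} (\<lambda>s. Xm (nrm (H s))) < \<infinity>" and f: "f \<in> schwartz"
  shows "integrable (lborel \<Otimes>\<^sub>M lborel) (\<lambda>(s, z). indicat_real {0..t} s *\<^sub>R (H s z $ i * f z))"
proof -
  have [measurable]: "bm (H s)" for s by (rule jm_section) fact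
  have [measurable]: "bm f" by (rule schwartz_measurable[OF f])
  obtain C where C: "C \<ge> 0" "\<And>z. (1 + norm z) ^ 1 * norm (f z) \<le> C" using schwartz_bound[OF f] by metis
  let ?g = "\<lambda>s z. indicat_real {0..t} s *\<^sub>R (H s z $ i * f z)"
  have pw: "en (H s z $ i * f z) \<le> ennreal C * (ennreal (inverse (norm z)) * en (H s z))" if "z \<noteq> 0" for s z
  proof -
    have "norm (f z) \<le> C * inverse (norm z)"
    proof -
      have "norm z * norm (f z) \<le> (1 + norm z) ^ 1 * norm (f z)" by (intro mult_right_mono) auto
      also have "\<dots> \<le> C" by (rule C)
      finally show ?thesis using that by (simp add: field_simps)
    qed
    then have "norm (H s z $ i * f z) \<le> norm (H s z) * (C * inverse (norm z))"
      unfolding norm_mult by (intro mult_mono Finite_Cartesian_Product.norm_nth_le) auto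
    then have "en (H s z $ i * f z) \<le> ennreal (C * (inverse (norm z) * norm (H s z)))" by (intro ennreal_leI) (simp add: mult_ac)
    then show ?thesis using C by (simp add: ennreal_mult)
  qed
  have bd: "(\<integral>\<^sub>Ls. \<integral>\<^sub>Lz. en (?g s z)) < \<infinity>"
  proof -
    have "(\<integral>\<^sub>Ls. \<integral>\<^sub>Lz. en (?g s z)) \<le> (\<integral>\<^sub>Ls. ennreal C * (Xm (nrm (H s)) * indicator {0..t} s))"
    proof (rule nn_integral_mono)
      fix s
      have "(\<integral>\<^sub>Lz. en (H s z $ i * f z)) \<le> (\<integral>\<^sub>Lz. ennreal C * (ennreal (inverse (norm z)) * en (H s z)))"
        using AE_lborel_singleton[of "0::real^3"] by (intro nn_integral_mono_AE, eventually_elim) (rule pw)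
      also have "\<dots> = ennreal C * Xm (nrm (H s))" unfolding Xm_def by (rule nn_integral_cmult) measurable
      finally show "(\<integral>\<^sub>Lz. en (?g s z)) \<le> ennreal C * (Xm (nrm (H s)) * indicator {0..t} s)"
        by (auto simp: indicator_def)
    qed
    also have "\<dots> = ennreal C * (lint {0..t} (\<lambda>s. Xm (nrm (H s))))" by (rule nn_integral_cmult) measurable
    also have "\<dots> < \<infinity>" using Hint by (auto simp: ennreal_mult_less_top)
    finally show ?thesis .
  qed
  show ?thesis
  proof (rule integrableI_bounded)
    have "(\<integral>\<^sup>+p. en (case p of (s, z) \<Rightarrow> ?g s z) \<partial>(lborel \<Otimes>\<^sub>M lborel)) = (\<integral>\<^sub>Ls. \<integral>\<^sub>Lz. en (?g s z))"
      by (subst lborel.nn_integral_fst[symmetric]) auto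
    then show "(\<integral>\<^sup>+p. en (case p of (s, z) \<Rightarrow> ?g s z) \<partial>(lborel \<Otimes>\<^sub>M lborel)) < \<infinity>" using bd by simp
  qed measurable
qed

abbreviation evolves :: "real \<Rightarrow> (real \<Rightarrow> vfield) \<Rightarrow> (real \<Rightarrow> vfield) \<Rightarrow> bool" where
  "evolves t U H \<equiv> AE z in lborel. integrable lborel (\<lambda>s. indicator {0..t} s *\<^sub>R H s z) \<and>
    U t z = U 0 z + (LBINT s. indicator {0..t} s *\<^sub>R H s z)"

text \<open>The information about one field that suffices for membership in the solution space and
  for the weak form: uniform bounds in \<chi>^-1, integrability in \<chi>^1, and a time derivative H
  locally integrable in time with values in \<chi>^-1.\<close>

locale fourier_evolution =
  fixes U H :: "real \<Rightarrow> vfield" and B :: real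
  assumes jU: "jm U" and jH: "jm H"
    and UB: "\<And>s. s \<ge> 0 \<Longrightarrow> Xm (nrm (U s)) \<le> ennreal B"
    and U1: "lint {0..} (\<lambda>s. X1 (nrm (U s))) < \<infinity>"
    and Hint: "\<And>t. t \<ge> 0 \<Longrightarrow> (lint {0..t} (\<lambda>s. Xm (nrm (H s)))) < \<infinity>"
    and evol: "\<And>t. t \<ge> 0 \<Longrightarrow> evolves t U H"
begin

lemma meas [measurable]: "jm U" "jm H" "bm (U s)" "bm (H s)"
  using jU jH by (auto intro: jm_section)

lemma frepv_U: "s \<ge> 0 \<Longrightarrow> frepv (U s) (vift (U s))" "s \<ge> 0 \<Longrightarrow> tempered (vift (U s) $ i)"
  using UB by (auto intro!: frepv_vift le_less_trans[OF UB])

text \<open>Makes the field absolutely continuous in \<chi>^-1, so that small slices of the integral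
  of H give a uniform modulus of continuity.\<close>

lemma increment:
  assumes "0 \<le> s" "s \<le> t"
  shows "Xm (\<lambda>z. en (U t z - U s z)) \<le> lint {s<..t} (\<lambda>r. Xm (nrm (H r)))"
proof -
  have le: "AE z in lborel. en (U t z - U s z) \<le> lint {s<..t} (\<lambda>r. en (H r z))"
    using evol[OF order_trans[OF assms]] evol[OF assms(1)]
  proof eventually_elim
    case (elim z)
    have "U t z - U s z = (LBINT r. indicator {0..t} r *\<^sub>R H r z) - (LBINT r. indicator {0..s} r *\<^sub>R H r z)"
      using elim by simp
    also have "\<dots> = (LBINT r. indicator {0..t} r *\<^sub>R H r z - indicator {0..s} r *\<^sub>R H r z)"
      using elim by (subst LINT_diff) auto
    finally have eq: "U t z - U s z = (LBINT r. indicator {0..t} r *\<^sub>R H r z - indicator {0..s} r *\<^sub>R H r z)" .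
    have "en (U t z - U s z) \<le> (\<integral>\<^sub>Lr. en (indicator {0..t} r *\<^sub>R H r z - indicator {0..s} r *\<^sub>R H r z))"
      unfolding eq by (rule integral_norm_bound_ennreal, rule integrable_sub) (use elim in auto)
    also have "\<dots> = lint {s<..t} (\<lambda>r. en (H r z))"
      by (intro nn_integral_cong) (use assms in \<open>auto simp: indicator_def\<close>)
    finally show ?case .
  qed
  have "Xm (\<lambda>z. en (U t z - U s z)) \<le> (\<integral>\<^sub>Lz. ennreal (inverse (norm z)) * (lint {s<..t} (\<lambda>r. en (H r z))))"
    unfolding Xm_def using le by (intro nn_integral_mono_AE, eventually_elim) (auto intro: mult_left_mono)
  also have "\<dots> = (\<integral>\<^sub>Lz. \<integral>\<^sub>Lr. ennreal (inverse (norm z)) * en (H r z) * indicator {s<..t} r)"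
    by (intro nn_integral_cong) (simp add: nn_integral_cmult[symmetric] mult.assoc)
  also have "\<dots> = (\<integral>\<^sub>Lr. \<integral>\<^sub>Lz. ennreal (inverse (norm z)) * en (H r z) * indicator {s<..t} r)"
    by (rule lborel_pair.Fubini') measurable
  also have "\<dots> = lint {s<..t} (\<lambda>r. Xm (nrm (H r)))"
    unfolding Xm_def by (intro nn_integral_cong nn_integral_multc) measurable
  finally show ?thesis .
qed

lemma modulus:
  assumes "e > 0"
  obtains d where "d > 0" "\<And>s t. 0 \<le> s \<Longrightarrow> 0 \<le> t \<Longrightarrow> s \<le> T \<Longrightarrow> t \<le> T \<Longrightarrow> \<bar>t - s\<bar> < d \<Longrightarrow> Xm (\<lambda>z. en (U t z - U s z)) \<le> ennreal e"
proof (cases "T \<ge> 0")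
  case True
  have [measurable]: "bm (\<lambda>r. Xm (nrm (H r)))" by measurable
  obtain d where d: "d > 0" "\<And>s t. 0 \<le> s \<Longrightarrow> s \<le> t \<Longrightarrow> t \<le> T \<Longrightarrow> t - s < d \<Longrightarrow> (lint {s<..t} (\<lambda>r. Xm (nrm (H r)))) \<le> ennreal e"
    using nn_integral_small_slices[OF _ Hint[OF True] assms] by auto
  have 1: "Xm (\<lambda>z. en (U t z - U s z)) \<le> ennreal e" if "0 \<le> s" "s \<le> t" "t \<le> T" "t - s < d" for s t
    using order_trans[OF increment d(2)] that by blast
  show ?thesis
  proof (rule that[OF d(1)])
    fix s t assume st: "0 \<le> s" "0 \<le> t" "s \<le> T" "t \<le> T" "\<bar>t - s\<bar> < d"
    show "Xm (\<lambda>z. en (U t z - U s z)) \<le> ennreal e"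
      using 1[of s t] 1[of t s] st by (cases "s \<le> t") (auto simp: norm_minus_commute)
  qed
qed (auto intro: that[of 1])

lemma C_chi_member: "(\<lambda>t. vift (U t)) \<in> C_chi (- 1)"
  unfolding C_chi_def
proof safe
  fix t :: real assume t: "t \<ge> 0"
  show "vift (U t) \<in> chi (- 1)"
    using chi_frepv(1)[OF frepv_U[OF t]] le_less_trans[OF UB[OF t]] by auto
  show "((\<lambda>r. chi_norm (- 1) (vift (U r) - vift (U t))) \<longlongrightarrow> 0) (at t within {0..})"
  proof (rule tendstoI)
    fix e :: real assume e: "e > 0"
    obtain d where d: "d > 0" "\<And>s r. 0 \<le> s \<Longrightarrow> 0 \<le> r \<Longrightarrow> s \<le> t + 1 \<Longrightarrow> r \<le> t + 1 \<Longrightarrow> \<bar>r - s\<bar> < d \<Longrightarrow> Xm (\<lambda>z. en (U r z - U s z)) \<le> ennreal (e / 2)"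
      using modulus[of "e / 2" "t + 1"] e by auto
    have "dist (chi_norm (- 1) (vift (U r) - vift (U t))) 0 < e" if r: "r \<ge> 0" "dist r t < min d 1" for r
    proof -
      have "Xm (\<lambda>z. en (U r z - U t z)) \<le> ennreal (e / 2)"
        using r t by (intro d(2)) (auto simp: dist_real_def)
      then have "enn2real (Xm (\<lambda>z. en (U r z - U t z))) \<le> e / 2" using e by (intro enn2real_leI) auto
      then show ?thesis
        unfolding chi_norm_frepv(1)[OF frepv_diff[OF frepv_U(1)[OF r(1)] frepv_U(1)[OF t]]] using e by (simp add: dist_real_def)
    qed
    then show "\<forall>\<^sub>F r in at t within {0..}. dist (chi_norm (- 1) (vift (U r) - vift (U t))) 0 < e"
      using d(1) unfolding eventually_at by (intro exI[of _ "min d 1"]) auto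
  qed
qed

lemma X1_AE: "AE t in lborel. t \<in> {0..} \<longrightarrow> X1 (nrm (U t)) < \<infinity>"
proof -
  have "AE t in lborel. X1 (nrm (U t)) * indicator {0..} t \<noteq> \<infinity>"
    by (rule nn_integral_PInf_AE) (use U1 in auto)
  then show ?thesis by eventually_elim (auto simp: less_top)
qed

text \<open>The third power is chosen against the factor n^2 lost by the frequency cutoff: n^2 / (n
  + 1)^3 \<le> 1 / (n + 1).\<close>

lemma approx_sequence:
  obtains m :: "nat \<Rightarrow> nat" where "\<And>n. m n > 0"
    "\<And>n s t. 0 \<le> s \<Longrightarrow> 0 \<le> t \<Longrightarrow> s \<le> real n \<Longrightarrow> t \<le> real n \<Longrightarrow> \<bar>t - s\<bar> \<le> 1 / real (m n) \<Longrightarrow>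
       Xm (\<lambda>z. en (U t z - U s z)) \<le> ennreal (1 / real (Suc n) ^ 3)"
proof -
  have ex: "\<exists>m>0. \<forall>s t. 0 \<le> s \<longrightarrow> 0 \<le> t \<longrightarrow> s \<le> real n \<longrightarrow> t \<le> real n \<longrightarrow> \<bar>t - s\<bar> \<le> 1 / real m \<longrightarrow>
       Xm (\<lambda>z. en (U t z - U s z)) \<le> ennreal (1 / real (Suc n) ^ 3)" for n
  proof -
    obtain d where d: "d > 0" "\<And>s t. 0 \<le> s \<Longrightarrow> 0 \<le> t \<Longrightarrow> s \<le> real n \<Longrightarrow> t \<le> real n \<Longrightarrow> \<bar>t - s\<bar> < d \<Longrightarrow> Xm (\<lambda>z. en (U t z - U s z)) \<le> ennreal (1 / real (Suc n) ^ 3)"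
      using modulus[of "1 / real (Suc n) ^ 3" "real n"] by auto
    obtain k where "inverse (real (Suc k)) < d" using reals_Archimedean[OF d(1)] by auto
    then have k: "1 / real (Suc k) < d" by (simp only: inverse_eq_divide)
    show ?thesis
    proof (intro exI[of _ "Suc k"] conjI allI impI)
      fix s t assume "0 \<le> s" "0 \<le> t" "s \<le> real n" "t \<le> real n" "\<bar>t - s\<bar> \<le> 1 / real (Suc k)"
      then show "Xm (\<lambda>z. en (U t z - U s z)) \<le> ennreal (1 / real (Suc n) ^ 3)"
        using k by (intro d(2)) linarith+
    qed simp
  qed
  from choice[OF allI[OF ex]] obtain m where m: "\<forall>n. m n > 0 \<and> (\<forall>s t. 0 \<le> s \<longrightarrow> 0 \<le> t \<longrightarrow> s \<le> real n \<longrightarrow> t \<le> real n \<longrightarrow> \<bar>t - s\<bar> \<le> 1 / real (m n) \<longrightarrow>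
       Xm (\<lambda>z. en (U t z - U s z)) \<le> ennreal (1 / real (Suc n) ^ 3))" ..
  show ?thesis by (rule that[of m]) (use m in \<open>simp_all only: simp_thms\<close>)
qed

text \<open>Strong measurability in \<open>\<chi>\<^sup>1\<close>: cutting off the frequencies above \<open>n\<close> makes the \<open>\<chi>\<^sup>1\<close> norm
  controlled by \<open>n\<^sup>2\<close> times the \<open>\<chi>\<^sup>-\<^sup>1\<close> norm, in which the field is uniformly continuous.\<close>

lemma L1_chi_member: "(\<lambda>t. vift (U t)) \<in> L1_chi 1"
proof -
  obtain m :: "nat \<Rightarrow> nat" where m: "\<And>n. m n > 0"
    "\<And>n s t. 0 \<le> s \<Longrightarrow> 0 \<le> t \<Longrightarrow> s \<le> real n \<Longrightarrow> t \<le> real n \<Longrightarrow> \<bar>t - s\<bar> \<le> 1 / real (m n) \<Longrightarrow>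
       Xm (\<lambda>z. en (U t z - U s z)) \<le> ennreal (1 / real (Suc n) ^ 3)"
    using approx_sequence by blast
  define cut where "cut n v z = (if norm z \<le> real n then v z else (0 :: complex^3))" for n v and z :: "real^3"
  have cm[measurable]: "bm (cut n v)" if [measurable]: "bm v" for n v
    unfolding cut_def by measurable
  have cut_Xm: "Xm (nrm (cut n v)) \<le> Xm (nrm v)" for n v
    by (rule X_mono) (simp add: cut_def)
  have cut_X1: "X1 (nrm (cut n v)) \<le> ennreal (real n ^ 2) * Xm (nrm v)" if [measurable]: "bm v" for n v
  proof -
    have "X1 (nrm (cut n v)) \<le> (\<integral>\<^sub>Lz. ennreal (real n ^ 2) * (ennreal (inverse (norm z)) * en (v z)))"
      unfolding X1_def
    proof (rule nn_integral_mono)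
      fix z :: "real^3"
      have "norm z \<le> real n ^ 2 * inverse (norm z)" if "norm z \<le> real n"
      proof (cases "z = 0")
        case False
        have "norm z ^ 2 \<le> real n ^ 2" using that by (intro power_mono) auto
        then show ?thesis using False by (simp add: field_simps power2_eq_square)
      qed simp
      then have "norm z * norm (v z) \<le> real n ^ 2 * inverse (norm z) * norm (v z)" if "norm z \<le> real n"
        using that by (intro mult_right_mono) auto
      from ennreal_leI[OF this]
      show "ennreal (norm z) * en (cut n v z) \<le> ennreal (real n ^ 2) * (ennreal (inverse (norm z)) * en (v z))"
        by (auto simp: cut_def ennreal_mult mult.assoc)
    qed
    also have "\<dots> = ennreal (real n ^ 2) * Xm (nrm v)" unfolding Xm_def by (rule nn_integral_cmult) measurable
    finally show ?thesis .
  qed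
  \<comment> \<open>The index of the grid point just below t, for mesh 1 / m n. Time is frozen after
    n, so only finitely many indices occur and the approximation is simple.\<close>
  define k where "k n t = nat \<lfloor>real (m n) * min t (real n)\<rfloor>" for n t
  define S where "S n j = vift (cut n (U (real j / real (m n))))" for n j
  have Sf: "frepv (cut n (U (real j / real (m n)))) (S n j)" "tempered (S n j $ i)" for n j i
  proof -
    have "Xm (\<lambda>z. en (cut n (U (real j / real (m n))) z)) \<le> ennreal B"
      by (rule order_trans[OF cut_Xm UB]) simp
    then have fin: "Xm (\<lambda>z. en (cut n (U (real j / real (m n))) z)) < \<infinity>" by (rule le_less_trans) simp
    show "frepv (cut n (U (real j / real (m n)))) (S n j)" "tempered (S n j $ i)"
      unfolding S_def by (rule frepv_vift[OF _ fin], measurable)+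
  qed
  have Schi: "S n j \<in> chi 1" for n j
  proof -
    have "X1 (\<lambda>z. en (cut n (U (real j / real (m n))) z)) \<le> ennreal (real n ^ 2) * ennreal B"
      by (rule order_trans[OF cut_X1 mult_left_mono[OF UB]]) auto
    also have "\<dots> < \<infinity>" by (simp add: ennreal_mult_less_top)
    finally show ?thesis using chi_frepv(2)[OF Sf] by simp
  qed
  have simp: "simple_function (lebesgue_on {0..}) (\<lambda>t. S n (k n t))" for n
  proof (rule simple_function_compose1[of _ "k n" "S n"])
    have sub: "k n ` {0..} \<subseteq> {..m n * n}"
    proof
      fix j assume "j \<in> k n ` {0..}"
      then obtain t where t: "t \<ge> 0" "j = k n t" by auto
      have "real (m n) * min t (real n) \<le> real (m n * n)" by (simp add: mult_left_mono)
      then have "\<lfloor>real (m n) * min t (real n)\<rfloor> \<le> int (m n * n)" by (metis floor_mono floor_of_nat)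
      then show "j \<in> {..m n * n}" by (simp add: t k_def nat_le_iff)
    qed
    have km: "k n \<in> borel \<rightarrow>\<^sub>M count_space UNIV" unfolding k_def by measurable
    show "simple_function (lebesgue_on {0..}) (k n)"
      unfolding simple_function_def
    proof safe
      show "finite (k n ` space (lebesgue_on {0..}))" using sub finite_subset by auto
      fix t :: real assume "t \<in> space (lebesgue_on {0..})"
      have "k n -` {k n t} \<inter> space borel \<in> sets borel" using km by (rule measurable_sets) simp
      then show "k n -` {k n t} \<inter> space (lebesgue_on {0..}) \<in> sets (lebesgue_on {0..})"
        by (auto simp: sets_restrict_space image_iff intro!: bexI[of _ "k n -` {k n t}"])
    qed
  qed
  have conv: "(\<lambda>n. chi_norm 1 (S n (k n t) - vift (U t))) \<longlonglongrightarrow> 0" if t: "t \<ge> 0" and fin: "X1 (nrm (U t)) < \<infinity>" for t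
  proof -
    have c: "chi_norm 1 (S n (k n t) - vift (U t)) = enn2real (X1 (\<lambda>z. en (cut n (U (real (k n t) / real (m n))) z - U t z)))" for n
      by (rule chi_norm_frepv(2)[OF frepv_diff[OF Sf(1) frepv_U(1)[OF t]]])
    \<comment> \<open>The part of the \<chi>^1 norm above frequency n, which the cutoff removes; it
      vanishes in the limit at each time at which that norm is finite.\<close>
    let ?T = "\<lambda>n. \<integral>\<^sup>+z. ennreal (norm z) * en (U t z) * indicator {z. norm z > real n} z \<partial>lborel"
    have bd: "X1 (\<lambda>z. en (cut n (U (real (k n t) / real (m n))) z - U t z)) \<le> ennreal (1 / real (Suc n)) + ?T n" if n: "t \<le> real n" for n
    proof -
      let ?s = "real (k n t) / real (m n)"
      have fl: "real (k n t) = of_int \<lfloor>real (m n) * t\<rfloor>" using n t by (simp add: k_def min_def)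
      have kt: "real (k n t) \<le> real (m n) * t" "real (m n) * t < real (k n t) + 1" unfolding fl by linarith+
      have "t \<le> (real (k n t) + 1) / real (m n)"
        using kt(2) m(1)[of n] by (simp add: pos_le_divide_eq mult.commute)
      then have s: "0 \<le> ?s" "?s \<le> t" "t - ?s \<le> 1 / real (m n)"
        using kt(1) m(1)[of n] by (simp_all add: pos_divide_le_eq mult.commute add_divide_distrib)
      have X: "Xm (\<lambda>z. en (U ?s z - U t z)) \<le> ennreal (1 / real (Suc n) ^ 3)"
        by (rule m(2)) (use s n t in auto)
      have "X1 (\<lambda>z. en (cut n (U ?s) z - U t z)) \<le> (\<integral>\<^sub>Lz. ennreal (norm z) * en (cut n (\<lambda>z. U ?s z - U t z) z) + ennreal (norm z) * en (U t z) * indicator {z. norm z > real n} z)"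
        unfolding X1_def by (intro nn_integral_mono) (auto simp: cut_def indicator_def)
      also have "\<dots> = X1 (\<lambda>z. en (cut n (\<lambda>z. U ?s z - U t z) z)) + ?T n"
        unfolding X1_def by (rule nn_integral_add) measurable
      also have "X1 (\<lambda>z. en (cut n (\<lambda>z. U ?s z - U t z) z)) \<le> ennreal (real n ^ 2) * ennreal (1 / real (Suc n) ^ 3)"
        by (rule order_trans[OF cut_X1 mult_left_mono[OF X]]) (rule borel_measurable_diff[OF meas(3) meas(3)], simp)
      also have "\<dots> = ennreal (real n ^ 2 * (1 / real (Suc n) ^ 3))" by (rule ennreal_mult[symmetric]) auto
      also have "\<dots> \<le> ennreal (1 / real (Suc n))"
      proof (rule ennreal_leI)
        have "real n ^ 2 * (1 / real (Suc n) ^ 3) \<le> real (Suc n) ^ 2 * (1 / real (Suc n) ^ 3)"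
          by (intro mult_right_mono power_mono) auto
        also have "\<dots> = 1 / real (Suc n)" by (simp add: power2_eq_square power3_eq_cube del: of_nat_Suc)
        finally show "real n ^ 2 * (1 / real (Suc n) ^ 3) \<le> 1 / real (Suc n)" .
      qed
      finally show ?thesis by (simp add: add_right_mono)
    qed
    have T0: "?T \<longlonglongrightarrow> (\<integral>\<^sup>+z. 0 \<partial>(lborel :: (real^3) measure))"
    proof (rule nn_integral_dominated_convergence[where w="\<lambda>z. ennreal (norm z) * en (U t z)"])
      show "(\<integral>\<^sub>Lz. ennreal (norm z) * en (U t z)) < \<infinity>" using fin by (simp add: X1_def)
      show "AE z in lborel. (\<lambda>n. ennreal (norm z) * en (U t z) * indicator {z. norm z > real n} z) \<longlonglongrightarrow> 0"
      proof (rule AE_I2)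
        fix z :: "real^3"
        obtain N where "norm z \<le> real N" using real_arch_simple by blast
        then have "ennreal (norm z) * en (U t z) * indicator {z. norm z > real n} z = 0" if "n \<ge> N" for n
          using that by (auto simp: indicator_def)
        then show "(\<lambda>n. ennreal (norm z) * en (U t z) * indicator {z. norm z > real n} z) \<longlonglongrightarrow> 0"
          by (intro tendsto_eventually) (auto simp: eventually_sequentially)
      qed
    qed (measurable, auto simp: indicator_def)
    have "(\<lambda>n. ennreal (1 / real (Suc n))) \<longlonglongrightarrow> ennreal 0"
      using LIMSEQ_inverse_real_of_nat unfolding inverse_eq_divide by (intro tendsto_ennrealI)
    from tendsto_add[OF this T0] have lim0: "(\<lambda>n. ennreal (1 / real (Suc n)) + ?T n) \<longlonglongrightarrow> 0" by simp
    obtain N where N: "t \<le> real N" using real_arch_simple by blast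
    have "(\<lambda>n. X1 (\<lambda>z. en (cut n (U (real (k n t) / real (m n))) z - U t z))) \<longlonglongrightarrow> 0"
    proof (rule tendsto_sandwich[OF _ _ tendsto_const lim0])
      show "\<forall>\<^sub>F n in sequentially. X1 (\<lambda>z. en (cut n (U (real (k n t) / real (m n))) z - U t z)) \<le> ennreal (1 / real (Suc n)) + ?T n"
        unfolding eventually_sequentially using N bd by (intro exI[of _ N]) (auto intro!: bd simp del: of_nat_Suc)
    qed simp
    then show ?thesis unfolding c using tendsto_enn2real[of _ 0] by simp
  qed
  have aeL: "AE t in lebesgue_on {0..}. X1 (nrm (U t)) < \<infinity>"
    using AE_completion[OF X1_AE] by (simp add: AE_restrict_space_iff)
  have aepos: "AE t in lebesgue_on {0..}. t \<ge> (0::real)" by (rule AE_I2) simp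
  show ?thesis
    unfolding L1_chi_def
  proof safe
    show "AE t in lebesgue_on {0..}. vift (U t) \<in> chi 1"
      using aeL aepos by eventually_elim (use chi_frepv(2)[OF frepv_U] in auto)
    show "\<exists>\<sigma>. (\<forall>n. simple_function (lebesgue_on {0..}) (\<sigma> n) \<and> (\<forall>t\<ge>0. \<sigma> n t \<in> chi 1)) \<and>
        (AE t in lebesgue_on {0..}. (\<lambda>n. chi_norm 1 (\<sigma> n t - vift (U t))) \<longlonglongrightarrow> 0)"
    proof (intro exI[of _ "\<lambda>n t. S n (k n t)"] conjI allI impI simp Schi)
      show "AE t in lebesgue_on {0..}. (\<lambda>n. chi_norm 1 (S n (k n t) - vift (U t))) \<longlonglongrightarrow> 0"
        using aeL aepos by eventually_elim (rule conv)
    qed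
    show "integrable (lebesgue_on {0..}) (\<lambda>t. chi_norm 1 (vift (U t)))"
    proof (rule lebesgue_on_transfer(1)[where J="\<lambda>t. enn2real (X1 (nrm (U t)))"])
      show "integrable lborel (\<lambda>s. indicat_real {0..} s *\<^sub>R enn2real (X1 (nrm (U s))))"
      proof (rule integrableI_nonneg)
        have "(\<integral>\<^sub>Ls. ennreal (indicat_real {0..} s *\<^sub>R enn2real (X1 (nrm (U s))))) = lint {0..} (\<lambda>s. X1 (nrm (U s)))"
          using X1_AE by (intro nn_integral_cong_AE, eventually_elim) (auto simp: indicator_def)
        then show "(\<integral>\<^sub>Ls. ennreal (indicat_real {0..} s *\<^sub>R enn2real (X1 (nrm (U s))))) < \<infinity>" using U1 by simp
      qed auto
      show "AE s in lborel. s \<in> {0..} \<longrightarrow> chi_norm 1 (vift (U s)) = enn2real (X1 (nrm (U s)))"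
        using chi_norm_frepv(2)[OF frepv_U(1)] by (intro AE_I2) auto
    qed simp
  qed
qed

lemma weak_form:
  assumes f: "f \<in> schwartz" and t: "t \<ge> 0"
  shows "integrable lborel (\<lambda>s. indicator {0..t} s *\<^sub>R (LBINT z. H s z $ i * f z))"
    and "(LBINT z. U t z $ i * f z) - (LBINT z. U 0 z $ i * f z) =
      (LBINT s. indicator {0..t} s *\<^sub>R (LBINT z. H s z $ i * f z))"
proof -
  have [measurable]: "bm f" by (rule schwartz_measurable[OF f])
  let ?g = "\<lambda>s z. indicat_real {0..t} s *\<^sub>R (H s z $ i * f z)"
  note gi = pairing_integrable[OF jH Hint[OF t] f, of i]
  have inner: "(LBINT z. ?g s z) = indicator {0..t} s *\<^sub>R (LBINT z. H s z $ i * f z)" for s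
    by (rule integral_scaleR_right)
  show "integrable lborel (\<lambda>s. indicator {0..t} s *\<^sub>R (LBINT z. H s z $ i * f z))"
    using lborel_pair.integrable_fst[OF gi] unfolding inner .
  have Ui: "integrable lborel (\<lambda>z. U s z $ i * f z)" if "s \<ge> 0" for s
    using frepD(1)[OF frepv_U(1)[OF that, unfolded frepv_def, rule_format] f] .
  have "(LBINT z. U t z $ i * f z) - (LBINT z. U 0 z $ i * f z) = (LBINT z. U t z $ i * f z - U 0 z $ i * f z)"
    by (rule LINT_diff[symmetric]) (use Ui t in auto)
  also have "\<dots> = (LBINT z. LBINT s. ?g s z)"
  proof (rule LINT_cong_AE)
    show "AE z in lborel. U t z $ i * f z - U 0 z $ i * f z = (LBINT s. ?g s z)"
      using evol[OF t]
    proof eventually_elim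
      case (elim z)
      have "(U t z - U 0 z) $ i = (LBINT s. (indicator {0..t} s *\<^sub>R H s z) $ i)"
        using elim integral_bounded_linear[OF bounded_linear_vec_nth[of i], of lborel "\<lambda>s. indicator {0..t} s *\<^sub>R H s z"] by simp
      then have "(U t z - U 0 z) $ i * f z = (LBINT s. (indicator {0..t} s *\<^sub>R H s z) $ i * f z)"
        by (simp only: integral_mult_left_zero)
      then show ?case by (simp add: left_diff_distrib)
    qed
  qed measurable
  also have "\<dots> = (LBINT s. LBINT z. ?g s z)"
    by (rule lborel_pair.Fubini_integral[OF gi])
  finally show "(LBINT z. U t z $ i * f z) - (LBINT z. U 0 z $ i * f z) =
      (LBINT s. indicator {0..t} s *\<^sub>R (LBINT z. H s z $ i * f z))"
    unfolding inner .
qed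

end

subsection \<open>Bilinearity\<close>

lemma vbilin_scaleR:
  "vbilin (\<lambda>z. r *\<^sub>R a z) b \<zeta> = r *\<^sub>R vbilin a b \<zeta>" "vbilin a (\<lambda>z. r *\<^sub>R b z) \<zeta> = r *\<^sub>R vbilin a b \<zeta>"
  unfolding vbilin_def bilin_def vec_eq_iff
  by (auto simp flip: integral_scaleR_right simp: dotc_scaleR scaleR_conv_of_real[where 'a=complex] mult_ac)

lemma cv_mono: "(\<And>\<eta>. f \<eta> \<le> f' \<eta>) \<Longrightarrow> (\<And>\<eta>. g \<eta> \<le> g' \<eta>) \<Longrightarrow> cv f g z \<le> cv f' g' z"
  unfolding cv_def by (intro nn_integral_mono mult_mono) auto

lemma vbilin_integrable:
  assumes [measurable]: "bm a" "bm b"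
    and a: "\<And>\<eta>. en (a \<eta>) \<le> G \<eta>" and b: "\<And>\<eta>. en (b \<eta>) \<le> G \<eta>" and fin: "cv G G \<zeta> < \<infinity>"
  shows "integrable lborel (\<lambda>\<eta>. \<i> * dotc \<zeta> (a (\<zeta> - \<eta>)) * b \<eta> $ i / cor ((2 * pi) ^ 3))"
proof (rule bilin_integrable)
  have "(\<integral>\<^sub>L\<eta>. en (a (\<zeta> - \<eta>)) * en (b \<eta> $ i)) \<le> cv G G \<zeta>"
    unfolding cv_def
    by (intro nn_integral_mono mult_mono a order_trans[OF _ b] ennreal_leI Finite_Cartesian_Product.norm_nth_le) auto
  then show "(\<integral>\<^sub>L\<eta>. en (a (\<zeta> - \<eta>)) * en (b \<eta> $ i)) < \<infinity>" using fin by (rule le_less_trans)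
qed measurable

lemma vbilin_add:
  assumes m: "bm a" "bm b" "bm c"
    and G: "\<And>\<eta>. en (a \<eta>) \<le> G \<eta>" "\<And>\<eta>. en (b \<eta>) \<le> G \<eta>" "\<And>\<eta>. en (c \<eta>) \<le> G \<eta>" and fin: "cv G G \<zeta> < \<infinity>"
  shows "vbilin (\<lambda>z. a z + b z) c \<zeta> = vbilin a c \<zeta> + vbilin b c \<zeta>"
    and "vbilin c (\<lambda>z. a z + b z) \<zeta> = vbilin c a \<zeta> + vbilin c b \<zeta>"
proof -
  note i = vbilin_integrable[OF _ _ _ _ fin]
  have "bilin (\<lambda>z. a z + b z) (\<lambda>\<eta>. c \<eta> $ i) \<zeta> = bilin a (\<lambda>\<eta>. c \<eta> $ i) \<zeta> + bilin b (\<lambda>\<eta>. c \<eta> $ i) \<zeta>" for i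
    unfolding bilin_def LINT_add[OF i[OF m(1,3) G(1,3)] i[OF m(2,3) G(2,3)], symmetric]
    by (simp add: dotc_add distrib_left distrib_right add_divide_distrib)
  then show "vbilin (\<lambda>z. a z + b z) c \<zeta> = vbilin a c \<zeta> + vbilin b c \<zeta>" by (simp add: vbilin_def vec_eq_iff)
  have "bilin c (\<lambda>\<eta>. (a \<eta> + b \<eta>) $ i) \<zeta> = bilin c (\<lambda>\<eta>. a \<eta> $ i) \<zeta> + bilin c (\<lambda>\<eta>. b \<eta> $ i) \<zeta>" for i
    unfolding bilin_def LINT_add[OF i[OF m(3,1) G(3,1)] i[OF m(3,2) G(3,2)], symmetric]
    by (simp add: distrib_left add_divide_distrib)
  then show "vbilin c (\<lambda>z. a z + b z) \<zeta> = vbilin c a \<zeta> + vbilin c b \<zeta>" by (simp add: vbilin_def vec_eq_iff)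
qed

text \<open>The double divergence of a tensor product is symmetric: contracting with \<zeta> gives
  the integral of (\<zeta> . a(\<zeta> - \<eta>)) (\<zeta> . b(\<eta>)), invariant under \<eta>
  \<mapsto> \<zeta> - \<eta>. Hence the nonlinearity of the magnetic equation is divergence free
  without a projection.\<close>

lemma dotc_vbilin_commute:
  assumes m[measurable]: "bm a" "bm b"
    and G: "\<And>\<eta>. en (a \<eta>) \<le> G \<eta>" "\<And>\<eta>. en (b \<eta>) \<le> G \<eta>" and fin: "cv G G \<zeta> < \<infinity>"
  shows "dotc \<zeta> (vbilin a b \<zeta>) = dotc \<zeta> (vbilin b a \<zeta>)"
proof -
  let ?c = "cor ((2 * pi) ^ 3)"
  have d: "dotc \<zeta> (vbilin a b \<zeta>) = (LBINT \<eta>. \<i> * dotc \<zeta> (a (\<zeta> - \<eta>)) * dotc \<zeta> (b \<eta>) / ?c)"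
    if "bm a" "bm b" "\<And>\<eta>. en (a \<eta>) \<le> G \<eta>" "\<And>\<eta>. en (b \<eta>) \<le> G \<eta>" for a b
  proof -
    have "dotc \<zeta> (vbilin a b \<zeta>) = (\<Sum>j\<in>UNIV. LBINT \<eta>. cor (\<zeta> $ j) * (\<i> * dotc \<zeta> (a (\<zeta> - \<eta>)) * b \<eta> $ j / ?c))"
      unfolding dotc_def[of \<zeta> "vbilin a b \<zeta>"] by (simp only: vbilin_def bilin_def vec_lambda_beta integral_mult_right_zero)
    also have "\<dots> = (LBINT \<eta>. (\<Sum>j\<in>UNIV. cor (\<zeta> $ j) * (\<i> * dotc \<zeta> (a (\<zeta> - \<eta>)) * b \<eta> $ j / ?c)))"
      by (rule LINT_sum[symmetric], rule integrable_mult_right, rule vbilin_integrable[OF that fin])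
    also have "\<dots> = (LBINT \<eta>. \<i> * dotc \<zeta> (a (\<zeta> - \<eta>)) * dotc \<zeta> (b \<eta>) / ?c)"
    proof (rule LINT_cong[OF refl])
      fix \<eta>
      show "(\<Sum>j\<in>UNIV. cor (\<zeta> $ j) * (\<i> * dotc \<zeta> (a (\<zeta> - \<eta>)) * b \<eta> $ j / ?c)) = \<i> * dotc \<zeta> (a (\<zeta> - \<eta>)) * dotc \<zeta> (b \<eta>) / ?c"
        unfolding dotc_def[of \<zeta> "b \<eta>"] sum_distrib_left sum_divide_distrib by (simp add: mult_ac)
    qed
    finally show ?thesis .
  qed
  have "dotc \<zeta> (vbilin a b \<zeta>) = (LBINT \<eta>. \<i> * dotc \<zeta> (a (\<zeta> - (\<zeta> - \<eta>))) * dotc \<zeta> (b (\<zeta> - \<eta>)) / ?c)"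
    unfolding d[OF m G] by (rule lborel_integral_reflect[symmetric]) measurable
  also have "\<dots> = dotc \<zeta> (vbilin b a \<zeta>)" unfolding d[OF m(2,1) G(2,1)] by (simp add: mult_ac)
  finally show ?thesis .
qed

lemma leray_id: "dotc z v = 0 \<Longrightarrow> leray z v = v"
  by (simp add: leray_def vec_eq_iff)

lemma leray_scaleR: "leray z (r *\<^sub>R v) = r *\<^sub>R leray z v"
  by (simp add: leray_def vec_eq_iff dotc_scaleR scaleR_diff_right scaleR_conv_of_real[where 'a=complex])

lemma leray_add: "leray z (v + w) = leray z v + leray z w"
  by (simp add: leray_def vec_eq_iff dotc_add add_divide_distrib distrib_right)

subsection \<open>Velocity and magnetic field from the Elsasser variables\<close>

text \<open>\<open>HU\<close> and \<open>HB\<close> are the time derivatives of velocity and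
  magnetic field in Fourier variables. The projector in \<open>HU\<close> has eliminated the
  pressure; \<open>HB\<close> has no pressure and needs none.\<close>

definition HU :: "real \<Rightarrow> vfield \<Rightarrow> vfield \<Rightarrow> vfield" where
  "HU \<mu> u b z = - ((\<mu> * (norm z)\<^sup>2) *\<^sub>R u z) - leray z (vbilin u u z - vbilin b b z)"

definition HB :: "real \<Rightarrow> vfield \<Rightarrow> vfield \<Rightarrow> vfield" where
  "HB \<mu> u b z = - ((\<mu> * (norm z)\<^sup>2) *\<^sub>R b z) - (vbilin u b z - vbilin b u z)"

lemma H_measurable [measurable (raw)]:
  assumes [measurable]: "jm u" "jm b" "f \<in> borel_measurable M" "g \<in> borel_measurable M"
  shows "(\<lambda>x. HU \<mu> (u (f x)) (b (f x)) (g x)) \<in> borel_measurable M" "(\<lambda>x. HB \<mu> (u (f x)) (b (f x)) (g x)) \<in> borel_measurable M"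
  unfolding HU_def HB_def by measurable

lemma vbilin_diff_norm:
  assumes m: "bm a" "bm b" "bm c" "bm d"
    and G: "\<And>\<eta>. en (a \<eta>) \<le> G \<eta>" "\<And>\<eta>. en (b \<eta>) \<le> G \<eta>" "\<And>\<eta>. en (c \<eta>) \<le> G \<eta>" "\<And>\<eta>. en (d \<eta>) \<le> G \<eta>"
  shows "en (vbilin a b z - vbilin c d z) \<le> ennreal (norm z / 12) * cv G G z"
proof -
  have 1: "en (vbilin a b z) \<le> ennreal (norm z / 24) * cv G G z" if "bm a" "bm b"
    "\<And>\<eta>. en (a \<eta>) \<le> G \<eta>" "\<And>\<eta>. en (b \<eta>) \<le> G \<eta>" for a b
    by (rule order_trans[OF vbilin_bound[OF that(1,2)] mult_left_mono[OF cv_mono]]) (auto simp: that)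
  have "en (vbilin a b z - vbilin c d z) \<le> ennreal (norm z / 24) * cv G G z + ennreal (norm z / 24) * cv G G z"
    by (rule order_trans[OF en_triangle(2) add_mono[OF 1[OF m(1,2) G(1,2)] 1[OF m(3,4) G(3,4)]]])
  also have "\<dots> = (ennreal (norm z / 24) + ennreal (norm z / 24)) * cv G G z" by (simp only: distrib_right)
  also have "ennreal (norm z / 24) + ennreal (norm z / 24) = ennreal (norm z / 12)" by (subst ennreal_plus[symmetric]) auto
  finally show ?thesis .
qed

text \<open>After division by |z| the viscous term is an \<open>X1\<close> norm and the nonlinear
  one the L^1 norm of a convolution; the crude constants are absorbed since 10 / 12 < 1.\<close>

lemma H_bound:
  assumes m[measurable]: "bm u" "bm b" "bm G"
    and G: "\<And>\<eta>. en (u \<eta>) \<le> G \<eta>" "\<And>\<eta>. en (b \<eta>) \<le> G \<eta>" and \<mu>: "\<mu> > 0"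
  shows "Xm (nrm (HU \<mu> u b)) \<le> ennreal \<mu> * X1 G + (X0 G)\<^sup>2" "Xm (nrm (HB \<mu> u b)) \<le> ennreal \<mu> * X1 G + (X0 G)\<^sup>2"
proof -
  have cvm[measurable]: "bm (cv G G)" unfolding cv_def by measurable
  have gen: "Xm (nrm h) \<le> ennreal \<mu> * X1 G + (X0 G)\<^sup>2"
    if h: "\<And>z. en (h z) \<le> ennreal (\<mu> * (norm z)\<^sup>2) * G z + ennreal (norm z) * cv G G z" for h :: "vfield"
  proof -
    have "Xm (nrm h) \<le> (\<integral>\<^sub>Lz. ennreal \<mu> * (ennreal (norm z) * G z) + cv G G z)"
      unfolding Xm_def
    proof (rule nn_integral_mono)
      fix z :: "real^3"
      let ?k = "ennreal (inverse (norm z))"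
      have "?k * en (h z) \<le> ?k * (ennreal (\<mu> * (norm z)\<^sup>2) * G z + ennreal (norm z) * cv G G z)"
        by (intro mult_left_mono h) simp
      also have "\<dots> = (?k * ennreal (\<mu> * (norm z)\<^sup>2)) * G z + (?k * ennreal (norm z)) * cv G G z"
        by (simp only: distrib_left mult.assoc)
      also have "?k * ennreal (\<mu> * (norm z)\<^sup>2) = ennreal \<mu> * ennreal (norm z)"
        using \<mu> by (cases "z = 0") (simp_all add: power2_eq_square flip: ennreal_mult)
      also have "(?k * ennreal (norm z)) * cv G G z \<le> 1 * cv G G z"
        by (rule mult_right_mono) (cases "z = 0", simp_all flip: ennreal_mult)
      finally show "?k * en (h z) \<le> ennreal \<mu> * (ennreal (norm z) * G z) + cv G G z"
        by (simp add: mult.assoc add_left_mono)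
    qed
    also have "\<dots> = ennreal \<mu> * X1 G + X0 (cv G G)"
      unfolding X1_def X0_def by (subst nn_integral_add) (auto intro: nn_integral_cmult)
    finally show ?thesis by (simp add: X0_cv power2_eq_square)
  qed
  have lin: "en (- ((\<mu> * (norm z)\<^sup>2) *\<^sub>R v)) \<le> ennreal (\<mu> * (norm z)\<^sup>2) * G z" if "en v \<le> G z" for v :: "complex^3" and z
    using mult_left_mono[OF that, of "ennreal (\<mu> * (norm z)\<^sup>2)"] \<mu> by (simp add: abs_mult ennreal_mult)
  show "Xm (nrm (HU \<mu> u b)) \<le> ennreal \<mu> * X1 G + (X0 G)\<^sup>2"
  proof (rule gen)
    fix z
    have "en (leray z (vbilin u u z - vbilin b b z)) \<le> ennreal 10 * en (vbilin u u z - vbilin b b z)"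
      by (subst ennreal_mult[symmetric]) (auto intro!: ennreal_leI norm_leray_le)
    also have "\<dots> \<le> ennreal 10 * (ennreal (norm z / 12) * cv G G z)"
      by (intro mult_left_mono vbilin_diff_norm m G) auto
    also have "\<dots> = ennreal (10 * (norm z / 12)) * cv G G z" by (simp only: mult.assoc[symmetric], subst ennreal_mult[symmetric]) auto
    also have "\<dots> \<le> ennreal (norm z) * cv G G z" by (intro mult_right_mono ennreal_leI) auto
    finally show "en (HU \<mu> u b z) \<le> ennreal (\<mu> * (norm z)\<^sup>2) * G z + ennreal (norm z) * cv G G z"
      unfolding HU_def by - (rule order_trans[OF en_triangle(2)], intro add_mono lin G)
  qed
  show "Xm (nrm (HB \<mu> u b)) \<le> ennreal \<mu> * X1 G + (X0 G)\<^sup>2"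
  proof (rule gen)
    fix z
    have "en (vbilin u b z - vbilin b u z) \<le> ennreal (norm z / 12) * cv G G z"
      by (intro vbilin_diff_norm m G)
    also have "\<dots> \<le> ennreal (norm z) * cv G G z" by (intro mult_right_mono ennreal_leI) auto
    finally show "en (HB \<mu> u b z) \<le> ennreal (\<mu> * (norm z)\<^sup>2) * G z + ennreal (norm z) * cv G G z"
      unfolding HB_def by - (rule order_trans[OF en_triangle(2)], intro add_mono lin G)
  qed
qed

text \<open>T = u + \<sigma> b and F = u - \<sigma> b, where the sign \<sigma> decides which
  combination is called F. Polarization turns the quadratic terms into (FT + TF) / 2 and \<sigma>
  (FT - TF) / 2. The second is divergence free by \<open>dotc_vbilin_commute\<close>, so the
  projectors in V drop out of the magnetic equation.\<close>

lemma elsasser: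
  fixes T F :: "vfield" and \<sigma> \<nu> m :: real
  assumes m: "bm T" "bm F" and [measurable]: "bm G"
    and G: "\<And>\<eta>. en (T \<eta>) \<le> G \<eta>" "\<And>\<eta>. en (F \<eta>) \<le> G \<eta>" and fin: "cv G G z < \<infinity>" and \<sigma>: "\<sigma> * \<sigma> = 1"
  defines "u \<equiv> \<lambda>z. (1 / 2) *\<^sub>R (T z + F z)" and "b \<equiv> \<lambda>z. (\<sigma> / 2) *\<^sub>R (T z + (- 1) *\<^sub>R F z)"
  defines "V \<equiv> \<lambda>a b. vsrc m a b z - (\<nu> * (norm z)\<^sup>2) *\<^sub>R a z"
  shows "HU (\<nu> + m) u b z = (1 / 2) *\<^sub>R (V T F + V F T)" "HB (\<nu> - m) u b z = (\<sigma> / 2) *\<^sub>R (V T F + (- 1) *\<^sub>R V F T)"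
proof -
  have m1: "bm (\<lambda>z. (- 1) *\<^sub>R F z)" using m by measurable
  have G1: "en ((- 1) *\<^sub>R F \<eta>) \<le> G \<eta>" for \<eta> using G by simp
  have mm: "bm (\<lambda>z. T z + F z)" "bm (\<lambda>z. T z + (- 1) *\<^sub>R F z)" using m by measurable
  \<comment> \<open>Twice the majorant also dominates the sums and differences of T and F, so a
    single finite convolution justifies every expansion below.\<close>
  define G2 where "G2 \<eta> = 2 * G \<eta>" for \<eta>
  have G2: "G \<eta> \<le> G2 \<eta>" "en (T \<eta> + F \<eta>) \<le> G2 \<eta>" "en (T \<eta> + (- 1) *\<^sub>R F \<eta>) \<le> G2 \<eta>" for \<eta>
  proof -
    show "G \<eta> \<le> G2 \<eta>" unfolding G2_def mult_2 by simp
    show "en (T \<eta> + F \<eta>) \<le> G2 \<eta>" unfolding G2_def mult_2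
      by (rule order_trans[OF en_triangle(1) add_mono[OF G]])
    show "en (T \<eta> + (- 1) *\<^sub>R F \<eta>) \<le> G2 \<eta>" unfolding G2_def mult_2
      by (rule order_trans[OF en_triangle(1) add_mono[OF G(1) G1]])
  qed
  have fin2: "cv G2 G2 z < \<infinity>"
  proof -
    have "cv G2 G2 z = (\<integral>\<^sub>L\<eta>. 2 * 2 * (G (z - \<eta>) * G \<eta>))"
      unfolding cv_def G2_def by (simp only: mult_ac)
    also have "\<dots> = 2 * 2 * cv G G z"
      unfolding cv_def by (rule nn_integral_cmult) measurable
    finally show ?thesis using fin by (auto simp: ennreal_mult_less_top intro: le_less_trans)
  qed
  have T2: "en (T \<eta>) \<le> G2 \<eta>" "en (F \<eta>) \<le> G2 \<eta>" "en ((- 1) *\<^sub>R F \<eta>) \<le> G2 \<eta>" for \<eta>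
    using G G1 G2(1) order_trans by blast+
  let ?TT = "vbilin T T z" and ?TF = "vbilin T F z" and ?FT = "vbilin F T z" and ?FF = "vbilin F F z"
  have uu: "vbilin u u z = (1 / 2 * (1 / 2)) *\<^sub>R (?TT + ?FT + (?TF + ?FF))"
    unfolding u_def vbilin_scaleR vbilin_add(2)[OF m mm(1) T2(1,2) G2(2) fin2]
      vbilin_add(1)[OF m m(1) T2(1,2) T2(1) fin2] vbilin_add(1)[OF m m(2) T2(1,2) T2(2) fin2]
    by simp
  have bb: "vbilin b b z = (1 / 2 * (1 / 2)) *\<^sub>R (?TT + (- 1) *\<^sub>R ?FT + (- 1) *\<^sub>R (?TF + (- 1) *\<^sub>R ?FF))"
    unfolding b_def vbilin_scaleR vbilin_add(2)[OF m(1) m1 mm(2) T2(1,3) G2(3) fin2]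
      vbilin_add(1)[OF m(1) m1 m(1) T2(1,3) T2(1) fin2] vbilin_add(1)[OF m(1) m1 m(2) T2(1,3) T2(2) fin2] scaleR_scaleR
    using \<sigma> by (simp add: mult.assoc)
  have ub: "vbilin u b z = (1 / 2 * (\<sigma> / 2)) *\<^sub>R (?TT + ?FT + (- 1) *\<^sub>R (?TF + ?FF))"
    unfolding u_def b_def vbilin_scaleR vbilin_add(2)[OF m(1) m1 mm(1) T2(1,3) G2(2) fin2]
      vbilin_add(1)[OF m m(1) T2(1,2) T2(1) fin2] vbilin_add(1)[OF m m(2) T2(1,2) T2(2) fin2] by (simp add: mult.commute)
  have bu: "vbilin b u z = (1 / 2 * (\<sigma> / 2)) *\<^sub>R (?TT + (- 1) *\<^sub>R ?FT + (?TF + (- 1) *\<^sub>R ?FF))"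
    unfolding u_def b_def vbilin_scaleR vbilin_add(2)[OF m mm(2) T2(1,2) G2(3) fin2]
      vbilin_add(1)[OF m(1) m1 m(1) T2(1,3) T2(1) fin2] vbilin_add(1)[OF m(1) m1 m(2) T2(1,3) T2(2) fin2] by (simp add: mult.commute)
  have N1: "vbilin u u z - vbilin b b z = (1 / 2) *\<^sub>R (?FT + ?TF)"
    unfolding uu bb by (simp add: vec_eq_iff scaleR_conv_of_real[where 'a=complex] algebra_simps)
  have N2: "vbilin u b z - vbilin b u z = (\<sigma> / 2) *\<^sub>R (?FT - ?TF)"
    unfolding ub bu by (simp add: vec_eq_iff scaleR_conv_of_real[where 'a=complex] algebra_simps)
  have "dotc z ?FT = dotc z ?TF" by (rule dotc_vbilin_commute[OF m(2,1) G(2,1) fin])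
  then have L: "leray z (?FT - ?TF) = ?FT - ?TF" by (intro leray_id) (simp add: dotc_diff)
  show "HU (\<nu> + m) u b z = (1 / 2) *\<^sub>R (V T F + V F T)"
    unfolding HU_def N1 V_def vsrc_def leray_scaleR leray_add
    by (simp add: u_def vec_eq_iff scaleR_conv_of_real[where 'a=complex] algebra_simps)
  have "V T F + (- 1) *\<^sub>R V F T = ((\<nu> - m) * (norm z)\<^sup>2) *\<^sub>R (F z - T z) - leray z (?FT - ?TF)"
    unfolding V_def vsrc_def leray_diff by (simp add: vec_eq_iff scaleR_conv_of_real[where 'a=complex] algebra_simps)
  then have V: "V T F + (- 1) *\<^sub>R V F T = ((\<nu> - m) * (norm z)\<^sup>2) *\<^sub>R (F z - T z) - (?FT - ?TF)" unfolding L .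
  show "HB (\<nu> - m) u b z = (\<sigma> / 2) *\<^sub>R (V T F + (- 1) *\<^sub>R V F T)"
    unfolding HB_def N2 V by (simp add: b_def vec_eq_iff scaleR_conv_of_real[where 'a=complex] algebra_simps)
qed

lemma X_add:
  assumes [measurable]: "bm f" "bm g"
  shows "Xm (\<lambda>z. f z + g z) = Xm f + Xm g" "X0 (\<lambda>z. f z + g z) = X0 f + X0 g" "X1 (\<lambda>z. f z + g z) = X1 f + X1 g"
  unfolding Xm_def X0_def X1_def by (simp_all add: distrib_left nn_integral_add)

text \<open>By interpolation (X0 G)^2 is integrable in time. It is the L^1 norm of the
  self-convolution of G, so Tonelli gives finiteness at almost every frequency and time.\<close>

lemma cv_finite_AE:
  assumes jG[measurable]: "jm G" and B: "\<And>s. s \<ge> 0 \<Longrightarrow> Xm (G s) \<le> ennreal B" and "B \<ge> 0" and G1: "lint {0..} (\<lambda>s. X1 (G s)) < \<infinity>"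
  shows "lint {0..} (\<lambda>s. (X0 (G s))\<^sup>2) < \<infinity>"
    and "AE z in lborel. AE s in lborel. s \<in> {0..} \<longrightarrow> cv (G s) (G s) z < \<infinity>"
    and "AE z in lborel. (lint {0..} (\<lambda>s. cv (G s) (G s) z)) \<noteq> \<infinity>"
proof -
  have [measurable]: "bm (G s)" for s by (rule jm_section[OF jG])
  obtain E where E: "lint {0..} (\<lambda>s. X1 (G s)) = ennreal E" "E \<ge> 0" using G1 by (cases "\<integral>\<^sup>+s\<in>{0..}. X1 (G s) \<partial>lborel") auto
  have "lint {0..} (\<lambda>s. (X0 (G s))\<^sup>2) \<le> ennreal (B * E)"
    by (rule X0_square_integral[OF jG B]) (use E \<open>B \<ge> 0\<close> in auto)
  then show fin: "lint {0..} (\<lambda>s. (X0 (G s))\<^sup>2) < \<infinity>" by (rule le_less_trans) simp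
  have "(\<integral>\<^sub>Lz. (lint {0..} (\<lambda>s. cv (G s) (G s) z))) = (\<integral>\<^sub>Ls. (\<integral>\<^sub>Lz. cv (G s) (G s) z * indicator {0..} s))"
    by (rule lborel_pair.Fubini') (unfold cv_def, measurable)
  also have "\<dots> = lint {0..} (\<lambda>s. (X0 (G s))\<^sup>2)"
  proof (rule nn_integral_cong)
    fix s
    have [measurable]: "bm (cv (G s) (G s))" unfolding cv_def by measurable
    show "(\<integral>\<^sub>Lz. cv (G s) (G s) z * indicator {0..} s) = (X0 (G s))\<^sup>2 * indicator {0..} s"
      by (subst nn_integral_multc) (auto simp: X0_cv[of "G s" "G s", unfolded X0_def] X0_def power2_eq_square)
  qed
  finally have "(\<integral>\<^sub>Lz. (lint {0..} (\<lambda>s. cv (G s) (G s) z))) \<noteq> \<infinity>" using fin by simp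
  then show ae: "AE z in lborel. (lint {0..} (\<lambda>s. cv (G s) (G s) z)) \<noteq> \<infinity>"
    by (intro nn_integral_PInf_AE) (unfold cv_def, measurable)
  show "AE z in lborel. AE s in lborel. s \<in> {0..} \<longrightarrow> cv (G s) (G s) z < \<infinity>" using ae
  proof eventually_elim
    case (elim z)
    have [measurable]: "bm (\<lambda>s. cv (G s) (G s) z)" unfolding cv_def by measurable
    have "AE s in lborel. cv (G s) (G s) z * indicator {0..} s \<noteq> \<infinity>"
      by (rule nn_integral_PInf_AE[OF _ elim]) measurable
    then show ?case by eventually_elim (auto simp: less_top)
  qed
qed

lemma H_integral_finite:
  assumes jG[measurable]: "jm G" and ju[measurable]: "jm u" and jb[measurable]: "jm b"
    and B: "\<And>s. s \<ge> 0 \<Longrightarrow> Xm (G s) \<le> ennreal B" and "B \<ge> 0" and G1: "lint {0..} (\<lambda>s. X1 (G s)) < \<infinity>"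
    and le: "\<And>s \<eta>. en (u s \<eta>) \<le> G s \<eta>" "\<And>s \<eta>. en (b s \<eta>) \<le> G s \<eta>" and \<mu>: "\<mu> > 0"
  shows "lint {0..t} (\<lambda>s. Xm (nrm (HU \<mu> (u s) (b s)))) < \<infinity>" "lint {0..t} (\<lambda>s. Xm (nrm (HB \<mu> (u s) (b s)))) < \<infinity>"
proof -
  have bd: "(\<integral>\<^sub>Ls. (ennreal \<mu> * (X1 (G s) * indicator {0..} s) + (X0 (G s))\<^sup>2 * indicator {0..} s)) < \<infinity>"
    by (subst nn_integral_add) (use cv_finite_AE(1)[OF jG _ \<open>B \<ge> 0\<close> G1] B G1 in \<open>auto simp: nn_integral_cmult ennreal_mult_less_top\<close>)
  have sec: "bm (u s)" "bm (b s)" "bm (G s)" for s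
    by (auto intro: jm_section ju jb jG)
  note hb = H_bound[OF sec le \<mu>]
  show "lint {0..t} (\<lambda>s. Xm (nrm (HU \<mu> (u s) (b s)))) < \<infinity>"
    by (rule le_less_trans[OF nn_integral_mono bd]) (use hb(1) in \<open>auto simp: indicator_def\<close>)
  show "lint {0..t} (\<lambda>s. Xm (nrm (HB \<mu> (u s) (b s)))) < \<infinity>"
    by (rule le_less_trans[OF nn_integral_mono bd]) (use hb(2) in \<open>auto simp: indicator_def\<close>)
qed

text \<open>The sign \<sigma> covers both alternatives of the smallness condition: \<sigma> = 1
  treats u0 - b0 as the small field and \<sigma> = - 1 treats u0 + b0 so.\<close>

theorem fourier_mhd:
  fixes u0 b0 :: "vfield" and \<sigma> :: real
  assumes m: "bm u0" "bm b0"
    and herm: "\<And>\<eta>. vcnj (u0 (- \<eta>)) = u0 \<eta>" "\<And>\<eta>. vcnj (b0 (- \<eta>)) = b0 \<eta>"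
    and div: "\<And>z. dotc z (u0 z) = 0" "\<And>z. dotc z (b0 z) = 0"
    and \<mu>: "\<mu>1 > 0" "\<mu>2 > 0" and \<sigma>: "\<sigma> * \<sigma> = 1"
    and D: "Xm (\<lambda>z. en (u0 z + \<sigma> *\<^sub>R b0 z)) = ennreal Dp" "Xm (\<lambda>z. en (u0 z - \<sigma> *\<^sub>R b0 z)) = ennreal Dm" "Dp \<ge> 0" "Dm \<ge> 0"
    and small: "(Dm + smallC * \<bar>(\<mu>1 - \<mu>2) / 2\<bar> / ((\<mu>1 + \<mu>2) / 2) * (\<bar>(\<mu>1 - \<mu>2) / 2\<bar> + Dp)) *
      exp (smallC / ((\<mu>1 + \<mu>2) / 2)\<^sup>2 * (\<bar>(\<mu>1 - \<mu>2) / 2\<bar> + Dp)\<^sup>2) < 2 * ((\<mu>1 + \<mu>2) / 2)"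
  obtains u b :: "real \<Rightarrow> vfield" and B :: real
  where "fourier_evolution u (\<lambda>s. HU \<mu>1 (u s) (b s)) B" "fourier_evolution b (\<lambda>s. HB \<mu>2 (u s) (b s)) B"
    and "\<And>t z. vcnj (u t (- z)) = u t z" "\<And>t z. vcnj (b t (- z)) = b t z"
    and "\<And>t z. dotc z (u t z) = 0" "\<And>t z. dotc z (b t z) = 0"
    and "AE z in lborel. u 0 z = u0 z" "AE z in lborel. b 0 z = b0 z"
proof -
  define \<nu> m' where "\<nu> = (\<mu>1 + \<mu>2) / 2" and "m' = (\<mu>1 - \<mu>2) / 2"
  have \<nu>: "\<nu> > 0" "\<mu>1 = \<nu> + m'" "\<mu>2 = \<nu> - m'" using \<mu> by (auto simp: \<nu>_def m'_def field_simps)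
  define w where "w c z = (if c then u0 z + \<sigma> *\<^sub>R b0 z else u0 z - \<sigma> *\<^sub>R b0 z)" for c :: bool and z
  have w: "bm (w c)" "vcnj (w c (- \<eta>)) = w c \<eta>" "dotc z (w c z) = 0" for c \<eta> z
  proof -
    show "bm (w c)" unfolding w_def using m by (cases c) auto
    show "vcnj (w c (- \<eta>)) = w c \<eta>" by (simp add: w_def herm)
    show "dotc z (w c z) = 0" by (simp add: w_def dotc_add dotc_diff dotc_scaleR div)
  qed
  have Dw: "Xm (nrm (w c)) = ennreal (if c then Dp else Dm)" "(if c then Dp else Dm) \<ge> 0" for c
    using D by (auto simp: w_def)
  obtain W B where W: "\<And>c. jm (W c)" "\<And>c t z. vcnj (W c t (- z)) = W c t z" "\<And>c t z. dotc z (W c t z) = 0"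
    and WB: "\<And>c s. s \<ge> 0 \<Longrightarrow> Xm (nrm (W c s)) \<le> ennreal B"
    and W1: "\<And>c. (lint {0..} (\<lambda>s. X1 (nrm (W c s)))) < \<infinity>"
    and We: "\<And>c t. t \<ge> 0 \<Longrightarrow> AE z in lborel.
      integrable lborel (\<lambda>s. indicator {0..t} s *\<^sub>R (vsrc m' (W c s) (W (\<not> c) s) z - (\<nu> * (norm z)\<^sup>2) *\<^sub>R W c s z)) \<and>
      W c t z = w c z + (LBINT s. indicator {0..t} s *\<^sub>R (vsrc m' (W c s) (W (\<not> c) s) z - (\<nu> * (norm z)\<^sup>2) *\<^sub>R W c s z))"
    using fourier_solution[where w=w and \<nu>=\<nu> and m=m' and D="\<lambda>c. if c then Dp else Dm", OF w \<nu>(1) Dw] small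
    unfolding \<nu>_def m'_def by auto
  define T F where "T = W True" and "F = W False"
  have jT[measurable]: "jm T" and jF[measurable]: "jm F" unfolding T_def F_def by (auto intro: W(1))
  have sec[measurable]: "bm (T s)" "bm (F s)" for s
    by (auto intro: jm_section jT jF)
  define u where "u s z = (1 / 2) *\<^sub>R (T s z + F s z)" for s z
  define b where "b s z = (\<sigma> / 2) *\<^sub>R (T s z + (- 1) *\<^sub>R F s z)" for s z
  define G where "G s z = en (T s z) + en (F s z)" for s z
  have ju[measurable]: "jm u" and jb[measurable]: "jm b" and jG[measurable]: "jm G" unfolding u_def b_def G_def by measurable
  have GT: "en (T s \<eta>) \<le> G s \<eta>" "en (F s \<eta>) \<le> G s \<eta>" for s \<eta> by (auto simp: G_def)
  have \<sigma>1: "\<bar>\<sigma>\<bar> = 1" using \<sigma> by (metis abs_1 abs_mult_self_eq abs_square_eq_1 power2_eq_square)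
  have half: "en ((c / 2) *\<^sub>R v) \<le> en v" if "\<bar>c\<bar> = 1" for c and v :: "complex^3"
    by (rule ennreal_leI) (use that in simp)
  have Gu: "en (u s \<eta>) \<le> G s \<eta>" "en (b s \<eta>) \<le> G s \<eta>" for s \<eta>
  proof -
    show "en (u s \<eta>) \<le> G s \<eta>" unfolding u_def G_def
      by (rule order_trans[OF half en_triangle(1)]) simp
    have "en (b s \<eta>) \<le> en (T s \<eta>) + en ((- 1) *\<^sub>R F s \<eta>)" unfolding b_def
      by (rule order_trans[OF half[OF \<sigma>1] en_triangle(1)])
    then show "en (b s \<eta>) \<le> G s \<eta>" by (simp add: G_def)
  qed
  \<comment> \<open>The maximum with 0 is taken because B is not known to be nonnegative, and
    \<open>ennreal\<close> is additive only on nonnegative reals.\<close>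
  define B2 where "B2 = 2 * max B 0"
  have GB: "Xm (G s) \<le> ennreal B2" if "s \<ge> 0" for s
  proof -
    have "Xm (G s) = Xm (nrm (T s)) + Xm (nrm (F s))" unfolding G_def by (rule X_add) measurable
    also have "\<dots> \<le> ennreal (max B 0) + ennreal (max B 0)"
      unfolding T_def F_def by (intro add_mono order_trans[OF WB[OF that]] ennreal_leI) auto
    finally show ?thesis by (simp add: B2_def flip: ennreal_plus)
  qed
  have G1: "lint {0..} (\<lambda>s. X1 (G s)) < \<infinity>"
  proof -
    have "X1 (G s) = X1 (nrm (T s)) + X1 (nrm (F s))" for s unfolding G_def by (rule X_add) measurable
    then show ?thesis using W1 by (simp add: distrib_right nn_integral_add T_def[symmetric] F_def[symmetric])  (simp add: T_def F_def)
  qed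
  have B2: "B2 \<ge> 0" by (simp add: B2_def)
  have bnd: "Xm (nrm (v s)) \<le> ennreal B2" if "\<And>s \<eta>. en (v s \<eta>) \<le> G s \<eta>" "s \<ge> 0" for v :: "real \<Rightarrow> vfield" and s
    by (rule order_trans[OF X_mono(1) GB[OF that(2)]]) (rule that)
  have bnd1: "lint {0..} (\<lambda>s. X1 (nrm (v s))) < \<infinity>" if "\<And>s \<eta>. en (v s \<eta>) \<le> G s \<eta>" for v :: "real \<Rightarrow> vfield"
    by (rule le_less_trans[OF nn_integral_mono G1]) (intro mult_right_mono X_mono that, simp)
  have cvf: "AE z in lborel. AE s in lborel. s \<in> {0..} \<longrightarrow> cv (G s) (G s) z < \<infinity>"
    by (rule cv_finite_AE(2)[OF jG _ B2 G1]) (rule GB)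
  have eqs: "AE z in lborel. (integrable lborel (\<lambda>s. indicator {0..t} s *\<^sub>R HU \<mu>1 (u s) (b s) z) \<and> u t z = u0 z + (LBINT s. indicator {0..t} s *\<^sub>R HU \<mu>1 (u s) (b s) z)) \<and>
    (integrable lborel (\<lambda>s. indicator {0..t} s *\<^sub>R HB \<mu>2 (u s) (b s) z) \<and> b t z = b0 z + (LBINT s. indicator {0..t} s *\<^sub>R HB \<mu>2 (u s) (b s) z))" if t: "t \<ge> 0" for t
    using We[OF t, of True] We[OF t, of False] cvf
  proof eventually_elim
    case (elim z)
    let ?VT = "\<lambda>s. vsrc m' (T s) (F s) z - (\<nu> * (norm z)\<^sup>2) *\<^sub>R T s z" and ?VF = "\<lambda>s. vsrc m' (F s) (T s) z - (\<nu> * (norm z)\<^sup>2) *\<^sub>R F s z"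
    let ?I = "indicat_real {0..t}"
    have iT: "integrable lborel (\<lambda>s. ?I s *\<^sub>R ?VT s)" and iF: "integrable lborel (\<lambda>s. ?I s *\<^sub>R ?VF s)"
      and eT: "T t z = w True z + (LBINT s. ?I s *\<^sub>R ?VT s)" and eF: "F t z = w False z + (LBINT s. ?I s *\<^sub>R ?VF s)"
      using elim by (auto simp: T_def F_def)
    have comb: "integrable lborel (\<lambda>s. ?I s *\<^sub>R H s) \<and> (LBINT s. ?I s *\<^sub>R H s) = c *\<^sub>R ((LBINT s. ?I s *\<^sub>R ?VT s) + d *\<^sub>R (LBINT s. ?I s *\<^sub>R ?VF s))"
      if H[measurable]: "bm H" and Heq: "\<And>s. cv (G s) (G s) z < \<infinity> \<Longrightarrow> H s = c *\<^sub>R (?VT s + d *\<^sub>R ?VF s)" for H c d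
    proof -
      have iK: "integrable lborel (\<lambda>s. c *\<^sub>R (?I s *\<^sub>R ?VT s + d *\<^sub>R (?I s *\<^sub>R ?VF s)))"
        by (intro integrable_scaleR_right integrable_plus iT iF)
      have ae: "AE s in lborel. ?I s *\<^sub>R H s = c *\<^sub>R (?I s *\<^sub>R ?VT s + d *\<^sub>R (?I s *\<^sub>R ?VF s))"
        using elim(3)
      proof eventually_elim
        case (elim s)
        then show ?case using Heq[of s] by (cases "s \<in> {0..t}") auto
      qed
      have "integrable lborel (\<lambda>s. ?I s *\<^sub>R H s)"
        by (subst integrable_cong_AE[OF _ _ ae]) (use iK in auto)
      moreover have "(LBINT s. ?I s *\<^sub>R H s) = (LBINT s. c *\<^sub>R (?I s *\<^sub>R ?VT s + d *\<^sub>R (?I s *\<^sub>R ?VF s)))"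
        by (rule LINT_cong_AE[OF _ _ ae]) (use iK in auto)
      moreover have "\<dots> = c *\<^sub>R ((LBINT s. ?I s *\<^sub>R ?VT s) + d *\<^sub>R (LBINT s. ?I s *\<^sub>R ?VF s))"
        unfolding integral_scaleR_right LINT_add[OF iT integrable_scaleR_right[OF iF]] ..
      ultimately show ?thesis by simp
    qed
    have els: "HU \<mu>1 (u s) (b s) z = (1 / 2) *\<^sub>R (?VT s + ?VF s)" "HB \<mu>2 (u s) (b s) z = (\<sigma> / 2) *\<^sub>R (?VT s + (- 1) *\<^sub>R ?VF s)"
      if "cv (G s) (G s) z < \<infinity>" for s
      using elsasser[OF sec jm_section[OF jG] GT that \<sigma>, where \<nu>=\<nu> and m=m'] unfolding \<nu>(2,3) u_def b_def by auto
    have U: "integrable lborel (\<lambda>s. ?I s *\<^sub>R HU \<mu>1 (u s) (b s) z) \<and> (LBINT s. ?I s *\<^sub>R HU \<mu>1 (u s) (b s) z) = (1 / 2) *\<^sub>R ((LBINT s. ?I s *\<^sub>R ?VT s) + 1 *\<^sub>R (LBINT s. ?I s *\<^sub>R ?VF s))"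
      by (rule comb) (use els(1) in auto)
    have Bb: "integrable lborel (\<lambda>s. ?I s *\<^sub>R HB \<mu>2 (u s) (b s) z) \<and> (LBINT s. ?I s *\<^sub>R HB \<mu>2 (u s) (b s) z) = (\<sigma> / 2) *\<^sub>R ((LBINT s. ?I s *\<^sub>R ?VT s) + (- 1) *\<^sub>R (LBINT s. ?I s *\<^sub>R ?VF s))"
      by (rule comb) (use els(2) in auto)
    have "u t z = (1 / 2) *\<^sub>R (w True z + w False z) + (1 / 2) *\<^sub>R ((LBINT s. ?I s *\<^sub>R ?VT s) + 1 *\<^sub>R (LBINT s. ?I s *\<^sub>R ?VF s))"
      unfolding u_def eT eF by (simp add: algebra_simps)
    moreover have "(1 / 2) *\<^sub>R (w True z + w False z) = u0 z" by (simp add: w_def flip: scaleR_2)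
    moreover have "b t z = (\<sigma> / 2) *\<^sub>R (w True z - w False z) + (\<sigma> / 2) *\<^sub>R ((LBINT s. ?I s *\<^sub>R ?VT s) + (- 1) *\<^sub>R (LBINT s. ?I s *\<^sub>R ?VF s))"
      unfolding b_def eT eF by (simp add: algebra_simps)
    moreover have "(\<sigma> / 2) *\<^sub>R (w True z - w False z) = b0 z" using \<sigma> by (simp add: w_def flip: scaleR_2)
    ultimately show ?case using U Bb by simp
  qed
  have zero: "(LBINT s. indicator {0..0} s *\<^sub>R H s) = 0" for H :: "real \<Rightarrow> complex^3"
    by (rule integral_eq_zero_AE) (use AE_lborel_singleton[of "0::real"] in \<open>eventually_elim, auto\<close>)
  have init: "AE z in lborel. u 0 z = u0 z \<and> b 0 z = b0 z"
    using eqs[OF order_refl] unfolding zero by eventually_elim simp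
  show ?thesis
  proof (rule that[of u b B2])
    show "fourier_evolution u (\<lambda>s. HU \<mu>1 (u s) (b s)) B2"
    proof
      show "jm (\<lambda>s. HU \<mu>1 (u s) (b s))" by measurable
      show "evolves t u (\<lambda>s. HU \<mu>1 (u s) (b s))" if "t \<ge> 0" for t
        using eqs[OF that] init by eventually_elim simp
    qed (use ju bnd Gu bnd1 H_integral_finite(1)[OF jG ju jb _ B2 G1 Gu \<mu>(1)] GB in auto)
    show "fourier_evolution b (\<lambda>s. HB \<mu>2 (u s) (b s)) B2"
    proof
      show "jm (\<lambda>s. HB \<mu>2 (u s) (b s))" by measurable
      show "evolves t b (\<lambda>s. HB \<mu>2 (u s) (b s))" if "t \<ge> 0" for t
        using eqs[OF that] init by eventually_elim simp
    qed (use jb bnd Gu bnd1 H_integral_finite(2)[OF jG ju jb _ B2 G1 Gu \<mu>(2)] GB in auto)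
    show "vcnj (u t (- z)) = u t z" "vcnj (b t (- z)) = b t z" for t z
      by (simp_all add: u_def b_def T_def F_def W(2))
    show "dotc z (u t z) = 0" "dotc z (b t z) = 0" for t z
      by (simp_all add: u_def b_def T_def F_def W(3) dotc_scaleR dotc_add dotc_diff dotc_uminus)
    show "AE z in lborel. u 0 z = u0 z" using init by eventually_elim simp
    show "AE z in lborel. b 0 z = b0 z" using init by eventually_elim simp
  qed
qed

subsection \<open>Existence of weak solutions\<close>

lemma frep_cong_AE:
  assumes g: "frep g T" and [measurable]: "bm h" and eq: "AE z in lborel. g z = h z"
  shows "frep h T"
proof -
  have [measurable]: "bm g" by (rule frep_measurable[OF g])
  have li: "set_integrable lborel K h" if "compact K" for K
  proof -
    have [measurable]: "K \<in> sets borel" using that by (rule borel_compact)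
    have ae: "AE z in lborel. indicat_real K z *\<^sub>R h z = indicat_real K z *\<^sub>R g z" using eq by eventually_elim simp
    have "set_integrable lborel K g" using g that by (auto simp: frep_def represents_def locally_integrable_def)
    then show ?thesis
      unfolding set_integrable_def by (subst integrable_cong_AE[OF _ _ ae]) measurable
  qed
  show ?thesis
    unfolding frep_def represents_def locally_integrable_def fourier_dist_def
  proof (intro conjI allI impI ballI li)
    fix f assume f: "f \<in> schwartz"
    have [measurable]: "bm f" by (rule schwartz_measurable[OF f])
    have ae: "AE z in lborel. h z * f z = g z * f z" using eq by eventually_elim simp
    show "integrable lborel (\<lambda>z. h z * f z)"
      by (subst integrable_cong_AE[OF _ _ ae]) (measurable, rule frepD(1)[OF g f])
    have "(LBINT z. h z * f z) = (LBINT z. g z * f z)"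
      by (rule LINT_cong_AE[OF _ _ ae]) measurable
    then show "T (fourier f) = (LBINT z. h z * f z)" by (simp add: frepD(2)[OF g f])
  qed
qed

lemma frepv_cong_AE:
  assumes "frepv g u" and "bm h" and "AE z in lborel. g z = h z"
  shows "frepv h u"
  unfolding frepv_def
proof
  fix i
  show "frep (\<lambda>z. h z $ i) (u $ i)"
  proof (rule frep_cong_AE)
    show "frep (\<lambda>z. g z $ i) (u $ i)" using assms(1) by (simp add: frepv_def)
    show "AE z in lborel. g z $ i = h z $ i" using assms(3) by eventually_elim simp
  qed (use assms(2) in measurable)
qed

text \<open>The chosen transform is hermitian and orthogonal to z only almost everywhere. Setting it
  to 0 outside the set \<open>P\<close>, which is symmetric under z \<mapsto> - z, makes both
  properties hold everywhere, as the iteration requires.\<close>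

lemma fourier_data:
  assumes u: "u \<in> chi (- 1)" and r: "\<And>i. real_valued (u $ i)" and d: "dist_eq (ddiv u) 0"
  obtains w where "bm w" "\<And>\<eta>. vcnj (w (- \<eta>)) = w \<eta>" "\<And>z. dotc z (w z) = 0" "frepv w u"
proof -
  define g where "g = fourier_fun u"
  have g: "frepv g u" and m[measurable]: "bm g" unfolding g_def using chiD[OF u] by auto
  define P where "P z \<longleftrightarrow> (\<forall>i. cnj (g (- z) $ i) = g z $ i) \<and> dotc z (g z) = 0" for z
  have P_minus: "P (- z)" if "P z" for z
  proof -
    have "g (- z) $ i = cnj (g z $ i)" for i using that unfolding P_def by (metis complex_cnj_cnj)
    then have e: "g (- z) = vcnj (g z)" by (simp add: vec_eq_iff)
    show ?thesis using that by (simp add: P_def e dotc_minus dotc_vcnj)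
  qed
  define w where "w z = (if P z then g z else 0)" for z
  have wm: "bm w" unfolding w_def P_def by measurable
  have "AE z in lborel. \<forall>i\<in>(UNIV::3 set). cnj (g (- z) $ i) = g z $ i"
    using g r by (intro AE_finite_allI) (auto simp: frepv_def intro: real_valued_frep)
  moreover have "AE z in lborel. dotc z (g z) = 0"
    using ddiv_zero_iff[of g u] g d by (auto simp: frepv_def)
  ultimately have ae: "AE z in lborel. g z = w z"
    by eventually_elim (simp add: w_def P_def)
  show ?thesis
  proof (rule that[OF wm])
    show "vcnj (w (- \<eta>)) = w \<eta>" for \<eta>
    proof (cases "P \<eta>")
      case True
      then show ?thesis unfolding w_def if_P[OF True] if_P[OF P_minus[OF True]] by (simp add: P_def vec_eq_iff)
    next
      case False
      then have "\<not> P (- \<eta>)" using P_minus[of "- \<eta>"] by (metis minus_minus)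
      with False show ?thesis by (simp add: w_def)
    qed
    show "dotc z (w z) = 0" for z by (simp add: w_def P_def)
    show "frepv w u" by (rule frepv_cong_AE[OF g wm ae])
  qed
qed

lemma X0_finite:
  assumes "bm f" "Xm f < \<infinity>" "X1 f < \<infinity>"
  shows "X0 f < \<infinity>"
proof -
  have "(X0 f)\<^sup>2 < \<infinity>" by (rule le_less_trans[OF X0_interpolation[OF assms(1)]]) (use assms in \<open>auto simp: ennreal_mult_less_top\<close>)
  then show ?thesis by (auto simp: power2_eq_square ennreal_mult_less_top less_top)
qed

text \<open>What is available at almost every time. By interpolation such a field has an integrable
  transform, and so have its first derivatives, so the products in \<open>advect\<close> are
  products of bounded functions.\<close>

definition vregular :: "vfield \<Rightarrow> vdist \<Rightarrow> bool" where
  "vregular a A \<longleftrightarrow> frepv a A \<and> Xm (nrm a) < \<infinity> \<and> X1 (nrm a) < \<infinity> \<and> (AE z in lborel. dotc z (a z) = 0)"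

lemma vregularD:
  assumes "vregular a A"
  shows "frepv a A" "bm a" "X0 (nrm a) < \<infinity>" "AE z in lborel. dotc z (a z) = 0"
    "Xm (nrm a) < \<infinity>" "X1 (nrm a) < \<infinity>" "frep (\<lambda>z. a z $ i) (A $ i)"
proof -
  show 1: "frepv a A" "AE z in lborel. dotc z (a z) = 0" "Xm (nrm a) < \<infinity>" "X1 (nrm a) < \<infinity>"
    using assms by (auto simp: vregular_def)
  show 2[measurable]: "bm a" by (rule frepv_measurable[OF 1(1)])
  show "X0 (nrm a) < \<infinity>" by (rule X0_finite[OF _ 1(3,4)]) measurable
  show "frep (\<lambda>z. a z $ i) (A $ i)" using 1(1) by (simp add: frepv_def)
qed

lemma advect_vfourier:
  assumes a: "vregular a A" and b: "vregular b D" and f: "f \<in> schwartz"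
  shows "integrable lborel (\<lambda>\<zeta>. vbilin a b \<zeta> $ i * f \<zeta>)"
    and "advect A (D $ i) (fourier f) = (LBINT \<zeta>. vbilin a b \<zeta> $ i * f \<zeta>)"
proof -
  note [measurable] = vregularD(2)[OF a] vregularD(2)[OF b] schwartz_measurable[OF f]
  let ?c = "cv (nrm a) (nrm b)"
  have [measurable]: "?c \<in> borel_measurable borel" unfolding cv_def by measurable
  have ai: "integrable lborel (\<lambda>z. a z $ j)" for j
  proof (rule integrableI_bounded)
    have "(\<integral>\<^sub>Lz. en (a z $ j)) \<le> X0 (nrm a)"
      unfolding X0_def by (intro nn_integral_mono ennreal_leI Finite_Cartesian_Product.norm_nth_le)
    then show "(\<integral>\<^sub>Lz. en (a z $ j)) < \<infinity>" using vregularD(3)[OF a] by (rule le_less_trans)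
  qed measurable
  have bi: "integrable lborel (\<lambda>z. cor (z $ j) * b z $ i)" for j
  proof (rule integrableI_bounded)
    have "(\<integral>\<^sub>Lz. en (cor (z $ j) * b z $ i)) \<le> X1 (nrm b)"
      unfolding X1_def
    proof (rule nn_integral_mono)
      fix z :: "real^3"
      have "norm (cor (z $ j) * b z $ i) \<le> norm z * norm (b z)"
        unfolding norm_mult norm_of_real by (intro mult_mono component_le_norm_cart Finite_Cartesian_Product.norm_nth_le) auto
      then show "en (cor (z $ j) * b z $ i) \<le> ennreal (norm z) * en (b z)"
        by (simp add: ennreal_leI flip: ennreal_mult)
    qed
    then show "(\<integral>\<^sub>Lz. en (cor (z $ j) * b z $ i)) < \<infinity>" using vregularD(6)[OF b] by (rule le_less_trans)
  qed measurable
  show "advect A (D $ i) (fourier f) = (LBINT \<zeta>. vbilin a b \<zeta> $ i * f \<zeta>)"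
    unfolding advect_fourier[OF vregularD(7)[OF a] ai vregularD(7)[OF b] bi vregularD(4)[OF a] f]
    by (simp add: vbilin_def)
  obtain C where C: "C \<ge> 0" "\<And>z. (1 + norm z) ^ 1 * norm (f z) \<le> C" using schwartz_bound[OF f] by metis
  show "integrable lborel (\<lambda>\<zeta>. vbilin a b \<zeta> $ i * f \<zeta>)"
  proof (rule integrableI_bounded)
    have "(\<integral>\<^sub>L\<zeta>. en (vbilin a b \<zeta> $ i * f \<zeta>)) \<le> (\<integral>\<^sub>L\<zeta>. ennreal C * ?c \<zeta>)"
    proof (rule nn_integral_mono)
      fix \<zeta>
      have fC: "norm \<zeta> / 24 * norm (f \<zeta>) \<le> C"
      proof -
        have "norm \<zeta> / 24 * norm (f \<zeta>) \<le> (1 + norm \<zeta>) ^ 1 * norm (f \<zeta>)" by (intro mult_right_mono) auto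
        then show ?thesis using C(2)[of \<zeta>] by linarith
      qed
      have "en (vbilin a b \<zeta> $ i * f \<zeta>) \<le> en (vbilin a b \<zeta>) * en (f \<zeta>)"
        unfolding norm_mult by (simp add: ennreal_mult mult_right_mono ennreal_leI Finite_Cartesian_Product.norm_nth_le)
      also have "\<dots> \<le> (ennreal (norm \<zeta> / 24) * ?c \<zeta>) * en (f \<zeta>)" by (intro mult_right_mono vbilin_bound) auto
      also have "\<dots> = ennreal (norm \<zeta> / 24 * norm (f \<zeta>)) * ?c \<zeta>" by (subst ennreal_mult) (auto simp: mult_ac)
      also have "\<dots> \<le> ennreal C * ?c \<zeta>" by (intro mult_right_mono ennreal_leI fC) auto
      finally show "en (vbilin a b \<zeta> $ i * f \<zeta>) \<le> ennreal C * ?c \<zeta>" .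
    qed
    also have "\<dots> = ennreal C * X0 ?c" unfolding X0_def by (rule nn_integral_cmult) measurable
    also have "\<dots> < \<infinity>" using vregularD(3)[OF a] vregularD(3)[OF b] by (subst X0_cv) (auto simp: ennreal_mult_less_top)
    finally show "(\<integral>\<^sub>L\<zeta>. en (vbilin a b \<zeta> $ i * f \<zeta>)) < \<infinity>" .
  qed measurable
qed

lemma integral_lincomb:
  fixes x y l :: "sfield"
  assumes "integrable lborel x" "integrable lborel y" "integrable lborel l"
  shows "integrable lborel (\<lambda>z. - x z + m * l z + y z)"
    and "- (LBINT z. x z) + m * (LBINT z. l z) + (LBINT z. y z) = (LBINT z. - x z + m * l z + y z)"
  using assms by auto

text \<open>The term \<open>K\<close> carries no projector: the existence proof subtracts the
  pressure gradient from it, and the uniqueness proof removes that gradient by solenoidal test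
  fields.\<close>

lemma weak_terms:
  fixes i :: 3 and \<mu> :: real
  assumes a: "vregular a A" and b: "vregular b D" and f: "f \<in> schwartz"
  defines "K \<equiv> \<lambda>z. (- ((\<mu> * (norm z)\<^sup>2) *\<^sub>R a z) - (vbilin a a z - vbilin b b z)) $ i * f z"
    and "L \<equiv> \<lambda>z. HB \<mu> a b z $ i * f z"
  shows "integrable lborel K" "integrable lborel L"
    and "- advect A (A $ i) (fourier f) + of_real \<mu> * dlaplace (A $ i) (fourier f) + advect D (D $ i) (fourier f) = (LBINT z. K z)"
    and "- advect A (D $ i) (fourier f) + advect D (A $ i) (fourier f) + of_real \<mu> * dlaplace (D $ i) (fourier f) = (LBINT z. L z)"
proof -
  note la = dlaplace_fourier[OF vregularD(7)[OF a, of i] f] and lb = dlaplace_fourier[OF vregularD(7)[OF b, of i] f]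
  note aa = advect_vfourier[OF a a f, of i] and bb = advect_vfourier[OF b b f, of i]
    and ab = advect_vfourier[OF a b f, of i] and ba = advect_vfourier[OF b a f, of i]
  have K: "K = (\<lambda>z. - (vbilin a a z $ i * f z) + of_real \<mu> * (- cor ((norm z)\<^sup>2) * a z $ i * f z) + vbilin b b z $ i * f z)"
    by (simp add: K_def fun_eq_iff scaleR_conv_of_real[where 'a=complex] algebra_simps)
  have L: "L = (\<lambda>z. - (vbilin a b z $ i * f z) + of_real \<mu> * (- cor ((norm z)\<^sup>2) * b z $ i * f z) + vbilin b a z $ i * f z)"
    by (simp add: L_def HB_def fun_eq_iff scaleR_conv_of_real[where 'a=complex] algebra_simps)
  show "integrable lborel K" unfolding K by (rule integral_lincomb(1)[OF aa(1) bb(1) la(2)])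
  show "integrable lborel L" unfolding L by (rule integral_lincomb(1)[OF ab(1) ba(1) lb(2)])
  show "- advect A (A $ i) (fourier f) + of_real \<mu> * dlaplace (A $ i) (fourier f) + advect D (D $ i) (fourier f) = (LBINT z. K z)"
    unfolding K aa(2) bb(2) la(1) by (rule integral_lincomb(2)[OF aa(1) bb(1) la(2)])
  show "- advect A (D $ i) (fourier f) + advect D (A $ i) (fourier f) + of_real \<mu> * dlaplace (D $ i) (fourier f) = (LBINT z. L z)"
    unfolding L ab(2) ba(2) lb(1) integral_lincomb(2)[OF ab(1) ba(1) lb(2), symmetric] by (simp add: ac_simps)
qed

text \<open>The divergence of the momentum equation determines the pressure.\<close>

definition pressure :: "vfield \<Rightarrow> vfield \<Rightarrow> sfield" where
  "pressure a b z = \<i> * dotc z (vbilin a a z - vbilin b b z) / cor ((norm z)\<^sup>2)"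

lemma pressure_cnj:
  assumes "bm a" "bm b"
    and a: "\<And>\<eta>. vcnj (a (- \<eta>)) = a \<eta>" and b: "\<And>\<eta>. vcnj (b (- \<eta>)) = b \<eta>"
  shows "cnj (pressure a b (- z)) = pressure a b z"
  using vbilin_vcnj[OF assms(1,1) a a, of z] vbilin_vcnj[OF assms(2,2) b b, of z]
  by (simp add: pressure_def dotc_minus dotc_diff right_diff_distrib diff_divide_distrib flip: dotc_vcnj)

text \<open>The double divergence contributes two powers of |z|, which cancel the inverse Laplacian.
  The pressure is thus bounded by a convolution of integrable functions.\<close>

lemma slow_pressure:
  assumes a: "vregular a A" and b: "vregular b D"
  shows "slow (pressure a b)"
proof (rule slow_of_integrable, rule integrableI_bounded)
  note [measurable] = vregularD(2)[OF a] vregularD(2)[OF b]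
  show "pressure a b \<in> borel_measurable lborel" unfolding pressure_def by measurable
  let ?G = "\<lambda>z. en (a z) + en (b z)"
  have G: "en (a z) \<le> ?G z" "en (b z) \<le> ?G z" for z by auto
  have "(\<integral>\<^sub>Lz. en (pressure a b z)) \<le> X0 (cv ?G ?G)"
    unfolding X0_def
  proof (rule nn_integral_mono)
    fix z
    let ?N = "vbilin a a z - vbilin b b z"
    have "norm (pressure a b z) \<le> 3 / norm z * norm ?N"
    proof (cases "z = 0")
      case False
      have "norm (pressure a b z) = norm (dotc z ?N) / (norm z)\<^sup>2" by (simp add: pressure_def norm_divide norm_mult norm_power)
      also have "\<dots> \<le> 3 * norm z * norm ?N / (norm z)\<^sup>2" by (intro divide_right_mono norm_dotc_le) simp
      also have "\<dots> = 3 / norm z * norm ?N" using False by (simp add: power2_eq_square)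
      finally show ?thesis .
    qed (simp add: pressure_def)
    then have "en (pressure a b z) \<le> ennreal (3 / norm z) * en ?N" by (simp add: ennreal_leI flip: ennreal_mult)
    also have "\<dots> \<le> ennreal (3 / norm z) * (ennreal (norm z / 12) * cv ?G ?G z)"
      by (intro mult_left_mono vbilin_diff_norm G) auto
    also have "\<dots> = ennreal (3 / norm z * (norm z / 12)) * cv ?G ?G z" by (subst ennreal_mult) (auto simp: mult.assoc)
    also have "\<dots> \<le> 1 * cv ?G ?G z"
      by (rule mult_right_mono) (cases "z = 0", auto)
    finally show "en (pressure a b z) \<le> cv ?G ?G z" by simp
  qed
  also have "\<dots> = X0 ?G * X0 ?G" by (rule X0_cv) measurable
  also have "\<dots> < \<infinity>"
    using vregularD(3)[OF a] vregularD(3)[OF b] by (simp add: X_add(2) ennreal_mult_less_top)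
  finally show "(\<integral>\<^sub>Lz. en (pressure a b z)) < \<infinity>" .
qed

lemma schwartz_is_fourier:
  assumes "\<phi> \<in> schwartz" obtains f where "f \<in> schwartz" "\<phi> = fourier f"
  using assms inv_fourier_schwartz fourier_inv_fourier by metis

theorem mhd_of_fourier:
  assumes fu: "fourier_evolution u (\<lambda>s. HU \<mu>1 (u s) (b s)) B" and fb: "fourier_evolution b (\<lambda>s. HB \<mu>2 (u s) (b s)) B"
    and herm: "\<And>t z. vcnj (u t (- z)) = u t z" "\<And>t z. vcnj (b t (- z)) = b t z"
    and div: "\<And>t z. dotc z (u t z) = 0" "\<And>t z. dotc z (b t z) = 0"
    and u0: "frepv u00 u0" "AE z in lborel. u 0 z = u00 z" and b0: "frepv b00 B0" "AE z in lborel. b 0 z = b00 z"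
  shows "mhd_solution \<mu>1 \<mu>2 u0 B0 (\<lambda>t. vift (u t)) (\<lambda>t. vift (b t))"
proof -
  interpret u: fourier_evolution u "\<lambda>s. HU \<mu>1 (u s) (b s)" B by fact
  interpret b: fourier_evolution b "\<lambda>s. HB \<mu>2 (u s) (b s)" B by fact
  have good: "AE s in lborel. s \<in> {0..} \<longrightarrow> vregular (u s) (vift (u s)) \<and> vregular (b s) (vift (b s))"
    using u.X1_AE b.X1_AE
  proof eventually_elim
    case (elim s)
    then show ?case
      using u.frepv_U(1)[of s] b.frepv_U(1)[of s] le_less_trans[OF u.UB[of s] ennreal_less_top] le_less_trans[OF b.UB[of s] ennreal_less_top]
      by (auto simp: vregular_def div)
  qed
  have rv: "real_valued (vift (u t) $ i)" "real_valued (vift (b t) $ i)" for t i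
    unfolding vift_def vec_lambda_beta
    using herm[unfolded vec_eq_iff, of t] by (auto intro!: real_valued_ift)
  \<comment> \<open>At the exceptional times at which the fields are not regular the pressure is set
    to 0, since the definition of a solution asks for a tempered distribution at every time.\<close>
  define ph where "ph s = (if slow (pressure (u s) (b s)) then pressure (u s) (b s) else (\<lambda>_. 0))" for s
  have ph: "slow (ph s)" "cnj (ph s (- z)) = ph s z" for s z
    using pressure_cnj[OF u.meas(3) b.meas(3) herm, of s s z] by (auto simp: ph_def slow_of_integrable)
  have phm: "bm (ph s)" for s using ph(1)[of s] by (simp add: slow_def)
  define p where "p s = ift (ph s)" for s
  have tu: "time_derivative (\<lambda>t. vift (u t) $ i) (\<lambda>t \<phi>. - advect (vift (u t)) (vift (u t) $ i) \<phi> + of_real \<mu>1 * dlaplace (vift (u t) $ i) \<phi>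
      - dpartial i (p t) \<phi> + advect (vift (b t)) (vift (b t) $ i) \<phi>)" (is "time_derivative _ ?F") for i
    unfolding time_derivative_def
  proof (intro ballI allI impI)
    fix \<phi> :: "sfield" and t :: real assume \<phi>: "\<phi> \<in> schwartz" and t: "t \<ge> 0"
    obtain f where f: "f \<in> schwartz" "\<phi> = fourier f" by (rule schwartz_is_fourier[OF \<phi>])
    note wf = u.weak_form[OF f(1) t, of i]
    have ae: "AE s in lborel. s \<in> {0..t} \<longrightarrow> ?F s \<phi> = (LBINT z. HU \<mu>1 (u s) (b s) z $ i * f z)"
      using good
    proof eventually_elim
      case (elim s)
      show ?case
      proof
        assume "s \<in> {0..t}"
        then have ra: "vregular (u s) (vift (u s))" and rb: "vregular (b s) (vift (b s))" using elim by auto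
        have "slow (pressure (u s) (b s))" by (rule slow_pressure[OF ra rb])
        then have phs: "ph s = pressure (u s) (b s)" by (simp add: ph_def)
        note pr = frepD[OF frep_dpartial[OF frep_ift[OF ph(1)], of i s] f(1), folded p_def]
        note wt = weak_terms[OF ra rb f(1), where \<mu>=\<mu>1 and i=i]
        have "?F s \<phi> = (LBINT z. (- ((\<mu>1 * (norm z)\<^sup>2) *\<^sub>R u s z) - (vbilin (u s) (u s) z - vbilin (b s) (b s) z)) $ i * f z)
            - (LBINT z. \<i> * cor (z $ i) * ph s z * f z)"
          unfolding wt(3)[symmetric] pr(2)[symmetric] f(2) by simp
        also have "\<dots> = (LBINT z. (- ((\<mu>1 * (norm z)\<^sup>2) *\<^sub>R u s z) - (vbilin (u s) (u s) z - vbilin (b s) (b s) z)) $ i * f z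
            - \<i> * cor (z $ i) * ph s z * f z)"
          by (rule LINT_diff[symmetric, OF wt(1) pr(1)])
        also have "\<dots> = (LBINT z. HU \<mu>1 (u s) (b s) z $ i * f z)"
          unfolding phs HU_def leray_def pressure_def
          by (intro LINT_cong refl) (simp add: algebra_simps)
        finally show "?F s \<phi> = (LBINT z. HU \<mu>1 (u s) (b s) z $ i * f z)" .
      qed
    qed
    note tr = lebesgue_on_transfer[OF wf(1) _ ae]
    show "integrable (lebesgue_on {0..t}) (\<lambda>s. ?F s \<phi>) \<and> (vift (u t) $ i) \<phi> - (vift (u 0) $ i) \<phi> = (LINT s|lebesgue_on {0..t}. ?F s \<phi>)"
    proof
      have rep: "(vift (u r) $ i) \<phi> = (LBINT z. u r z $ i * f z)" if "r \<ge> 0" for r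
        unfolding f(2) using frepD(2)[of "\<lambda>z. u r z $ i" "vift (u r) $ i", OF _ f(1)] u.frepv_U(1)[OF that] by (simp add: frepv_def)
      show "(vift (u t) $ i) \<phi> - (vift (u 0) $ i) \<phi> = (LINT s|lebesgue_on {0..t}. ?F s \<phi>)"
        unfolding rep[OF t] rep[OF order_refl] wf(2) by (rule tr(2)[symmetric]) simp
    qed (rule tr(1), simp)
  qed
  have tb: "time_derivative (\<lambda>t. vift (b t) $ i) (\<lambda>t \<phi>. - advect (vift (u t)) (vift (b t) $ i) \<phi> + advect (vift (b t)) (vift (u t) $ i) \<phi>
      + of_real \<mu>2 * dlaplace (vift (b t) $ i) \<phi>)" (is "time_derivative _ ?F") for i
    unfolding time_derivative_def
  proof (intro ballI allI impI)
    fix \<phi> :: "sfield" and t :: real assume \<phi>: "\<phi> \<in> schwartz" and t: "t \<ge> 0"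
    obtain f where f: "f \<in> schwartz" "\<phi> = fourier f" by (rule schwartz_is_fourier[OF \<phi>])
    note wf = b.weak_form[OF f(1) t, of i]
    have ae: "AE s in lborel. s \<in> {0..t} \<longrightarrow> ?F s \<phi> = (LBINT z. HB \<mu>2 (u s) (b s) z $ i * f z)"
      using good by eventually_elim (use weak_terms(4)[OF _ _ f(1)] f(2) in auto)
    note tr = lebesgue_on_transfer[OF wf(1) _ ae]
    show "integrable (lebesgue_on {0..t}) (\<lambda>s. ?F s \<phi>) \<and> (vift (b t) $ i) \<phi> - (vift (b 0) $ i) \<phi> = (LINT s|lebesgue_on {0..t}. ?F s \<phi>)"
    proof
      have rep: "(vift (b r) $ i) \<phi> = (LBINT z. b r z $ i * f z)" if "r \<ge> 0" for r
        unfolding f(2) using frepD(2)[of "\<lambda>z. b r z $ i" "vift (b r) $ i", OF _ f(1)] b.frepv_U(1)[OF that] by (simp add: frepv_def)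
      show "(vift (b t) $ i) \<phi> - (vift (b 0) $ i) \<phi> = (LINT s|lebesgue_on {0..t}. ?F s \<phi>)"
        unfolding rep[OF t] rep[OF order_refl] wf(2) by (rule tr(2)[symmetric]) simp
    qed (rule tr(1), simp)
  qed
  have dv: "dist_eq (ddiv (vift (u t))) 0" "dist_eq (ddiv (vift (b t))) 0" if "t \<ge> 0" for t
    using ddiv_zero_iff[of "u t" "vift (u t)"] ddiv_zero_iff[of "b t" "vift (b t)"] u.frepv_U(1)[OF that] b.frepv_U(1)[OF that]
    by (auto simp: div frepv_def)
  have init: "vdist_eq (vift v) w" if "frepv v (vift v)" "frepv v0 w" "AE z in lborel. v z = v0 z" for v v0 w
    unfolding vdist_eq_def
  proof
    fix i
    have "AE z in lborel. v z $ i = v0 z $ i" using that(3) by eventually_elim simp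
    then show "dist_eq (vift v $ i) (w $ i)" using that by (auto simp: frepv_def intro: frep_dist_eq)
  qed
  show ?thesis
    unfolding mhd_solution_def
  proof (intro conjI allI impI exI[of _ p])
    show "tempered (p t)" "real_valued (p t)" for t
      unfolding p_def using tempered_ift[OF ph(1)] real_valued_ift[OF phm ph(2)] by auto
  qed (use rv dv init[OF u.frepv_U(1) u0] init[OF b.frepv_U(1) b0] in \<open>blast intro: tu tb order_refl\<close>)+
qed

subsection \<open>Measurable representatives of continuous curves\<close>

lemma Xm_triangle:
  fixes a b c :: "vfield"
  assumes [measurable]: "bm a" "bm b" "bm c"
  shows "Xm (\<lambda>z. en (a z - c z)) \<le> Xm (\<lambda>z. en (a z - b z)) + Xm (\<lambda>z. en (b z - c z))"
proof -
  have "en (a z - c z) \<le> en (a z - b z) + en (b z - c z)" for z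
    using en_triangle(1)[of "a z - b z" "b z - c z"] by simp
  then show ?thesis by (subst X_add(1)[symmetric]) (auto intro: X_mono)
qed

lemma Xm_fourier_fun_diff:
  assumes u: "u \<in> chi (- 1)" and v: "v \<in> chi (- 1)"
  shows "Xm (\<lambda>z. en (fourier_fun u z - fourier_fun v z)) = ennreal (chi_norm (- 1) (u - v))"
proof -
  note [measurable] = chiD(3)[OF u] chiD(3)[OF v]
  have "Xm (\<lambda>z. en (fourier_fun u z - fourier_fun v z)) \<le> Xm (\<lambda>z. en (fourier_fun u z) + en (fourier_fun v z))"
    by (rule X_mono) (rule en_triangle)
  also have "\<dots> = Xm (nrm (fourier_fun u)) + Xm (nrm (fourier_fun v))" by (rule X_add) measurable
  also have "\<dots> < \<infinity>" by (simp add: chi_Xm u v)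
  finally show ?thesis
    using chi_norm_frepv(1)[OF frepv_diff[OF chiD(1)[OF u] chiD(1)[OF v]]] by simp
qed

text \<open>The Heine-Cantor argument carried out by hand with a Lebesgue number, since
  \<open>C_chi\<close> expresses continuity through norms of differences only.\<close>

lemma C_chi_modulus:
  assumes u: "u \<in> C_chi (- 1)" and e: "e > 0"
  obtains d where "d > 0" "\<And>s t. s \<in> {0..T} \<Longrightarrow> t \<in> {0..T} \<Longrightarrow> \<bar>s - t\<bar> < d \<Longrightarrow>
    Xm (\<lambda>z. en (fourier_fun (u s) z - fourier_fun (u t) z)) \<le> ennreal e"
proof -
  have chi: "u t \<in> chi (- 1)" if "t \<ge> 0" for t using u that by (simp add: C_chi_def)
  have "\<exists>d>0. \<forall>r\<ge>0. \<bar>r - t\<bar> < d \<longrightarrow> chi_norm (- 1) (u r - u t) < e / 2" if t: "t \<ge> 0" for t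
  proof -
    have "((\<lambda>r. chi_norm (- 1) (u r - u t)) \<longlongrightarrow> 0) (at t within {0..})" using u t by (simp add: C_chi_def)
    then obtain d where d: "d > 0" "\<And>r. r \<ge> 0 \<Longrightarrow> r \<noteq> t \<Longrightarrow> \<bar>r - t\<bar> < d \<Longrightarrow> \<bar>chi_norm (- 1) (u r - u t)\<bar> < e / 2"
      unfolding tendsto_iff eventually_at dist_real_def using e by (auto dest!: spec[of _ "e / 2"])
    have "ennreal (chi_norm (- 1) (u t - u t)) = 0"
      unfolding Xm_fourier_fun_diff[OF chi[OF t] chi[OF t], symmetric] by (simp add: Xm_def)
    then have "chi_norm (- 1) (u r - u t) < e / 2" if "r \<ge> 0" "\<bar>r - t\<bar> < d" for r
      using d(2)[of r] that e by (cases "r = t") (auto simp: ennreal_eq_0_iff)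
    then show ?thesis using d(1) by blast
  qed
  then obtain d where d: "\<And>t. t \<ge> 0 \<Longrightarrow> d t > 0"
      "\<And>t r. t \<ge> 0 \<Longrightarrow> r \<ge> 0 \<Longrightarrow> \<bar>r - t\<bar> < d t \<Longrightarrow> chi_norm (- 1) (u r - u t) < e / 2"
    by metis
  have "{0..T} \<subseteq> \<Union>((\<lambda>t. ball t (d t)) ` {0..T})" using d(1) by force
  then obtain \<delta> where \<delta>: "\<delta> > 0" "\<forall>s\<in>{0..T}. \<exists>G\<in>(\<lambda>t. ball t (d t)) ` {0..T}. ball s \<delta> \<subseteq> G"
    by (rule Heine_Borel_lemma[OF compact_Icc]) auto
  show ?thesis
  proof (rule that[OF \<delta>(1)])
    fix s t assume st: "s \<in> {0..T}" "t \<in> {0..T}" "\<bar>s - t\<bar> < \<delta>"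
    obtain r where r: "r \<in> {0..T}" "ball s \<delta> \<subseteq> ball r (d r)" using \<delta>(2) st(1) by blast
    have "s \<in> ball s \<delta>" "t \<in> ball s \<delta>" using \<delta>(1) st(3) by (auto simp: dist_real_def)
    then have "s \<in> ball r (d r)" "t \<in> ball r (d r)" using r(2) by blast+
    then have "\<bar>s - r\<bar> < d r" "\<bar>t - r\<bar> < d r" by (auto simp: dist_real_def abs_minus_commute)
    then have c: "chi_norm (- 1) (u s - u r) < e / 2" "chi_norm (- 1) (u t - u r) < e / 2"
      using d(2) st r by auto
    note X = Xm_fourier_fun_diff[OF chi chi]
    have "Xm (\<lambda>z. en (fourier_fun (u s) z - fourier_fun (u t) z)) \<le>
        Xm (\<lambda>z. en (fourier_fun (u s) z - fourier_fun (u r) z)) + Xm (\<lambda>z. en (fourier_fun (u r) z - fourier_fun (u t) z))"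
      by (intro Xm_triangle chiD(3)[OF chi]) (use st r in auto)
    also have "(\<lambda>z. en (fourier_fun (u r) z - fourier_fun (u t) z)) = (\<lambda>z. en (fourier_fun (u t) z - fourier_fun (u r) z))"
      by (simp add: norm_minus_commute)
    also have "Xm (\<lambda>z. en (fourier_fun (u s) z - fourier_fun (u r) z)) + Xm (\<lambda>z. en (fourier_fun (u t) z - fourier_fun (u r) z)) \<le> ennreal (e / 2) + ennreal (e / 2)"
      using st r c by (intro add_mono) (auto simp: X intro!: ennreal_leI)
    also have "\<dots> = ennreal e" using e by (simp flip: ennreal_plus)
    finally show "Xm (\<lambda>z. en (fourier_fun (u s) z - fourier_fun (u t) z)) \<le> ennreal e" .
  qed
qed

lemma C_chi_bounded:
  assumes u: "u \<in> C_chi (- 1)"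
  obtains M where "M \<ge> 0" "\<And>t. t \<in> {0..T} \<Longrightarrow> Xm (nrm (fourier_fun (u t))) \<le> ennreal M"
proof -
  let ?f = "\<lambda>t. chi_norm (- 1) (u t)"
  have chi: "u t \<in> chi (- 1)" if "t \<ge> 0" for t using u that by (simp add: C_chi_def)
  have nn: "chi_norm (- 1) v \<ge> 0" for v unfolding chi_norm_def by (rule integral_nonneg_AE) simp
  have tri: "?f s \<le> chi_norm (- 1) (u s - u t) + ?f t" if st: "s \<ge> 0" "t \<ge> 0" for s t
  proof -
    note [measurable] = chiD(3)[OF chi[OF st(1)]] chiD(3)[OF chi[OF st(2)]]
    have "ennreal (?f s) \<le> ennreal (chi_norm (- 1) (u s - u t)) + ennreal (?f t)"
      using Xm_triangle[of "fourier_fun (u s)" "fourier_fun (u t)" "\<lambda>_. 0"]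
      by (simp add: chi_Xm[OF chi] Xm_fourier_fun_diff[OF chi chi] st)
    then show ?thesis using nn by (simp flip: ennreal_plus)
  qed
  have sym: "chi_norm (- 1) (u s - u t) = chi_norm (- 1) (u t - u s)" if st: "s \<ge> 0" "t \<ge> 0" for s t
  proof -
    have "ennreal (chi_norm (- 1) (u s - u t)) = ennreal (chi_norm (- 1) (u t - u s))"
      unfolding Xm_fourier_fun_diff[OF chi[OF st(1)] chi[OF st(2)], symmetric] Xm_fourier_fun_diff[OF chi[OF st(2)] chi[OF st(1)], symmetric]
      by (simp add: norm_minus_commute)
    then show ?thesis using nn by simp
  qed
  have "continuous_on {0..T} ?f"
    unfolding continuous_on_def
  proof
    fix t assume t: "t \<in> {0..T}"
    have "((\<lambda>r. chi_norm (- 1) (u r - u t)) \<longlongrightarrow> 0) (at t within {0..})" using u t by (simp add: C_chi_def)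
    then have lim: "((\<lambda>r. chi_norm (- 1) (u r - u t)) \<longlongrightarrow> 0) (at t within {0..T})" by (rule tendsto_within_subset) auto
    show "(?f \<longlongrightarrow> ?f t) (at t within {0..T})"
    proof (rule metric_tendsto_imp_tendsto[OF lim])
      have "dist (?f r) (?f t) \<le> dist (chi_norm (- 1) (u r - u t)) 0" if r: "r \<in> {0..T}" for r
        using tri[of r t] tri[of t r] sym[of r t] r t by (auto simp: dist_real_def abs_le_iff)
      then show "\<forall>\<^sub>F r in at t within {0..T}. dist (?f r) (?f t) \<le> dist (chi_norm (- 1) (u r - u t)) 0"
        unfolding eventually_at_filter by (auto intro: always_eventually)
    qed
  qed
  then have "bounded (?f ` {0..T})" by (intro compact_imp_bounded compact_continuous_image compact_Icc)
  then obtain M where M: "M > 0" "\<And>t. t \<in> {0..T} \<Longrightarrow> \<bar>?f t\<bar> \<le> M" unfolding bounded_pos by auto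
  show ?thesis
  proof (rule that[of M])
    show "Xm (nrm (fourier_fun (u t))) \<le> ennreal M" if "t \<in> {0..T}" for t
      using M(2)[OF that] that by (simp add: chi_Xm[OF chi] ennreal_leI)
  qed (use M in simp)
qed

text \<open>\<open>fourier_fun (u t)\<close> is chosen separately for each t and need not be jointly
  measurable. Step functions in time are, and with errors 2^-k in \<chi>^-1 they converge at almost
  every frequency, because the errors are summable; their limit is a jointly measurable
  version.\<close>

lemma representative:
  assumes u: "u \<in> C_chi (- 1)"
  obtains U where "jm U" "\<And>t. t \<in> {0..T} \<Longrightarrow> AE z in lborel. fourier_fun (u t) z = U t z" "\<And>t. t \<notin> {0..T} \<Longrightarrow> U t = (\<lambda>_. 0)"
proof -
  define g where "g t = fourier_fun (u t)" for t
  have gm[measurable]: "bm (g t)" if "t \<ge> 0" for t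
    unfolding g_def using u that by (intro chiD(3)[of _ "- 1"]) (simp add: C_chi_def)
  have "\<exists>m::nat. m > 0 \<and> (\<forall>s t. s \<in> {0..T} \<longrightarrow> t \<in> {0..T} \<longrightarrow> \<bar>s - t\<bar> \<le> 1 / real m \<longrightarrow> Xm (\<lambda>z. en (g s z - g t z)) \<le> ennreal ((1 / 2) ^ k))" for k
  proof -
    obtain d where d: "d > 0" "\<And>s t. s \<in> {0..T} \<Longrightarrow> t \<in> {0..T} \<Longrightarrow> \<bar>s - t\<bar> < d \<Longrightarrow> Xm (\<lambda>z. en (g s z - g t z)) \<le> ennreal ((1 / 2) ^ k)"
      unfolding g_def using C_chi_modulus[OF u, of "(1 / 2) ^ k" T] by auto
    obtain n where "inverse (real (Suc n)) < d" using reals_Archimedean[OF d(1)] by blast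
    then show ?thesis using d(2) by (intro exI[of _ "Suc n"]) (auto simp: inverse_eq_divide simp del: of_nat_Suc)
  qed
  then have "\<forall>k. \<exists>m::nat. m > 0 \<and> (\<forall>s t. s \<in> {0..T} \<longrightarrow> t \<in> {0..T} \<longrightarrow> \<bar>s - t\<bar> \<le> 1 / real m \<longrightarrow> Xm (\<lambda>z. en (g s z - g t z)) \<le> ennreal ((1 / 2) ^ k))" ..
  from choice[OF this] obtain m :: "nat \<Rightarrow> nat" where m: "\<And>k. m k > 0"
      "\<And>k s t. s \<in> {0..T} \<Longrightarrow> t \<in> {0..T} \<Longrightarrow> \<bar>s - t\<bar> \<le> 1 / real (m k) \<Longrightarrow> Xm (\<lambda>z. en (g s z - g t z)) \<le> ennreal ((1 / 2) ^ k)"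
    by blast
  define S where "S k t z = g (real (nat \<lfloor>real (m k) * t\<rfloor>) / real (m k)) z" for k t z
  have jS[measurable]: "jm (S k)" for k
    unfolding S_def split_def
  proof (rule measurable_compose_countable[where f="\<lambda>j x. g (real j / real (m k)) (snd x)" and g="\<lambda>x. nat \<lfloor>real (m k) * fst x\<rfloor>"])
    show "(\<lambda>x. g (real j / real (m k)) (snd x)) \<in> borel_measurable (borel \<Otimes>\<^sub>M borel)" for j
      by (rule measurable_compose[OF measurable_snd gm]) simp
  qed measurable
  have S_conv: "AE z in lborel. (\<lambda>k. S k t z) \<longlonglongrightarrow> g t z" if t: "t \<in> {0..T}" for t
  proof -
    note [measurable] = jm_section[OF jS, of _ t]
    have [measurable]: "bm (g t)" using t by auto
    have X: "Xm (\<lambda>z. en (S k t z - g t z)) \<le> ennreal ((1 / 2) ^ k)" for k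
    proof -
      let ?j = "real (nat \<lfloor>real (m k) * t\<rfloor>)"
      have "?j = of_int \<lfloor>real (m k) * t\<rfloor>" using t by simp
      then have kt: "?j \<le> real (m k) * t" "real (m k) * t < ?j + 1" by linarith+
      have "t \<le> (?j + 1) / real (m k)" using kt(2) m(1)[of k] by (simp add: pos_le_divide_eq mult.commute)
      then have "t \<le> ?j / real (m k) + 1 / real (m k)" by (simp add: add_divide_distrib)
      moreover have "0 \<le> ?j / real (m k)" "?j / real (m k) \<le> t" using kt(1) m(1)[of k] by (auto simp: pos_divide_le_eq mult.commute)
      ultimately show ?thesis unfolding S_def using t by (intro m(2)) auto
    qed
    have "(\<integral>\<^sub>Lz. (\<Sum>k. ennreal (inverse (norm z)) * en (S k t z - g t z))) = (\<Sum>k. Xm (\<lambda>z. en (S k t z - g t z)))"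
      unfolding Xm_def by (rule nn_integral_suminf) measurable
    also have "\<dots> \<le> (\<Sum>k. ennreal ((1 / 2) ^ k))" by (rule suminf_le[OF X]) auto
    also have "\<dots> = ennreal (\<Sum>k. (1 / 2) ^ k)" by (rule suminf_ennreal2) (auto intro: summable_geometric)
    also have "\<dots> < \<infinity>" by simp
    finally have "AE z in lborel. (\<Sum>k. ennreal (inverse (norm z)) * en (S k t z - g t z)) \<noteq> \<infinity>"
      by (intro nn_integral_PInf_AE) auto
    then show ?thesis
      using AE_lborel_singleton[of "0::real^3"]
    proof eventually_elim
      case (elim z)
      have "summable (\<lambda>k. inverse (norm z) * norm (S k t z - g t z))"
        by (rule summable_suminf_not_top) (use elim(1) in \<open>auto simp: ennreal_mult\<close>)
      then have "(\<lambda>k. inverse (norm z) * norm (S k t z - g t z)) \<longlonglongrightarrow> 0" by (rule summable_LIMSEQ_zero)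
      from tendsto_mult_left[OF this, of "norm z"] have "(\<lambda>k. norm (S k t z - g t z)) \<longlonglongrightarrow> 0"
        using elim(2) by (simp flip: mult.assoc)
      then show ?case by (simp add: tendsto_norm_zero_iff LIM_zero_iff)
    qed
  qed
  define U where "U t z = indicat_real {0..T} t *\<^sub>R lim (\<lambda>k. S k t z)" for t z
  show ?thesis
  proof (rule that[of U])
    have "(\<lambda>x. lim (\<lambda>k. S k (fst x) (snd x))) \<in> borel_measurable (borel \<Otimes>\<^sub>M borel)"
      by (rule borel_measurable_lim_metric) measurable
    then show "jm U" unfolding U_def split_def by measurable
    show "AE z in lborel. fourier_fun (u t) z = U t z" if "t \<in> {0..T}" for t
      using S_conv[OF that] by eventually_elim (use that in \<open>simp add: U_def g_def limI\<close>)
  qed (simp add: U_def fun_eq_iff)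
qed

text \<open>The representative vanishes outside \<open>{0..T}\<close>. Thus bounds over the whole
  half line become available although a curve in \<open>C_chi\<close> is only locally
  bounded.\<close>

lemma solution_class:
  assumes u: "u \<in> C_chi (- 1) \<inter> L1_chi 1"
  obtains U M where "jm U" "M \<ge> 0" "\<And>s. Xm (nrm (U s)) \<le> ennreal M" "lint {0..} (\<lambda>s. X1 (nrm (U s))) < \<infinity>"
    "\<And>t. t \<in> {0..T} \<Longrightarrow> frepv (U t) (u t)"
proof -
  have uC: "u \<in> C_chi (- 1)" and u1: "u \<in> L1_chi 1" using u by auto
  have chi: "u t \<in> chi (- 1)" if "t \<ge> 0" for t using uC that by (simp add: C_chi_def)
  obtain U where U: "jm U" "\<And>t. t \<in> {0..T} \<Longrightarrow> AE z in lborel. fourier_fun (u t) z = U t z" "\<And>t. t \<notin> {0..T} \<Longrightarrow> U t = (\<lambda>_. 0)"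
    using representative[OF uC] by blast
  obtain M where M: "M \<ge> 0" "\<And>t. t \<in> {0..T} \<Longrightarrow> Xm (nrm (fourier_fun (u t))) \<le> ennreal M"
    using C_chi_bounded[OF uC] by blast
  note [measurable] = U(1) jm_section[OF U(1)]
  have aeX: "Xm (nrm (U t)) = Xm (nrm (fourier_fun (u t)))" "X1 (nrm (U t)) = X1 (nrm (fourier_fun (u t)))"
    if "t \<in> {0..T}" for t
    unfolding Xm_def X1_def using U(2)[OF that] by (auto intro!: nn_integral_cong_AE elim!: eventually_mono)
  have "lint {0..} (\<lambda>s. X1 (nrm (U s))) = (\<integral>\<^sup>+s\<in>{0..}. X1 (nrm (U s)) \<partial>lebesgue)"
    by (rule nn_integral_completion[symmetric])
  also have "\<dots> = (\<integral>\<^sup>+s. X1 (nrm (U s)) \<partial>lebesgue_on {0..})"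
    by (rule nn_integral_restrict_space[symmetric]) simp
  also have "\<dots> \<le> (\<integral>\<^sup>+s. ennreal (norm (chi_norm 1 (u s))) \<partial>lebesgue_on {0..})"
  proof (rule nn_integral_mono_AE)
    have "AE s in lebesgue_on {0..}. u s \<in> chi 1" using u1 by (simp add: L1_chi_def)
    then show "AE s in lebesgue_on {0..}. X1 (nrm (U s)) \<le> ennreal (norm (chi_norm 1 (u s)))"
    proof eventually_elim
      case (elim s)
      show ?case
      proof (cases "s \<in> {0..T}")
        case True
        then show ?thesis by (simp only: aeX(2) chi_X1[OF elim]) (simp add: ennreal_leI)
      next
        case False
        then show ?thesis by (simp add: U(3) X1_def)
      qed
    qed
  qed
  also have "\<dots> < \<infinity>" using u1 by (simp add: L1_chi_def integrable_iff_bounded)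
  finally have X1f: "lint {0..} (\<lambda>s. X1 (nrm (U s))) < \<infinity>" .
  show ?thesis
  proof (rule that[OF U(1) M(1) _ X1f])
    show "Xm (nrm (U s)) \<le> ennreal M" for s
    proof (cases "s \<in> {0..T}")
      case True
      then show ?thesis using aeX(1) M(2) by simp
    next
      case False
      then show ?thesis by (simp add: U(3) Xm_def)
    qed
    show "frepv (U t) (u t)" if "t \<in> {0..T}" for t
      by (rule frepv_cong_AE[OF chiD(1)[OF chi] _ U(2)[OF that]]) (use that in auto)
  qed
qed

subsection \<open>The evolution equation of a weak solution\<close>

lemma norm_power2_vec3: "(norm (z :: real^3))\<^sup>2 = (\<Sum>j\<in>UNIV. z $ j * z $ j)"
  by (simp add: power2_norm_eq_inner inner_vec_def)

lemma schwartz_norm2: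
  assumes "\<rho> \<in> schwartz"
  shows "(\<lambda>z. cor ((norm z)\<^sup>2) * \<rho> z) \<in> schwartz"
proof -
  have "(\<lambda>z. \<Sum>j\<in>UNIV. cor (z $ j) * (cor (z $ j) * \<rho> z)) \<in> schwartz"
    by (intro schwartz_sum schwartz_coord assms) auto
  then show ?thesis by (simp add: norm_power2_vec3 sum_distrib_right mult.assoc)
qed

lemma evolution_integrable:
  fixes H :: "real \<Rightarrow> vfield"
  assumes j[measurable]: "jm H" and fin: "lint {0..t} (\<lambda>s. Xm (nrm (H s))) < \<infinity>"
  shows "AE z in lborel. integrable lborel (\<lambda>s. indicat_real {0..t} s *\<^sub>R H s z)"
proof -
  \<comment> \<open>The additional weight |z|^-2 turns the \<open>X1\<close> norm into the
    \<open>Xm\<close> norm of H, so that \<open>X1_finite_AE\<close> applies; the weight is removed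
    again for z \<noteq> 0.\<close>
  let ?f = "\<lambda>s z. ennreal ((inverse (norm z))\<^sup>2) * en (H s z)"
  have X: "X1 (?f s) = Xm (nrm (H s))" for s
    unfolding X1_def Xm_def
  proof (intro nn_integral_cong)
    fix z :: "real^3"
    have "norm z * (inverse (norm z))\<^sup>2 = inverse (norm z)" by (cases "z = 0") (simp_all add: power2_eq_square)
    then show "ennreal (norm z) * ?f s z = ennreal (inverse (norm z)) * en (H s z)"
      by (simp flip: mult.assoc ennreal_mult)
  qed
  have "AE z in lborel. (lint {0..t} (\<lambda>s. ?f s z)) < \<infinity>"
    by (rule X1_finite_AE) (unfold X, use fin in auto)
  then show ?thesis
    using AE_lborel_singleton[of "0::real^3"]
  proof eventually_elim
    case (elim z)
    have "lint {0..t} (\<lambda>s. ?f s z) = ennreal ((inverse (norm z))\<^sup>2) * (lint {0..t} (\<lambda>s. en (H s z)))"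
      unfolding mult.assoc by (rule nn_integral_cmult) measurable
    then have "lint {0..t} (\<lambda>s. en (H s z)) < \<infinity>"
      using elim by (auto simp: ennreal_mult_less_top power2_eq_square)
    moreover have "(\<integral>\<^sub>Ls. en (indicat_real {0..t} s *\<^sub>R H s z)) = lint {0..t} (\<lambda>s. en (H s z))"
      by (intro nn_integral_cong) (auto simp: indicator_def)
    ultimately show ?case by (intro integrableI_bounded) auto
  qed
qed

text \<open>The test functions carry the factor |z|^2 because solenoidal ones are built from |z|^2
  times the Leray projector, which is polynomial, whereas the projector itself is not smooth at the
  origin. The factor is divided out for z \<noteq> 0.\<close>

lemma weak_evolution:
  fixes H :: "real \<Rightarrow> vfield"
  assumes [measurable]: "bm v0" "bm v1"
    and v: "Xm (nrm v0) < \<infinity>" "Xm (nrm v1) < \<infinity>"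
    and j[measurable]: "jm H" and fin: "lint {0..t} (\<lambda>s. Xm (nrm (H s))) < \<infinity>"
    and weak: "\<And>\<rho> k. \<rho> \<in> schwartz \<Longrightarrow> (LBINT z. (v1 z - v0 z) $ k * (cor ((norm z)\<^sup>2) * \<rho> z)) =
      (LBINT s. indicat_real {0..t} s *\<^sub>R (LBINT z. H s z $ k * (cor ((norm z)\<^sup>2) * \<rho> z)))"
  shows "AE z in lborel. integrable lborel (\<lambda>s. indicat_real {0..t} s *\<^sub>R H s z) \<and>
    v1 z = v0 z + (LBINT s. indicat_real {0..t} s *\<^sub>R H s z)"
proof -
  define q where "q z = (LBINT s. indicat_real {0..t} s *\<^sub>R H s z)" for z
  have [measurable]: "bm q" unfolding q_def by measurable
  note int = evolution_integrable[OF j fin]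
  have "AE z in lborel. cor ((norm z)\<^sup>2) * (v1 z - v0 z - q z) $ k = 0" for k
  proof (rule schwartz_fundamental)
    fix \<rho> :: "sfield" assume \<rho>: "\<rho> \<in> schwartz"
    define f where "f z = cor ((norm z)\<^sup>2) * \<rho> z" for z :: "real^3"
    have f: "f \<in> schwartz" unfolding f_def by (rule schwartz_norm2[OF \<rho>])
    have [measurable]: "bm f" "bm \<rho>" by (intro schwartz_measurable f \<rho>)+
    let ?g = "\<lambda>s z. indicat_real {0..t} s *\<^sub>R (H s z $ k * f z)"
    note gi = pairing_integrable[OF j fin f, of k]
    have ae: "AE z in lborel. (LBINT s. ?g s z) = q z $ k * f z"
      using int
    proof eventually_elim
      case (elim z)
      have "q z $ k = (LBINT s. (indicat_real {0..t} s *\<^sub>R H s z) $ k)"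
        unfolding q_def by (rule integral_bounded_linear[OF bounded_linear_vec_nth elim, symmetric])
      then have "q z $ k * f z = (LBINT s. (indicat_real {0..t} s *\<^sub>R H s z) $ k * f z)"
        by (simp only: integral_mult_left_zero)
      then show ?case by simp
    qed
    have qi: "integrable lborel (\<lambda>z. q z $ k * f z)"
      by (subst integrable_cong_AE[OF _ _ ae, symmetric]) (measurable, rule lborel_pair.integrable_snd[OF gi])
    have vi: "integrable lborel (\<lambda>z. (v1 z - v0 z) $ k * f z)"
      using slow_schwartz[OF slow_of_Xm[OF _ v(1), of k] f] slow_schwartz[OF slow_of_Xm[OF _ v(2), of k] f]
      by (auto simp: left_diff_distrib)
    have split: "(\<lambda>z. cor ((norm z)\<^sup>2) * (v1 z - v0 z - q z) $ k * \<rho> z) = (\<lambda>z. (v1 z - v0 z) $ k * f z - q z $ k * f z)"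
      by (simp add: fun_eq_iff f_def algebra_simps)
    show "integrable lborel (\<lambda>z. cor ((norm z)\<^sup>2) * (v1 z - v0 z - q z) $ k * \<rho> z)"
      unfolding split by (rule integrable_sub[OF vi qi])
    have "(LBINT z. q z $ k * f z) = (LBINT z. LBINT s. ?g s z)"
      by (rule LINT_cong_AE[symmetric, OF _ _ ae]) measurable
    also have "\<dots> = (LBINT s. LBINT z. ?g s z)" by (rule lborel_pair.Fubini_integral[OF gi])
    also have "\<dots> = (LBINT s. indicat_real {0..t} s *\<^sub>R (LBINT z. H s z $ k * f z))"
      by (simp only: integral_scaleR_right)
    also have "\<dots> = (LBINT z. (v1 z - v0 z) $ k * f z)" unfolding f_def by (rule weak[OF \<rho>, symmetric])
    finally show "(LBINT z. cor ((norm z)\<^sup>2) * (v1 z - v0 z - q z) $ k * \<rho> z) = 0"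
      unfolding split LINT_diff[OF vi qi] by simp
  qed measurable
  then have "AE z in lborel. \<forall>k\<in>(UNIV::3 set). cor ((norm z)\<^sup>2) * (v1 z - v0 z - q z) $ k = 0"
    by (intro AE_finite_allI) auto
  then show ?thesis
    using int AE_lborel_singleton[of "0::real^3"]
  proof eventually_elim
    case (elim z)
    have "(v1 z - v0 z - q z) $ k = 0" for k
      using elim(1)[rule_format, of k] elim(3) by (simp del: vector_minus_component)
    then have "v1 z - v0 z - q z = 0" by (simp add: vec_eq_iff)
    then show ?case using elim(2) by (simp add: q_def algebra_simps)
  qed
qed

text \<open>Linearity of a tempered distribution is given for combinations of two Schwartz
  functions, so the third function is expressed through the other two.\<close>

lemma tempered_sum_zero:
  fixes f :: "3 \<Rightarrow> sfield"
  assumes P: "tempered P" and f: "\<And>i. f i \<in> schwartz" and z: "\<And>x. (\<Sum>i\<in>UNIV. f i x) = 0"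
  shows "(\<Sum>i\<in>UNIV. P (f i)) = 0"
proof -
  have lin: "P (\<lambda>x. a * \<phi> x + b * \<psi> x) = a * P \<phi> + b * P \<psi>" if "\<phi> \<in> schwartz" "\<psi> \<in> schwartz" for \<phi> \<psi> a b
    using P that by (simp add: tempered_def)
  have "f 3 = (\<lambda>x. (- 1) * f 1 x + (- 1) * f 2 x)"
  proof
    fix x show "f 3 x = (- 1) * f 1 x + (- 1) * f 2 x"
      using z[of x] unfolding sum_3 by (simp add: eq_neg_iff_add_eq_0 algebra_simps)
  qed
  then have "P (f 3) = (- 1) * P (f 1) + (- 1) * P (f 2)" by (simp only: lin[OF f f])
  then show ?thesis unfolding sum_3 by simp
qed

lemma fourier_sum_zero:
  fixes f :: "3 \<Rightarrow> sfield"
  assumes f: "\<And>i. f i \<in> schwartz" and z: "\<And>x. (\<Sum>i\<in>UNIV. f i x) = 0"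
  shows "(\<Sum>i\<in>UNIV. fourier (f i) z) = 0"
  unfolding fourier_def LINT_sum[OF phase_schwartz_integrable[OF f], symmetric]
  by (simp add: z flip: sum_distrib_left)

text \<open>Solenoidal test fields do not see the pressure.\<close>

lemma pressure_cancel:
  fixes f :: "3 \<Rightarrow> sfield"
  assumes P: "tempered P" and f: "\<And>i. f i \<in> schwartz" and z: "\<And>x. (\<Sum>i\<in>UNIV. cor (x $ i) * f i x) = 0"
  shows "(\<Sum>i\<in>UNIV. dpartial i P (fourier (f i))) = 0"
proof -
  let ?g = "\<lambda>i x. - \<i> * (cor (x $ i) * f i x)"
  have g: "?g i \<in> schwartz" for i by (intro schwartz_scale schwartz_coord f)
  have gz: "(\<Sum>i\<in>UNIV. ?g i x) = 0" for x using z[of x] unfolding sum_distrib_left[symmetric] by simp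
  have "(\<Sum>i\<in>UNIV. P (fourier (?g i))) = 0"
    by (rule tempered_sum_zero[OF P fourier_schwartz[OF g] fourier_sum_zero[OF g gz]])
  then show ?thesis unfolding dpartial_def partial_fourier[OF f] sum_negf by simp
qed

lemma proj_sum:
  "(\<Sum>i\<in>UNIV. V $ i * ((if i = k then 1 else 0) * (cor ((norm z)\<^sup>2) * r) - cor (z $ i) * (cor (z $ k) * r))) =
    V $ k * (cor ((norm z)\<^sup>2) * r) - dotc z V * (cor (z $ k) * r)"
proof -
  have "(\<Sum>i\<in>UNIV. V $ i * ((if i = k then 1 else 0) * (cor ((norm z)\<^sup>2) * r) - cor (z $ i) * (cor (z $ k) * r))) =
    (\<Sum>i\<in>UNIV. (if i = k then V $ i * (cor ((norm z)\<^sup>2) * r) else 0) - cor (z $ i) * V $ i * (cor (z $ k) * r))"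
    by (intro sum.cong refl) (simp add: algebra_simps)
  then show ?thesis unfolding sum_subtractf dotc_def sum_distrib_right by simp
qed

text \<open>Testing the unprojected right side against |z|^2 e_k - z_k z amounts to testing |z|^2
  times its projection, so the pressure-free equation reappears.\<close>

lemma HU_proj:
  fixes a b :: "vfield" and \<mu> :: real
  assumes d: "dotc z (a z) = 0"
  defines "V \<equiv> - ((\<mu> * (norm z)\<^sup>2) *\<^sub>R a z) - (vbilin a a z - vbilin b b z)"
  shows "V $ k * (cor ((norm z)\<^sup>2) * r) - dotc z V * (cor (z $ k) * r) = HU \<mu> a b z $ k * (cor ((norm z)\<^sup>2) * r)"
proof (cases "z = 0")
  case False
  have dV: "dotc z V = - dotc z (vbilin a a z - vbilin b b z)" by (simp add: V_def dotc_diff dotc_uminus dotc_scaleR d)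
  show ?thesis unfolding dV unfolding V_def HU_def leray_def using False by (simp add: field_simps)
qed simp

locale mhd_fields =
  fixes U b :: "real \<Rightarrow> vfield" and M T \<mu>1 \<mu>2 :: real
  assumes j: "jm U" "jm b"
    and M: "M \<ge> 0" "\<And>s. Xm (nrm (U s)) \<le> ennreal M" "\<And>s. Xm (nrm (b s)) \<le> ennreal M"
    and X1: "lint {0..} (\<lambda>s. X1 (nrm (U s))) < \<infinity>" "lint {0..} (\<lambda>s. X1 (nrm (b s))) < \<infinity>"
    and evol: "\<And>t. t \<in> {0..T} \<Longrightarrow> evolves t U (\<lambda>s. HU \<mu>1 (U s) (b s))" "\<And>t. t \<in> {0..T} \<Longrightarrow> evolves t b (\<lambda>s. HB \<mu>2 (U s) (b s))"

text \<open>An arbitrary weak solution comes with an unknown tempered pressure that need not even be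
  a function on the Fourier side. Only solenoidal test fields can remove it; the sum over components
  of the momentum equation then yields \<open>HU\<close> at almost every frequency.\<close>

lemma mhd_fourier:
  assumes u: "u \<in> C_chi (- 1) \<inter> L1_chi 1" and B: "B \<in> C_chi (- 1) \<inter> L1_chi 1" and sol: "mhd_solution \<mu>1 \<mu>2 u0 B0 u B"
    and \<mu>: "\<mu>1 > 0" "\<mu>2 > 0"
  obtains U b M where "mhd_fields U b M T \<mu>1 \<mu>2" "\<And>t. t \<in> {0..T} \<Longrightarrow> frepv (U t) (u t)" "\<And>t. t \<in> {0..T} \<Longrightarrow> frepv (b t) (B t)"
proof -
  obtain U M1 where U: "jm U" "M1 \<ge> 0" "\<And>s. Xm (nrm (U s)) \<le> ennreal M1" "lint {0..} (\<lambda>s. X1 (nrm (U s))) < \<infinity>"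
    "\<And>t. t \<in> {0..T} \<Longrightarrow> frepv (U t) (u t)" using solution_class[OF u, where T=T] by blast
  obtain b M2 where b: "jm b" "M2 \<ge> 0" "\<And>s. Xm (nrm (b s)) \<le> ennreal M2" "lint {0..} (\<lambda>s. X1 (nrm (b s))) < \<infinity>"
    "\<And>t. t \<in> {0..T} \<Longrightarrow> frepv (b t) (B t)" using solution_class[OF B, where T=T] by blast
  define M where "M = M1 + M2"
  have M: "M \<ge> 0" "Xm (nrm (U s)) \<le> ennreal M" "Xm (nrm (b s)) \<le> ennreal M" for s
    using U(2) b(2) by (auto simp: M_def intro: order_trans[OF U(3)] order_trans[OF b(3)] ennreal_leI)
  define G where "G s z = en (U s z) + en (b s z)" for s z
  note [measurable] = U(1) b(1) jm_section[OF U(1)] jm_section[OF b(1)]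
  have jG: "jm G" unfolding G_def by measurable
  have GX: "Xm (G s) \<le> ennreal M" for s
    unfolding G_def M_def using U(2) b(2) by (subst X_add(1)) (auto simp: ennreal_plus intro: add_mono U(3) b(3))
  have G1: "lint {0..} (\<lambda>s. X1 (G s)) < \<infinity>"
  proof -
    have "X1 (G s) = X1 (nrm (U s)) + X1 (nrm (b s))" for s unfolding G_def by (rule X_add) measurable
    then show ?thesis using U(4) b(4) by (simp add: distrib_right nn_integral_add)
  qed
  have Gle: "en (U s \<eta>) \<le> G s \<eta>" "en (b s \<eta>) \<le> G s \<eta>" for s \<eta> by (auto simp: G_def)
  have HUf: "lint {0..t} (\<lambda>s. Xm (\<lambda>z. en (HU \<mu>1 (U s) (b s) z))) < \<infinity>" for t
    by (rule H_integral_finite(1)[OF jG U(1) b(1) GX M(1) G1 Gle \<mu>(1)])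
  have HBf: "lint {0..t} (\<lambda>s. Xm (\<lambda>z. en (HB \<mu>2 (U s) (b s) z))) < \<infinity>" for t
    by (rule H_integral_finite(2)[OF jG U(1) b(1) GX M(1) G1 Gle \<mu>(2)])
  have jH[measurable]: "jm (\<lambda>s. HU \<mu>1 (U s) (b s))" "jm (\<lambda>s. HB \<mu>2 (U s) (b s))" by measurable
  have div: "AE z in lborel. dotc z (U s z) = 0" "AE z in lborel. dotc z (b s z) = 0" if s: "s \<in> {0..T}" for s
    using sol s U(5)[OF s] b(5)[OF s] ddiv_zero_iff[of "U s" "u s"] ddiv_zero_iff[of "b s" "B s"]
    by (auto simp: mhd_solution_def frepv_def)
  have fin: "Xm (nrm (U s)) < \<infinity>" "Xm (nrm (b s)) < \<infinity>" for s
    using le_less_trans[OF M(2) ennreal_less_top] le_less_trans[OF M(3) ennreal_less_top] by auto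
  have aeX1: "AE s in lborel. X1 (nrm (w s)) * indicator {0..} s \<noteq> \<infinity>"
    if "jm w" "lint {0..} (\<lambda>s. X1 (nrm (w s))) < \<infinity>" for w :: "real \<Rightarrow> vfield"
  proof (rule nn_integral_PInf_AE)
    note [measurable] = that(1)
    show "(\<lambda>s. X1 (nrm (w s)) * indicator {0..} s) \<in> borel_measurable lborel" by measurable
  qed (use that(2) in simp)
  have good: "AE s in lborel. s \<in> {0..T} \<longrightarrow> vregular (U s) (u s) \<and> vregular (b s) (B s)"
    using aeX1[OF U(1,4)] aeX1[OF b(1,4)]
    by eventually_elim (use U(5) b(5) fin div in \<open>auto simp: vregular_def less_top\<close>)
  have rep: "integrable lborel (\<lambda>z. U r z $ k * f z)" "(u r $ k) (fourier f) = (LBINT z. U r z $ k * f z)"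
      "integrable lborel (\<lambda>z. b r z $ k * f z)" "(B r $ k) (fourier f) = (LBINT z. b r z $ k * f z)"
    if r: "r \<in> {0..T}" and f: "f \<in> schwartz" for r k f
    using frepD[OF U(5)[OF r, unfolded frepv_def, rule_format] f] frepD[OF b(5)[OF r, unfolded frepv_def, rule_format] f] by auto
  show ?thesis
  proof (rule that[OF _ U(5) b(5)], rule mhd_fields.intro[OF U(1) b(1) M(1,2,3) U(4) b(4)])
    fix t assume t: "t \<in> {0..T}"
    then have t0: "0 \<in> {0..T}" "t \<ge> 0" by auto
    have goodt: "AE s in lborel. s \<in> {0..t} \<longrightarrow> vregular (U s) (u s) \<and> vregular (b s) (B s)"
      using good by eventually_elim (use t in auto)
    show "evolves t b (\<lambda>s. HB \<mu>2 (U s) (b s))"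
    proof (rule weak_evolution[OF _ _ fin(2) fin(2) jH(2) HBf])
      fix \<rho> :: "sfield" and k assume \<rho>: "\<rho> \<in> schwartz"
      define f where "f z = cor ((norm z)\<^sup>2) * \<rho> z" for z :: "real^3"
      have f: "f \<in> schwartz" unfolding f_def by (rule schwartz_norm2[OF \<rho>])
      let ?F = "\<lambda>s \<phi>. - advect (u s) (B s $ k) \<phi> + advect (B s) (u s $ k) \<phi> + of_real \<mu>2 * dlaplace (B s $ k) \<phi>"
      have td: "(B t $ k) (fourier f) - (B 0 $ k) (fourier f) = (LINT s|lebesgue_on {0..t}. ?F s (fourier f))"
        using sol fourier_schwartz[OF f] t0(2) by (simp add: mhd_solution_def time_derivative_def)
      have ae: "AE s in lborel. s \<in> {0..t} \<longrightarrow> ?F s (fourier f) = (LBINT z. HB \<mu>2 (U s) (b s) z $ k * f z)"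
        using goodt by eventually_elim (use weak_terms(4)[OF _ _ f] in auto)
      have J: "integrable lborel (\<lambda>s. indicat_real {0..t} s *\<^sub>R (LBINT z. HB \<mu>2 (U s) (b s) z $ k * f z))"
        using lborel_pair.integrable_fst[OF pairing_integrable[OF jH(2) HBf f, of t k]] unfolding integral_scaleR_right .
      have "(LBINT z. (b t z - b 0 z) $ k * f z) = (B t $ k) (fourier f) - (B 0 $ k) (fourier f)"
        unfolding rep(4)[OF t f] rep(4)[OF t0(1) f] LINT_diff[OF rep(3)[OF t f] rep(3)[OF t0(1) f], symmetric]
        by (simp add: left_diff_distrib)
      also have "\<dots> = (LBINT s. indicat_real {0..t} s *\<^sub>R (LBINT z. HB \<mu>2 (U s) (b s) z $ k * f z))"
        unfolding td by (rule lebesgue_on_transfer(2)[OF J _ ae]) simp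
      finally show "(LBINT z. (b t z - b 0 z) $ k * (cor ((norm z)\<^sup>2) * \<rho> z)) =
        (LBINT s. indicat_real {0..t} s *\<^sub>R (LBINT z. HB \<mu>2 (U s) (b s) z $ k * (cor ((norm z)\<^sup>2) * \<rho> z)))"
        unfolding f_def .
    qed measurable
    show "evolves t U (\<lambda>s. HU \<mu>1 (U s) (b s))"
    proof (rule weak_evolution[OF _ _ fin(1) fin(1) jH(1) HUf])
      fix \<rho> :: "sfield" and k :: 3 assume \<rho>: "\<rho> \<in> schwartz"
      define f where "f z = cor ((norm z)\<^sup>2) * \<rho> z" for z :: "real^3"
      have f: "f \<in> schwartz" unfolding f_def by (rule schwartz_norm2[OF \<rho>])
      \<comment> \<open>The k-th column of |z|^2 times the Leray projector, multiplied by \<rho>: a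
        Schwartz field orthogonal to z at every frequency.\<close>
      define \<psi> where "\<psi> i z = (if i = k then 1 else 0) * (cor ((norm z)\<^sup>2) * \<rho> z) - cor (z $ i) * (cor (z $ k) * \<rho> z)"
        for i and z :: "real^3"
      have \<psi>: "\<psi> i \<in> schwartz" for i unfolding \<psi>_def
        by (intro schwartz_diff schwartz_scale schwartz_norm2 schwartz_coord \<rho>)
      have sol\<psi>: "(\<Sum>i\<in>UNIV. cor (z $ i) * \<psi> i z) = 0" for z
        using proj_sum[of "\<chi> i. cor (z $ i)" k z "\<rho> z"]
        by (simp add: \<psi>_def dotc_def norm_power2_vec3)
      have psum: "(\<Sum>i\<in>UNIV. V $ i * \<psi> i z) = V $ k * f z - dotc z V * (cor (z $ k) * \<rho> z)" for V z
        unfolding \<psi>_def f_def by (rule proj_sum)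
      obtain p where p: "\<And>t. t \<ge> 0 \<Longrightarrow> tempered (p t)" and
        td: "\<And>i. time_derivative (\<lambda>t. u t $ i) (\<lambda>t \<phi>. - advect (u t) (u t $ i) \<phi> + of_real \<mu>1 * dlaplace (u t $ i) \<phi>
             - dpartial i (p t) \<phi> + advect (B t) (B t $ i) \<phi>)"
        using sol unfolding mhd_solution_def by blast
      let ?F = "\<lambda>i s \<phi>. - advect (u s) (u s $ i) \<phi> + of_real \<mu>1 * dlaplace (u s $ i) \<phi> - dpartial i (p s) \<phi> + advect (B s) (B s $ i) \<phi>"
      have tdi: "integrable (lebesgue_on {0..t}) (\<lambda>s. ?F i s (fourier (\<psi> i)))"
        "(u t $ i) (fourier (\<psi> i)) - (u 0 $ i) (fourier (\<psi> i)) = (LINT s|lebesgue_on {0..t}. ?F i s (fourier (\<psi> i)))" for i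
        using td[of i] fourier_schwartz[OF \<psi>[of i]] t0(2) by (simp_all add: time_derivative_def)
      have ae: "AE s in lborel. s \<in> {0..t} \<longrightarrow> (\<Sum>i\<in>UNIV. ?F i s (fourier (\<psi> i))) = (LBINT z. HU \<mu>1 (U s) (b s) z $ k * f z)"
        using goodt
      proof eventually_elim
        case (elim s)
        show ?case
        proof
          assume s: "s \<in> {0..t}"
          then have ra: "vregular (U s) (u s)" and rb: "vregular (b s) (B s)" using elim by auto
          let ?V = "\<lambda>z. - ((\<mu>1 * (norm z)\<^sup>2) *\<^sub>R U s z) - (vbilin (U s) (U s) z - vbilin (b s) (b s) z)"
          note wt = weak_terms[OF ra rb \<psi>, where \<mu>=\<mu>1]
          have "(\<Sum>i\<in>UNIV. ?F i s (fourier (\<psi> i))) = (\<Sum>i\<in>UNIV. (LBINT z. ?V z $ i * \<psi> i z) - dpartial i (p s) (fourier (\<psi> i)))"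
            unfolding wt(3)[symmetric] by (intro sum.cong refl) simp
          also have "\<dots> = (\<Sum>i\<in>UNIV. LBINT z. ?V z $ i * \<psi> i z)"
            unfolding sum_subtractf using pressure_cancel[OF p \<psi> sol\<psi>, of s] s by simp
          also have "\<dots> = (LBINT z. (\<Sum>i\<in>UNIV. ?V z $ i * \<psi> i z))"
            by (rule LINT_sum[symmetric]) (rule wt(1))
          also have "\<dots> = (LBINT z. HU \<mu>1 (U s) (b s) z $ k * f z)"
          proof (rule LINT_cong_AE)
            show "AE z in lborel. (\<Sum>i\<in>UNIV. ?V z $ i * \<psi> i z) = HU \<mu>1 (U s) (b s) z $ k * f z"
              using vregularD(4)[OF ra] unfolding psum f_def by eventually_elim (rule HU_proj)
            show "(\<lambda>z. \<Sum>i\<in>UNIV. ?V z $ i * \<psi> i z) \<in> borel_measurable lborel"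
              by (intro borel_measurable_sum borel_measurable_integrable wt(1))
            have [measurable]: "bm f" by (rule schwartz_measurable[OF f])
            show "(\<lambda>z. HU \<mu>1 (U s) (b s) z $ k * f z) \<in> borel_measurable lborel" by measurable
          qed
          finally show "(\<Sum>i\<in>UNIV. ?F i s (fourier (\<psi> i))) = (LBINT z. HU \<mu>1 (U s) (b s) z $ k * f z)" .
        qed
      qed
      have J: "integrable lborel (\<lambda>s. indicat_real {0..t} s *\<^sub>R (LBINT z. HU \<mu>1 (U s) (b s) z $ k * f z))"
        using lborel_pair.integrable_fst[OF pairing_integrable[OF jH(1) HUf f, of t k]] unfolding integral_scaleR_right .
      have Ui: "integrable lborel (\<lambda>z. (U t z - U 0 z) $ i * \<psi> i z)" for i
        using rep(1)[OF t \<psi>] rep(1)[OF t0(1) \<psi>] by (simp add: left_diff_distrib)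
      have "(LBINT z. (U t z - U 0 z) $ k * f z) = (LBINT z. (\<Sum>i\<in>UNIV. (U t z - U 0 z) $ i * \<psi> i z))"
      proof (rule LINT_cong_AE)
        show "AE z in lborel. (U t z - U 0 z) $ k * f z = (\<Sum>i\<in>UNIV. (U t z - U 0 z) $ i * \<psi> i z)"
          using div(1)[OF t] div(1)[OF t0(1)] unfolding psum by eventually_elim (simp add: dotc_diff)
        show "(\<lambda>z. \<Sum>i\<in>UNIV. (U t z - U 0 z) $ i * \<psi> i z) \<in> borel_measurable lborel"
          by (intro borel_measurable_sum borel_measurable_integrable Ui)
        have [measurable]: "bm f" by (rule schwartz_measurable[OF f])
        show "(\<lambda>z. (U t z - U 0 z) $ k * f z) \<in> borel_measurable lborel" by measurable
      qed
      also have "\<dots> = (\<Sum>i\<in>UNIV. LBINT z. (U t z - U 0 z) $ i * \<psi> i z)"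
        by (rule LINT_sum) (rule Ui)
      also have "\<dots> = (\<Sum>i\<in>UNIV. LINT s|lebesgue_on {0..t}. ?F i s (fourier (\<psi> i)))"
      proof (intro sum.cong refl)
        fix i
        show "(LBINT z. (U t z - U 0 z) $ i * \<psi> i z) = (LINT s|lebesgue_on {0..t}. ?F i s (fourier (\<psi> i)))"
          unfolding tdi(2)[symmetric] rep(2)[OF t \<psi>] rep(2)[OF t0(1) \<psi>] LINT_diff[OF rep(1)[OF t \<psi>] rep(1)[OF t0(1) \<psi>], symmetric]
          by (simp add: left_diff_distrib)
      qed
      also have "\<dots> = (LINT s|lebesgue_on {0..t}. (\<Sum>i\<in>UNIV. ?F i s (fourier (\<psi> i))))"
        by (rule LINT_sum[symmetric]) (rule tdi(1))
      also have "\<dots> = (LBINT s. indicat_real {0..t} s *\<^sub>R (LBINT z. HU \<mu>1 (U s) (b s) z $ k * f z))"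
        by (rule lebesgue_on_transfer(2)[OF J _ ae]) simp
      finally show "(LBINT z. (U t z - U 0 z) $ k * (cor ((norm z)\<^sup>2) * \<rho> z)) =
        (LBINT s. indicat_real {0..t} s *\<^sub>R (LBINT z. HU \<mu>1 (U s) (b s) z $ k * (cor ((norm z)\<^sup>2) * \<rho> z)))"
        unfolding f_def .
    qed measurable
  qed
qed

subsection \<open>Uniqueness\<close>

lemma duhamel_le:
  assumes "bm G" "l \<ge> 0" "t \<ge> 0"
  shows "duhamel l G t \<le> lint {0..t} G"
  unfolding duhamel_energy[OF assms, symmetric] by simp

lemma vduhamel_le:
  fixes F :: "real \<Rightarrow> 'a::{banach, second_countable_topology}"
  assumes "bm F" and fin: "duhamel l (nrm F) t < \<infinity>"
  shows "en (vduhamel l F t) \<le> duhamel l (nrm F) t"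
proof -
  have "en (vduhamel l F t) \<le> (\<integral>\<^sub>Ls. en (indicat_real {0..t} s *\<^sub>R (exp (- l * (t - s)) *\<^sub>R F s)))"
    unfolding vduhamel_def by (rule integral_norm_bound_ennreal[OF vduhamel_integrable[OF assms(1) order_refl fin]])
  also have "\<dots> = duhamel l (nrm F) t"
    unfolding duhamel_def by (intro nn_integral_cong) (auto simp: indicator_def ennreal_mult)
  finally show ?thesis .
qed

text \<open>The equation d' = F - l d with d 0 = 0 is solved by Duhamel's formula. The difference e
  of d and that formula satisfies e \<le> l times its own integral, so Gronwall with zero data gives
  e = 0. The integral equation is known at almost every time before t and at t itself.\<close>

lemma ode_duhamel:
  fixes d F :: "real \<Rightarrow> 'a::{banach, second_countable_topology}" and l t :: real
  defines "I \<equiv> \<lambda>t. LBINT r. indicat_real {0..t} r *\<^sub>R (F r - l *\<^sub>R d r)"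
  assumes [measurable]: "bm d" "bm F" and l: "l \<ge> 0"
    and F: "lint {0..t} (nrm F) < \<infinity>" and d: "lint {0..t} (nrm d) < \<infinity>"
    and ae: "AE s in lborel. s \<in> {0..t} \<longrightarrow> d s = I s" and t: "t \<ge> 0" "d t = I t"
  shows "en (d t) \<le> duhamel l (nrm F) t"
proof -
  let ?f = "vduhamel l F"
  have mono: "lint {0..r} g \<le> lint {0..t} g" if "r \<in> {0..t}" for r and g :: "real \<Rightarrow> ennreal"
    using that by (intro nn_integral_mono) (auto simp: indicator_def)
  have [measurable]: "?f \<in> borel_measurable borel" unfolding vduhamel_def by measurable
  define C where "C = lint {0..t} (nrm F)"
  have fC: "duhamel l (nrm F) r \<le> C" if "r \<in> {0..t}" for r
    unfolding C_def using that l by (intro order_trans[OF duhamel_le mono]) auto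
  have fle: "en (?f r) \<le> C" if "r \<in> {0..t}" for r
    using fC[OF that] F by (intro order_trans[OF vduhamel_le]) (auto simp: C_def intro: le_less_trans)
  define e where "e r = en (d r - ?f r)" for r
  have [measurable]: "bm e" unfolding e_def by measurable
  define Y where "Y r = 0 + lint {0..r} (\<lambda>s. ennreal l * e s)" for r
  have eY: "e r \<le> Y r" if r: "r \<in> {0..t}" "d r = I r" for r
  proof -
    have Fr: "lint {0..r} (nrm F) < \<infinity>" "lint {0..r} (nrm d) < \<infinity>"
      using le_less_trans[OF mono[OF r(1)] F] le_less_trans[OF mono[OF r(1)] d] by auto
    have i: "integrable lborel (\<lambda>s. indicat_real {0..r} s *\<^sub>R g s)"
      if "lint {0..r} (nrm g) < \<infinity>" "bm g" for g :: "real \<Rightarrow> 'a"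
    proof (rule integrableI_bounded)
      note [measurable] = that(2)
      show "(\<lambda>s. indicat_real {0..r} s *\<^sub>R g s) \<in> borel_measurable lborel" by measurable
      have "(\<integral>\<^sub>Ls. en (indicat_real {0..r} s *\<^sub>R g s)) = lint {0..r} (nrm g)"
        by (intro nn_integral_cong) (auto simp: indicator_def)
      then show "(\<integral>\<^sub>Ls. en (indicat_real {0..r} s *\<^sub>R g s)) < \<infinity>" using that(1) by simp
    qed
    have id: "integrable lborel (\<lambda>s. indicat_real {0..r} s *\<^sub>R (F s - l *\<^sub>R d s))"
      using integrable_sub[OF i[OF Fr(1)] integrable_scaleR_right[OF i[OF Fr(2)], of l]]
      by (simp add: scaleR_diff_right mult.commute)
    note vi = vduhamel_identity[where F=F and l=l and t=r and a=0, OF _ Fr(1) l, simplified]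
    have fr: "?f r = (LBINT s. indicat_real {0..r} s *\<^sub>R (F s - l *\<^sub>R ?f s))"
      and if': "integrable lborel (\<lambda>s. indicat_real {0..r} s *\<^sub>R (F s - l *\<^sub>R ?f s))" using vi r by auto
    have "d r - ?f r = (LBINT s. indicat_real {0..r} s *\<^sub>R (F s - l *\<^sub>R d s) - indicat_real {0..r} s *\<^sub>R (F s - l *\<^sub>R ?f s))"
      unfolding LINT_diff[OF id if'] fr[symmetric] r(2) I_def ..
    then have "e r \<le> (\<integral>\<^sub>Ls. en (indicat_real {0..r} s *\<^sub>R (F s - l *\<^sub>R d s) - indicat_real {0..r} s *\<^sub>R (F s - l *\<^sub>R ?f s)))"
      unfolding e_def using integral_norm_bound_ennreal[OF integrable_sub[OF id if']] by simp
    also have "\<dots> = Y r"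
      unfolding Y_def add_0
    proof (intro nn_integral_cong)
      fix s
      have eq: "(F s - l *\<^sub>R d s) - (F s - l *\<^sub>R ?f s) = - (l *\<^sub>R (d s - ?f s))" by (simp add: scaleR_diff_right)
      show "en (indicat_real {0..r} s *\<^sub>R (F s - l *\<^sub>R d s) - indicat_real {0..r} s *\<^sub>R (F s - l *\<^sub>R ?f s)) = ennreal l * e s * indicator {0..r} s"
        unfolding scaleR_diff_right[symmetric] eq e_def using l by (simp add: indicator_def ennreal_mult)
    qed
    finally show ?thesis .
  qed
  have "Y t \<le> 0 * ennreal (exp (2 * enn2real (lint {0..t} (\<lambda>s. ennreal l))))"
    unfolding Y_def
  proof (rule gronwall)
    show "lint {0..t} (\<lambda>s. ennreal l) < \<infinity>" using t by (simp add: nn_integral_cmult_indicator ennreal_mult_less_top)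
    have "lint {0..t} (\<lambda>s. ennreal l * e s) \<le> (\<integral>\<^sub>Ls. ennreal l * (en (d s) * indicator {0..t} s + C * indicator {0..t} s))"
    proof (rule nn_integral_mono)
      fix s
      show "ennreal l * e s * indicator {0..t} s \<le> ennreal l * (en (d s) * indicator {0..t} s + C * indicator {0..t} s)"
        using order_trans[OF en_triangle(2)[of "d s" "?f s"] add_left_mono[OF fle[of s]]]
        by (auto simp: indicator_def e_def intro!: mult_left_mono)
    qed
    also have "\<dots> = ennreal l * (lint {0..t} (nrm d) + C * ennreal t)"
      using t by (simp add: nn_integral_cmult nn_integral_add nn_integral_cmult_indicator)
    also have "\<dots> < \<infinity>" using d F by (auto simp: C_def ennreal_mult_less_top)
    finally show "0 + lint {0..t} (\<lambda>s. ennreal l * e s) < \<infinity>" by simp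
    show "AE s in lborel. s \<in> {0..t} \<longrightarrow> e s \<le> 0 + lint {0..s} (\<lambda>s. ennreal l * e s)"
      using ae by eventually_elim (use eY in \<open>auto simp: Y_def\<close>)
  qed (use t in auto)
  then have "e t = 0" using eY[of t] t by simp
  then have "d t = ?f t" by (simp add: e_def)
  then show ?thesis
    using fC[of t] F t by (simp add: C_def) (intro vduhamel_le, auto intro: le_less_trans)
qed

lemma vbilin_perturb:
  assumes [measurable]: "bm a" "bm c" "bm a'" "bm c'"
    "bm G" "bm \<delta>"
    and G: "\<And>\<eta>. en (a \<eta>) \<le> G \<eta>" "\<And>\<eta>. en (c \<eta>) \<le> G \<eta>" "\<And>\<eta>. en (a' \<eta>) \<le> G \<eta>" "\<And>\<eta>. en (c' \<eta>) \<le> G \<eta>"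
    and d: "\<And>\<eta>. en (a \<eta> - a' \<eta>) \<le> \<delta> \<eta>" "\<And>\<eta>. en (c \<eta> - c' \<eta>) \<le> \<delta> \<eta>" and fin: "cv G G z < \<infinity>"
  shows "en (vbilin a c z - vbilin a' c' z) \<le> ennreal (norm z / 12) * cv G \<delta> z"
proof -
  have "cv (nrm a) (nrm c) z < \<infinity>" "cv (nrm a') (nrm c') z < \<infinity>"
    by (rule le_less_trans[OF cv_mono fin]; rule G)+
  then have "en (vbilin a c z - vbilin a' c' z) \<le> ennreal (norm z / 24) *
      (\<integral>\<^sub>L\<eta>. en (a (z - \<eta>)) * en (c \<eta> - c' \<eta>) + en (a (z - \<eta>) - a' (z - \<eta>)) * en (c' \<eta>))"
    by (intro vbilin_diff_bound) auto
  also have "\<dots> \<le> ennreal (norm z / 24) * (\<integral>\<^sub>L\<eta>. G (z - \<eta>) * \<delta> \<eta> + \<delta> (z - \<eta>) * G \<eta>)"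
    by (intro mult_left_mono nn_integral_mono add_mono mult_mono G d) auto
  also have "(\<integral>\<^sub>L\<eta>. G (z - \<eta>) * \<delta> \<eta> + \<delta> (z - \<eta>) * G \<eta>) = cv G \<delta> z + cv \<delta> G z"
    unfolding cv_def by (rule nn_integral_add) measurable
  also have "\<dots> = 2 * cv G \<delta> z" by (simp add: cv_commute[of \<delta> G] mult_2)
  also have "ennreal (norm z / 24) * (2 * cv G \<delta> z) = ennreal (norm z / 24 * 2) * cv G \<delta> z"
    by (subst ennreal_mult) (auto simp: mult_ac)
  finally show ?thesis by simp
qed

text \<open>The two evolution equations are subtracted and solved by Duhamel at each frequency. The
  rate \<nu> is lowered to \<mu>, so that fields with different viscosities can share one
  majorant.\<close>

lemma evolution_difference:
  fixes a a' H H' Q :: "real \<Rightarrow> vfield"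
  assumes j[measurable]: "jm a" "jm a'" "jm Q" "jm K" and \<nu>: "\<nu> \<ge> \<mu>" "\<mu> > 0"
    and H: "\<And>s z. H s z - H' s z = Q s z - (\<nu> * (norm z)\<^sup>2) *\<^sub>R (a s z - a' s z)"
    and Q: "AE z in lborel. AE s in lborel. s \<in> {0..} \<longrightarrow> en (Q s z) \<le> K s z" and K: "AE z in lborel. (lint {0..} (\<lambda>s. K s z)) < \<infinity>"
    and a1: "AE z in lborel. (lint {0..} (\<lambda>s. en (a s z - a' s z))) < \<infinity>"
    and ea: "\<And>t. t \<in> {0..T} \<Longrightarrow> evolves t a H"
    and ea': "\<And>t. t \<in> {0..T} \<Longrightarrow> evolves t a' H'"
    and init: "AE z in lborel. a 0 z = a' 0 z" and t: "t \<in> {0..T}"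
  shows "AE z in lborel. en (a t z - a' t z) \<le> duhamel (\<mu> * (norm z)\<^sup>2) (\<lambda>s. K s z) t"
proof -
  define d where "d s z = a s z - a' s z" for s z
  have [measurable]: "jm d" unfolding d_def by measurable
  define I where "I s z = (LBINT r. indicat_real {0..s} r *\<^sub>R (Q r z - (\<nu> * (norm z)\<^sup>2) *\<^sub>R d r z))" for s z
  have [measurable]: "jm I" unfolding I_def by measurable
  have eqI: "AE z in lborel. d s z = I s z" if "s \<in> {0..T}" for s
    using ea[OF that] ea'[OF that] init
  proof eventually_elim
    case (elim z)
    have i: "integrable lborel (\<lambda>r. indicat_real {0..s} r *\<^sub>R H r z)" "integrable lborel (\<lambda>r. indicat_real {0..s} r *\<^sub>R H' r z)" using elim by auto
    have "d s z = (LBINT r. indicat_real {0..s} r *\<^sub>R H r z) - (LBINT r. indicat_real {0..s} r *\<^sub>R H' r z)"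
      using elim by (simp add: d_def)
    then show ?case
      unfolding LINT_diff[OF i, symmetric] I_def d_def scaleR_diff_right[symmetric] H .
  qed
  \<comment> \<open>The equation holds at each time for almost every frequency. Tonelli for this
    function exchanges the quantifiers to almost every frequency and then almost every time, the
    order that \<open>ode_duhamel\<close> needs.\<close>
  let ?Z = "\<lambda>s z. en (d s z - I s z) * indicator {0..T} s"
  have "(\<integral>\<^sub>Lz. (\<integral>\<^sub>Ls. ?Z s z)) = (\<integral>\<^sub>Ls. (\<integral>\<^sub>Lz. ?Z s z))"
    by (rule lborel_pair.Fubini') measurable
  also have "\<dots> = (\<integral>\<^sup>+s. 0 \<partial>(lborel :: real measure))"
  proof (rule nn_integral_cong)
    fix s
    have "AE z in lborel. ?Z s z = 0"
      using eqI[of s] by (cases "s \<in> {0..T}") (auto elim!: eventually_mono)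
    then have "(\<integral>\<^sub>Lz. ?Z s z) = (\<integral>\<^sup>+z. 0 \<partial>(lborel :: (real^3) measure))" by (rule nn_integral_cong_AE)
    then show "(\<integral>\<^sub>Lz. ?Z s z) = 0" by simp
  qed
  finally have z: "(\<integral>\<^sub>Lz. (\<integral>\<^sub>Ls. ?Z s z)) = 0" by simp
  have "AE z in lborel. (\<integral>\<^sub>Ls. ?Z s z) = 0"
    by (rule nn_integral_0_iff_AE[THEN iffD1, OF _ z]) measurable
  then have aeI: "AE z in lborel. AE s in lborel. s \<in> {0..T} \<longrightarrow> d s z = I s z"
  proof eventually_elim
    case (elim z)
    then have "AE s in lborel. ?Z s z = 0" by (subst (asm) nn_integral_0_iff_AE) auto
    then show ?case by eventually_elim (auto simp: indicator_def)
  qed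
  show ?thesis
    using eqI[OF t] aeI Q K a1
  proof eventually_elim
    case (elim z)
    have sec[measurable]: "bm (\<lambda>s. d s z)" "bm (\<lambda>s. Q s z)" "bm (\<lambda>s. K s z)"
      by measurable
    have QK: "AE s in lborel. en (Q s z) * indicator {0..t} s \<le> K s z * indicator {0..t} s"
      using elim(3) by eventually_elim (auto simp: indicator_def)
    have "en (d t z) \<le> duhamel (\<nu> * (norm z)\<^sup>2) (\<lambda>s. en (Q s z)) t"
    proof (rule ode_duhamel[OF sec(1,2)])
      show "lint {0..t} (\<lambda>s. en (Q s z)) < \<infinity>"
        by (rule le_less_trans[OF order_trans[OF nn_integral_mono_AE[OF QK] nn_integral_Icc_le_atLeast] elim(4)])
      show "lint {0..t} (\<lambda>s. en (d s z)) < \<infinity>"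
        using le_less_trans[OF nn_integral_Icc_le_atLeast elim(5)] by (simp add: d_def)
      show "AE s in lborel. s \<in> {0..t} \<longrightarrow> d s z = (LBINT r. indicat_real {0..s} r *\<^sub>R (Q r z - (\<nu> * (norm z)\<^sup>2) *\<^sub>R d r z))"
        using elim(2) by eventually_elim (use t in \<open>auto simp: I_def\<close>)
    qed (use t \<nu> elim(1) in \<open>auto simp: I_def\<close>)
    also have "\<dots> \<le> duhamel (\<mu> * (norm z)\<^sup>2) (\<lambda>s. K s z) t"
      unfolding duhamel_def
    proof (rule nn_integral_mono_AE, use QK in eventually_elim)
      case (elim s)
      show "ennreal (exp (- (\<nu> * (norm z)\<^sup>2) * (t - s))) * en (Q s z) * indicator {0..t} s \<le>
          ennreal (exp (- (\<mu> * (norm z)\<^sup>2) * (t - s))) * K s z * indicator {0..t} s"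
      proof (cases "s \<in> {0..t}")
        case True
        have "exp (- (\<nu> * (norm z)\<^sup>2) * (t - s)) \<le> exp (- (\<mu> * (norm z)\<^sup>2) * (t - s))"
          using True \<nu> by (simp add: mult_right_mono)
        then show ?thesis using True elim by (auto intro!: mult_mono ennreal_leI)
      qed simp
    qed
    finally show ?case by (simp add: d_def)
  qed
qed

text \<open>The sum \<delta> of the moduli of the differences satisfies a linear majorant inequality
  whose coefficient is controlled by the two solutions. With zero data and no coupling,
  \<open>majorant_bound\<close> gives the bound 0, however large the coefficient is.\<close>

theorem fourier_unique:
  assumes f: "mhd_fields u b M T \<mu>1 \<mu>2" and f': "mhd_fields u' b' M' T \<mu>1 \<mu>2" and \<mu>12: "\<mu>1 > 0" "\<mu>2 > 0"
    and init: "AE z in lborel. u 0 z = u' 0 z" "AE z in lborel. b 0 z = b' 0 z" and t: "t \<in> {0..T}"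
  shows "AE z in lborel. u t z = u' t z \<and> b t z = b' t z"
proof -
  interpret p: mhd_fields u b M T \<mu>1 \<mu>2 by fact
  interpret q: mhd_fields u' b' M' T \<mu>1 \<mu>2 by fact
  note j[measurable] = p.j q.j
  define G where "G s z = (en (u s z) + en (b s z)) + (en (u' s z) + en (b' s z))" for s z
  define \<delta> where "\<delta> s z = en (u s z - u' s z) + en (b s z - b' s z)" for s z
  \<comment> \<open>The nonlinear difference of each field is at most K = 2 |z| times the
    convolution of G and \<delta>. Adding the two fields doubles this, which the factor 4 puts into
    the form of \<open>src\<close> with m = 0.\<close>
  define Q where "Q s z = 4 * G s z" for s z
  define K where "K s z = ennreal (2 * norm z) * cv (G s) (\<delta> s) z" for s z
  have jG[measurable]: "jm G" and j\<delta>[measurable]: "jm \<delta>" unfolding G_def \<delta>_def by measurable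
  have jQ[measurable]: "jm Q" and jK[measurable]: "jm K" unfolding Q_def K_def by measurable
  have sec[measurable]: "bm (u s)" "bm (b s)" "bm (u' s)" "bm (b' s)"
    "bm (G s)" "bm (\<delta> s)" "bm (Q s)" for s
    by (auto intro: jm_section j jG j\<delta> jQ)
  have Gle: "en (u s \<eta>) \<le> G s \<eta>" "en (b s \<eta>) \<le> G s \<eta>" "en (u' s \<eta>) \<le> G s \<eta>" "en (b' s \<eta>) \<le> G s \<eta>" for s \<eta>
    unfolding G_def by (simp_all add: add_increasing add_increasing2)
  have \<delta>le: "en (u s \<eta> - u' s \<eta>) \<le> \<delta> s \<eta>" "en (b s \<eta> - b' s \<eta>) \<le> \<delta> s \<eta>" for s \<eta> by (auto simp: \<delta>_def)
  have \<delta>G: "\<delta> s \<eta> \<le> G s \<eta>" for s \<eta>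
    unfolding \<delta>_def G_def using add_mono[OF en_triangle(2)[of "u s \<eta>" "u' s \<eta>"] en_triangle(2)[of "b s \<eta>" "b' s \<eta>"]] by (simp add: ac_simps)
  have Xsum: "Xm (G s) = (Xm (nrm (u s)) + Xm (nrm (b s))) + (Xm (nrm (u' s)) + Xm (nrm (b' s)))"
    "X1 (G s) = (X1 (nrm (u s)) + X1 (nrm (b s))) + (X1 (nrm (u' s)) + X1 (nrm (b' s)))" for s
    unfolding G_def by (simp_all add: X_add)
  have GM: "Xm (G s) \<le> ennreal (2 * (M + M'))" for s
  proof -
    have "Xm (G s) \<le> (ennreal M + ennreal M) + (ennreal M' + ennreal M')" unfolding Xsum by (intro add_mono p.M q.M)
    then show ?thesis using p.M(1) q.M(1) by (simp flip: ennreal_plus)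
  qed
  have G1: "lint {0..} (\<lambda>s. X1 (G s)) < \<infinity>"
    unfolding Xsum distrib_right using p.X1 q.X1 by (simp add: nn_integral_add)
  have M4: "2 * (M + M') \<ge> 0" using p.M(1) q.M(1) by simp
  note cvG = cv_finite_AE(2,3)[OF jG GM M4 G1]
  have Kf: "AE z in lborel. (lint {0..} (\<lambda>s. K s z)) < \<infinity>"
    using cvG(2)
  proof eventually_elim
    case (elim z)
    have "lint {0..} (\<lambda>s. K s z) \<le> (\<integral>\<^sub>Ls. ennreal (2 * norm z) * (cv (G s) (G s) z * indicator {0..} s))"
      unfolding K_def mult.assoc by (intro nn_integral_mono mult_left_mono mult_right_mono cv_mono \<delta>G) auto
    also have "\<dots> = ennreal (2 * norm z) * (lint {0..} (\<lambda>s. cv (G s) (G s) z))" by (rule nn_integral_cmult) measurable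
    also have "\<dots> < \<infinity>" using elim by (simp add: ennreal_mult_less_top less_top)
    finally show ?case .
  qed
  have d1: "AE z in lborel. (lint {0..} (\<lambda>s. \<delta> s z)) < \<infinity>"
  proof (rule X1_finite_AE[OF j\<delta>])
    show "lint {0..} (\<lambda>s. X1 (\<delta> s)) < \<infinity>"
      by (rule le_less_trans[OF nn_integral_mono G1]) (intro mult_right_mono X_mono \<delta>G, simp)
  qed simp
  have d1': "AE z in lborel. (lint {0..} (\<lambda>s. en (u s z - u' s z))) < \<infinity>" "AE z in lborel. (lint {0..} (\<lambda>s. en (b s z - b' s z))) < \<infinity>"
    by (use d1 in eventually_elim, erule le_less_trans[rotated], intro nn_integral_mono mult_right_mono \<delta>le, simp)+
  define QU where "QU s z = - leray z ((vbilin (u s) (u s) z - vbilin (u' s) (u' s) z) - (vbilin (b s) (b s) z - vbilin (b' s) (b' s) z))" for s z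
  define QB where "QB s z = (vbilin (b s) (u s) z - vbilin (b' s) (u' s) z) - (vbilin (u s) (b s) z - vbilin (u' s) (b' s) z)" for s z
  have jQU: "jm QU" "jm QB" unfolding QU_def QB_def by measurable
  have HQ: "HU \<mu>1 (u s) (b s) z - HU \<mu>1 (u' s) (b' s) z = QU s z - (\<mu>1 * (norm z)\<^sup>2) *\<^sub>R (u s z - u' s z)"
    "HB \<mu>2 (u s) (b s) z - HB \<mu>2 (u' s) (b' s) z = QB s z - (\<mu>2 * (norm z)\<^sup>2) *\<^sub>R (b s z - b' s z)" for s z
    unfolding HU_def HB_def QU_def QB_def leray_diff by (simp_all add: algebra_simps)
  have QK: "en (QU s z) \<le> K s z" "en (QB s z) \<le> K s z" if "cv (G s) (G s) z < \<infinity>" for s z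
  proof -
    have two: "en (v - w) \<le> ennreal (norm z / 6) * cv (G s) (\<delta> s) z"
      if "en v \<le> ennreal (norm z / 12) * cv (G s) (\<delta> s) z" "en w \<le> ennreal (norm z / 12) * cv (G s) (\<delta> s) z" for v w :: "complex^3"
    proof -
      have "en (v - w) \<le> ennreal (norm z / 12) * cv (G s) (\<delta> s) z + ennreal (norm z / 12) * cv (G s) (\<delta> s) z"
        by (rule order_trans[OF en_triangle(2) add_mono[OF that]])
      also have "\<dots> = (ennreal (norm z / 12) + ennreal (norm z / 12)) * cv (G s) (\<delta> s) z" by (simp only: distrib_right)
      also have "ennreal (norm z / 12) + ennreal (norm z / 12) = ennreal (norm z / 6)" by (subst ennreal_plus[symmetric]) auto
      finally show ?thesis .
    qed
    note vp = vbilin_perturb[OF sec(1,1,3,3,5,6) Gle(1,1,3,3) \<delta>le(1,1) that] vbilin_perturb[OF sec(2,2,4,4,5,6) Gle(2,2,4,4) \<delta>le(2,2) that]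
      vbilin_perturb[OF sec(2,1,4,3,5,6) Gle(2,1,4,3) \<delta>le(2,1) that] vbilin_perturb[OF sec(1,2,3,4,5,6) Gle(1,2,3,4) \<delta>le(1,2) that]
    have "en (QU s z) \<le> ennreal 10 * en ((vbilin (u s) (u s) z - vbilin (u' s) (u' s) z) - (vbilin (b s) (b s) z - vbilin (b' s) (b' s) z))"
      unfolding QU_def by (subst ennreal_mult[symmetric]) (auto intro!: ennreal_leI norm_leray_le)
    also have "\<dots> \<le> ennreal 10 * (ennreal (norm z / 6) * cv (G s) (\<delta> s) z)" by (intro mult_left_mono two vp) auto
    also have "\<dots> = ennreal (10 * (norm z / 6)) * cv (G s) (\<delta> s) z" by (simp only: mult.assoc[symmetric], subst ennreal_mult[symmetric]) auto
    also have "\<dots> \<le> K s z" unfolding K_def by (intro mult_right_mono ennreal_leI) auto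
    finally show "en (QU s z) \<le> K s z" .
    have "en (QB s z) \<le> ennreal (norm z / 6) * cv (G s) (\<delta> s) z" unfolding QB_def by (intro two vp)
    also have "\<dots> \<le> K s z" unfolding K_def by (intro mult_right_mono ennreal_leI) auto
    finally show "en (QB s z) \<le> K s z" .
  qed
  have QKae: "AE z in lborel. AE s in lborel. s \<in> {0..} \<longrightarrow> en (QU s z) \<le> K s z" "AE z in lborel. AE s in lborel. s \<in> {0..} \<longrightarrow> en (QB s z) \<le> K s z"
    by (use cvG(1) in eventually_elim, erule eventually_mono, simp add: QK)+
  \<comment> \<open>The slower of the two decay rates serves both fields.\<close>
  define \<mu> where "\<mu> = min \<mu>1 \<mu>2"
  have \<mu>: "\<mu> > 0" "\<mu>1 \<ge> \<mu>" "\<mu>2 \<ge> \<mu>" using \<mu>12 by (auto simp: \<mu>_def)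
  \<comment> \<open>At each time \<delta> is dominated by y only at almost every frequency, while
    the majorant lemmas want a pointwise inequality. The function y has it: it is built from
    integrals of \<delta>, which do not see null sets.\<close>
  define y where "y = Phi \<mu> 0 (\<lambda>_. 0) \<delta> Q"
  have jy[measurable]: "jm y" unfolding y_def by (rule jm_Phi) measurable
  have \<delta>y: "AE z in lborel. \<delta> s z \<le> y s z" if s: "s \<in> {0..T}" for s
  proof -
    have "AE z in lborel. en (u s z - u' s z) \<le> duhamel (\<mu> * (norm z)\<^sup>2) (\<lambda>s. K s z) s"
      by (rule evolution_difference[OF j(1,3) jQU(1) jK \<mu>(2,1) HQ(1) QKae(1) Kf d1'(1) _ _ init(1) s]) (erule p.evol, erule q.evol)
    moreover have "AE z in lborel. en (b s z - b' s z) \<le> duhamel (\<mu> * (norm z)\<^sup>2) (\<lambda>s. K s z) s"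
      by (rule evolution_difference[OF j(2,4) jQU(2) jK \<mu>(3,1) HQ(2) QKae(2) Kf d1'(2) _ _ init(2) s]) (erule p.evol, erule q.evol)
    ultimately show ?thesis
  proof eventually_elim
    case (elim z)
    have "\<delta> s z \<le> duhamel (\<mu> * (norm z)\<^sup>2) (\<lambda>s. K s z) s + duhamel (\<mu> * (norm z)\<^sup>2) (\<lambda>s. K s z) s"
      unfolding \<delta>_def by (intro add_mono elim)
    also have "\<dots> = duhamel (\<mu> * (norm z)\<^sup>2) (\<lambda>s. K s z + K s z) s"
      unfolding duhamel_def by (subst nn_integral_add[symmetric]) (measurable, simp add: distrib_left distrib_right)
    also have "(\<lambda>s. K s z + K s z) = (\<lambda>s. src 0 (\<delta> s) (Q s) z)"
    proof
      fix s
      have "cv (Q s) (\<delta> s) z = 4 * cv (G s) (\<delta> s) z"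
        unfolding cv_def Q_def mult.assoc by (rule nn_integral_cmult) measurable
      moreover have "K s z + K s z = ennreal (norm z) * (4 * cv (G s) (\<delta> s) z)"
      proof -
        have "K s z + K s z = (ennreal (2 * norm z) + ennreal (2 * norm z)) * cv (G s) (\<delta> s) z" unfolding K_def by (simp only: distrib_right)
        also have "ennreal (2 * norm z) + ennreal (2 * norm z) = ennreal (norm z * 4)" by (subst ennreal_plus[symmetric]) auto
        also have "\<dots> = ennreal (norm z) * 4" by (subst ennreal_mult) auto
        finally show ?thesis by (simp only: mult.assoc)
      qed
      ultimately show "K s z + K s z = src 0 (\<delta> s) (Q s) z" by (simp add: src_def)
    qed
    finally show ?case by (simp add: y_def Phi_def)
  qed
  qed
  \<comment> \<open>The cutoff at T extends the inequality to all times, as the majorant lemmas are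
    stated on the half line.\<close>
  define p where "p s z = indicator {0..T} s * y s z" for s z
  have jp[measurable]: "jm p" unfolding p_def by measurable
  have y0: "y s z \<le> Phi \<mu> 0 (\<lambda>_. 0) p Q s z" if s: "s \<in> {0..T}" for s z
    unfolding y_def Phi_def duhamel_def
  proof (intro add_left_mono nn_integral_mono)
    fix r
    show "ennreal (exp (- (\<mu> * (norm z)\<^sup>2) * (s - r))) * src 0 (\<delta> r) (Q r) z * indicator {0..s} r \<le>
        ennreal (exp (- (\<mu> * (norm z)\<^sup>2) * (s - r))) * src 0 (p r) (Q r) z * indicator {0..s} r"
    proof (cases "r \<in> {0..s}")
      case True
      then have r: "r \<in> {0..T}" using s by auto
      have "cv (Q r) (\<delta> r) z \<le> cv (Q r) (p r) z"
        unfolding cv_def using \<delta>y[OF r] by (intro nn_integral_mono_AE, eventually_elim) (use r in \<open>auto simp: p_def intro: mult_left_mono\<close>)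
      then show ?thesis by (auto simp: src_def intro!: mult_right_mono mult_left_mono)
    qed simp
  qed
  have ple: "p s z \<le> Phi \<mu> 0 (\<lambda>_. 0) p Q s z" for s z
    using y0[of s z] by (cases "s \<in> {0..T}") (auto simp: p_def)
  have QX: "Xm (Q s) = 4 * Xm (G s)" "X1 (Q s) = 4 * X1 (G s)" for s
    unfolding Xm_def X1_def Q_def mult.left_commute[of _ 4] by (rule nn_integral_cmult, measurable)+
  have QM: "Xm (Q s) \<le> ennreal (8 * (M + M'))" for s
  proof -
    have "Xm (Q s) \<le> ennreal 4 * ennreal (2 * (M + M'))" unfolding QX using mult_left_mono[OF GM, of 4] by simp
    also have "ennreal 4 * ennreal (2 * (M + M')) = ennreal (8 * (M + M'))" using p.M(1) q.M(1) by (subst ennreal_mult[symmetric]) auto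
    finally show ?thesis .
  qed
  have Q1: "lint {0..} (\<lambda>s. X1 (Q s)) < \<infinity>"
    unfolding QX mult.assoc using G1 by (simp add: nn_integral_cmult ennreal_mult_less_top)
  have M16: "8 * (M + M') \<ge> 0" using p.M(1) q.M(1) by simp
  obtain E where E: "lint {0..} (\<lambda>s. X1 (Q s)) \<le> ennreal E" "E \<ge> 0"
    using Q1 by (cases "\<integral>\<^sup>+s\<in>{0..}. X1 (Q s) \<partial>lborel") auto
  define S where "S = lint {0..} (\<lambda>s. (X0 (Q s))\<^sup>2)"
  have S: "S < \<infinity>" unfolding S_def by (rule cv_finite_AE(1)[OF jQ QM M16 Q1])
  have \<delta>Q: "\<delta> s z \<le> Q s z" for s z
  proof -
    have "1 * G s z \<le> 4 * G s z" by (rule mult_right_mono) auto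
    then show ?thesis using order_trans[OF \<delta>G] by (simp add: Q_def)
  qed
  \<comment> \<open>The a priori finiteness that \<open>majorant_bound\<close> requires of its
    subsolution, obtained from the crude bound \<delta> \<le> Q.\<close>
  have energy: "Xm (y s) + ennreal \<mu> * (lint {0..s} (\<lambda>r. X1 (y r))) \<le> S" if s: "s \<ge> 0" for s
  proof -
    have "Xm (y s) + ennreal \<mu> * (lint {0..s} (\<lambda>r. X1 (y r))) \<le>
        Xm (\<lambda>_. 0) + lint {0..s} (\<lambda>r. (ennreal 0 * X1 (Q r) + X0 (\<delta> r) * X0 (Q r)))"
      unfolding y_def by (rule Phi_energy) (use \<mu> s in auto)
    also have "\<dots> = lint {0..s} (\<lambda>r. X0 (\<delta> r) * X0 (Q r))" by (simp add: Xm_def)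
    also have "\<dots> \<le> lint {0..s} (\<lambda>r. (X0 (Q r))\<^sup>2)"
      unfolding power2_eq_square by (intro nn_integral_mono mult_right_mono X_mono \<delta>Q) auto
    also have "\<dots> \<le> S" unfolding S_def by (rule nn_integral_Icc_le_atLeast)
    finally show ?thesis .
  qed
  have pM: "Xm (p s) \<le> ennreal (enn2real S)" for s
  proof (cases "s \<in> {0..T}")
    case True
    then have "p s = y s" by (simp add: p_def fun_eq_iff)
    moreover have "Xm (y s) \<le> S" using True by (intro order_trans[OF _ energy[of s]]) auto
    ultimately show ?thesis using S by simp
  next
    case False
    then show ?thesis by (simp add: p_def Xm_def)
  qed
  have T: "T \<ge> 0" using t by auto
  have p1: "lint {0..} (\<lambda>s. X1 (p s)) < \<infinity>"
  proof -
    have "lint {0..} (\<lambda>s. X1 (p s)) = lint {0..T} (\<lambda>s. X1 (y s))"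
      by (intro nn_integral_cong) (auto simp: p_def indicator_def X1_def)
    moreover have "ennreal \<mu> * (lint {0..T} (\<lambda>s. X1 (y s))) < \<infinity>"
      by (rule le_less_trans[OF order_trans[OF _ energy[OF T]] S]) simp
    ultimately show ?thesis using \<mu> by (auto simp: ennreal_mult_less_top)
  qed
  have "Xm (Phi \<mu> 0 (\<lambda>_. 0) p Q t) \<le> ennreal 0"
  proof (rule majorant_bound(1)[OF jp jQ _ \<mu>(1) order_refl ple _ order_refl pM p1 E QM M16])
    show "Xm (\<lambda>_. 0) = ennreal 0" by (simp add: Xm_def)
    show "(0 + 0 * E) * exp (8 * (M + M') * E / \<mu>) \<le> 0" by simp
  qed (use t in auto)
  then have "Xm (y t) = 0" using X_mono(1)[of "y t" "Phi \<mu> 0 (\<lambda>_. 0) p Q t"] y0[OF t] by simp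
  then have "AE z in lborel. ennreal (inverse (norm z)) * y t z = 0"
    unfolding Xm_def using jm_section[OF jy] by (subst (asm) nn_integral_0_iff_AE) auto
  then show ?thesis
    using \<delta>y[OF t] AE_lborel_singleton[of "0::real^3"]
    by eventually_elim (auto simp: \<delta>_def ennreal_eq_0_iff)
qed

theorem mhd_unique:
  assumes u: "u \<in> C_chi (- 1) \<inter> L1_chi 1" and B: "B \<in> C_chi (- 1) \<inter> L1_chi 1" and sol: "mhd_solution \<mu>1 \<mu>2 u0 B0 u B"
    and u': "u' \<in> C_chi (- 1) \<inter> L1_chi 1" and B': "B' \<in> C_chi (- 1) \<inter> L1_chi 1" and sol': "mhd_solution \<mu>1 \<mu>2 u0 B0 u' B'"
    and \<mu>: "\<mu>1 > 0" "\<mu>2 > 0" and T: "T \<ge> 0"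
  shows "vdist_eq (u' T) (u T) \<and> vdist_eq (B' T) (B T)"
proof (rule mhd_fourier[OF u B sol \<mu>, where T=T], rule mhd_fourier[OF u' B' sol' \<mu>, where T=T])
  fix U b :: "real \<Rightarrow> vfield" and M and U' b' :: "real \<Rightarrow> vfield" and M'
  assume f: "mhd_fields U b M T \<mu>1 \<mu>2" and a: "\<And>t. t \<in> {0..T} \<Longrightarrow> frepv (U t) (u t)" "\<And>t. t \<in> {0..T} \<Longrightarrow> frepv (b t) (B t)"
    and f': "mhd_fields U' b' M' T \<mu>1 \<mu>2" and a': "\<And>t. t \<in> {0..T} \<Longrightarrow> frepv (U' t) (u' t)" "\<And>t. t \<in> {0..T} \<Longrightarrow> frepv (b' t) (B' t)"
  have T0: "0 \<in> {0..T}" "T \<in> {0..T}" using T by auto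
  have init: "AE z in lborel. v z = w z" if "frepv v x" "frepv w z" "vdist_eq x x0" "vdist_eq z x0" for v w x z x0
  proof -
    have "dist_eq (x $ i) (z $ i)" for i using that(3,4) by (simp add: vdist_eq_def dist_eq_def)
    then have "AE z in lborel. \<forall>i\<in>(UNIV::3 set). v z $ i = w z $ i"
      using that(1,2) by (intro AE_finite_allI) (auto simp: frepv_def intro: frep_unique)
    then show ?thesis by eventually_elim (simp add: vec_eq_iff)
  qed
  have i: "AE z in lborel. U 0 z = U' 0 z" "AE z in lborel. b 0 z = b' 0 z"
    using init[OF a(1)[OF T0(1)] a'(1)[OF T0(1)], of u0] init[OF a(2)[OF T0(1)] a'(2)[OF T0(1)], of B0] sol sol'
    by (auto simp: mhd_solution_def)
  have "AE z in lborel. U T z = U' T z \<and> b T z = b' T z"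
    by (rule fourier_unique[OF f f' \<mu> i T0(2)])
  then have ae: "AE z in lborel. U' T z = U T z" "AE z in lborel. b' T z = b T z" by auto
  have eq: "vdist_eq x z" if "frepv v x" "frepv w z" "AE z in lborel. v z = w z" for v w x z
    unfolding vdist_eq_def
  proof
    fix i
    have "AE z in lborel. v z $ i = w z $ i" using that(3) by eventually_elim simp
    then show "dist_eq (x $ i) (z $ i)" using that by (auto simp: frepv_def intro: frep_dist_eq)
  qed
  show ?thesis using eq[OF a'(1)[OF T0(2)] a(1)[OF T0(2)] ae(1)] eq[OF a'(2)[OF T0(2)] a(2)[OF T0(2)] ae(2)] by simp
qed

theorem theorem1p4:
  "\<exists>C::real. C > 0 \<and>
    (\<forall>(\<mu>1::real) (\<mu>2::real) (u0::vdist) (B0::vdist).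
      \<mu>1 > 0 \<longrightarrow> \<mu>2 > 0 \<longrightarrow>
      u0 \<in> chi (-1) \<longrightarrow> B0 \<in> chi (-1) \<longrightarrow>
      (\<forall>i. real_valued (u0 $ i) \<and> real_valued (B0 $ i)) \<longrightarrow>
      dist_eq (ddiv u0) 0 \<longrightarrow> dist_eq (ddiv B0) 0 \<longrightarrow>
      (let \<nu>p = (\<mu>1 + \<mu>2) / 2;
           \<nu>m = (\<mu>1 - \<mu>2) / 2;
           Wp = chi_norm (-1) (u0 + B0);
           Wm = chi_norm (-1) (u0 - B0)
       in (Wm + C * \<bar>\<nu>m\<bar> / \<nu>p * (\<bar>\<nu>m\<bar> + Wp)) * exp (C / \<nu>p\<^sup>2 * (\<bar>\<nu>m\<bar> + Wp)\<^sup>2) < 2 * \<nu>p \<or>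
          (Wp + C * \<bar>\<nu>m\<bar> / \<nu>p * (\<bar>\<nu>m\<bar> + Wm)) * exp (C / \<nu>p\<^sup>2 * (\<bar>\<nu>m\<bar> + Wm)\<^sup>2) < 2 * \<nu>p) \<longrightarrow>
      (\<exists>u B. u \<in> C_chi (-1) \<inter> L1_chi 1 \<and> B \<in> C_chi (-1) \<inter> L1_chi 1 \<and>
             mhd_solution \<mu>1 \<mu>2 u0 B0 u B \<and>
             (\<forall>u' B'. u' \<in> C_chi (-1) \<inter> L1_chi 1 \<longrightarrow> B' \<in> C_chi (-1) \<inter> L1_chi 1 \<longrightarrow>
                mhd_solution \<mu>1 \<mu>2 u0 B0 u' B' \<longrightarrow>
                (\<forall>t\<ge>0. vdist_eq (u' t) (u t) \<and> vdist_eq (B' t) (B t)))))"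
proof (rule exI[of _ smallC], intro conjI allI impI)
  show "smallC > 0" by (simp add: smallC_def)
next
  fix \<mu>1 \<mu>2 :: real and u0 B0 :: vdist
  assume \<mu>: "\<mu>1 > 0" "\<mu>2 > 0" and chi: "u0 \<in> chi (-1)" "B0 \<in> chi (-1)"
    and real: "\<forall>i. real_valued (u0 $ i) \<and> real_valued (B0 $ i)" and div: "dist_eq (ddiv u0) 0" "dist_eq (ddiv B0) 0"
    and small: "let \<nu>p = (\<mu>1 + \<mu>2) / 2;
           \<nu>m = (\<mu>1 - \<mu>2) / 2;
           Wp = chi_norm (-1) (u0 + B0);
           Wm = chi_norm (-1) (u0 - B0)
       in (Wm + smallC * \<bar>\<nu>m\<bar> / \<nu>p * (\<bar>\<nu>m\<bar> + Wp)) * exp (smallC / \<nu>p\<^sup>2 * (\<bar>\<nu>m\<bar> + Wp)\<^sup>2) < 2 * \<nu>p \<or>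
          (Wp + smallC * \<bar>\<nu>m\<bar> / \<nu>p * (\<bar>\<nu>m\<bar> + Wm)) * exp (smallC / \<nu>p\<^sup>2 * (\<bar>\<nu>m\<bar> + Wm)\<^sup>2) < 2 * \<nu>p"
  obtain w where w: "bm w" "\<And>\<eta>. vcnj (w (- \<eta>)) = w \<eta>" "\<And>z. dotc z (w z) = 0" "frepv w u0"
    using fourier_data[OF chi(1) _ div(1)] real by blast
  obtain v where v: "bm v" "\<And>\<eta>. vcnj (v (- \<eta>)) = v \<eta>" "\<And>z. dotc z (v z) = 0" "frepv v B0"
    using fourier_data[OF chi(2) _ div(2)] real by blast
  define P N where "P = chi_norm (-1) (u0 + B0)" and "N = chi_norm (-1) (u0 - B0)"
  have fin: "Xm (\<lambda>z. en (w z) + en (v z)) < \<infinity>"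
    using chi_frepv(1)[OF w(4) chiD(2)[OF chi(1)]] chi_frepv(1)[OF v(4) chiD(2)[OF chi(2)]] chi w(1) v(1) by (subst X_add) auto
  have X: "Xm (\<lambda>z. en (w z + v z)) = ennreal P" "Xm (\<lambda>z. en (w z - v z)) = ennreal N"
    unfolding P_def N_def chi_norm_frepv(1)[OF frepv_add[OF w(4) v(4)]] chi_norm_frepv(1)[OF frepv_diff[OF w(4) v(4)]]
    using le_less_trans[OF X_mono(1)[OF en_triangle(1)] fin] le_less_trans[OF X_mono(1)[OF en_triangle(2)] fin] by simp_all
  have nn: "P \<ge> 0" "N \<ge> 0" unfolding P_def N_def chi_norm_def by (rule integral_nonneg_AE, simp)+
  \<comment> \<open>Exchanging B0 for - B0 swaps the two Elsasser fields; the sign \<sigma> lets one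
    argument serve both alternatives of the smallness condition.\<close>
  have ex: "\<exists>u B. u \<in> C_chi (-1) \<inter> L1_chi 1 \<and> B \<in> C_chi (-1) \<inter> L1_chi 1 \<and> mhd_solution \<mu>1 \<mu>2 u0 B0 u B"
    if "\<sigma> * \<sigma> = 1" "Xm (\<lambda>z. en (w z + \<sigma> *\<^sub>R v z)) = ennreal Dp" "Xm (\<lambda>z. en (w z - \<sigma> *\<^sub>R v z)) = ennreal Dm" "Dp \<ge> 0" "Dm \<ge> 0"
      "(Dm + smallC * \<bar>(\<mu>1 - \<mu>2) / 2\<bar> / ((\<mu>1 + \<mu>2) / 2) * (\<bar>(\<mu>1 - \<mu>2) / 2\<bar> + Dp)) *
      exp (smallC / ((\<mu>1 + \<mu>2) / 2)\<^sup>2 * (\<bar>(\<mu>1 - \<mu>2) / 2\<bar> + Dp)\<^sup>2) < 2 * ((\<mu>1 + \<mu>2) / 2)"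
    for \<sigma> Dp Dm :: real
  proof (rule fourier_mhd[OF w(1) v(1) w(2) v(2) w(3) v(3) \<mu> that])
    fix U b M
    assume e: "fourier_evolution U (\<lambda>s. HU \<mu>1 (U s) (b s)) M" "fourier_evolution b (\<lambda>s. HB \<mu>2 (U s) (b s)) M"
      and s: "\<And>t z. vcnj (U t (- z)) = U t z" "\<And>t z. vcnj (b t (- z)) = b t z" "\<And>t z. dotc z (U t z) = 0" "\<And>t z. dotc z (b t z) = 0"
      and i: "AE z in lborel. U 0 z = w z" "AE z in lborel. b 0 z = v z"
    show ?thesis
      using mhd_of_fourier[OF e s w(4) i(1) v(4) i(2)] fourier_evolution.C_chi_member[OF e(1)] fourier_evolution.C_chi_member[OF e(2)]
        fourier_evolution.L1_chi_member[OF e(1)] fourier_evolution.L1_chi_member[OF e(2)] by blast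
  qed
  have "\<exists>u B. u \<in> C_chi (-1) \<inter> L1_chi 1 \<and> B \<in> C_chi (-1) \<inter> L1_chi 1 \<and> mhd_solution \<mu>1 \<mu>2 u0 B0 u B"
    using small unfolding Let_def P_def[symmetric] N_def[symmetric]
  proof (elim disjE)
    show ?thesis if "(N + smallC * \<bar>(\<mu>1 - \<mu>2) / 2\<bar> / ((\<mu>1 + \<mu>2) / 2) * (\<bar>(\<mu>1 - \<mu>2) / 2\<bar> + P)) *
      exp (smallC / ((\<mu>1 + \<mu>2) / 2)\<^sup>2 * (\<bar>(\<mu>1 - \<mu>2) / 2\<bar> + P)\<^sup>2) < 2 * ((\<mu>1 + \<mu>2) / 2)"
      by (rule ex[of 1 P N, OF _ _ _ nn that]) (simp_all add: X)
    show ?thesis if "(P + smallC * \<bar>(\<mu>1 - \<mu>2) / 2\<bar> / ((\<mu>1 + \<mu>2) / 2) * (\<bar>(\<mu>1 - \<mu>2) / 2\<bar> + N)) *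
      exp (smallC / ((\<mu>1 + \<mu>2) / 2)\<^sup>2 * (\<bar>(\<mu>1 - \<mu>2) / 2\<bar> + N)\<^sup>2) < 2 * ((\<mu>1 + \<mu>2) / 2)"
      by (rule ex[of "- 1" N P, OF _ _ _ nn(2,1) that]) (simp_all add: X)
  qed
  then show "\<exists>u B. u \<in> C_chi (-1) \<inter> L1_chi 1 \<and> B \<in> C_chi (-1) \<inter> L1_chi 1 \<and>
             mhd_solution \<mu>1 \<mu>2 u0 B0 u B \<and>
             (\<forall>u' B'. u' \<in> C_chi (-1) \<inter> L1_chi 1 \<longrightarrow> B' \<in> C_chi (-1) \<inter> L1_chi 1 \<longrightarrow>
                mhd_solution \<mu>1 \<mu>2 u0 B0 u' B' \<longrightarrow>
                (\<forall>t\<ge>0. vdist_eq (u' t) (u t) \<and> vdist_eq (B' t) (B t)))"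
    using mhd_unique[OF _ _ _ _ _ _ \<mu>] by blast
qed

end
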